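(* Let $(R,\mathfrak m)$ be a (commutative Noetherian) local ring of prime characteristic $p$, let $I$ be a proper ideal of $R$ of finite projective dimension (as an $R$-module), and let $J$ be a non-zero $F$-ideal of $R$. If $R$ is either a Cohen--Macaulay ring or an excellent equidimensional reduced ring, then $J\nsubseteq I$.
   Context: Let $(R,\mathfrak m)$ be a $d$-dimensional Noetherian local ring of prime characteristic $p$ and $x_1,\dots,x_d$ a system of parameters. There is an isomorphism $\varinjlim_n R/(x_1^n,\dots,x_d^n)\cong \operatorname{H}^d_{\mathfrak m}(R)$, where the transition map $R/(x_1^n,\dots,x_d^n)\to R/(x_1^{n+1},\dots,x_d^{n+1})$ is multiplication by $\prod_{i=1}^d x_i$. The natural Frobenius action $F:\operatorname{H}^d_{\mathfrak m}(R)\to \operatorname{H}^d_{\mathfrak m}(R)$ sends the class $[z+(x_1^n,\dots,x_d^n)]$ to $[z^p+(x_1^{pn},\dots,x_d^{pn})]$. An $R$-submodule $N\subseteq \operatorname{H}^d_{\mathfrak m}(R)$ is $F$-stable if $F(N)\subseteq N$. An ideal $J$ of $R$ is an $F$-ideal if the submodule $(0:_{\operatorname{H}^d_{\mathfrak m}(R)}J)=\{\eta\in \operatorname{H}^d_{\mathfrak m}(R)\mid J\eta=0\}$ is $F$-stable. *)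

theory Defs
  imports
    "HOL-Algebra.Algebra"
    "HOL-Library.Extended_Nat"
    "HOL-Computational_Algebra.Primes"
begin

section \<open>Local rings, dimension, depth\<close>

definition local_ring :: "('a, 'b) ring_scheme \<Rightarrow> 'a set \<Rightarrow> bool"
  where "local_ring R m \<longleftrightarrow>
    cring R \<and> maximalideal m R \<and> (\<forall>m'. maximalideal m' R \<longrightarrow> m' = m)"

definition noetherian_local_ring :: "('a, 'b) ring_scheme \<Rightarrow> 'a set \<Rightarrow> bool"
  where "noetherian_local_ring R m \<longleftrightarrow> noetherian_ring R \<and> local_ring R m"

definition prime_chain :: "('a, 'b) ring_scheme \<Rightarrow> nat \<Rightarrow> (nat \<Rightarrow> 'a set) \<Rightarrow> bool"
  where "prime_chain R n c \<longleftrightarrow>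
    (\<forall>i\<le>n. primeideal (c i) R) \<and> (\<forall>i<n. c i \<subset> c (Suc i))"

definition krull_dim :: "('a, 'b) ring_scheme \<Rightarrow> enat"
  where "krull_dim R = Sup {enat n | n. \<exists>c. prime_chain R n c}"

definition system_of_parameters :: "('a, 'b) ring_scheme \<Rightarrow> 'a set \<Rightarrow> 'a list \<Rightarrow> bool"
  where "system_of_parameters R m xs \<longleftrightarrow>
    set xs \<subseteq> m \<and> enat (length xs) = krull_dim R \<and>
    (\<forall>a\<in>m. \<exists>k::nat. a [^]\<^bsub>R\<^esub> k \<in> genideal R (set xs))"

definition regular_sequence :: "('a, 'b) ring_scheme \<Rightarrow> 'a list \<Rightarrow> bool"
  where "regular_sequence R xs \<longleftrightarrow>
    set xs \<subseteq> carrier R \<and> genideal R (set xs) \<noteq> carrier R \<and>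
    (\<forall>i<length xs. \<forall>a\<in>carrier R.
       xs ! i \<otimes>\<^bsub>R\<^esub> a \<in> genideal R (set (take i xs)) \<longrightarrow> a \<in> genideal R (set (take i xs)))"

definition depth :: "('a, 'b) ring_scheme \<Rightarrow> 'a set \<Rightarrow> enat"
  where "depth R m = Sup {enat (length xs) | xs. set xs \<subseteq> m \<and> regular_sequence R xs}"

definition cohen_macaulay :: "('a, 'b) ring_scheme \<Rightarrow> 'a set \<Rightarrow> bool"
  where "cohen_macaulay R m \<longleftrightarrow> noetherian_local_ring R m \<and> depth R m = krull_dim R"

definition reduced_ring :: "('a, 'b) ring_scheme \<Rightarrow> bool"
  where "reduced_ring R \<longleftrightarrow>
    (\<forall>a\<in>carrier R. \<forall>n::nat. a [^]\<^bsub>R\<^esub> n = \<zero>\<^bsub>R\<^esub> \<longrightarrow> a = \<zero>\<^bsub>R\<^esub>)"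

definition minimal_prime :: "('a, 'b) ring_scheme \<Rightarrow> 'a set \<Rightarrow> bool"
  where "minimal_prime R P \<longleftrightarrow>
    primeideal P R \<and> (\<forall>Q. primeideal Q R \<and> Q \<subseteq> P \<longrightarrow> Q = P)"

definition equidimensional :: "('a, 'b) ring_scheme \<Rightarrow> bool"
  where "equidimensional R \<longleftrightarrow>
    (\<forall>P. minimal_prime R P \<longrightarrow> krull_dim (R Quot P) = krull_dim R)"

definition regular_local_ring :: "('a, 'b) ring_scheme \<Rightarrow> bool"
  where "regular_local_ring R \<longleftrightarrow>
    (\<exists>m. noetherian_local_ring R m \<and>
      (\<exists>S\<subseteq>carrier R. finite S \<and> m = genideal R S \<and> enat (card S) = krull_dim R))"

section \<open>Constructions of rings\<close>

text \<open>In this theory the operations on a set of equivalence classes are written as unions over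
  all representatives, as in \<^const>\<open>rcoset_mult\<close>; by well-definedness all members of such a
  union coincide.\<close>

subsection \<open>Localization\<close>

definition fraction :: "('a, 'b) ring_scheme \<Rightarrow> 'a set \<Rightarrow> 'a \<Rightarrow> 'a \<Rightarrow> ('a \<times> 'a) set"
  where "fraction R S a s = {(b, t). b \<in> carrier R \<and> t \<in> S \<and>
    (\<exists>u\<in>S. u \<otimes>\<^bsub>R\<^esub> (a \<otimes>\<^bsub>R\<^esub> t \<ominus>\<^bsub>R\<^esub> b \<otimes>\<^bsub>R\<^esub> s) = \<zero>\<^bsub>R\<^esub>)}"

definition localization :: "('a, 'b) ring_scheme \<Rightarrow> 'a set \<Rightarrow> ('a \<times> 'a) set ring"
  where "localization R S =
    \<lparr>carrier = {fraction R S a s | a s. a \<in> carrier R \<and> s \<in> S},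
     monoid.mult = (\<lambda>U V. \<Union>{fraction R S (a \<otimes>\<^bsub>R\<^esub> b) (s \<otimes>\<^bsub>R\<^esub> t) | a s b t.
              (a, s) \<in> U \<and> (b, t) \<in> V}),
     monoid.one = fraction R S \<one>\<^bsub>R\<^esub> \<one>\<^bsub>R\<^esub>,
     ring.zero = fraction R S \<zero>\<^bsub>R\<^esub> \<one>\<^bsub>R\<^esub>,
     ring.add = (\<lambda>U V. \<Union>{fraction R S (a \<otimes>\<^bsub>R\<^esub> t \<oplus>\<^bsub>R\<^esub> b \<otimes>\<^bsub>R\<^esub> s) (s \<otimes>\<^bsub>R\<^esub> t) | a s b t.
              (a, s) \<in> U \<and> (b, t) \<in> V})\<rparr>"

abbreviation localization_at :: "('a, 'b) ring_scheme \<Rightarrow> 'a set \<Rightarrow> ('a \<times> 'a) set ring"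
  where "localization_at R P \<equiv> localization R (carrier R - P)"

text \<open>The maximal ideal $PR_P$ of $R_P$.\<close>

definition localized_prime :: "('a, 'b) ring_scheme \<Rightarrow> 'a set \<Rightarrow> ('a \<times> 'a) set set"
  where "localized_prime R P =
    {fraction R (carrier R - P) a s | a s. a \<in> P \<and> s \<in> carrier R - P}"

text \<open>The residue field $\kappa(P) = \mathrm{Frac}(R/P)$ with its structure map.\<close>

definition residue_field :: "('a, 'b) ring_scheme \<Rightarrow> 'a set \<Rightarrow> ('a set \<times> 'a set) set ring"
  where "residue_field R P = localization_at (R Quot P) {\<zero>\<^bsub>R Quot P\<^esub>}"

definition to_residue_field :: "('a, 'b) ring_scheme \<Rightarrow> 'a set \<Rightarrow> 'a \<Rightarrow> ('a set \<times> 'a set) set"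
  where "to_residue_field R P a =
    fraction (R Quot P) (carrier (R Quot P) - {\<zero>\<^bsub>R Quot P\<^esub>}) (P +>\<^bsub>R\<^esub> a) \<one>\<^bsub>R Quot P\<^esub>"

subsection \<open>Adic completion\<close>

primrec ideal_power :: "('a, 'b) ring_scheme \<Rightarrow> 'a set \<Rightarrow> nat \<Rightarrow> 'a set"
  where
    "ideal_power R I 0 = carrier R"
  | "ideal_power R I (Suc n) = ideal_prod R (ideal_power R I n) I"

text \<open>The inverse limit of the $R/I^n$: the transition map $R/I^{n+1} \to R/I^n$ sends a coset
  to the unique coset containing it.\<close>

definition completion :: "('a, 'b) ring_scheme \<Rightarrow> 'a set \<Rightarrow> (nat \<Rightarrow> 'a set) ring"
  where "completion R I =
    \<lparr>carrier = {f. \<forall>n. f n \<in> carrier (R Quot ideal_power R I n) \<and> f (Suc n) \<subseteq> f n},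
     monoid.mult = (\<lambda>f g n. f n \<otimes>\<^bsub>R Quot ideal_power R I n\<^esub> g n),
     monoid.one = (\<lambda>n. \<one>\<^bsub>R Quot ideal_power R I n\<^esub>),
     ring.zero = (\<lambda>n. \<zero>\<^bsub>R Quot ideal_power R I n\<^esub>),
     ring.add = (\<lambda>f g n. f n \<oplus>\<^bsub>R Quot ideal_power R I n\<^esub> g n)\<rparr>"

definition to_completion :: "('a, 'b) ring_scheme \<Rightarrow> 'a set \<Rightarrow> 'a \<Rightarrow> nat \<Rightarrow> 'a set"
  where "to_completion R I a = (\<lambda>n. ideal_power R I n +>\<^bsub>R\<^esub> a)"

subsection \<open>Polynomial rings and tensor products\<close>

text \<open>The polynomial ring $R[X_v : v \in V]$ on the carrier of \<^theory>\<open>HOL-Algebra.Indexed_Polynomials\<close>,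
  which does not supply the multiplication.\<close>

definition mpoly_ring :: "('a, 'b) ring_scheme \<Rightarrow> 'v set \<Rightarrow> ('v multiset \<Rightarrow> 'a) ring"
  where "mpoly_ring R V =
    \<lparr>carrier = ring.indexed_pset R V (carrier R),
     monoid.mult = (\<lambda>f g m. \<Oplus>\<^bsub>R\<^esub>k\<in>{k. k \<subseteq># m}. f k \<otimes>\<^bsub>R\<^esub> g (m - k)),
     monoid.one = ring.indexed_const R \<one>\<^bsub>R\<^esub>,
     ring.zero = ring.indexed_const R \<zero>\<^bsub>R\<^esub>,
     ring.add = ring.indexed_padd R\<rparr>"

text \<open>The tensor product $B \otimes_A C$ of commutative $A$-algebras $\varphi : A \to B$ and
  $\psi : A \to C$, presented as a $B$-algebra by generators $X_c = 1 \otimes c$, $c \in C$, subject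
  to the relations making $c \mapsto X_c$ a homomorphism of $A$-algebras.\<close>

definition tensor_relations ::
    "('a, 'r) ring_scheme \<Rightarrow> ('b, 's) ring_scheme \<Rightarrow> ('c, 't) ring_scheme \<Rightarrow>
     ('a \<Rightarrow> 'b) \<Rightarrow> ('a \<Rightarrow> 'c) \<Rightarrow> ('c multiset \<Rightarrow> 'b) set"
  where "tensor_relations A B C \<phi> \<psi> =
    (let T = mpoly_ring B (carrier C); v = ring.indexed_var B in
      {v (c \<oplus>\<^bsub>C\<^esub> c') \<ominus>\<^bsub>T\<^esub> (v c \<oplus>\<^bsub>T\<^esub> v c') | c c'. c \<in> carrier C \<and> c' \<in> carrier C} \<union>
      {v (c \<otimes>\<^bsub>C\<^esub> c') \<ominus>\<^bsub>T\<^esub> (v c \<otimes>\<^bsub>T\<^esub> v c') | c c'. c \<in> carrier C \<and> c' \<in> carrier C} \<union>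
      {v (\<psi> a) \<ominus>\<^bsub>T\<^esub> ring.indexed_const B (\<phi> a) | a. a \<in> carrier A})"

definition tensor_ideal ::
    "('a, 'r) ring_scheme \<Rightarrow> ('b, 's) ring_scheme \<Rightarrow> ('c, 't) ring_scheme \<Rightarrow>
     ('a \<Rightarrow> 'b) \<Rightarrow> ('a \<Rightarrow> 'c) \<Rightarrow> ('c multiset \<Rightarrow> 'b) set"
  where "tensor_ideal A B C \<phi> \<psi> =
    genideal (mpoly_ring B (carrier C)) (tensor_relations A B C \<phi> \<psi>)"

definition tensor_product ::
    "('a, 'r) ring_scheme \<Rightarrow> ('b, 's) ring_scheme \<Rightarrow> ('c, 't) ring_scheme \<Rightarrow>
     ('a \<Rightarrow> 'b) \<Rightarrow> ('a \<Rightarrow> 'c) \<Rightarrow> ('c multiset \<Rightarrow> 'b) set ring"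
  where "tensor_product A B C \<phi> \<psi> =
    mpoly_ring B (carrier C) Quot tensor_ideal A B C \<phi> \<psi>"

text \<open>The map $c \mapsto 1 \otimes c$.\<close>

definition tensor_inr ::
    "('a, 'r) ring_scheme \<Rightarrow> ('b, 's) ring_scheme \<Rightarrow> ('c, 't) ring_scheme \<Rightarrow>
     ('a \<Rightarrow> 'b) \<Rightarrow> ('a \<Rightarrow> 'c) \<Rightarrow> 'c \<Rightarrow> ('c multiset \<Rightarrow> 'b) set"
  where "tensor_inr A B C \<phi> \<psi> c =
    tensor_ideal A B C \<phi> \<psi> +>\<^bsub>mpoly_ring B (carrier C)\<^esub> ring.indexed_var B c"

section \<open>Excellent rings\<close>

definition regular_ring :: "('a, 'b) ring_scheme \<Rightarrow> bool"
  where "regular_ring R \<longleftrightarrow>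
    cring R \<and> noetherian_ring R \<and>
    (\<forall>P. primeideal P R \<longrightarrow> regular_local_ring (localization_at R P))"

text \<open>A \<open>k\<close>-algebra $\varphi : k \to A$ is geometrically regular if $A \otimes_k K$ is regular for
  every finite field extension $K$ of $k$.  Up to isomorphism, the finite extensions of $k$ are
  exactly the quotients $K = k[X_0, \dots, X_{n-1}]/\mathfrak M$ by maximal ideals (by Zariski's
  lemma all of these are finite over $k$); quantifying over those keeps $K$ within one type.\<close>

definition geometrically_regular ::
    "('k, 'b) ring_scheme \<Rightarrow> ('a, 'c) ring_scheme \<Rightarrow> ('k \<Rightarrow> 'a) \<Rightarrow> bool"
  where "geometrically_regular k A \<phi> \<longleftrightarrow>
    (\<forall>(n::nat) M. maximalideal M (mpoly_ring k {..<n}) \<longrightarrow>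
      regular_ring (tensor_product k A (mpoly_ring k {..<n} Quot M) \<phi>
        (\<lambda>a. M +>\<^bsub>mpoly_ring k {..<n}\<^esub> ring.indexed_const k a)))"

text \<open>For each prime $P$ the map from $A = R_P$ to its completion $\hat A$ has geometrically
  regular fibres $\hat A \otimes_A \kappa(Q)$.  (This map is automatically flat, $A$ being
  Noetherian, so that it is a regular homomorphism.)\<close>

definition G_ring :: "('a, 'b) ring_scheme \<Rightarrow> bool"
  where "G_ring R \<longleftrightarrow>
    cring R \<and> noetherian_ring R \<and>
    (\<forall>P. primeideal P R \<longrightarrow>
      (let A = localization_at R P; m = localized_prime R P in
        \<forall>Q. primeideal Q A \<longrightarrow>
          geometrically_regular (residue_field A Q)
            (tensor_product A (completion A m) (residue_field A Q)
              (to_completion A m) (to_residue_field A Q))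
            (tensor_inr A (completion A m) (residue_field A Q)
              (to_completion A m) (to_residue_field A Q))))"

definition regular_locus_open :: "('a, 'b) ring_scheme \<Rightarrow> bool"
  where "regular_locus_open R \<longleftrightarrow>
    (\<exists>E. ideal E R \<and>
      (\<forall>P. primeideal P R \<longrightarrow> (regular_local_ring (localization_at R P) \<longleftrightarrow> \<not> E \<subseteq> P)))"

text \<open>Finitely generated algebras are taken in the form $R[X_0, \dots, X_{n-1}]/\mathfrak a$.\<close>

definition J2_ring :: "('a, 'b) ring_scheme \<Rightarrow> bool"
  where "J2_ring R \<longleftrightarrow>
    (\<forall>(n::nat) E. ideal E (mpoly_ring R {..<n}) \<longrightarrow>
      regular_locus_open (mpoly_ring R {..<n} Quot E))"

definition saturated_chain :: "('a, 'b) ring_scheme \<Rightarrow> nat \<Rightarrow> (nat \<Rightarrow> 'a set) \<Rightarrow> bool"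
  where "saturated_chain R n c \<longleftrightarrow>
    prime_chain R n c \<and> (\<forall>i<n. \<nexists>P. primeideal P R \<and> c i \<subset> P \<and> P \<subset> c (Suc i))"

definition catenary :: "('a, 'b) ring_scheme \<Rightarrow> bool"
  where "catenary R \<longleftrightarrow>
    (\<forall>P Q. primeideal P R \<and> primeideal Q R \<and> P \<subseteq> Q \<longrightarrow>
      (\<exists>N. \<forall>n c. prime_chain R n c \<and> c 0 = P \<and> c n = Q \<longrightarrow> n \<le> N) \<and>
      (\<forall>n n' c c'. saturated_chain R n c \<and> c 0 = P \<and> c n = Q \<and>
         saturated_chain R n' c' \<and> c' 0 = P \<and> c' n' = Q \<longrightarrow> n = n'))"

definition universally_catenary :: "('a, 'b) ring_scheme \<Rightarrow> bool"
  where "universally_catenary R \<longleftrightarrow>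
    (\<forall>(n::nat) E. ideal E (mpoly_ring R {..<n}) \<longrightarrow> catenary (mpoly_ring R {..<n} Quot E))"

definition excellent :: "('a, 'b) ring_scheme \<Rightarrow> bool"
  where "excellent R \<longleftrightarrow>
    cring R \<and> noetherian_ring R \<and> G_ring R \<and> J2_ring R \<and> universally_catenary R"

section \<open>Modules and projective dimension\<close>

text \<open>The fields \<^const>\<open>monoid.mult\<close> and \<^const>\<open>monoid.one\<close>, which the record type of modules inherits from
  rings, play no role for modules and are left unspecified where no ring structure is present.\<close>

definition regular_module :: "('a, 'b) ring_scheme \<Rightarrow> ('a, 'a) module"
  where "regular_module R =
    \<lparr>carrier = carrier R, monoid.mult = monoid.mult R, monoid.one = \<one>\<^bsub>R\<^esub>,
     ring.zero = \<zero>\<^bsub>R\<^esub>, ring.add = ring.add R, smult = monoid.mult R\<rparr>"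

abbreviation ideal_module :: "('a, 'b) ring_scheme \<Rightarrow> 'a set \<Rightarrow> ('a, 'a) module"
  where "ideal_module R I \<equiv> (regular_module R)\<lparr>carrier := I\<rparr>"

definition module_hom ::
    "('a, 'r) ring_scheme \<Rightarrow> ('a, 'm, 's) module_scheme \<Rightarrow> ('a, 'n, 't) module_scheme \<Rightarrow> ('m \<Rightarrow> 'n) set"
  where "module_hom R M N =
    {f \<in> carrier M \<rightarrow> carrier N.
      (\<forall>x\<in>carrier M. \<forall>y\<in>carrier M. f (x \<oplus>\<^bsub>M\<^esub> y) = f x \<oplus>\<^bsub>N\<^esub> f y) \<and>
      (\<forall>a\<in>carrier R. \<forall>x\<in>carrier M. f (a \<odot>\<^bsub>M\<^esub> x) = a \<odot>\<^bsub>N\<^esub> f x)}"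

definition module_ker ::
    "('a, 'm, 's) module_scheme \<Rightarrow> ('a, 'n, 't) module_scheme \<Rightarrow> ('m \<Rightarrow> 'n) \<Rightarrow> 'm set"
  where "module_ker M N f = {x \<in> carrier M. f x = \<zero>\<^bsub>N\<^esub>}"

definition free_module :: "('a, 'r) ring_scheme \<Rightarrow> 'b set \<Rightarrow> ('a, 'b \<Rightarrow> 'a) module"
  where "free_module R B =
    \<lparr>carrier = {f. (\<forall>b\<in>B. f b \<in> carrier R) \<and> (\<forall>b. b \<notin> B \<longrightarrow> f b = \<zero>\<^bsub>R\<^esub>) \<and>
                   finite {b. f b \<noteq> \<zero>\<^bsub>R\<^esub>}},
     monoid.mult = undefined, monoid.one = undefined,
     ring.zero = (\<lambda>b. \<zero>\<^bsub>R\<^esub>),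
     ring.add = (\<lambda>f g b. f b \<oplus>\<^bsub>R\<^esub> g b),
     smult = (\<lambda>a f b. a \<otimes>\<^bsub>R\<^esub> f b)\<rparr>"

text \<open>Projective: a direct summand of a free module.  Taking the basis \<open>B\<close> inside the type of
  elements of \<open>P\<close> is no restriction, because if \<open>P\<close> is projective then the canonical surjection
  onto \<open>P\<close> from the free module on \<^term>\<open>carrier P\<close> splits.\<close>

definition projective_module :: "('a, 'r) ring_scheme \<Rightarrow> ('a, 'm, 's) module_scheme \<Rightarrow> bool"
  where "projective_module R P \<longleftrightarrow> module R P \<and>
    (\<exists>(B :: 'm set) i \<pi>. i \<in> module_hom R P (free_module R B) \<and>
      \<pi> \<in> module_hom R (free_module R B) P \<and> (\<forall>x\<in>carrier P. \<pi> (i x) = x))"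

text \<open>An exact sequence $\cdots \to P_1 \to P_0 \to M \to 0$ of projective modules with $P_i = 0$
  for $i > n$.\<close>

definition projective_resolution ::
    "('a, 'r) ring_scheme \<Rightarrow> ('a, 'c, 's) module_scheme \<Rightarrow> nat \<Rightarrow>
     (nat \<Rightarrow> ('a, 'm) module) \<Rightarrow> ('m \<Rightarrow> 'c) \<Rightarrow> (nat \<Rightarrow> 'm \<Rightarrow> 'm) \<Rightarrow> bool"
  where "projective_resolution R M n P \<epsilon> d \<longleftrightarrow>
    (\<forall>i. projective_module R (P i)) \<and> (\<forall>i>n. carrier (P i) = {\<zero>\<^bsub>P i\<^esub>}) \<and>
    \<epsilon> \<in> module_hom R (P 0) M \<and> \<epsilon> ` carrier (P 0) = carrier M \<and>
    (\<forall>i. d i \<in> module_hom R (P (Suc i)) (P i)) \<and>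
    module_ker (P 0) M \<epsilon> = d 0 ` carrier (P 1) \<and>
    (\<forall>i. module_ker (P (Suc i)) (P i) (d i) = d (Suc i) ` carrier (P (Suc (Suc i))))"

text \<open>The type argument only names the type in which the members of the resolution live.  In a
  hypothesis with a free type variable \<open>'m\<close> it is therefore arbitrary, and a resolution by modules
  in whatever type satisfies the hypothesis for a suitable instance of \<open>'m\<close>.\<close>

definition finite_projective_dimension ::
    "'m itself \<Rightarrow> ('a, 'r) ring_scheme \<Rightarrow> ('a, 'c, 's) module_scheme \<Rightarrow> bool"
  where "finite_projective_dimension T R M \<longleftrightarrow>
    (\<exists>n (P :: nat \<Rightarrow> ('a, 'm) module) \<epsilon> d. projective_resolution R M n P \<epsilon> d)"

section \<open>Top local cohomology and its Frobenius action\<close>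

definition quotient_module :: "('a, 'b) ring_scheme \<Rightarrow> 'a set \<Rightarrow> ('a, 'a set) module"
  where "quotient_module R I =
    \<lparr>carrier = carrier (R Quot I), monoid.mult = monoid.mult (R Quot I), monoid.one = \<one>\<^bsub>R Quot I\<^esub>,
     ring.zero = \<zero>\<^bsub>R Quot I\<^esub>, ring.add = ring.add (R Quot I),
     smult = (\<lambda>a C. \<Union>c\<in>C. I +>\<^bsub>R\<^esub> (a \<otimes>\<^bsub>R\<^esub> c))\<rparr>"

text \<open>Direct limit of a sequence $M_0 \to M_1 \to \cdots$ with transition maps
  $f_n : M_n \to M_{n+1}$.  The composite $M_n \to M_k$ is \<open>fold f [n..<k]\<close>.\<close>

definition limit_class ::
    "(nat \<Rightarrow> ('a, 'm) module) \<Rightarrow> (nat \<Rightarrow> 'm \<Rightarrow> 'm) \<Rightarrow> nat \<Rightarrow> 'm \<Rightarrow> (nat \<times> 'm) set"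
  where "limit_class M f n x =
    {(k, y). y \<in> carrier (M k) \<and> (\<exists>l. n \<le> l \<and> k \<le> l \<and> fold f [n..<l] x = fold f [k..<l] y)}"

definition direct_limit ::
    "(nat \<Rightarrow> ('a, 'm) module) \<Rightarrow> (nat \<Rightarrow> 'm \<Rightarrow> 'm) \<Rightarrow> ('a, (nat \<times> 'm) set) module"
  where "direct_limit M f =
    \<lparr>carrier = {limit_class M f n x | n x. x \<in> carrier (M n)},
     monoid.mult = undefined, monoid.one = undefined,
     ring.zero = limit_class M f 0 \<zero>\<^bsub>M 0\<^esub>,
     ring.add = (\<lambda>U V. \<Union>{limit_class M f l (fold f [n..<l] x \<oplus>\<^bsub>M l\<^esub> fold f [k..<l] y) | n x k y l.
              (n, x) \<in> U \<and> (k, y) \<in> V \<and> l = max n k}),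
     smult = (\<lambda>a U. \<Union>{limit_class M f n (a \<odot>\<^bsub>M n\<^esub> x) | n x. (n, x) \<in> U})\<rparr>"

text \<open>The ideal $(x_1^n, \dots, x_d^n)$.\<close>

definition param_ideal :: "('a, 'b) ring_scheme \<Rightarrow> 'a list \<Rightarrow> nat \<Rightarrow> 'a set"
  where "param_ideal R xs n = genideal R ((\<lambda>x. x [^]\<^bsub>R\<^esub> n) ` set xs)"

abbreviation lc_term :: "('a, 'b) ring_scheme \<Rightarrow> 'a list \<Rightarrow> nat \<Rightarrow> ('a, 'a set) module"
  where "lc_term R xs n \<equiv> quotient_module R (param_ideal R xs n)"

definition lc_map :: "('a, 'b) ring_scheme \<Rightarrow> 'a list \<Rightarrow> nat \<Rightarrow> 'a set \<Rightarrow> 'a set"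
  where "lc_map R xs n C =
    (\<Union>c\<in>C. param_ideal R xs (Suc n) +>\<^bsub>R\<^esub> (foldr (monoid.mult R) xs \<one>\<^bsub>R\<^esub> \<otimes>\<^bsub>R\<^esub> c))"

text \<open>$H^d_{\mathfrak m}(R) = \varinjlim_n R/(x_1^n, \dots, x_d^n)$ for a system of parameters
  \<open>xs\<close> $= x_1, \dots, x_d$.  The index $n = 0$ is included, which does not affect the limit.\<close>

definition local_cohomology ::
    "('a, 'b) ring_scheme \<Rightarrow> 'a list \<Rightarrow> ('a, (nat \<times> 'a set) set) module"
  where "local_cohomology R xs = direct_limit (lc_term R xs) (lc_map R xs)"

text \<open>The class $[z + (x_1^n, \dots, x_d^n)]$.\<close>

definition lc_class :: "('a, 'b) ring_scheme \<Rightarrow> 'a list \<Rightarrow> nat \<Rightarrow> 'a \<Rightarrow> (nat \<times> 'a set) set"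
  where "lc_class R xs n z =
    limit_class (lc_term R xs) (lc_map R xs) n (param_ideal R xs n +>\<^bsub>R\<^esub> z)"

definition lc_frobenius ::
    "('a, 'b) ring_scheme \<Rightarrow> nat \<Rightarrow> 'a list \<Rightarrow> (nat \<times> 'a set) set \<Rightarrow> (nat \<times> 'a set) set"
  where "lc_frobenius R p xs \<eta> = 
    \<Union>{lc_class R xs (p * n) (z [^]\<^bsub>R\<^esub> p) | n C z. (n, C) \<in> \<eta> \<and> z \<in> C}"

definition F_stable :: "('a, 'b) ring_scheme \<Rightarrow> nat \<Rightarrow> 'a list \<Rightarrow> (nat \<times> 'a set) set set \<Rightarrow> bool"
  where "F_stable R p xs N \<longleftrightarrow>
    submodule N R (local_cohomology R xs) \<and> lc_frobenius R p xs ` N \<subseteq> N"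

definition lc_annihilated :: "('a, 'b) ring_scheme \<Rightarrow> 'a list \<Rightarrow> 'a set \<Rightarrow> (nat \<times> 'a set) set set"
  where "lc_annihilated R xs J =
    {\<eta> \<in> carrier (local_cohomology R xs).
      \<forall>a\<in>J. a \<odot>\<^bsub>local_cohomology R xs\<^esub> \<eta> = \<zero>\<^bsub>local_cohomology R xs\<^esub>}"

text \<open>The notion does not depend on the system of parameters \<open>xs\<close>: the canonical isomorphisms
  between the limits for different systems of parameters commute with the Frobenius actions.\<close>

definition F_ideal :: "('a, 'b) ring_scheme \<Rightarrow> nat \<Rightarrow> 'a list \<Rightarrow> 'a set \<Rightarrow> bool"
  where "F_ideal R p xs J \<longleftrightarrow> ideal J R \<and> F_stable R p xs (lc_annihilated R xs J)"

end

theory Submission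
  imports Defs Complex_Main
begin

text \<open>Suppose that $J \subseteq I$.  A module of finite projective dimension has a minimal free resolution
  $G$ of some finite length $s$.  By the argument of Auslander and Buchsbaum there is a regular sequence
  $y_1, \dots, y_s$ such that $y_i$ annihilates $\mathrm{Ext}^c(R/I, R)$ for all $c \ge i$.  Multiplication by powers
  of the $y_i$ moves a cocycle of $\mathrm{Hom}(G_s, R)$ with a unit entry down to a $z \in R$ with
  $zI \subseteq (x_1, \dots, x_d)$, where $x$ is a system of parameters extending the sequence; hence $J$ annihilates
  the class of $z$ in local cohomology, and since $J$ is an $F$-ideal it annihilates all Frobenius powers of this class.

  Going up the resolution again with Frobenius powers turns this into the statement that $J$ lies in
  an ideal close to the $q/p^{e_0}$-th powers of the $x_i$, up to error terms.  If $R$ is Cohen-Macaulay these errors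
  vanish, and $J = 0$ by Krull's intersection theorem.  Otherwise one works modulo a minimal prime $P$ with
  $\dim R/P = d$, with the limit closures of the ideals $(x_1^n, \dots, x_d^n)$: their colengths grow like $q^d$,
  the error terms are $o(q^d)$, and $J \not\subseteq P$ would make the colength $o(q^d)$.  So $J$ lies in every
  minimal prime, that is $J = 0$ as $R$ is reduced.\<close>

section \<open>Ideals of commutative rings\<close>

text \<open>Outside the Cohen-Macaulay case a factor y^q cannot be cancelled modulo parameter
  ideals. The ideals \<open>lim\<close> are kernels of maps into a direct limit, so for them
  cancellation holds by construction (\<open>lim_shift\<close>). The price: a remainder in lim(y^q,
  ...) need not be a multiple of y^q modulo lim(y^(pq), ...). This is the error; its length is at
  most a rank times colen B - u(e), where B is generated by y^q and lim(y^(pq), ...), and u(e) =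
  colen lim(x^(p^e)). Slicing by powers of y^q bounds colen B - u(e) by u(e+1)/p^(d-1) - p u(e).
  Since u(e)/p^(ed) is increasing and bounded it converges, which makes the error o(q^d). On the
  other side, an element j of J outside P makes the dimension drop, so 1 lies in a limit closure
  modulo P + (j), and Frobenius repeats that relation at every scale: colengths then decay
  geometrically relative to q^d. Powers of the y_i occur because annihilating Ext modulo one more
  regular element costs a squaring. Quotient rings are avoided: a base ideal \<open>c\<close> is
  carried along and everything is read modulo \<open>c\<close>.\<close>

lemma ne_emptyI: "x \<in> A ==> A \<noteq> {}"
 by auto

context cring
begin

lemma idealD:
 assumes "ideal I R"
 shows ideal_sub: "I <= carrier R"
  and ideal_zero: "\<zero> \<in> I"
  and ideal_add: "\<And>a b. a \<in> I ==> b \<in> I ==> a \<oplus> b \<in> I"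
  and ideal_neg: "\<And>a. a \<in> I ==> \<ominus> a \<in> I"
  and ideal_minus: "\<And>a b. a \<in> I ==> b \<in> I ==> a \<ominus> b \<in> I"
  and ideal_mult: "\<And>a r. a \<in> I ==> r \<in> carrier R ==> r \<otimes> a \<in> I"
  and ideal_mult': "\<And>a r. a \<in> I ==> r \<in> carrier R ==> a \<otimes> r \<in> I"
  and ideal_carr: "\<And>a. a \<in> I ==> a \<in> carrier R"
proof -
 interpret ideal I R by fact
 show "I <= carrier R" by (rule a_subset)
 show "\<zero> \<in> I" by simp
 show "\<And>a b. a \<in> I ==> b \<in> I ==> a \<oplus> b \<in> I" by simp
 show *: "\<And>a. a \<in> I ==> \<ominus> a \<in> I" by simp
 show "\<And>a b. a \<in> I ==> b \<in> I ==> a \<ominus> b \<in> I" using * by (simp add: a_minus_def)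
 show "\<And>a r. a \<in> I ==> r \<in> carrier R ==> r \<otimes> a \<in> I" by (rule I_l_closed)
 show "\<And>a r. a \<in> I ==> r \<in> carrier R ==> a \<otimes> r \<in> I" by (rule I_r_closed)
 show "\<And>a. a \<in> I ==> a \<in> carrier R" by (rule Icarr)
qed

lemma ideal_intro:
 assumes "I <= carrier R" "\<zero> \<in> I" "\<And>a b. a \<in> I ==> b \<in> I ==> a \<oplus> b \<in> I"
  and "\<And>a r. a \<in> I ==> r \<in> carrier R ==> r \<otimes> a \<in> I"
 shows "ideal I R"
proof (rule idealI)
 show "ring R" by (rule ring_axioms)
 have neg: "\<ominus> a \<in> I" if "a \<in> I" for a
 proof -
  have "\<ominus> \<one> \<otimes> a \<in> I" using assms(4)[OF that] by simp
  moreover have "\<ominus> \<one> \<otimes> a = \<ominus> a" using assms(1) that by (simp add: subsetD l_minus)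
  ultimately show ?thesis by simp
 qed
 show "subgroup I (add_monoid R)"
  by (rule subgroup.intro) (use assms neg in \<open>auto simp flip: a_inv_def\<close>)
 show "\<And>a x. [|a \<in> I; x \<in> carrier R|] ==> x \<otimes> a \<in> I" by (rule assms(4))
 show "\<And>a x. [|a \<in> I; x \<in> carrier R|] ==> a \<otimes> x \<in> I"
  using assms(1,4) m_comm by (metis subsetD)
qed

lemma ideal_add_cancel:
 assumes "ideal I R" "a \<in> I" "b \<in> carrier R" "b \<oplus> a \<in> I"
 shows "b \<in> I"
proof -
 have "(b \<oplus> a) \<ominus> a \<in> I" using assms by (simp add: ideal_minus)
 moreover have "(b \<oplus> a) \<ominus> a = b"
  using assms ideal_carr[OF assms(1)] by (simp add: a_assoc minus_eq r_neg)
 ultimately show ?thesis by simp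
qed

lemma ideal_minus_cancel:
 assumes "ideal I R" "a \<in> I" "b \<in> carrier R" "b \<ominus> a \<in> I"
 shows "b \<in> I"
 using ideal_add_cancel[OF assms(1) ideal_neg[OF assms(1,2)] assms(3)] assms(4)
 by (simp add: minus_eq)

lemma ideal_minus_cancel':
 assumes "ideal I R" "a \<in> I" "b \<in> carrier R" "a \<ominus> b \<in> I"
 shows "b \<in> I"
proof -
 have "a \<ominus> (a \<ominus> b) \<in> I" using assms by (simp add: ideal_minus)
 moreover have "a \<ominus> (a \<ominus> b) = b"
  using ideal_carr[OF assms(1,2)] assms(3) by algebra
 ultimately show ?thesis by simp
qed

lemma ideal_one: "ideal I R ==> \<one> \<in> I \<longleftrightarrow> I = carrier R"
 using ideal.one_imp_carrier by auto

lemma ideal_pow: "ideal I R ==> a \<in> I ==> n > 0 ==> a [^] (n::nat) \<in> I"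
 by (cases n) (auto intro: ideal_mult simp: ideal_carr)

lemma ideal_pow_le:
 assumes "ideal I R" "a \<in> carrier R" "a [^] (k::nat) \<in> I" "k \<le> l"
 shows "a [^] l \<in> I"
proof -
 have "a [^] l = a [^] (l - k) \<otimes> a [^] k"
  using assms by (simp add: nat_pow_mult)
 thus ?thesis using assms by (simp add: ideal_mult)
qed

lemma Idl_ideal: "ideal I R ==> Idl I = I"
 by (meson genideal_minimal genideal_self ideal_sub subset_antisym order_refl)

lemma Idl_mono: "S <= T ==> T <= carrier R ==> Idl S <= Idl T"
 by (rule subset_Idl_subset)

lemma Idl_mem: "a \<in> S ==> S <= carrier R ==> a \<in> Idl S"
 using genideal_self by blast

lemma Idl_insert:
 assumes "S <= carrier R" "a \<in> carrier R"
 shows "Idl (insert a S) = {i \<oplus> r \<otimes> a | i r. i \<in> Idl S \<and> r \<in> carrier R}" (is "_ = ?E")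
proof
 have I: "ideal (Idl S) R" by (rule genideal_ideal[OF assms(1)])
 have J: "ideal (Idl (insert a S)) R" using assms by (auto intro: genideal_ideal)
 have E: "ideal ?E R"
 proof (rule ideal_intro)
  show "?E <= carrier R" using assms(2) ideal_carr[OF I] by auto
  have "\<zero> = \<zero> \<oplus> \<zero> \<otimes> a" using assms(2) by simp
  thus "\<zero> \<in> ?E" using ideal_zero[OF I] by blast
 next
  fix x y assume "x \<in> ?E" "y \<in> ?E"
  then obtain i r j s where *: "x = i \<oplus> r \<otimes> a" "y = j \<oplus> s \<otimes> a" "i \<in> Idl S" "j \<in> Idl S"
   "r \<in> carrier R" "s \<in> carrier R" by blast
  have c: "i \<in> carrier R" "j \<in> carrier R" using * ideal_carr[OF I] by auto
  have "x \<oplus> y = (i \<oplus> j) \<oplus> (r \<oplus> s) \<otimes> a" unfolding *(1,2) using c * assms(2) by algebra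
  thus "x \<oplus> y \<in> ?E" using * ideal_add[OF I] by blast
 next
  fix x s assume "x \<in> ?E" and s: "s \<in> carrier R"
  then obtain i r where *: "x = i \<oplus> r \<otimes> a" "i \<in> Idl S" "r \<in> carrier R" by blast
  have c: "i \<in> carrier R" using * ideal_carr[OF I] by auto
  have "s \<otimes> x = s \<otimes> i \<oplus> (s \<otimes> r) \<otimes> a" unfolding *(1) using c * assms(2) s by algebra
  thus "s \<otimes> x \<in> ?E" using * s ideal_mult[OF I] by blast
 qed
 show "Idl (insert a S) <= ?E"
 proof (rule genideal_minimal[OF E], clarsimp, intro conjI subsetI)
  have "a = \<zero> \<oplus> \<one> \<otimes> a" using assms(2) by simp
  thus "\<exists>i r. a = i \<oplus> r \<otimes> a \<and> i \<in> Idl S \<and> r \<in> carrier R" using ideal_zero[OF I] by blast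
  fix x assume "x \<in> S"
  hence "x = x \<oplus> \<zero> \<otimes> a" "x \<in> Idl S" using assms Idl_mem by auto
  thus "x \<in> {i \<oplus> r \<otimes> a |i r. i \<in> Idl S \<and> r \<in> carrier R}" by blast
 qed
 show "?E <= Idl (insert a S)"
 proof clarsimp
  fix i r assume i: "i \<in> Idl S" and r: "r \<in> carrier R"
  have "i \<in> Idl (insert a S)" using i Idl_mono[of S "insert a S"] assms by blast
  moreover have "a \<in> Idl (insert a S)" using assms by (auto intro: Idl_mem)
  ultimately show "i \<oplus> r \<otimes> a \<in> Idl (insert a S)" using r ideal_add[OF J] ideal_mult[OF J] by blast
 qed
qed

lemma Idl_insertE:
 assumes "x \<in> Idl (insert a S)" "S <= carrier R" "a \<in> carrier R"
 obtains i r where "i \<in> Idl S" "r \<in> carrier R" "x = i \<oplus> r \<otimes> a"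
 using assms Idl_insert[of S a] by blast

lemma Idl_insertE':
 assumes "x \<in> Idl (insert a S)" "S <= carrier R" "a \<in> carrier R"
 obtains r where "r \<in> carrier R" "x \<ominus> r \<otimes> a \<in> Idl S"
proof -
 obtain i r where *: "i \<in> Idl S" "r \<in> carrier R" "x = i \<oplus> r \<otimes> a" using assms by (rule Idl_insertE)
 have "i \<in> carrier R" using *(1) genideal_ideal[OF assms(2)] ideal_carr by blast
 hence "x \<ominus> r \<otimes> a = i" unfolding *(3) using * assms(3) by algebra
 thus ?thesis using * that by blast
qed

lemma Idl_insertI:
 assumes "x \<ominus> r \<otimes> a \<in> Idl S" "r \<in> carrier R" "x \<in> carrier R" "S <= carrier R" "a \<in> carrier R"
 shows "x \<in> Idl (insert a S)"
proof -
 have "x = (x \<ominus> r \<otimes> a) \<oplus> r \<otimes> a" using assms by algebra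
 thus ?thesis using Idl_insert[OF assms(4,5)] assms(1,2) by blast
qed

lemma Idl_Un_Idl:
 assumes "S <= carrier R" "T <= carrier R"
 shows "Idl (Idl S \<union> T) = Idl (S \<union> T)"
proof
 have S: "Idl S <= carrier R" using genideal_ideal[OF assms(1)] ideal_sub by blast
 show "Idl (Idl S \<union> T) <= Idl (S \<union> T)"
  by (rule genideal_minimal)
    (use assms Idl_mono[of S "S \<union> T"] Idl_mem[of _ "S \<union> T"] in \<open>auto intro!: genideal_ideal\<close>)
 show "Idl (S \<union> T) <= Idl (Idl S \<union> T)"
  by (rule Idl_mono) (use assms S genideal_self[OF assms(1)] in auto)
qed

lemma Idl_insert_Idl:
 assumes "S <= carrier R" "a \<in> carrier R"
 shows "Idl (insert a (Idl S)) = Idl (insert a S)"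
 using Idl_Un_Idl[of S "{a}"] assms by simp

lemma Idl_subI:
 assumes "S <= I" "ideal I R"
 shows "Idl S <= I"
 using assms by (simp add: genideal_minimal)

section \<open>Ideal quotients, prime ideals and prime avoidance\<close>

definition colon :: "'a set => 'a => 'a set"
 where "colon I u = {r \<in> carrier R. r \<otimes> u \<in> I}"

lemma colon_ideal:
 assumes "ideal I R" "u \<in> carrier R"
 shows "ideal (colon I u) R"
proof (rule ideal_intro)
 show "colon I u <= carrier R" by (auto simp: colon_def)
 show "\<zero> \<in> colon I u" using assms by (simp add: colon_def ideal_zero)
 show "a \<oplus> b \<in> colon I u" if "a \<in> colon I u" "b \<in> colon I u" for a b
  using that assms by (auto simp: colon_def l_distr ideal_add)
 show "r \<otimes> a \<in> colon I u" if "a \<in> colon I u" "r \<in> carrier R" for a r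
  using that assms by (auto simp: colon_def m_assoc ideal_mult)
qed

lemma colon_sup: "ideal I R ==> u \<in> carrier R ==> I <= colon I u"
 by (auto simp: colon_def ideal_carr ideal_mult')

lemma primeideal_iff:
 "primeideal P R \<longleftrightarrow> ideal P R \<and> \<one> \<notin> P \<and>
   (\<forall>a\<in>carrier R. \<forall>b\<in>carrier R. a \<otimes> b \<in> P --> a \<in> P \<or> b \<in> P)"
proof
 assume "primeideal P R"
 then interpret primeideal P R .
 show "ideal P R \<and> \<one> \<notin> P \<and> (\<forall>a\<in>carrier R. \<forall>b\<in>carrier R. a \<otimes> b \<in> P --> a \<in> P \<or> b \<in> P)"
  using I_notcarr I_prime is_ideal ideal_one by blast
next
 assume *: "ideal P R \<and> \<one> \<notin> P \<and> (\<forall>a\<in>carrier R. \<forall>b\<in>carrier R. a \<otimes> b \<in> P --> a \<in> P \<or> b \<in> P)"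
 show "primeideal P R"
  by (rule primeidealI) (use * is_cring in auto)
qed

lemma prime_ideal: "primeideal P R ==> ideal P R"
 by (simp add: primeideal_iff)

lemma prime_one: "primeideal P R ==> \<one> \<notin> P"
 by (simp add: primeideal_iff)

lemma primeD: "primeideal P R ==> a \<otimes> b \<in> P ==> a \<in> carrier R ==> b \<in> carrier R ==> a \<in> P \<or> b \<in> P"
 by (auto simp: primeideal_iff)

lemma prime_pow:
 assumes "primeideal P R" "a \<in> carrier R" "a [^] (n::nat) \<in> P"
 shows "a \<in> P"
 using assms(3)
proof (induction n)
 case 0 thus ?case using prime_one[OF assms(1)] by simp
next
 case (Suc n) thus ?case using primeD[OF assms(1), of "a [^] n" a] assms(2) by auto
qed

text \<open>Elements of the single ideals outside P multiply to an element that lies in all of them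
  and still outside P. Later this provides a common denominator for finitely many statements that
  hold locally at P.\<close>

lemma prime_Inter_sub:
 assumes "primeideal P R" "finite A" "\<And>I. I \<in> A ==> ideal (F I) R"
  "\<And>I. I \<in> A ==> \<not> F I <= P"
 shows "\<exists>a\<in>carrier R - P. \<forall>I\<in>A. a \<in> F I"
 using assms(2-)
proof (induction A rule: finite_induct)
 case empty thus ?case using prime_one[OF assms(1)] by blast
next
 case (insert I A)
 then obtain a where a: "a \<in> carrier R - P" "\<forall>I\<in>A. a \<in> F I" by auto
 have "\<not> F I <= P" by (rule insert.prems) simp
 then obtain b where b: "b \<in> F I" "b \<notin> P" by blast
 have bc: "b \<in> carrier R" using b insert ideal_carr by blast
 have "a \<otimes> b \<notin> P" using a b bc primeD[OF assms(1)] by blast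
 moreover have "a \<otimes> b \<in> F I'" if "I' \<in> insert I A" for I'
  using that a b bc insert(4) by (cases "I' = I") (auto intro: ideal_mult ideal_mult')
 ultimately show ?case using a bc by blast
qed

text \<open>In a minimal counterexample each P contains an element \<open>f P\<close> of I that lies
  in no other member of A. Adding to \<open>f P0\<close> an element of I that lies in all other
  members but not in \<open>P0\<close> gives an element outside every member.\<close>

lemma prime_avoidance:
 assumes "finite A" "\<And>P. P \<in> A ==> primeideal P R" "ideal I R" "\<And>P. P \<in> A ==> \<not> I <= P"
 shows "\<exists>a\<in>I. \<forall>P\<in>A. a \<notin> P"
 using assms(1,2,4)
proof (induction A rule: finite_psubset_induct)
 case (psubset A)
 show ?case
 proof (cases "A = {}")
  case True thus ?thesis using ideal_zero[OF assms(3)] by blast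
 next
  case False
  show ?thesis
  proof (rule ccontr)
   assume neg: "\<not> ?thesis"
   have "\<exists>a\<in>I. a \<in> P \<and> (\<forall>Q\<in>A - {P}. a \<notin> Q)" if "P \<in> A" for P
   proof -
    have "A - {P} \<subset> A" using that by auto
    hence "\<exists>a\<in>I. \<forall>Q\<in>A - {P}. a \<notin> Q" using psubset.IH[of "A - {P}"] psubset.prems by auto
    thus ?thesis using neg by blast
   qed
   then obtain f where f: "\<And>P. P \<in> A ==> f P \<in> I \<and> f P \<in> P \<and> (\<forall>Q\<in>A - {P}. f P \<notin> Q)"
    by metis
   obtain P0 where P0: "P0 \<in> A" using False by blast
   have fc: "f P \<in> carrier R" if "P \<in> A" for P using f[OF that] ideal_carr[OF assms(3)] by blast
   show False
   proof (cases "A = {P0}")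
    case True
    have "\<not> I <= P0" using psubset.prems P0 by blast
    thus False using neg True by blast
   next
    case False
    have "\<exists>a\<in>carrier R - P0. \<forall>Q\<in>A - {P0}. a \<in> Idl {f Q}"
    proof (rule prime_Inter_sub)
     show "primeideal P0 R" using psubset.prems P0 by blast
     show "finite (A - {P0})" using psubset.hyps by simp
     show "ideal (Idl {f Q}) R" if "Q \<in> A - {P0}" for Q
      by (rule genideal_ideal) (use that fc in auto)
     show "\<not> Idl {f Q} <= P0" if "Q \<in> A - {P0}" for Q
     proof
      assume *: "Idl {f Q} <= P0"
      have Q: "Q \<in> A" "P0 \<in> A - {Q}" using that P0 by auto
      have "f Q \<in> P0" using * genideal_self'[OF fc[OF Q(1)]] by (rule subsetD)
      thus False using f[OF Q(1)] Q(2) by blast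
     qed
    qed
    then obtain a where a: "a \<in> carrier R" "a \<notin> P0" "\<And>Q. Q \<in> A - {P0} ==> a \<in> Idl {f Q}" by blast
    have aQ: "a \<in> Q \<inter> I" if "Q \<in> A - {P0}" for Q
    proof -
     have "Idl {f Q} <= Q \<inter> I"
      by (rule Idl_subI) (use that f[of Q] psubset.prems assms(3) prime_ideal in \<open>auto intro!: i_intersect\<close>)
     thus ?thesis using a(3)[OF that] by blast
    qed
    have aI: "a \<in> I" using aQ False P0 by blast
    let ?b = "a \<oplus> f P0"
    have "?b \<in> I" using aI f[OF P0] ideal_add[OF assms(3)] by blast
    moreover have "?b \<notin> Q" if Q: "Q \<in> A" for Q
    proof
     assume b: "?b \<in> Q"
     have Qi: "ideal Q R" using psubset.prems Q prime_ideal by blast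
     show False
     proof (cases "Q = P0")
      case True
      thus False using ideal_add_cancel[OF Qi _ a(1) b] f[OF P0] a(2) by blast
     next
      case False
      hence "a \<in> Q" using aQ Q by blast
      moreover have "f P0 \<oplus> a \<in> Q" using b a(1) fc[OF P0] by (simp add: a_comm)
      ultimately have "f P0 \<in> Q" using ideal_add_cancel[OF Qi _ fc[OF P0]] by blast
      thus False using f[OF P0] Q False by blast
     qed
    qed
    ultimately show False using neg by blast
   qed
  qed
 qed
qed

end

section \<open>Noetherian rings\<close>

locale noeth = cring R + noetherian_ring R for R (structure)
begin

lemma noeth_maximal:
 assumes "S \<noteq> {}" "\<And>I. I \<in> S ==> ideal I R"
 shows "\<exists>M\<in>S. \<forall>K\<in>S. M <= K --> K = M"
proof (rule subset_Zorn)
 fix C assume C: "subset.chain S C"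
 show "\<exists>U\<in>S. \<forall>Y\<in>C. Y <= U"
 proof (cases "C = {}")
  case True thus ?thesis using assms(1) by blast
 next
  case False
  have "subset.chain {I. ideal I R} C" using C assms(2) unfolding pred_on.chain_def by blast
  hence "\<Union>C \<in> C" using ideal_chain_is_trivial False by blast
  moreover from this have "\<Union>C \<in> S" using C unfolding pred_on.chain_def by (meson subsetD)
  ultimately show ?thesis by (intro bexI[of _ "\<Union>C"]) auto
 qed
qed

lemma noeth_induct [consumes 1, case_names step]:
 assumes "ideal I R"
  and step: "\<And>I. ideal I R ==> (\<And>K. ideal K R ==> I \<subset> K ==> Q K) ==> Q I"
 shows "Q I"
proof (rule ccontr)
 assume "\<not> Q I"
 let ?S = "{K. ideal K R \<and> \<not> Q K}"
 have "?S \<noteq> {}" using \<open>\<not> Q I\<close> assms(1) by blast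
 then obtain M where M: "M \<in> ?S" "\<forall>K\<in>?S. M <= K --> K = M" using noeth_maximal[of ?S] by blast
 have "Q M" by (rule step) (use M in blast)+
 thus False using M by blast
qed

lemma ideal_seq_stable:
 assumes "\<And>n::nat. ideal (F n) R" "\<And>n. F n <= F (Suc n)"
 shows "\<exists>N. \<forall>n\<ge>N. F n = F N"
proof -
 obtain M where M: "M \<in> range F" "\<forall>K\<in>range F. M <= K --> K = M"
  using noeth_maximal[of "range F"] assms(1) by blast
 then obtain N where N: "M = F N" by blast
 have "F N <= F n" if "n \<ge> N" for n
  using that assms(2) by (simp add: lift_Suc_mono_le)
 thus ?thesis using M(2) unfolding N by (intro exI[of _ N]) auto
qed

lemma ideal_fin_gen:
 assumes "ideal I R"
 obtains xs where "set xs <= carrier R" "I = Idl (set xs)"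
 using finetely_gen[OF assms] by (metis finite_list)

text \<open>An ideal over \<open>c\<close> that is maximal among those missing S is prime: for a and
  b outside it, S meets both enlarged ideals, and if a b were inside, the product of the two
  elements of S found there would be inside as well.\<close>

lemma prime_disjoint:
 assumes "ideal c R" "S <= carrier R" "\<one> \<in> S" "\<And>a b. a \<in> S ==> b \<in> S ==> a \<otimes> b \<in> S" "c \<inter> S = {}"
 obtains P where "primeideal P R" "c <= P" "P \<inter> S = {}"
proof -
 let ?S = "{K. ideal K R \<and> c <= K \<and> K \<inter> S = {}}"
 have "\<exists>M\<in>?S. \<forall>K\<in>?S. M <= K --> K = M"
  by (rule noeth_maximal) (use assms in auto)
 then obtain P where P0: "P \<in> ?S" "\<forall>K\<in>?S. P <= K --> K = P" by (rule bexE)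
 have P: "ideal P R" "c <= P" "P \<inter> S = {}" using P0(1) by simp_all
 have max: "K = P" if "ideal K R" "c <= K" "K \<inter> S = {}" "P <= K" for K
  using P0(2) that by simp
 have key: "\<exists>s\<in>S. \<exists>r\<in>carrier R. s \<ominus> r \<otimes> a \<in> P" if a: "a \<in> carrier R" "a \<notin> P" for a
 proof (rule ccontr)
  assume neg: "\<not> ?thesis"
  have sub: "P <= Idl (insert a P)" "a \<in> Idl (insert a P)"
   using a Idl_mem[of _ "insert a P"] ideal_sub[OF P(1)] by auto
  have "Idl (insert a P) = P"
  proof (rule max)
   show "ideal (Idl (insert a P)) R" using a ideal_sub[OF P(1)] by (auto intro: genideal_ideal)
   show "c <= Idl (insert a P)" "P <= Idl (insert a P)" using sub P by auto
   show "Idl (insert a P) \<inter> S = {}"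
   proof (rule ccontr)
    assume "Idl (insert a P) \<inter> S \<noteq> {}"
    then obtain s where s: "s \<in> Idl (insert a P)" "s \<in> S" by blast
    from s(1) ideal_sub[OF P(1)] a(1) obtain r where "r \<in> carrier R" "s \<ominus> r \<otimes> a \<in> Idl P"
     by (rule Idl_insertE')
    thus False using neg s Idl_ideal[OF P(1)] by auto
   qed
  qed
  thus False using sub a by blast
 qed
 have "primeideal P R" unfolding primeideal_iff
 proof (intro conjI ballI impI)
  show "ideal P R" by (rule P)
  show "\<one> \<notin> P" using P assms(3) by blast
  fix a b assume ab: "a \<in> carrier R" "b \<in> carrier R" "a \<otimes> b \<in> P"
  show "a \<in> P \<or> b \<in> P"
  proof (rule ccontr)
   assume "\<not> ?thesis"
   then obtain s r t u where *: "s \<in> S" "r \<in> carrier R" "s \<ominus> r \<otimes> a \<in> P"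
    "t \<in> S" "u \<in> carrier R" "t \<ominus> u \<otimes> b \<in> P" using key ab by metis
   have c: "s \<in> carrier R" "t \<in> carrier R" using * assms(2) by auto
   have "s \<otimes> t = (s \<ominus> r \<otimes> a) \<otimes> t \<oplus> (r \<otimes> a) \<otimes> (t \<ominus> u \<otimes> b) \<oplus> (r \<otimes> u) \<otimes> (a \<otimes> b)"
    using c * ab by algebra
   moreover have "(s \<ominus> r \<otimes> a) \<otimes> t \<in> P" using ideal_mult'[OF P(1)] * c by blast
   moreover have "(r \<otimes> a) \<otimes> (t \<ominus> u \<otimes> b) \<in> P" using ideal_mult[OF P(1)] * ab(1) by blast
   moreover have "(r \<otimes> u) \<otimes> (a \<otimes> b) \<in> P" using ideal_mult[OF P(1)] * ab(3) by blast
   ultimately have "s \<otimes> t \<in> P" by (simp add: ideal_add[OF P(1)])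
   thus False using assms(4) * P(3) by blast
  qed
 qed
 thus ?thesis using P that by blast
qed

text \<open>Noetherian induction. If a b lies in I but neither factor does, each prime over I
  contains a or b, hence lies over one of two strictly larger ideals. The family need not consist of
  minimal primes; that it dominates all primes over \<open>c\<close> from below is enough to extract
  one.\<close>

lemma finite_primes_over:
 assumes "ideal c R"
 shows "\<exists>A. finite A \<and> (\<forall>P\<in>A. primeideal P R \<and> c <= P) \<and> (\<forall>Q. primeideal Q R --> c <= Q --> (\<exists>P\<in>A. P <= Q))"
 using assms
proof (induction rule: noeth_induct)
 case (step I)
 show ?case
 proof (cases "I = carrier R")
  case True
  have "\<not> I <= Q" if "primeideal Q R" for Q using that True prime_one by blast
  thus ?thesis by (intro exI[of _ "{}"]) auto
 next
  case F: False
  show ?thesis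
  proof (cases "primeideal I R")
   case True thus ?thesis by (intro exI[of _ "{I}"]) auto
  next
   case False
   then obtain a b where ab: "a \<in> carrier R" "b \<in> carrier R" "a \<otimes> b \<in> I" "a \<notin> I" "b \<notin> I"
    using step(1) F ideal_one unfolding primeideal_iff by blast
   have I: "I <= carrier R" using ideal_sub step(1) by blast
   have ex: "\<exists>A. finite A \<and> (\<forall>P\<in>A. primeideal P R \<and> I <= P) \<and> (\<forall>Q. primeideal Q R --> I <= Q --> d \<in> Q --> (\<exists>P\<in>A. P <= Q))"
    if d: "d \<in> carrier R" "d \<notin> I" for d
   proof -
    have D: "ideal (Idl (insert d I)) R" using I d by (auto intro: genideal_ideal)
    have sub: "insert d I <= Idl (insert d I)" using I d by (intro genideal_self) auto
    hence "I \<subset> Idl (insert d I)" using d by blast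
    from step(2)[OF D this] obtain A where A: "finite A" "\<forall>P\<in>A. primeideal P R \<and> Idl (insert d I) <= P"
     "\<forall>Q. primeideal Q R --> Idl (insert d I) <= Q --> (\<exists>P\<in>A. P <= Q)" by blast
    have "Idl (insert d I) <= Q" if "primeideal Q R" "I <= Q" "d \<in> Q" for Q
     by (rule Idl_subI) (use that prime_ideal in auto)
    hence "\<forall>Q. primeideal Q R --> I <= Q --> d \<in> Q --> (\<exists>P\<in>A. P <= Q)" using A(3) by simp
    moreover have "\<forall>P\<in>A. primeideal P R \<and> I <= P" using A(2) sub by auto
    ultimately show ?thesis using A(1) by (intro exI[of _ A] conjI)
   qed
   obtain A where A: "finite A" "\<forall>P\<in>A. primeideal P R \<and> I <= P"
    "\<forall>Q. primeideal Q R --> I <= Q --> a \<in> Q --> (\<exists>P\<in>A. P <= Q)" using ex[of a] ab by blast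
   obtain B where B: "finite B" "\<forall>P\<in>B. primeideal P R \<and> I <= P"
    "\<forall>Q. primeideal Q R --> I <= Q --> b \<in> Q --> (\<exists>P\<in>B. P <= Q)" using ex[of b] ab by blast
   have *: "a \<in> Q \<or> b \<in> Q" if "primeideal Q R" "I <= Q" for Q using that ab primeD by blast
   show ?thesis
   proof (intro exI[of _ "A \<union> B"] conjI allI impI)
    show "finite (A \<union> B)" "\<forall>P\<in>A \<union> B. primeideal P R \<and> I <= P" using A B by auto
    fix Q assume Q: "primeideal Q R" "I <= Q"
    show "\<exists>P\<in>A \<union> B. P <= Q"
    proof (cases "a \<in> Q")
     case True
     then obtain P where "P \<in> A" "P <= Q" using A(3) Q by blast
     thus ?thesis by (intro bexI[of _ P]) auto
    next
     case False
     then obtain P where "P \<in> B" "P <= Q" using B(3) Q *[OF Q] by blast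
     thus ?thesis by (intro bexI[of _ P]) auto
    qed
   qed
  qed
 qed
qed

lemma minimal_prime_below:
 assumes "primeideal Q R" "ideal c R" "c <= Q"
 obtains P where "primeideal P R" "c <= P" "P <= Q" "\<And>P'. primeideal P' R ==> c <= P' ==> P' <= P ==> P' = P"
proof -
 obtain A where A: "finite A" "\<forall>P\<in>A. primeideal P R \<and> c <= P"
  "\<And>Q. primeideal Q R ==> c <= Q ==> (\<exists>P\<in>A. P <= Q)" using finite_primes_over[OF assms(2)] by blast
 let ?A = "{P\<in>A. P <= Q}"
 obtain P1 where "P1 \<in> A" "P1 <= Q" using A(3)[OF assms(1,3)] by blast
 hence "finite ?A" "?A \<noteq> {}" using A(1) by auto
 then obtain P where P: "P \<in> ?A" "\<And>P'. P' \<in> ?A ==> P' <= P ==> P' = P"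
  by (metis (no_types, lifting) finite_has_minimal)
 show ?thesis
 proof (rule that[of P])
  show "primeideal P R" "c <= P" "P <= Q" using P A by auto
  fix P' assume P': "primeideal P' R" "c <= P'" "P' <= P"
  obtain P'' where P'': "P'' \<in> A" "P'' <= P'" using A(3)[OF P'(1,2)] by blast
  hence "P'' \<in> ?A" "P'' <= P" using P' P(1) by auto
  hence "P'' = P" by (rule P(2))
  thus "P' = P" using P' P'' by blast
 qed
qed

text \<open>A maximal quotient \<open>colon c u\<close> is prime: if b u is not in c, then
  \<open>colon c (b \<otimes> u)\<close> is at least as large, hence equal. Maximality is kept as a
  conclusion because the finiteness argument compares such quotients with each other.\<close>

lemma associated_prime_above:
 assumes "ideal c R" "v \<in> carrier R" "v \<notin> c"
 obtains u where "u \<in> carrier R" "u \<notin> c" "primeideal (colon c u) R" "colon c v <= colon c u"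
  "\<And>w. w \<in> carrier R ==> w \<notin> c ==> colon c u <= colon c w ==> colon c w = colon c u"
proof -
 let ?S = "{colon c w | w. w \<in> carrier R \<and> w \<notin> c \<and> colon c v <= colon c w}"
 have "\<exists>M\<in>?S. \<forall>K\<in>?S. M <= K --> K = M"
 proof (rule noeth_maximal)
  have "colon c v \<in> ?S" by (rule CollectI, intro exI[of _ v] conjI) (use assms in simp_all)
  thus "?S \<noteq> {}" by (rule ne_emptyI)
  show "ideal I R" if "I \<in> ?S" for I using that colon_ideal[OF assms(1)] by auto
 qed
 then obtain M where M: "M \<in> ?S" "\<forall>K\<in>?S. M <= K --> K = M" by (rule bexE)
 obtain u where u: "u \<in> carrier R" "u \<notin> c" "colon c v <= colon c u" "M = colon c u"
  using M(1) by auto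
 have max: "colon c w = colon c u" if "w \<in> carrier R" "w \<notin> c" "colon c u <= colon c w" for w
 proof -
  have "colon c w \<in> ?S" using that u by auto
  thus ?thesis using M(2) that u(4) by simp
 qed
 have "primeideal (colon c u) R" unfolding primeideal_iff
 proof (intro conjI ballI impI)
  show "ideal (colon c u) R" using assms u by (simp add: colon_ideal)
  show "\<one> \<notin> colon c u" using u by (simp add: colon_def)
  fix a b assume ab: "a \<in> carrier R" "b \<in> carrier R" "a \<otimes> b \<in> colon c u"
  show "a \<in> colon c u \<or> b \<in> colon c u"
  proof (rule disjCI)
   assume "b \<notin> colon c u"
   hence bu: "b \<otimes> u \<notin> c" "b \<otimes> u \<in> carrier R" using ab u by (auto simp: colon_def)
   have "colon c u <= colon c (b \<otimes> u)"
   proof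
    fix r assume r: "r \<in> colon c u"
    hence rc: "r \<in> carrier R" "r \<otimes> u \<in> c" by (auto simp: colon_def)
    have "r \<otimes> (b \<otimes> u) = b \<otimes> (r \<otimes> u)" using rc ab u by (simp add: m_lcomm)
    thus "r \<in> colon c (b \<otimes> u)" using rc ab assms(1) by (simp add: colon_def ideal_mult)
   qed
   hence "colon c (b \<otimes> u) = colon c u" using max[OF bu(2,1)] by blast
   moreover have "a \<in> colon c (b \<otimes> u)" using ab u by (simp add: colon_def m_assoc)
   ultimately show "a \<in> colon c u" by simp
  qed
 qed
 thus ?thesis by (rule that[OF u(1,2) _ u(3) max])
qed

text \<open>Kaplansky: the maximal annihilators are finitely many primes because the elements they annihilate
 generate a finitely generated ideal.\<close>

lemma zero_divisors_finite:
 assumes c: "ideal c R"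
 shows "\<exists>U. finite U \<and> U <= carrier R - c \<and> (\<forall>u\<in>U. primeideal (colon c u) R) \<and>
  (\<forall>v\<in>carrier R - c. \<exists>u\<in>U. colon c v <= colon c u)"
proof -
 define M where "M = {u\<in>carrier R - c. primeideal (colon c u) R \<and>
   (\<forall>w\<in>carrier R - c. colon c u <= colon c w --> colon c w = colon c u)}"
 have Mc: "M <= carrier R" by (auto simp: M_def)
 have fin: "\<exists>U\<subseteq>M. finite U \<and> x \<in> Idl U" if "x \<in> Idl M" for x
 proof -
  let ?I = "{x. \<exists>U. U <= M \<and> finite U \<and> x \<in> Idl U}"
  have "ideal ?I R"
  proof (rule ideal_intro)
   show "?I <= carrier R"
   proof clarify
    fix x U assume "U <= M" "x \<in> Idl U"
    thus "x \<in> carrier R" using Mc ideal_carr[OF genideal_ideal] by (meson subset_trans)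
   qed
   have "\<zero> \<in> Idl {}" by (rule ideal_zero[OF genideal_ideal]) simp
   thus "\<zero> \<in> ?I" by (auto intro!: exI[of _ "{}"])
   show "a \<oplus> b \<in> ?I" if ab: "a \<in> ?I" "b \<in> ?I" for a b
   proof -
    obtain U V where UV: "U <= M" "finite U" "a \<in> Idl U" "V <= M" "finite V" "b \<in> Idl V" using ab by auto
    have "a \<in> Idl (U \<union> V)" "b \<in> Idl (U \<union> V)"
     using UV Mc Idl_mono[of U "U \<union> V"] Idl_mono[of V "U \<union> V"] by auto
    hence "a \<oplus> b \<in> Idl (U \<union> V)" using UV Mc by (intro ideal_add[OF genideal_ideal]) auto
    thus ?thesis using UV by (auto intro!: exI[of _ "U \<union> V"])
   qed
   show "r \<otimes> a \<in> ?I" if ar: "a \<in> ?I" "r \<in> carrier R" for a r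
   proof -
    obtain U where U: "U <= M" "finite U" "a \<in> Idl U" using ar by auto
    hence "r \<otimes> a \<in> Idl U" using Mc ar by (intro ideal_mult[OF genideal_ideal]) auto
    thus ?thesis using U by (auto intro!: exI[of _ U])
   qed
  qed
  moreover have "M <= ?I"
  proof
   fix u assume u: "u \<in> M"
   have "u \<in> Idl {u}" using u Mc genideal_self' by blast
   thus "u \<in> ?I" using u by (auto intro!: exI[of _ "{u}"])
  qed
  ultimately have "Idl M <= ?I" by (simp add: Idl_subI)
  thus ?thesis using that by blast
 qed
 obtain xs where xs: "set xs <= carrier R" "Idl M = Idl (set xs)"
  using ideal_fin_gen[OF genideal_ideal[OF Mc]] by blast
 have "\<forall>x\<in>set xs. \<exists>U\<subseteq>M. finite U \<and> x \<in> Idl U" using fin xs Idl_mem by blast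
 then obtain f where f: "\<And>x. x \<in> set xs ==> f x <= M \<and> finite (f x) \<and> x \<in> Idl (f x)" by metis
 define U where "U = (\<Union>x\<in>set xs. f x)"
 have U: "finite U" "U <= M" using f by (auto simp: U_def)
 have "set xs <= Idl U"
 proof
  fix x assume x: "x \<in> set xs"
  have "Idl (f x) <= Idl U" by (rule Idl_mono) (use x U Mc in \<open>auto simp: U_def\<close>)
  thus "x \<in> Idl U" using f[OF x] by blast
 qed
 hence "Idl M <= Idl U" unfolding xs(2) using U Mc by (intro Idl_subI genideal_ideal) auto
 hence MU: "M <= Idl U" using Mc Idl_mem by blast
 \<comment> \<open>If no \<open>colon c u\<close> were inside the prime \<open>colon c w\<close>,
   some \<open>a\<close> would lie in all of them but not in \<open>colon c w\<close>. It would
   annihilate the elements of U modulo c, hence everything they generate, in particular w.\<close>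
 have cover: "\<exists>u\<in>U. colon c u <= colon c w" if w: "w \<in> M" for w
 proof (rule ccontr)
  assume neg: "\<not> ?thesis"
  have "\<exists>a\<in>carrier R - colon c w. \<forall>u\<in>U. a \<in> colon c u"
   by (rule prime_Inter_sub) (use w U M_def neg c colon_ideal in auto)
  then obtain a where a: "a \<in> carrier R" "a \<notin> colon c w" "\<And>u. u \<in> U ==> a \<in> colon c u" by blast
  have "Idl U <= colon c a"
  proof (rule Idl_subI)
   show "ideal (colon c a) R" using a c by (simp add: colon_ideal)
   show "U <= colon c a" using a U Mc by (auto simp: colon_def m_comm subset_iff)
  qed
  hence "w \<in> colon c a" using MU w by blast
  thus False using a w Mc by (auto simp: colon_def m_comm)
 qed
 show ?thesis
 proof (intro exI conjI ballI)
  show "finite U" "U <= carrier R - c" using U by (auto simp: M_def)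
  show "primeideal (colon c u) R" if "u \<in> U" for u using that U by (auto simp: M_def)
  fix v assume v: "v \<in> carrier R - c"
  then obtain w where w: "w \<in> carrier R" "w \<notin> c" "primeideal (colon c w) R" "colon c v <= colon c w"
   "\<And>w'. w' \<in> carrier R ==> w' \<notin> c ==> colon c w <= colon c w' ==> colon c w' = colon c w"
   using associated_prime_above[OF c, of v] by blast
  hence wM: "w \<in> M" by (auto simp: M_def)
  then obtain u where u: "u \<in> U" "colon c u <= colon c w" using cover by blast
  hence "colon c w = colon c u" using U w by (auto simp: M_def)
  thus "\<exists>u\<in>U. colon c v <= colon c u" using u w by blast
 qed
qed

text \<open>The zero divisors modulo c are covered by finitely many associated primes, and prime
  avoidance finds an element of I outside all of these.\<close>

lemma exists_nonzerodivisor: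
 assumes "ideal c R" "ideal I R"
  and "\<And>u. u \<in> carrier R ==> u \<notin> c ==> primeideal (colon c u) R ==> \<not> I <= colon c u"
 shows "\<exists>a\<in>I. \<forall>v\<in>carrier R. a \<otimes> v \<in> c --> v \<in> c"
proof -
 obtain U where U: "finite U" "U <= carrier R - c" "\<forall>u\<in>U. primeideal (colon c u) R"
  "\<And>v. v\<in>carrier R - c ==> \<exists>u\<in>U. colon c v <= colon c u" using zero_divisors_finite[OF assms(1)] by blast
 have "\<exists>a\<in>I. \<forall>P\<in>colon c ` U. a \<notin> P"
  by (rule prime_avoidance) (use U assms in auto)
 then obtain a where a: "a \<in> I" "\<And>u. u \<in> U ==> a \<notin> colon c u" by blast
 have "v \<in> c" if v: "v \<in> carrier R" "a \<otimes> v \<in> c" for v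
 proof (rule ccontr)
  assume "v \<notin> c"
  then obtain u where "u \<in> U" "colon c v <= colon c u" using U(4) v by blast
  moreover have "a \<in> colon c v" using v a assms(2) ideal_carr by (auto simp: colon_def)
  ultimately show False using a by blast
 qed
 thus ?thesis using a by blast
qed

end

section \<open>Noetherian local rings and chains of primes\<close>

locale nlocal = noeth +
 fixes m
 assumes local: "local_ring R m"
begin

lemma m_maximal: "maximalideal m R"
 using local by (simp add: local_ring_def)

lemma m_ideal: "ideal m R"
 using m_maximal by (simp add: maximalideal.axioms)

lemma m_carr: "m <= carrier R"
 by (rule ideal_sub[OF m_ideal])

lemma one_notin_m: "\<one> \<notin> m"
 using maximalideal.I_notcarr[OF m_maximal] ideal_one[OF m_ideal] by auto

lemma m_prime: "primeideal m R"
 using maximalideal_prime[OF m_maximal] .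

lemma proper_sub_m:
 assumes "ideal I R" "\<one> \<notin> I"
 shows "I <= m"
proof -
 let ?S = "{K. ideal K R \<and> I <= K \<and> \<one> \<notin> K}"
 have "I \<in> ?S" using assms by simp
 hence "\<exists>M\<in>?S. \<forall>K\<in>?S. M <= K --> K = M"
  by (intro noeth_maximal) auto
 then obtain M where M: "M \<in> ?S" "\<forall>K\<in>?S. M <= K --> K = M" by (rule bexE)
 have "maximalideal M R"
 proof (rule maximalidealI)
  show "ideal M R" "carrier R \<noteq> M" using M by auto
  fix K assume K: "ideal K R" "M <= K" "K <= carrier R"
  show "K = M \<or> K = carrier R"
  proof (cases "\<one> \<in> K")
   case True thus ?thesis using ideal_one[OF K(1)] by simp
  next
   case False
   hence "K \<in> ?S" using K M(1) by auto
   thus ?thesis using M(2) K(2) by simp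
  qed
 qed
 hence "M = m" using local by (simp add: local_ring_def)
 thus ?thesis using M(1) by simp
qed

lemma prime_sub_m: "primeideal P R ==> P <= m"
 using proper_sub_m prime_ideal prime_one by blast

lemma unit_inverse:
 assumes "a \<in> carrier R" "a \<notin> m"
 obtains b where "b \<in> carrier R" "b \<otimes> a = \<one>"
proof -
 have "\<not> Idl {a} <= m" using genideal_self'[OF assms(1)] assms(2) by blast
 hence "\<one> \<in> Idl {a}" using proper_sub_m[OF genideal_ideal] assms by blast
 hence "\<one> \<in> PIdl a" using cgenideal_eq_genideal[OF assms(1)] by simp
 thus ?thesis using that by (auto simp: cgenideal_def)
qed

text \<open>Either m-primary or the unit ideal; admitting the latter makes the notion stable under
  enlarging the ideal.\<close>

definition mprim :: "'a set => bool"
 where "mprim I \<longleftrightarrow> (\<forall>a\<in>m. \<exists>n::nat. a [^] n \<in> I)"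

lemma mprim_mono: "mprim I ==> I <= K ==> mprim K"
 unfolding mprim_def by blast

text \<open>The bound dim R/c < k. The strict form gives the unit ideal the bound 0, so no dimension
  -1 is required.\<close>

definition dimlt :: "'a set => nat => bool"
 where "dimlt c k \<longleftrightarrow> (\<forall>n f. prime_chain R n f --> c <= f 0 --> n < k)"

lemma prime_chain_Cons:
 assumes "prime_chain R n f" "primeideal Q R" "Q \<subset> f 0"
 shows "prime_chain R (Suc n) (case_nat Q f)"
 using assms unfolding prime_chain_def by (auto split: nat.splits)

lemma prime_chain_0: "primeideal Q R ==> prime_chain R 0 (%_. Q)"
 by (simp add: prime_chain_def)

lemma prime_chain_head: "prime_chain R n f ==> primeideal (f 0) R"
 by (simp add: prime_chain_def)

lemma dimlt_drop:
 assumes "dimlt c (Suc k)" "\<And>Q. primeideal Q R ==> d <= Q ==> \<exists>P. primeideal P R \<and> c <= P \<and> P \<subset> Q"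
 shows "dimlt d k"
 unfolding dimlt_def
proof (intro allI impI)
 fix n f assume nf: "prime_chain R n f" "d <= f 0"
 obtain P where P: "primeideal P R" "c <= P" "P \<subset> f 0"
  using assms(2)[OF prime_chain_head[OF nf(1)] nf(2)] by blast
 show "n < k"
  using assms(1) prime_chain_Cons[OF nf(1) P(1,3)] P(2) unfolding dimlt_def by fastforce
qed

text \<open>By the last hypothesis the multiplicative set of all x^n v with v outside Q misses c. A
  prime over c disjoint from this set is contained in Q (take n = 0) and does not contain x (take v
  = 1).\<close>

lemma smaller_prime:
 assumes "ideal c R" "primeideal Q R" "x \<in> Q"
  and "\<And>(n::nat) v. v \<in> carrier R ==> x [^] n \<otimes> v \<in> c ==> v \<in> Q"
 shows "\<exists>P. primeideal P R \<and> c <= P \<and> P \<subset> Q"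
proof -
 have x: "x \<in> carrier R" using assms(2,3) prime_ideal ideal_carr by blast
 let ?S = "{x [^] (n::nat) \<otimes> v | n v. v \<in> carrier R - Q}"
 have 1: "\<one> \<in> carrier R - Q" using prime_one[OF assms(2)] by simp
 have S: "x [^] (n::nat) \<otimes> v \<in> ?S" if "v \<in> carrier R - Q" for n v using that by blast
 obtain P where P: "primeideal P R" "c <= P" "P \<inter> ?S = {}"
 proof (rule prime_disjoint[OF assms(1)])
  show "?S <= carrier R" using x by auto
  show "\<one> \<in> ?S" using S[OF 1, of 0] by simp
  show "c \<inter> ?S = {}" using assms(4) by auto
  fix a b assume "a \<in> ?S" "b \<in> ?S"
  then obtain n v k w where *: "a = x [^] (n::nat) \<otimes> v" "v \<in> carrier R - Q" "b = x [^] (k::nat) \<otimes> w" "w \<in> carrier R - Q"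
   by auto
  have "a \<otimes> b = (x [^] n \<otimes> x [^] k) \<otimes> (v \<otimes> w)" unfolding * using * x by (simp add: m_ac)
  hence "a \<otimes> b = x [^] (n + k) \<otimes> (v \<otimes> w)" using x by (simp add: nat_pow_mult)
  moreover have "v \<otimes> w \<in> carrier R - Q" using * primeD[OF assms(2)] by auto
  ultimately show "a \<otimes> b \<in> ?S" using S by simp
 qed
 have "P <= Q"
 proof
  fix v assume v: "v \<in> P"
  have vc: "v \<in> carrier R" using v P(1) prime_ideal ideal_carr by blast
  show "v \<in> Q"
  proof (rule ccontr)
   assume "v \<notin> Q"
   hence "v \<in> ?S" using S[of v 0] vc by simp
   thus False using v P(3) by blast
  qed
 qed
 moreover have "x \<notin> P"
 proof -
  have "x \<in> ?S" using S[OF 1, of 1] x by simp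
  thus ?thesis using P(3) by blast
 qed
 ultimately show ?thesis using P assms(3) by blast
qed

lemma dimlt_nonzerodivisor:
 assumes "ideal c R" "dimlt c (Suc k)" "y \<in> carrier R" "\<And>v. v \<in> carrier R ==> y \<otimes> v \<in> c ==> v \<in> c"
 shows "dimlt (Idl (insert y c)) k"
proof (rule dimlt_drop[OF assms(2)])
 fix Q assume Q: "primeideal Q R" "Idl (insert y c) <= Q"
 have sub: "insert y c <= Q" using Q(2) genideal_self[of "insert y c"] assms(3) ideal_sub[OF assms(1)] by auto
 have "v \<in> c" if "v \<in> carrier R" "y [^] (n::nat) \<otimes> v \<in> c" for n v
  using that
 proof (induction n)
  case (Suc n)
  have "y \<otimes> (y [^] n \<otimes> v) = y [^] Suc n \<otimes> v" using Suc(2) assms(3) by (simp add: m_ac)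
  hence "y [^] n \<otimes> v \<in> c" using assms(3,4) Suc(2,3) by simp
  thus ?case by (rule Suc.IH[OF Suc(2)])
 qed simp
 thus "\<exists>P. primeideal P R \<and> c <= P \<and> P \<subset> Q"
  using sub by (intro smaller_prime[OF assms(1) Q(1), of y]) auto
qed

text \<open>N is where the ascending ideals c : y^n become stationary. A relation y^n v in c then
  already puts v into c : y^N, so every prime over the boundary ideal (c : y^N) + (y) strictly
  contains a prime over c, for arbitrary y.\<close>

lemma dimlt_boundary:
 assumes "ideal c R" "dimlt c (Suc k)" "y \<in> carrier R"
 obtains N :: nat where "dimlt (Idl (insert y (colon c (y [^] N)))) k"
proof -
 have "colon c (y [^] n) <= colon c (y [^] Suc n)" for n :: nat
 proof
  fix r assume "r \<in> colon c (y [^] n)"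
  hence "r \<in> carrier R" "r \<otimes> y [^] n \<otimes> y \<in> c" using ideal_mult'[OF assms(1)] assms(3) by (auto simp: colon_def)
  thus "r \<in> colon c (y [^] Suc n)" using assms(3) by (simp add: colon_def m_assoc)
 qed
 then obtain N :: nat where N: "\<forall>n\<ge>N. colon c (y [^] n) = colon c (y [^] N)"
  using ideal_seq_stable[of "%n. colon c (y [^] n)"] colon_ideal[OF assms(1)] assms(3) by auto
 have c: "colon c (y [^] N) <= carrier R" by (auto simp: colon_def)
 have "dimlt (Idl (insert y (colon c (y [^] N)))) k"
 proof (rule dimlt_drop[OF assms(2)])
  fix Q assume Q: "primeideal Q R" "Idl (insert y (colon c (y [^] N))) <= Q"
  have sub: "insert y (colon c (y [^] N)) <= Q" using Q(2) genideal_self[of "insert y (colon c (y [^] N))"] assms(3) c by auto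
  have "v \<in> Q" if v: "v \<in> carrier R" "y [^] (n::nat) \<otimes> v \<in> c" for n v
  proof -
   have "y [^] N \<otimes> (y [^] n \<otimes> v) \<in> c" using v(2) assms by (simp add: ideal_mult)
   hence "y [^] (N + n) \<otimes> v \<in> c" using v assms(3) by (simp add: m_assoc flip: nat_pow_mult)
   hence "v \<in> colon c (y [^] (N + n))" using v assms(3) by (simp add: colon_def m_comm)
   moreover have "colon c (y [^] (N + n)) = colon c (y [^] N)" using N by (meson le_add1)
   ultimately show ?thesis using sub by blast
  qed
  thus "\<exists>P. primeideal P R \<and> c <= P \<and> P \<subset> Q"
   using sub by (intro smaller_prime[OF assms(1) Q(1), of y]) auto
 qed
 thus ?thesis using that by blast
qed

lemma dimlt_0: "ideal c R ==> dimlt c 0 ==> \<one> \<in> c"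
 using proper_sub_m[of c] m_prime prime_chain_0[OF m_prime] unfolding dimlt_def by blast

lemma dimlt_1_mprim:
 assumes "ideal c R" "dimlt c 1"
 shows "mprim c"
 unfolding mprim_def
proof (rule ballI, rule ccontr)
 fix a assume a: "a \<in> m" and neg: "\<not> (\<exists>n::nat. a [^] n \<in> c)"
 have ac: "a \<in> carrier R" using a m_carr by blast
 let ?S = "range (%n::nat. a [^] n)"
 have S: "a [^] (n::nat) \<in> ?S" for n by blast
 obtain P where P: "primeideal P R" "c <= P" "P \<inter> ?S = {}"
 proof (rule prime_disjoint[OF assms(1)])
  show "?S <= carrier R" using ac by auto
  show "\<one> \<in> ?S" using S[of 0] by simp
  show "c \<inter> ?S = {}" using neg by blast
  show "x \<otimes> y \<in> ?S" if "x \<in> ?S" "y \<in> ?S" for x y using that ac by (auto simp: nat_pow_mult)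
 qed
 have "a \<notin> P" using P(3) S[of 1] ac by auto
 hence "P \<subset> m" using prime_sub_m[OF P(1)] a by blast
 hence "prime_chain R 1 (case_nat P (%_. m))"
  using prime_chain_Cons[OF prime_chain_0[OF m_prime] P(1)] by simp
 thus False using assms(2) P(2) unfolding dimlt_def by fastforce
qed

text \<open>The element y avoids all primes of the finite dominating families except m itself. A
  whole set A of ideals is served by the same y because an exchange of parameters needs one
  completion that fits two lists. The successor in the conclusion leaves room for the chain
  consisting of m alone.\<close>

lemma generic_parameter:
 assumes "finite A" "\<And>c. c \<in> A ==> ideal c R \<and> dimlt c (Suc (Suc k))"
 obtains y where "y \<in> m" "\<And>c. c \<in> A ==> dimlt (Idl (insert y c)) (Suc k)"
proof -
 have ex: "\<forall>c\<in>A. \<exists>B. finite B \<and> (\<forall>P\<in>B. primeideal P R \<and> c <= P) \<and> (\<forall>Q. primeideal Q R --> c <= Q --> (\<exists>P\<in>B. P <= Q))"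
  using finite_primes_over assms(2) by blast
 obtain B where B: "\<And>c. c \<in> A ==> finite (B c)" "\<And>c P. c \<in> A ==> P \<in> B c ==> primeideal P R \<and> c <= P"
  "\<And>c Q. c \<in> A ==> primeideal Q R ==> c <= Q ==> \<exists>P\<in>B c. P <= Q"
 proof -
  assume *: "\<And>B. [|\<And>c. c \<in> A ==> finite (B c); \<And>c P. c \<in> A ==> P \<in> B c ==> primeideal P R \<and> c <= P;
   \<And>c Q. c \<in> A ==> primeideal Q R ==> c <= Q ==> \<exists>P\<in>B c. P <= Q|] ==> thesis"
  obtain B where B: "\<forall>c\<in>A. finite (B c) \<and> (\<forall>P\<in>B c. primeideal P R \<and> c <= P) \<and>
    (\<forall>Q. primeideal Q R --> c <= Q --> (\<exists>P\<in>B c. P <= Q))"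
   using bchoice[OF ex] by (rule exE)
  show thesis by (rule *[of B]) (use B in simp_all)
 qed
 have "\<exists>y\<in>m. \<forall>P\<in>(\<Union>c\<in>A. B c) - {m}. y \<notin> P"
 proof (rule prime_avoidance)
  show "finite ((\<Union>c\<in>A. B c) - {m})" using assms(1) B(1) by auto
  show "primeideal P R" if "P \<in> (\<Union>c\<in>A. B c) - {m}" for P using that B(2) by blast
  show "ideal m R" by (rule m_ideal)
  show "\<not> m <= P" if P: "P \<in> (\<Union>c\<in>A. B c) - {m}" for P
  proof
   assume "m <= P"
   moreover obtain c where "c \<in> A" "P \<in> B c" using P by blast
   hence "primeideal P R" using B(2) by blast
   ultimately show False using prime_sub_m P by blast
  qed
 qed
 then obtain y where y: "y \<in> m" "\<And>P c. c \<in> A ==> P \<in> B c ==> P \<noteq> m ==> y \<notin> P" by blast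
 show ?thesis
 proof (rule that[OF y(1)])
  fix c assume c: "c \<in> A"
  show "dimlt (Idl (insert y c)) (Suc k)" unfolding dimlt_def
  proof (intro allI impI)
   fix n f assume nf: "prime_chain R n f" "Idl (insert y c) <= f 0"
   have "insert y c <= carrier R" using y(1) m_carr assms(2)[OF c] ideal_sub by blast
   hence sub: "insert y c <= f 0" using nf(2) genideal_self by blast
   have f0: "primeideal (f 0) R" using nf(1) prime_chain_head by blast
   obtain P where P: "P \<in> B c" "P <= f 0" using B(3)[OF c f0] sub by blast
   show "n < Suc k"
   proof (cases "P = f 0")
    case True
    hence "f 0 = m" using y(2)[OF c P(1)] sub by blast
    have "n = 0"
    proof (rule ccontr)
     assume "n \<noteq> 0"
     hence "f 0 \<subset> f 1" "primeideal (f 1) R" using nf(1) by (auto simp: prime_chain_def)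
     thus False using prime_sub_m \<open>f 0 = m\<close> by blast
    qed
    thus ?thesis by simp
   next
    case False
    hence "prime_chain R (Suc n) (case_nat P f)"
     using prime_chain_Cons[OF nf(1)] P(2) B(2)[OF c P(1)] by blast
    moreover have "c <= case_nat P f 0" using B(2)[OF c P(1)] by simp
    ultimately have "Suc n < Suc (Suc k)" using assms(2)[OF c] unfolding dimlt_def by blast
    thus ?thesis by simp
   qed
  qed
 qed
qed

lemma generic_parameters:
 assumes "finite A" "\<And>c. c \<in> A ==> ideal c R \<and> dimlt c (Suc k)"
 obtains ws where "length ws = k" "set ws <= m" "\<And>c. c \<in> A ==> mprim (Idl (c \<union> set ws))"
proof -
 have "\<exists>ws. length ws = k \<and> set ws <= m \<and> (\<forall>c\<in>A. mprim (Idl (c \<union> set ws)))"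
  using assms
 proof (induction k arbitrary: A)
  case 0
  have "mprim (Idl c)" if "c \<in> A" for c
   using dimlt_1_mprim 0(2)[OF that] Idl_ideal by simp
  thus ?case by (intro exI[of _ "[]"]) auto
 next
  case (Suc k)
  obtain y where y: "y \<in> m" "\<And>c. c \<in> A ==> dimlt (Idl (insert y c)) (Suc k)"
   using generic_parameter[OF Suc(2), of k] Suc(3) by blast
  let ?A = "(%c. Idl (insert y c)) ` A"
  have "ideal d R \<and> dimlt d (Suc k)" if d: "d \<in> ?A" for d
  proof -
   obtain c where c: "d = Idl (insert y c)" "c \<in> A" using d by blast
   have "insert y c <= carrier R" using y(1) m_carr Suc(3)[OF c(2)] ideal_sub by blast
   thus ?thesis using y(2)[OF c(2)] c(1) genideal_ideal by blast
  qed
  then obtain ws where ws: "length ws = k" "set ws <= m" "\<And>d. d \<in> ?A ==> mprim (Idl (d \<union> set ws))"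
   using Suc.IH[of ?A] Suc(2) by blast
  have "mprim (Idl (c \<union> set (y # ws)))" if c: "c \<in> A" for c
  proof -
   have "insert y c <= carrier R" using y(1) m_carr Suc(3)[OF c] ideal_sub by blast
   hence "Idl (Idl (insert y c) \<union> set ws) = Idl (insert y c \<union> set ws)"
    using Idl_Un_Idl ws(2) m_carr by blast
   thus ?thesis using ws(3)[of "Idl (insert y c)"] c by simp
  qed
  thus ?case using ws y(1) by (intro exI[of _ "y # ws"]) auto
 qed
 thus ?thesis using that by blast
qed

end

section \<open>Limit closures\<close>

text \<open>For a system of parameters \<open>xs\<close>, \<open>lim c xs\<close> is the kernel of the map from the ring to the top
 local cohomology of its quotient by \<open>c\<close> that sends \<open>r\<close> to the class $[r + (x_1, \dots, x_d)]$.\<close>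

context cring
begin

definition lprod :: "'a list => 'a"
 where "lprod xs = foldr (\<otimes>) xs \<one>"

definition pw :: "nat => 'a list => 'a list"
 where "pw n xs = map (%x. x [^] n) xs"

definition lim :: "'a set => 'a list => 'a set"
 where "lim c xs = {r \<in> carrier R. \<exists>t. r \<otimes> lprod (pw t xs) \<in> Idl (c \<union> set (pw (Suc t) xs))}"

lemma lprod_simps [simp]: "lprod [] = \<one>" "lprod (x # xs) = x \<otimes> lprod xs"
 by (simp_all add: lprod_def)

lemma lprod_closed [simp]: "set xs <= carrier R ==> lprod xs \<in> carrier R"
 by (induction xs) auto

lemma pw_simps [simp]: "pw n [] = []" "pw n (x # xs) = x [^] n # pw n xs"
 by (simp_all add: pw_def)

lemma pw_append [simp]: "pw n (xs @ ys) = pw n xs @ pw n ys"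
 by (simp add: pw_def)

lemma length_pw [simp]: "length (pw n xs) = length xs"
 by (simp add: pw_def)

lemma set_pw: "set (pw n xs) = (%x. x [^] n) ` set xs"
 by (simp add: pw_def)

lemma pw_carr [simp]: "set xs <= carrier R ==> set (pw n xs) <= carrier R"
 by (auto simp: set_pw)

lemma pw_pw: "set xs <= carrier R ==> pw k (pw n xs) = pw (n * k) xs"
 by (auto simp: pw_def nat_pow_pow)

lemma pw_1: "set xs <= carrier R ==> pw (Suc 0) xs = xs"
 by (induction xs) auto

lemma lprod_pw_add:
 "set xs <= carrier R ==> lprod (pw (s + t) xs) = lprod (pw s xs) \<otimes> lprod (pw t xs)"
 by (induction xs) (simp_all add: m_ac flip: nat_pow_mult)

lemma lprod_mem:
 assumes "set xs <= carrier R" "x \<in> set xs"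
 shows "\<exists>r\<in>carrier R. lprod xs = x \<otimes> r"
 using assms
proof (induction xs)
 case (Cons a xs)
 show ?case
 proof (cases "x = a")
  case True thus ?thesis using Cons by auto
 next
  case False
  then obtain r where "r \<in> carrier R" "lprod xs = x \<otimes> r" using Cons by auto
  thus ?thesis using Cons False by (intro bexI[of _ "a \<otimes> r"]) (auto simp: m_lcomm)
 qed
qed simp

lemma lprod_append: "set xs <= carrier R ==> set ys <= carrier R ==> lprod (xs @ ys) = lprod xs \<otimes> lprod ys"
 by (induction xs) (auto simp: m_assoc)

lemma lprod_mset:
 assumes "mset xs = mset ys" "set xs <= carrier R"
 shows "lprod xs = lprod ys"
 using assms
proof (induction xs arbitrary: ys)
 case (Cons x xs)
 have "x \<in> set ys" using Cons(2) by (metis list.set_intros(1) set_mset_mset)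
 then obtain us vs where ys: "ys = us @ x # vs" by (metis split_list)
 have sub: "set ys <= carrier R" using Cons(2,3) by (metis set_mset_mset)
 have "mset xs = mset (us @ vs)" using Cons(2) ys by simp
 hence "lprod xs = lprod (us @ vs)" using Cons(1)[of "us @ vs"] Cons(3) by simp
 thus ?case using ys sub by (simp add: lprod_append m_lcomm)
qed simp

text \<open>Any entry may thus be moved to the head, the only place where the shift and exchange
  lemmas act.\<close>

lemma lim_mset:
 assumes "mset xs = mset ys" "set xs <= carrier R"
 shows "lim c xs = lim c ys"
proof -
 have "lprod (pw t xs) = lprod (pw t ys)" for t
  by (rule lprod_mset) (use assms in \<open>auto simp: pw_def\<close>)
 moreover have "set (pw t xs) = set (pw t ys)" for t
  using assms(1) by (metis set_pw set_mset_mset)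
 ultimately show ?thesis unfolding lim_def by simp
qed

lemma Idl_colon_sub:
 assumes "ideal K R" "u \<in> carrier R" "\<And>s. s \<in> S ==> s \<in> carrier R" "\<And>s. s \<in> S ==> s \<otimes> u \<in> K" "y \<in> Idl S"
 shows "y \<otimes> u \<in> K"
proof -
 have "Idl S <= colon K u"
  by (rule Idl_subI) (use assms colon_ideal in \<open>auto simp: colon_def\<close>)
 thus ?thesis using assms(5) by (auto simp: colon_def)
qed

text \<open>The head \<open>a\<close> has exponents of its own, so that the power of one parameter
  can change while those of the others follow a different pattern. The claim is checked on
  generators, each of which divides into the multiplier in the right power.\<close>

lemma pw_shift:
 assumes c: "ideal c R" "set xs <= carrier R" "a \<in> carrier R"
  and y: "y \<in> Idl (insert (a [^] (N::nat)) (c \<union> set (pw n xs)))"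
 shows "y \<otimes> (a [^] (k::nat) \<otimes> lprod (pw l xs)) \<in> Idl (insert (a [^] (N + k)) (c \<union> set (pw (n + l) xs)))" (is "_ \<in> ?K")
proof -
 have S: "insert (a [^] (N + k)) (c \<union> set (pw (n + l) xs)) <= carrier R"
  using c ideal_sub[OF c(1)] pw_carr[OF c(2)] by auto
 hence K: "ideal ?K R" by (rule genideal_ideal)
 have mem: "z \<in> ?K" if "z \<in> insert (a [^] (N + k)) (c \<union> set (pw (n + l) xs))" for z
  using that S by (rule Idl_mem)
 have P: "lprod (pw l xs) \<in> carrier R" using c by simp
 show ?thesis
 proof (rule Idl_colon_sub[OF K _ _ _ y])
  show "a [^] k \<otimes> lprod (pw l xs) \<in> carrier R" using c P by simp
  show "s \<in> carrier R" if "s \<in> insert (a [^] N) (c \<union> set (pw n xs))" for s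
   using that c(3) ideal_sub[OF c(1)] pw_carr[OF c(2), of n] by auto
  fix s assume "s \<in> insert (a [^] N) (c \<union> set (pw n xs))"
  then consider "s = a [^] N" | "s \<in> c" | "s \<in> set (pw n xs)" by blast
  thus "s \<otimes> (a [^] k \<otimes> lprod (pw l xs)) \<in> ?K"
  proof cases
   case 1
   have "s \<otimes> (a [^] k \<otimes> lprod (pw l xs)) = a [^] (N + k) \<otimes> lprod (pw l xs)"
    unfolding 1 using c P by (simp add: m_assoc flip: nat_pow_mult)
   thus ?thesis using mem ideal_mult'[OF K] P by simp
  next
   case 2
   thus ?thesis using mem ideal_mult'[OF K] P c by simp
  next
   case 3
   then obtain x where x: "x \<in> set xs" "s = x [^] n" by (auto simp: set_pw)
   have "x [^] l \<in> set (pw l xs)" using x by (simp add: set_pw)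
   then obtain r where r: "r \<in> carrier R" "lprod (pw l xs) = x [^] l \<otimes> r"
    using lprod_mem[OF pw_carr[OF c(2)]] by blast
   have xc: "x \<in> carrier R" using x c by blast
   have "s \<otimes> (a [^] k \<otimes> lprod (pw l xs)) = x [^] (n + l) \<otimes> (a [^] k \<otimes> r)"
    unfolding r x using c r xc by (simp add: m_ac flip: nat_pow_mult)
   moreover have "x [^] (n + l) \<in> ?K" by (rule mem) (use x in \<open>simp add: set_pw\<close>)
   ultimately show ?thesis using ideal_mult'[OF K] r c by simp
  qed
 qed
qed

lemma pw_shift':
 assumes c: "ideal c R" "set xs <= carrier R" and y: "y \<in> Idl (c \<union> set (pw n xs))"
 shows "y \<otimes> lprod (pw l xs) \<in> Idl (c \<union> set (pw (n + l) xs))"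
proof (cases xs)
 case Nil
 thus ?thesis using assms ideal_carr[OF genideal_ideal[of c]] ideal_sub[OF c(1)] by simp
next
 case (Cons a as)
 have "y \<in> Idl (insert (a [^] n) (c \<union> set (pw n as)))" using y Cons by simp
 from pw_shift[OF c(1) _ _ this, of l l] c Cons show ?thesis by simp
qed

lemma lim_carr: "lim c xs <= carrier R"
 by (auto simp: lim_def)

lemma lim_up:
 assumes c: "ideal c R" "set xs <= carrier R" "r \<in> carrier R"
  and y: "r \<otimes> lprod (pw t xs) \<in> Idl (c \<union> set (pw (Suc t) xs))" "t \<le> t'"
 shows "r \<otimes> lprod (pw t' xs) \<in> Idl (c \<union> set (pw (Suc t') xs))"
 using pw_shift'[OF c(1,2) y(1), of "t' - t"] c y(2)
 by (simp add: m_assoc flip: lprod_pw_add)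

lemma lim_ideal:
 assumes c: "ideal c R" "set xs <= carrier R"
 shows "ideal (lim c xs) R"
proof (rule ideal_intro)
 have K: "ideal (Idl (c \<union> set (pw n xs))) R" for n
  using c ideal_sub[OF c(1)] pw_carr[OF c(2)] by (intro genideal_ideal) auto
 have P: "lprod (pw l xs) \<in> carrier R" for l using c by simp
 show "lim c xs <= carrier R" by (rule lim_carr)
 have "\<zero> \<otimes> lprod (pw 0 xs) \<in> Idl (c \<union> set (pw (Suc 0) xs))" using P ideal_zero[OF K] by simp
 thus "\<zero> \<in> lim c xs" unfolding lim_def by blast
 fix a b assume "a \<in> lim c xs" "b \<in> lim c xs"
 then obtain s t where *: "a \<in> carrier R" "a \<otimes> lprod (pw s xs) \<in> Idl (c \<union> set (pw (Suc s) xs))"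
   "b \<in> carrier R" "b \<otimes> lprod (pw t xs) \<in> Idl (c \<union> set (pw (Suc t) xs))" by (auto simp: lim_def)
 let ?t = "max s t"
 have "a \<otimes> lprod (pw ?t xs) \<in> Idl (c \<union> set (pw (Suc ?t) xs))" by (rule lim_up[OF c *(1,2)]) simp
 moreover have "b \<otimes> lprod (pw ?t xs) \<in> Idl (c \<union> set (pw (Suc ?t) xs))" by (rule lim_up[OF c *(3,4)]) simp
 ultimately have "(a \<oplus> b) \<otimes> lprod (pw ?t xs) \<in> Idl (c \<union> set (pw (Suc ?t) xs))"
  using * P ideal_add[OF K] by (simp add: l_distr)
 thus "a \<oplus> b \<in> lim c xs" using * unfolding lim_def by blast
next
 have K: "ideal (Idl (c \<union> set (pw n xs))) R" for n
  using c ideal_sub[OF c(1)] pw_carr[OF c(2)] by (intro genideal_ideal) auto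
 have P: "lprod (pw l xs) \<in> carrier R" for l using c by simp
 fix a r assume "a \<in> lim c xs" and r: "r \<in> carrier R"
 then obtain s where *: "a \<in> carrier R" "a \<otimes> lprod (pw s xs) \<in> Idl (c \<union> set (pw (Suc s) xs))" by (auto simp: lim_def)
 hence "r \<otimes> a \<otimes> lprod (pw s xs) \<in> Idl (c \<union> set (pw (Suc s) xs))"
  using r P ideal_mult[OF K] by (simp add: m_assoc)
 thus "r \<otimes> a \<in> lim c xs" using * r unfolding lim_def by blast
qed

lemma lim_sup:
 assumes c: "ideal c R" "set xs <= carrier R"
 shows "Idl (c \<union> set xs) <= lim c xs"
proof
 fix r assume r: "r \<in> Idl (c \<union> set xs)"
 have K: "ideal (Idl (c \<union> set xs)) R"
  using c ideal_sub[OF c(1)] by (intro genideal_ideal) auto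
 have "lprod (pw 0 xs) = \<one>" using c(2) by (induction xs) auto
 hence "r \<otimes> lprod (pw 0 xs) \<in> Idl (c \<union> set (pw (Suc 0) xs))"
  using r ideal_carr[OF K] c by (simp add: pw_1)
 thus "r \<in> lim c xs" using ideal_carr[OF K r] unfolding lim_def by blast
qed

text \<open>The exponents of the head and of the other entries in a witness may be chosen
  independently: pairs (k, t) are cofinal with the diagonal ones, and a witness is raised to the
  list exponent T = max k t, which is n T at \<open>a\<close> because the head is
  \<open>a [^] n\<close>.\<close>

lemma lim_Cons_iff:
 assumes c: "ideal c R" "set as <= carrier R" "a \<in> carrier R" "n > 0" "r \<in> carrier R"
 shows "r \<in> lim c (a [^] n # as) \<longleftrightarrow>
  (\<exists>k t. r \<otimes> (a [^] (k::nat) \<otimes> lprod (pw t as)) \<in> Idl (insert (a [^] (n + k)) (c \<union> set (pw (Suc t) as))))"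
  (is "?L \<longleftrightarrow> ?E")
proof
 assume ?L
 then obtain t where "r \<otimes> lprod (pw t (a [^] n # as)) \<in> Idl (c \<union> set (pw (Suc t) (a [^] n # as)))"
  by (auto simp: lim_def)
 hence "r \<otimes> (a [^] (n * t) \<otimes> lprod (pw t as)) \<in> Idl (insert (a [^] (n + n * t)) (c \<union> set (pw (Suc t) as)))"
  using c by (simp add: nat_pow_pow nat_pow_mult add.commute del: nat_pow_Suc)
 thus ?E by blast
next
 assume ?E
 then obtain k t where *: "r \<otimes> (a [^] k \<otimes> lprod (pw t as)) \<in> Idl (insert (a [^] (n + k)) (c \<union> set (pw (Suc t) as)))" by blast
 define T where "T = max k t"
 have T: "k \<le> n * T" "t \<le> T"
 proof -
  have "T \<le> n * T" using c(4) by simp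
  thus "k \<le> n * T" "t \<le> T" unfolding T_def by auto
 qed
 have P: "lprod (pw l as) \<in> carrier R" for l using c by simp
 have "r \<otimes> (a [^] k \<otimes> lprod (pw t as)) \<otimes> (a [^] (n * T - k) \<otimes> lprod (pw (T - t) as))
   \<in> Idl (insert (a [^] (n + k + (n * T - k))) (c \<union> set (pw (Suc t + (T - t)) as)))"
  by (rule pw_shift[OF c(1-3) *])
 moreover have "r \<otimes> (a [^] k \<otimes> lprod (pw t as)) \<otimes> (a [^] (n * T - k) \<otimes> lprod (pw (T - t) as))
   = r \<otimes> ((a [^] k \<otimes> a [^] (n * T - k)) \<otimes> (lprod (pw t as) \<otimes> lprod (pw (T - t) as)))"
  using c P by (simp add: m_ac)
 moreover have "\<dots> = r \<otimes> (a [^] (n * T) \<otimes> lprod (pw T as))"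
  using c T by (simp add: nat_pow_mult flip: lprod_pw_add)
 moreover have "n + k + (n * T - k) = n * Suc T" "Suc t + (T - t) = Suc T" using T by simp_all
 ultimately have "r \<otimes> (a [^] (n * T) \<otimes> lprod (pw T as)) \<in> Idl (insert (a [^] (n * Suc T)) (c \<union> set (pw (Suc T) as)))"
  by metis
 moreover have "pw l (a [^] n # as) = a [^] (n * l) # pw l as" for l
  by (simp only: pw_simps nat_pow_pow[OF c(3)])
 ultimately have "r \<otimes> lprod (pw T (a [^] n # as)) \<in> Idl (c \<union> set (pw (Suc T) (a [^] n # as)))"
  by (simp only: lprod_simps list.set Un_insert_right)
 thus ?L using c(5) unfolding lim_def by blast
qed

text \<open>r modulo (a^n, ...) and r a^k modulo (a^(n+k), ...) represent the same class of the
  direct limit. This cancellation holds for every \<open>a\<close>, regular or not, and is the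
  reason for working with limit closures.\<close>

lemma lim_shift:
 assumes c: "ideal c R" "set as <= carrier R" "a \<in> carrier R" "n > 0" "r \<in> carrier R"
 shows "r \<otimes> a [^] (k::nat) \<in> lim c (a [^] (n + k) # as) \<longleftrightarrow> r \<in> lim c (a [^] n # as)"
proof
 have P: "lprod (pw l as) \<in> carrier R" for l using c by simp
 {
  assume "r \<otimes> a [^] k \<in> lim c (a [^] (n + k) # as)"
  then obtain l t where "r \<otimes> a [^] k \<otimes> (a [^] (l::nat) \<otimes> lprod (pw t as)) \<in> Idl (insert (a [^] (n + k + l)) (c \<union> set (pw (Suc t) as)))"
   using lim_Cons_iff[OF c(1-3), of "n + k"] c by auto
  hence "r \<otimes> (a [^] (k + l) \<otimes> lprod (pw t as)) \<in> Idl (insert (a [^] (n + (k + l))) (c \<union> set (pw (Suc t) as)))"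
   using c P by (simp add: m_assoc add.assoc flip: nat_pow_mult)
  thus "r \<in> lim c (a [^] n # as)" using lim_Cons_iff[OF c] by blast
 next
  assume "r \<in> lim c (a [^] n # as)"
  then obtain l t where *: "r \<otimes> (a [^] (l::nat) \<otimes> lprod (pw t as)) \<in> Idl (insert (a [^] (n + l)) (c \<union> set (pw (Suc t) as)))"
   using lim_Cons_iff[OF c] by blast
  have "r \<otimes> (a [^] l \<otimes> lprod (pw t as)) \<otimes> (a [^] k \<otimes> lprod (pw 0 as)) \<in> Idl (insert (a [^] (n + l + k)) (c \<union> set (pw (Suc t + 0) as)))"
   by (rule pw_shift[OF c(1-3) *])
  moreover have "lprod (pw 0 as) = \<one>" using c(2) by (induction as) auto
  ultimately have "r \<otimes> a [^] k \<otimes> (a [^] (l::nat) \<otimes> lprod (pw t as)) \<in> Idl (insert (a [^] (n + k + l)) (c \<union> set (pw (Suc t) as)))"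
   using c P by (simp add: m_ac add_ac)
  thus "r \<otimes> a [^] k \<in> lim c (a [^] (n + k) # as)"
   using lim_Cons_iff[OF c(1-3), of "n + k" "r \<otimes> a [^] k"] c by auto
 }
qed

lemma lim_Cons_mono:
 assumes c: "ideal c R" "set as <= carrier R" "a \<in> carrier R" "n > 0" "n \<le> (k::nat)"
 shows "lim c (a [^] k # as) <= lim c (a [^] n # as)"
proof
 fix r assume r: "r \<in> lim c (a [^] k # as)"
 have rc: "r \<in> carrier R" using r lim_carr by blast
 obtain l t where *: "r \<otimes> (a [^] (l::nat) \<otimes> lprod (pw t as)) \<in> Idl (insert (a [^] (k + l)) (c \<union> set (pw (Suc t) as)))"
  using lim_Cons_iff[OF c(1-3) _ rc, of k] r c by auto
 have S: "insert (a [^] (n + l)) (c \<union> set (pw (Suc t) as)) <= carrier R"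
  using c ideal_sub[OF c(1)] pw_carr[OF c(2), of "Suc t"] by auto
 let ?K = "Idl (insert (a [^] (n + l)) (c \<union> set (pw (Suc t) as)))"
 have K: "ideal ?K R" using S by (rule genideal_ideal)
 have "a [^] (n + l) \<in> ?K" by (rule Idl_mem[OF _ S]) simp
 hence "a [^] (k + l) \<in> ?K" using ideal_pow_le[OF K c(3)] c(5) by simp
 moreover have "c \<union> set (pw (Suc t) as) <= ?K" using Idl_mem[OF _ S] by blast
 ultimately have "Idl (insert (a [^] (k + l)) (c \<union> set (pw (Suc t) as))) <= ?K"
  by (intro Idl_subI[OF _ K]) simp
 thus "r \<in> lim c (a [^] n # as)" using lim_Cons_iff[OF c(1-4) rc] * by blast
qed

lemma lim_base_mono:
 assumes "ideal c R" "ideal d R" "c <= d" "set xs <= carrier R"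
 shows "lim c xs <= lim d xs"
proof -
 have "Idl (c \<union> set (pw n xs)) <= Idl (d \<union> set (pw n xs))" for n
  by (rule Idl_mono) (use assms ideal_sub[OF assms(2)] pw_carr[OF assms(4)] in auto)
 thus ?thesis unfolding lim_def by blast
qed

end

text \<open>Vanishing of top local cohomology in the degree above the dimension, by the boundary ideals
 of Lombardi and Quitte.\<close>

lemma (in nlocal) lim_one_of_dimlt:
 assumes "ideal c R" "dimlt c (length xs)" "set xs <= carrier R"
 shows "\<one> \<in> lim c xs"
 using assms
proof (induction xs arbitrary: c)
 case Nil
 thus ?case using dimlt_0[of c] Idl_ideal[of c] by (auto simp: lim_def)
next
 case (Cons x xs)
 have x: "x \<in> carrier R" "set xs <= carrier R" using Cons by auto
 obtain N :: nat where N: "dimlt (Idl (insert x (colon c (x [^] N)))) (length xs)"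
  using dimlt_boundary[OF Cons(2) _ x(1), of "length xs"] Cons(3) by auto
 let ?S = "insert x (colon c (x [^] N))"
 have S: "?S <= carrier R" using x by (auto simp: colon_def)
 have "\<one> \<in> lim (Idl ?S) xs" using Cons.IH[OF genideal_ideal[OF S] N x(2)] .
 then obtain t where "\<one> \<otimes> lprod (pw t xs) \<in> Idl (Idl ?S \<union> set (pw (Suc t) xs))" by (auto simp: lim_def)
 hence t: "lprod (pw t xs) \<in> Idl (?S \<union> set (pw (Suc t) xs))"
  using Idl_Un_Idl[OF S] x by simp
 let ?K = "Idl (insert (x [^] (1 + N)) (c \<union> set (pw (Suc t) xs)))"
 have KS: "insert (x [^] (1 + N)) (c \<union> set (pw (Suc t) xs)) <= carrier R"
  using x ideal_sub[OF Cons(2)] pw_carr[OF x(2), of "Suc t"] by auto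
 have K: "ideal ?K R" using KS by (rule genideal_ideal)
 have mem: "z \<in> ?K" if "z \<in> insert (x [^] (1 + N)) (c \<union> set (pw (Suc t) xs))" for z
  using that KS by (rule Idl_mem)
 \<comment> \<open>Multiplication by x^N maps the generator x of the boundary ideal to x^(N+1) and
   its other part c : x^N into c. A witness for \<open>xs\<close> modulo the boundary ideal thereby
   becomes a witness for \<open>x # xs\<close> modulo c.\<close>
 have "lprod (pw t xs) \<otimes> x [^] N \<in> ?K"
 proof (rule Idl_colon_sub[OF K _ _ _ t])
  show "x [^] N \<in> carrier R" using x by simp
  show "s \<in> carrier R" if "s \<in> ?S \<union> set (pw (Suc t) xs)" for s using that S pw_carr[OF x(2)] by blast
  fix s assume "s \<in> ?S \<union> set (pw (Suc t) xs)"
  then consider "s = x" | "s \<in> colon c (x [^] N)" | "s \<in> set (pw (Suc t) xs)" by blast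
  thus "s \<otimes> x [^] N \<in> ?K"
  proof cases
   case 1 thus ?thesis using mem[of "x [^] (1 + N)"] x by (simp add: m_comm)
  next
   case 2 thus ?thesis using mem by (auto simp: colon_def)
  next
   case 3 thus ?thesis using mem ideal_mult'[OF K] x by simp
  qed
 qed
 hence "\<one> \<otimes> (x [^] N \<otimes> lprod (pw t xs)) \<in> ?K" using x by (simp add: m_comm)
 thus ?case using lim_Cons_iff[OF Cons(2) x(2,1), of 1 \<one>] x by auto
qed

no_notation Sum_Type.Plus (infixr \<open><+>\<close> 65)

section \<open>Lengths of intervals of ideals\<close>

context cring
begin

text \<open>The length of K/I is measured by chains of ideals; n counts strict inclusions, and the
  chain need not reach I or K.\<close>

definition ichain :: "'a set => 'a set => nat => bool"
 where "ichain I K n \<longleftrightarrow> (\<exists>f. I <= f 0 \<and> f n <= K \<and> (\<forall>i\<le>n. ideal (f i) R) \<and> (\<forall>i<n. f i \<subset> f (Suc i)))"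

definition finlen :: "'a set => 'a set => bool"
 where "finlen I K \<longleftrightarrow> (\<exists>N. \<forall>n. ichain I K n --> n \<le> N)"

text \<open>The length of $K/I$; without \<^const>\<open>finlen\<close> the value is unspecified.\<close>

definition len :: "'a set => 'a set => nat"
 where "len I K = (GREATEST n. ichain I K n)"

lemma ichainE:
 assumes "ichain I K n"
 obtains f where "I <= f 0" "f n <= K" "\<forall>i\<le>n. ideal (f i) R" "\<forall>i<n. f i \<subset> f (Suc i)"
 using assms unfolding ichain_def by (elim exE conjE)

lemma ichain_mono: "ichain I K n ==> I' <= I ==> K <= K' ==> ichain I' K' n"
 unfolding ichain_def by (meson subset_trans)

lemma finlen_mono: "finlen I' K' ==> I' <= I ==> K <= K' ==> finlen I K"
 unfolding finlen_def using ichain_mono by blast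

lemma ichain_0: "ideal I R ==> I <= K ==> ichain I K 0"
 unfolding ichain_def by (intro exI[of _ "%_. I"]) simp

lemma len_ge: "finlen I K ==> ichain I K n ==> n \<le> len I K"
 unfolding finlen_def len_def by (metis Greatest_le_nat)

lemma len_chain: "finlen I K ==> ideal I R ==> I <= K ==> ichain I K (len I K)"
 unfolding finlen_def len_def using ichain_0 by (metis GreatestI_nat)

lemma len_le:
 assumes "ideal I R" "I <= K" "\<And>n. ichain I K n ==> n \<le> N"
 shows "finlen I K \<and> len I K \<le> N"
proof
 show *: "finlen I K" unfolding finlen_def using assms by blast
 show "len I K \<le> N" using len_chain[OF * assms(1,2)] assms(3) by blast
qed

lemma len_mono:
 assumes "finlen I' K'" "ideal I R" "I <= K" "I' <= I" "K <= K'"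
 shows "len I K \<le> len I' K'"
 using len_ge[OF assms(1)] ichain_mono len_chain[OF finlen_mono[OF assms(1,4,5)] assms(2,3)] assms(4,5) by blast

lemma ichain_join:
 assumes "ichain I J n" "ichain J K k"
 shows "ichain I K (n + k)"
proof -
 obtain f where f: "I <= f 0" "f n <= J" "\<forall>i\<le>n. ideal (f i) R" "\<forall>i<n. f i \<subset> f (Suc i)"
  using assms(1) by (rule ichainE)
 obtain g where g: "J <= g 0" "g k <= K" "\<forall>i\<le>k. ideal (g i) R" "\<forall>i<k. g i \<subset> g (Suc i)"
  using assms(2) by (rule ichainE)
 show ?thesis
 proof (cases "k = 0")
  case True
  thus ?thesis using f g unfolding ichain_def by (intro exI[of _ f]) auto
 next
  case False
  \<comment> \<open>The ideal \<open>g 0\<close> is left out since it may equal \<open>f n\<close>;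
    at the joint one has f n <= J <= g 0, and g 0 is strictly below g 1.\<close>
  let ?h = "%i. if i \<le> n then f i else g (i - n)"
  have "?h i \<subset> ?h (Suc i)" if i: "i < n + k" for i
  proof -
   consider "i < n" | "i = n" | "i > n" by linarith
   thus ?thesis
   proof cases
    case 1 thus ?thesis using f by simp
   next
    case 2
    have "g 0 \<subset> g (Suc 0)" using g(4) False by blast
    thus ?thesis using 2 f(2) g(1) by auto
   next
    case 3
    hence "g (i - n) \<subset> g (Suc (i - n))" using g(4) i by simp
    thus ?thesis using 3 by (simp add: Suc_diff_le)
   qed
  qed
  moreover have "ideal (?h i) R" if "i \<le> n + k" for i using f g that by auto
  ultimately show ?thesis using f g False unfolding ichain_def by (intro exI[of _ ?h]) auto
 qed
qed

lemma ichain_compress: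
 assumes "\<And>i. i \<le> n ==> ideal (g i) R" "\<And>i. i < n ==> g i <= g (Suc i)"
 shows "ichain (g 0) (g n) (card {i. i < n \<and> g i \<noteq> g (Suc i)})"
 using assms
proof (induction n)
 case 0
 thus ?case using ichain_0[of "g 0" "g 0"] by simp
next
 case (Suc n)
 have IH: "ichain (g 0) (g n) (card {i. i < n \<and> g i \<noteq> g (Suc i)})" using Suc by simp
 show ?case
 proof (cases "g n = g (Suc n)")
  case True
  hence "{i. i < Suc n \<and> g i \<noteq> g (Suc i)} = {i. i < n \<and> g i \<noteq> g (Suc i)}"
   using less_Suc_eq by auto
  thus ?thesis using IH True by simp
 next
  case False
  hence "{i. i < Suc n \<and> g i \<noteq> g (Suc i)} = insert n {i. i < n \<and> g i \<noteq> g (Suc i)}"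
   using less_Suc_eq by auto
  hence "card {i. i < Suc n \<and> g i \<noteq> g (Suc i)} = card {i. i < n \<and> g i \<noteq> g (Suc i)} + 1" by simp
  moreover have "ichain (g n) (g (Suc n)) 1"
   unfolding ichain_def using Suc False by (intro exI[of _ "case_nat (g n) (%_. g (Suc n))"]) (auto split: nat.splits)
  ultimately show ?thesis using ichain_join[OF IH, of "g (Suc n)" 1] by simp
 qed
qed

lemma set_addI: "a \<in> I ==> b \<in> J ==> a \<oplus> b \<in> I <+> J"
 unfolding set_add_def' by blast

lemma set_addE:
 assumes "x \<in> I <+> J"
 obtains a b where "a \<in> I" "b \<in> J" "x = a \<oplus> b"
 using assms unfolding set_add_def' by blast

lemma modular_eq:
 assumes "ideal A R" "ideal B R" "ideal J R" "A <= B" "A \<inter> J = B \<inter> J" "A <+> J = B <+> J"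
 shows "A = B"
proof
 show "B <= A"
 proof
  fix b assume b: "b \<in> B"
  have bc: "b \<in> carrier R" using b assms(2) ideal_carr by blast
  have "b \<oplus> \<zero> \<in> A <+> J" unfolding assms(6) by (rule set_addI[OF b ideal_zero[OF assms(3)]])
  then obtain a j where aj: "a \<in> A" "j \<in> J" "b = a \<oplus> j" using bc by (auto elim: set_addE)
  have c: "a \<in> carrier R" "j \<in> carrier R" using aj assms ideal_carr by blast+
  have "j \<oplus> a \<in> B" using b aj c by (simp add: a_comm)
  hence "j \<in> B" using ideal_add_cancel[OF assms(2)] aj assms(4) c by blast
  hence "j \<in> A" using aj assms(5) by blast
  thus "b \<in> A" using aj ideal_add[OF assms(1)] by simp
 qed
qed (rule assms)

text \<open>Intersecting with J and adding J turns a chain into one below J and one above J. By the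
  modular law a strict inclusion cannot become an equality in both, so every step is counted at
  least once.\<close>

lemma len_subadditive:
 assumes "finlen I J" "finlen J K" "ideal I R" "ideal J R" "ideal K R" "I <= J" "J <= K" "ichain I K n"
 shows "n \<le> len I J + len J K"
proof -
 obtain f where "I <= f 0" "f n <= K" "\<forall>i\<le>n. ideal (f i) R" "\<forall>i<n. f i \<subset> f (Suc i)"
  using assms(8) by (rule ichainE)
 hence f: "I <= f 0" "f n <= K" "\<And>i. i \<le> n ==> ideal (f i) R" "\<And>i. i < n ==> f i \<subset> f (Suc i)" by simp_all
 let ?a = "%i. f i \<inter> J" and ?b = "%i. f i <+> J"
 have a: "ichain (?a 0) (?a n) (card {i. i < n \<and> ?a i \<noteq> ?a (Suc i)})"
 proof (rule ichain_compress)
  show "ideal (?a i) R" if "i \<le> n" for i using f(3)[OF that] assms(4) i_intersect by blast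
  show "?a i <= ?a (Suc i)" if "i < n" for i using f(4)[OF that] by blast
 qed
 have b: "ichain (?b 0) (?b n) (card {i. i < n \<and> ?b i \<noteq> ?b (Suc i)})"
 proof (rule ichain_compress)
  show "ideal (?b i) R" if "i \<le> n" for i using f(3)[OF that] assms(4) add_ideals by blast
  show "?b i <= ?b (Suc i)" if "i < n" for i
   using f(4)[OF that] by (auto elim!: set_addE intro: set_addI)
 qed
 have cover: "{..<n} <= {i. i < n \<and> ?a i \<noteq> ?a (Suc i)} \<union> {i. i < n \<and> ?b i \<noteq> ?b (Suc i)}"
 proof
  fix i assume "i \<in> {..<n}"
  hence i: "i < n" by simp
  have "?a i \<noteq> ?a (Suc i) \<or> ?b i \<noteq> ?b (Suc i)"
   using modular_eq[OF f(3)[of i] f(3)[of "Suc i"] assms(4)] f(4)[OF i] i by auto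
  thus "i \<in> {i. i < n \<and> ?a i \<noteq> ?a (Suc i)} \<union> {i. i < n \<and> ?b i \<noteq> ?b (Suc i)}" using i by blast
 qed
 have "n = card {..<n}" by simp
 also have "\<dots> \<le> card ({i. i < n \<and> ?a i \<noteq> ?a (Suc i)} \<union> {i. i < n \<and> ?b i \<noteq> ?b (Suc i)})"
  by (rule card_mono[OF _ cover]) auto
 also have "\<dots> \<le> card {i. i < n \<and> ?a i \<noteq> ?a (Suc i)} + card {i. i < n \<and> ?b i \<noteq> ?b (Suc i)}"
  by (rule card_Un_le)
 also have "card {i. i < n \<and> ?a i \<noteq> ?a (Suc i)} \<le> len I J"
  by (rule len_ge[OF assms(1)], rule ichain_mono[OF a]) (use f assms(6) in auto)
 also have "card {i. i < n \<and> ?b i \<noteq> ?b (Suc i)} \<le> len J K"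
 proof (rule len_ge[OF assms(2)], rule ichain_mono[OF b])
  show "J <= ?b 0"
  proof
   fix x assume x: "x \<in> J"
   have "\<zero> \<oplus> x \<in> ?b 0" using set_addI ideal_zero[OF f(3)[of 0]] x by blast
   thus "x \<in> ?b 0" using x ideal_carr[OF assms(4)] by simp
  qed
  show "?b n <= K"
   using f(2) assms(7) ideal_add[OF assms(5)] by (auto elim!: set_addE)
 qed
 finally show ?thesis by simp
qed

lemma len_add:
 assumes "finlen I J" "finlen J K" "ideal I R" "ideal J R" "ideal K R" "I <= J" "J <= K"
 shows "finlen I K" and "len I K = len I J + len J K"
proof -
 have *: "finlen I K \<and> len I K \<le> len I J + len J K"
  by (rule len_le) (use assms len_subadditive in auto)
 thus "finlen I K" by blast
 have "len I J + len J K \<le> len I K"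
  using len_ge[of I K] * ichain_join[OF len_chain[OF assms(1,3,6)] len_chain[OF assms(2,4,7)]] by blast
 thus "len I K = len I J + len J K" using * by simp
qed

text \<open>Strictly monotone maps between intervals of ideals play the role of embeddings of
  subquotients: they carry chains to chains of the same length, and no quotient module has to be
  formed.\<close>

lemma len_transfer:
 assumes "finlen A' B'" "ideal A R" "A <= B"
  and T: "\<And>L. ideal L R ==> A <= L ==> L <= B ==> ideal (T L) R \<and> A' <= T L \<and> T L <= B'"
  and strict: "\<And>L M. ideal L R ==> ideal M R ==> A <= L ==> L \<subset> M ==> M <= B ==> T L \<subset> T M"
 shows "finlen A B \<and> len A B \<le> len A' B'"
proof (rule len_le[OF assms(2,3)])
 fix n assume "ichain A B n"
 then obtain f where "A <= f 0" "f n <= B" "\<forall>i\<le>n. ideal (f i) R" "\<forall>i<n. f i \<subset> f (Suc i)"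
  by (rule ichainE)
 hence f: "A <= f 0" "f n <= B" "\<And>i. i \<le> n ==> ideal (f i) R" "\<And>i. i < n ==> f i \<subset> f (Suc i)" by simp_all
 have up: "f 0 <= f i" if "i \<le> n" for i using that
 proof (induction i)
  case (Suc i)
  thus ?case using f(4)[of i] by auto
 qed simp
 have down: "f (n - i) <= f n" for i
 proof (induction i)
  case (Suc i)
  show ?case
  proof (cases "i < n")
   case True
   hence "f (n - Suc i) \<subset> f (Suc (n - Suc i))" by (intro f(4)) simp
   thus ?thesis using Suc True by (simp add: Suc_diff_Suc)
  next
   case False thus ?thesis using Suc by simp
  qed
 qed simp
 have AB: "A <= f i \<and> f i <= B" if "i \<le> n" for i
  using up[OF that] down[of "n - i"] that f(1,2) by auto
 have "ichain A' B' n" unfolding ichain_def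
 proof (intro exI[of _ "%i. T (f i)"] conjI allI impI)
  show "A' <= T (f 0)" "T (f n) <= B'" using T[OF f(3)] AB by auto
  show "ideal (T (f i)) R" if "i \<le> n" for i using T[OF f(3)] AB that by auto
  show "T (f i) \<subset> T (f (Suc i))" if "i < n" for i
   using strict[OF f(3) f(3), of i "Suc i"] f(4)[OF that] AB[of i] AB[of "Suc i"] that by simp
 qed
 thus "n \<le> len A' B'" by (rule len_ge[OF assms(1)])
qed

abbreviation colen :: "'a set => nat"
 where "colen I \<equiv> len I (carrier R)"

abbreviation fincolen :: "'a set => bool"
 where "fincolen I \<equiv> finlen I (carrier R)"

lemma colen_mono: "fincolen I ==> ideal K R ==> I <= K ==> colen K \<le> colen I"
 by (rule len_mono) (auto simp: ideal_sub)

lemma colen_diff: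
 assumes "fincolen I" "ideal I R" "ideal K R" "I <= K"
 shows "finlen I K" "colen I = len I K + colen K"
proof -
 show *: "finlen I K" by (rule finlen_mono[OF assms(1)]) (use ideal_sub[OF assms(3)] in auto)
 have "fincolen K" by (rule finlen_mono[OF assms(1)]) (use assms in auto)
 thus "colen I = len I K + colen K"
  using len_add(2)[OF * _ assms(2,3) oneideal assms(4) ideal_sub[OF assms(3)]] by simp
qed

lemma colen_carrier: "colen (carrier R) = 0"
proof -
 have "finlen (carrier R) (carrier R) \<and> len (carrier R) (carrier R) \<le> 0"
 proof (rule len_le[OF oneideal subset_refl])
  fix n assume "ichain (carrier R) (carrier R) n"
  then obtain f where f: "carrier R <= f 0" "f n <= carrier R" "\<forall>i\<le>n. ideal (f i) R" "\<forall>i<n. f i \<subset> f (Suc i)"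
   by (rule ichainE)
  show "n \<le> 0"
  proof (rule ccontr)
   assume "\<not> n \<le> 0"
   hence "f 0 \<subset> f (Suc 0)" "ideal (f (Suc 0)) R" using f by auto
   thus False using f(1) ideal_sub by blast
  qed
 qed
 thus ?thesis by simp
qed

lemma colen_pos:
 assumes "fincolen I" "ideal I R" "\<one> \<notin> I"
 shows "colen I \<ge> 1"
proof -
 have "I \<subset> carrier R" using assms ideal_sub ideal_one by blast
 hence "ichain I (carrier R) 1"
  unfolding ichain_def using assms(2) oneideal
  by (intro exI[of _ "case_nat I (%_. carrier R)"]) (auto split: nat.splits)
 thus ?thesis using len_ge[OF assms(1)] by blast
qed

lemma fincolen_mono: "fincolen I ==> I <= K ==> fincolen K"
 by (rule finlen_mono) auto

text \<open>Behind this is the isomorphism of (I + (y))/I with R/(I : y). It is replaced by two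
  strictly monotone maps in opposite directions, L to L : y and L to I + L y.\<close>

lemma colen_colon:
 assumes "fincolen I" "ideal I R" "y \<in> carrier R"
 shows "colen I = colen (Idl (insert y I)) + colen (colon I y)"
proof -
 have S: "insert y I <= carrier R" using assms ideal_sub by blast
 let ?K = "Idl (insert y I)"
 have K: "ideal ?K R" "I <= ?K" "y \<in> ?K" using genideal_ideal[OF S] genideal_self[OF S] by auto
 have C: "ideal (colon I y) R" using colon_ideal assms by blast
 have fIK: "finlen I ?K" "colen I = len I ?K + colen ?K" using colen_diff[OF assms(1,2) K(1,2)] by auto
 have fC: "fincolen (colon I y)" using fincolen_mono[OF assms(1) colon_sup[OF assms(2,3)]] .
 have "finlen I ?K \<and> len I ?K \<le> colen (colon I y)"
 proof (rule len_transfer[where T = "%L. colon L y", OF fC assms(2) K(2)])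
  fix L assume "ideal L R" "I <= L"
  thus "ideal (colon L y) R \<and> colon I y <= colon L y \<and> colon L y <= carrier R"
   using colon_ideal assms(3) by (auto simp: colon_def)
 next
  fix L M assume LM: "ideal L R" "ideal M R" "I <= L" "L \<subset> M" "M <= ?K"
  then obtain x where x: "x \<in> M" "x \<notin> L" by blast
  obtain i r where ir: "i \<in> I" "r \<in> carrier R" "x = i \<oplus> r \<otimes> y"
   using x LM(5) ideal_sub[OF assms(2)] assms(3) Idl_ideal[OF assms(2)] by (metis Idl_insertE subsetD)
  have ic: "i \<in> carrier R" using ir assms(2) ideal_carr by blast
  have "r \<otimes> y \<oplus> i \<in> M" using x ir ic assms(3) by (simp add: a_comm)
  hence "r \<otimes> y \<in> M" using ideal_add_cancel[OF LM(2)] ir LM assms(3) by blast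
  moreover have "r \<otimes> y \<notin> L" using x ir ideal_add[OF LM(1)] LM(3) by blast
  ultimately have "r \<in> colon M y" "r \<notin> colon L y" using ir by (auto simp: colon_def)
  moreover have "colon L y <= colon M y" using LM by (auto simp: colon_def)
  ultimately show "colon L y \<subset> colon M y" by blast
 qed
 moreover have "finlen (colon I y) (carrier R) \<and> colen (colon I y) \<le> len I ?K"
 proof (rule len_transfer[where T = "%L. {i \<oplus> r \<otimes> y | i r. i \<in> I \<and> r \<in> L}", OF fIK(1) C ideal_sub[OF C]])
  fix L assume L: "ideal L R" "colon I y <= L"
  let ?T = "{i \<oplus> r \<otimes> y | i r. i \<in> I \<and> r \<in> L}"
  have "ideal ?T R"
  proof (rule ideal_intro)
   show "?T <= carrier R" using ideal_carr[OF L(1)] ideal_carr[OF assms(2)] assms(3) by auto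
   have "\<zero> = \<zero> \<oplus> \<zero> \<otimes> y" using assms(3) by simp
   thus "\<zero> \<in> ?T" using ideal_zero[OF L(1)] ideal_zero[OF assms(2)] by blast
  next
   fix a b assume "a \<in> ?T" "b \<in> ?T"
   then obtain i r j s where *: "a = i \<oplus> r \<otimes> y" "b = j \<oplus> s \<otimes> y" "i \<in> I" "j \<in> I" "r \<in> L" "s \<in> L" by blast
   have c: "i \<in> carrier R" "j \<in> carrier R" "r \<in> carrier R" "s \<in> carrier R"
    using * ideal_carr[OF L(1)] ideal_carr[OF assms(2)] by auto
   have "a \<oplus> b = (i \<oplus> j) \<oplus> (r \<oplus> s) \<otimes> y" unfolding * using c assms(3) by algebra
   thus "a \<oplus> b \<in> ?T" using * ideal_add[OF L(1)] ideal_add[OF assms(2)] by blast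
  next
   fix a t assume "a \<in> ?T" and t: "t \<in> carrier R"
   then obtain i r where *: "a = i \<oplus> r \<otimes> y" "i \<in> I" "r \<in> L" by blast
   have c: "i \<in> carrier R" "r \<in> carrier R" using * ideal_carr[OF L(1)] ideal_carr[OF assms(2)] by auto
   have "t \<otimes> a = t \<otimes> i \<oplus> (t \<otimes> r) \<otimes> y" unfolding * using c t assms(3) by algebra
   thus "t \<otimes> a \<in> ?T" using * t ideal_mult[OF L(1)] ideal_mult[OF assms(2)] by blast
  qed
  moreover have "I <= ?T"
  proof
   fix x assume x: "x \<in> I"
   hence "x = x \<oplus> \<zero> \<otimes> y" using assms ideal_carr by auto
   thus "x \<in> ?T" using x ideal_zero[OF L(1)] by blast
  qed
  moreover have "?T <= ?K"
   using K ideal_add[OF K(1)] ideal_mult[OF K(1)] ideal_carr[OF L(1)] by (auto simp: subset_iff)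
  ultimately show "ideal ?T R \<and> I <= ?T \<and> ?T <= ?K" by blast
 next
  fix L M assume LM: "ideal L R" "ideal M R" "colon I y <= L" "L \<subset> M" "M <= carrier R"
  then obtain r where r: "r \<in> M" "r \<notin> L" by blast
  have rc: "r \<in> carrier R" using r LM by blast
  have "r \<otimes> y = \<zero> \<oplus> r \<otimes> y" using rc assms(3) by simp
  hence "r \<otimes> y \<in> {i \<oplus> r \<otimes> y | i r. i \<in> I \<and> r \<in> M}" using ideal_zero[OF assms(2)] r by blast
  moreover have "r \<otimes> y \<notin> {i \<oplus> r \<otimes> y | i r. i \<in> I \<and> r \<in> L}"
  proof
   assume "r \<otimes> y \<in> {i \<oplus> r \<otimes> y | i r. i \<in> I \<and> r \<in> L}"
   then obtain i s where is_: "r \<otimes> y = i \<oplus> s \<otimes> y" "i \<in> I" "s \<in> L" by blast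
   have c: "i \<in> carrier R" "s \<in> carrier R" using is_ ideal_carr[OF LM(1)] ideal_carr[OF assms(2)] by auto
   have "(r \<ominus> s) \<otimes> y = r \<otimes> y \<ominus> s \<otimes> y" using rc c assms(3) by algebra
   also have "\<dots> = i" unfolding is_ using c assms(3) by algebra
   finally have "r \<ominus> s \<in> L" using is_ LM(3) rc c by (auto simp: colon_def)
   thus False using ideal_minus_cancel[OF LM(1) is_(3) rc] r by blast
  qed
  ultimately show "{i \<oplus> r \<otimes> y | i r. i \<in> I \<and> r \<in> L} \<subset> {i \<oplus> r \<otimes> y | i r. i \<in> I \<and> r \<in> M}"
   using LM(4) by blast
 qed
 ultimately show ?thesis using fIK(2) by simp
qed

text \<open>The filtration of R/I by the powers of y: its i-th layer is isomorphic to R/((y) + (I :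
  y^i)). The previous lemma is applied to I, then to I : y, and so on, until 1 is reached.\<close>

lemma colen_layers:
 assumes "fincolen I" "ideal I R" "y \<in> carrier R" "y [^] (k::nat) \<in> I"
 shows "colen I = (\<Sum>i<k. colen (Idl (insert y (colon I (y [^] i)))))"
 using assms
proof (induction k arbitrary: I)
 case 0
 thus ?case using ideal_one colen_carrier by simp
next
 case (Suc k)
 have C: "ideal (colon I y) R" "fincolen (colon I y)"
  using colon_ideal[OF Suc(3,4)] fincolen_mono[OF Suc(2) colon_sup[OF Suc(3,4)]] by auto
 have "colon (colon I y) (y [^] i) = colon I (y [^] Suc i)" for i :: nat
  using Suc(4) by (auto simp: colon_def m_assoc)
 moreover have "y [^] k \<in> colon I y" using Suc by (simp add: colon_def)
 ultimately have "colen (colon I y) = (\<Sum>i<k. colen (Idl (insert y (colon I (y [^] Suc i)))))"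
  using Suc.IH[OF C(2,1) Suc(4)] by simp
 moreover have "colon I (y [^] (0::nat)) = I" using ideal_carr[OF Suc(3)] by (auto simp: colon_def)
 ultimately show ?case
  using colen_colon[OF Suc(2,3,4)] by (simp add: sum.lessThan_Suc_shift del: nat_pow_Suc sum.lessThan_Suc)
qed

end

section \<open>Colengths of ideals primary to the maximal ideal\<close>

context nlocal
begin

text \<open>Noetherian induction. An associated prime \<open>colon I u\<close> contains m, so
  nothing lies strictly between I and I + (u): passing to the larger ideal costs one step, and the
  larger ideal has finite colength by induction.\<close>

lemma mprim_fincolen:
 assumes "ideal I R" "mprim I"
 shows "fincolen I"
 using assms
proof (induction rule: noeth_induct)
 case (step I)
 show ?case
 proof (cases "\<one> \<in> I")
  case True
  hence I: "I = carrier R" using ideal_one step(1) by blast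
  have "n = 0" if n: "ichain I (carrier R) n" for n
  proof (rule ccontr)
   assume "n \<noteq> 0"
   moreover obtain f where f: "I <= f 0" "f n <= carrier R" "\<forall>i\<le>n. ideal (f i) R" "\<forall>i<n. f i \<subset> f (Suc i)"
    using n by (rule ichainE)
   ultimately have "f 0 \<subset> f (Suc 0)" "ideal (f (Suc 0)) R" by auto
   thus False using f(1) I ideal_sub by blast
  qed
  thus ?thesis unfolding finlen_def by blast
 next
  case False
  obtain u where u: "u \<in> carrier R" "u \<notin> I" "primeideal (colon I u) R"
   by (rule associated_prime_above[OF step(1) one_closed False], rule that, assumption+)
  have "m <= colon I u"
  proof
   fix a assume a: "a \<in> m"
   then obtain n :: nat where "a [^] n \<in> I" using step(3) unfolding mprim_def by blast
   hence "a [^] n \<in> colon I u" using colon_sup[OF step(1) u(1)] by blast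
   thus "a \<in> colon I u" using prime_pow[OF u(3)] a m_carr by blast
  qed
  hence mu: "a \<otimes> u \<in> I" if "a \<in> m" for a using that by (auto simp: colon_def)
  let ?K = "Idl (insert u I)"
  have S: "insert u I <= carrier R" using u ideal_sub[OF step(1)] by blast
  have K: "ideal ?K R" "I <= ?K" "u \<in> ?K" using genideal_ideal[OF S] genideal_self[OF S] by auto
  hence "I \<subset> ?K" using u(2) by blast
  hence fK: "fincolen ?K" using step(2)[OF K(1)] mprim_mono[OF step(3) K(2)] by blast
  have between: "L = ?K" if L: "ideal L R" "I \<subset> L" "L <= ?K" for L
  proof -
   obtain x where x: "x \<in> L" "x \<notin> I" using L by blast
   obtain i r where ir: "i \<in> I" "r \<in> carrier R" "x = i \<oplus> r \<otimes> u"
    using x L(3) ideal_sub[OF step(1)] u(1) Idl_ideal[OF step(1)] by (metis Idl_insertE subsetD)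
   have ic: "i \<in> carrier R" using ir step(1) ideal_carr by blast
   have "r \<otimes> u \<oplus> i \<in> L" using x ir ic u(1) by (simp add: a_comm)
   hence ru: "r \<otimes> u \<in> L" using ideal_add_cancel[OF L(1)] ir L u(1) by blast
   have "r \<notin> m" using x(2) ir mu ideal_add[OF step(1)] by blast
   then obtain b where b: "b \<in> carrier R" "b \<otimes> r = \<one>" using unit_inverse ir(2) by blast
   have "b \<otimes> (r \<otimes> u) = u" using b ir u(1) by (simp flip: m_assoc)
   hence "u \<in> L" using ideal_mult[OF L(1) ru b(1)] by simp
   hence "?K <= L" using L by (intro Idl_subI) auto
   thus ?thesis using L(3) by blast
  qed
  have "n \<le> 1" if n: "ichain I ?K n" for n
  proof (rule ccontr)
   assume "\<not> n \<le> 1"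
   moreover obtain f where f: "I <= f 0" "f n <= ?K" "\<forall>i\<le>n. ideal (f i) R" "\<forall>i<n. f i \<subset> f (Suc i)"
    using n by (rule ichainE)
   ultimately have *: "f 0 \<subset> f 1" "f 1 \<subset> f 2" "ideal (f 1) R" "ideal (f 2) R"
    by (auto simp: numeral_2_eq_2)
   have "f 2 <= f n"
   proof -
    have "f 2 <= f (2 + k)" if "2 + k \<le> n" for k using that
    proof (induction k)
     case (Suc k)
     have "f (2 + k) \<subset> f (Suc (2 + k))" using f(4) Suc(2) by simp
     thus ?case using Suc by auto
    qed simp
    moreover have "2 + (n - 2) = n" using \<open>\<not> n \<le> 1\<close> by simp
    ultimately show ?thesis by (metis order_refl)
   qed
   hence "f 1 = ?K" "f 2 = ?K" using between[of "f 1"] between[of "f 2"] * f(1,2) by auto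
   thus False using * by blast
  qed
  hence "finlen I ?K" unfolding finlen_def by blast
  thus ?thesis using len_add(1)[OF _ fK step(1) K(1) oneideal K(2) ideal_sub[OF K(1)]] by blast
 qed
qed

lemma mprim_lim:
 assumes "ideal c R" "set xs <= carrier R" "mprim (Idl (c \<union> set xs))"
 shows "mprim (lim c xs)" "fincolen (lim c xs)"
proof -
 show "mprim (lim c xs)" using mprim_mono[OF assms(3) lim_sup[OF assms(1,2)]] .
 thus "fincolen (lim c xs)" using mprim_fincolen lim_ideal assms by blast
qed

text \<open>Slice R/lim(a^(kn), ...) by powers of y = a^n. By the cancellation property the i-th
  layer maps onto R/lim(a^n, ...), so each of the k layers is at least that long. The second
  inequality keeps layer 0 exactly; it will bound the ideal generated by y^q and lim(y^(pq), ...)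
  that carries the error.\<close>

lemma colen_lim_shift:
 assumes c: "ideal c R" "set as <= carrier R" "a \<in> carrier R" "n > 0" "k > 0"
  and prim: "mprim (Idl (c \<union> set (a [^] (k * n) # as)))"
 shows "k * colen (lim c (a [^] n # as)) \<le> colen (lim c (a [^] (k * n) # as))"
  and "colen (Idl (insert (a [^] n) (lim c (a [^] (k * n) # as)))) + (k - 1) * colen (lim c (a [^] n # as))
   \<le> colen (lim c (a [^] (k * n) # as))"
proof -
 let ?I = "lim c (a [^] (k * n) # as)" and ?L = "lim c (a [^] n # as)" and ?y = "a [^] n"
 have cs: "set (a [^] (k * n) # as) <= carrier R" "set (a [^] n # as) <= carrier R" using c by auto
 have I: "ideal ?I R" "fincolen ?I" using lim_ideal[OF c(1) cs(1)] mprim_lim(2)[OF c(1) cs(1) prim] by auto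
 have L: "ideal ?L R" using lim_ideal[OF c(1) cs(2)] .
 have y: "?y \<in> carrier R" using c by simp
 have IS: "Idl (c \<union> set (a [^] (j::nat) # as)) <= lim c (a [^] j # as)" for j
  using lim_sup[OF c(1), of "a [^] j # as"] c by auto
 have mem: "a [^] (j::nat) \<in> lim c (a [^] j # as)" for j
  using IS[of j] Idl_mem[of "a [^] j" "c \<union> set (a [^] j # as)"] c ideal_sub[OF c(1)] by auto
 have "?y [^] k \<in> ?I" using mem[of "k * n"] c by (simp add: nat_pow_pow mult.commute)
 from colen_layers[OF I(2,1) y this]
 have eq: "colen ?I = (\<Sum>i<k. colen (Idl (insert ?y (colon ?I (?y [^] i)))))" .
 have layer: "colen ?L \<le> colen (Idl (insert ?y (colon ?I (?y [^] i))))" if i: "i < k" for i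
 proof (rule colen_mono[OF _ L])
  have S: "insert ?y (colon ?I (?y [^] i)) <= carrier R" using y by (auto simp: colon_def)
  have "?I <= Idl (insert ?y (colon ?I (?y [^] i)))"
   using colon_sup[OF I(1), of "?y [^] i"] y genideal_self[OF S] by auto
  thus "fincolen (Idl (insert ?y (colon ?I (?y [^] i))))" using fincolen_mono[OF I(2)] by blast
  have "colon ?I (?y [^] i) <= ?L"
  proof
   fix r assume "r \<in> colon ?I (?y [^] i)"
   hence r: "r \<in> carrier R" "r \<otimes> a [^] (n * i) \<in> lim c (a [^] (k * n) # as)"
    using c by (auto simp: colon_def nat_pow_pow)
   have "n * i + n \<le> k * n" using i by (metis Suc_leI add.commute mult.commute mult_Suc_right mult_le_mono2)
   hence kn: "k * n = (k * n - n * i) + n * i" "n \<le> k * n - n * i" by auto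
   have "r \<in> lim c (a [^] (k * n - n * i) # as)"
   proof (rule iffD1[OF lim_shift[OF c(1-3) _ r(1), of "k * n - n * i" "n * i"]])
    show "0 < k * n - n * i" using kn(2) c(4) by linarith
    show "r \<otimes> a [^] (n * i) \<in> lim c (a [^] (k * n - n * i + n * i) # as)" using r(2) kn(1) by metis
   qed
   thus "r \<in> ?L" using lim_Cons_mono[OF c(1-4) kn(2)] by blast
  qed
  thus "Idl (insert ?y (colon ?I (?y [^] i))) <= ?L" using mem[of n] L by (intro Idl_subI) auto
 qed
 have "(\<Sum>i<k. colen ?L) \<le> colen ?I" unfolding eq by (rule sum_mono) (use layer in auto)
 thus "k * colen ?L \<le> colen ?I" by simp
 obtain k' where k': "k = Suc k'" using c(5) gr0_conv_Suc by blast
 have "colon ?I (?y [^] (0::nat)) = ?I" using ideal_carr[OF I(1)] by (auto simp: colon_def)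
 moreover have "(\<Sum>i<k. colen (Idl (insert ?y (colon ?I (?y [^] i))))) =
   colen (Idl (insert ?y (colon ?I (?y [^] (0::nat))))) + (\<Sum>i<k'. colen (Idl (insert ?y (colon ?I (?y [^] Suc i)))))"
  unfolding k' by (rule sum.lessThan_Suc_shift)
 ultimately have "colen ?I = colen (Idl (insert ?y ?I)) + (\<Sum>i<k'. colen (Idl (insert ?y (colon ?I (?y [^] Suc i)))))"
  using eq by metis
 moreover have "(\<Sum>i<k'. colen ?L) \<le> (\<Sum>i<k'. colen (Idl (insert ?y (colon ?I (?y [^] Suc i)))))"
 proof (rule sum_mono)
  fix i assume "i \<in> {..<k'}"
  hence "Suc i < k" using k' by simp
  thus "colen ?L \<le> colen (Idl (insert ?y (colon ?I (?y [^] Suc i))))" by (rule layer)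
 qed
 ultimately show "colen (Idl (insert ?y ?I)) + (k - 1) * colen ?L \<le> colen ?I" using k' by simp
qed

text \<open>Slicing along each parameter gives k^d layers, each a quotient of R/(c, zs). If the
  monomial with all exponents k - 1 already lies in the ideal, the layer belonging to it vanishes,
  which lowers the number of layers by one. This single missing layer is the source of all later
  strict decay.\<close>

lemma colen_power_list:
 assumes "ideal c R" "set zs <= carrier R" "mprim (Idl (c \<union> set zs))" "k > 0"
 shows "mprim (Idl (c \<union> set (pw k zs)))"
  and "colen (Idl (c \<union> set (pw k zs))) \<le> k ^ length zs * colen (Idl (c \<union> set zs))"
  and "lprod (pw (k - 1) zs) \<in> Idl (c \<union> set (pw k zs)) ==>
   colen (Idl (c \<union> set (pw k zs))) \<le> (k ^ length zs - 1) * colen (Idl (c \<union> set zs))"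
proof -
 have A: "mprim (Idl (c \<union> set (pw k zs))) \<and>
   colen (Idl (c \<union> set (pw k zs))) \<le> k ^ length zs * colen (Idl (c \<union> set zs)) \<and>
   (lprod (pw (k - 1) zs) \<in> Idl (c \<union> set (pw k zs)) -->
   colen (Idl (c \<union> set (pw k zs))) \<le> (k ^ length zs - 1) * colen (Idl (c \<union> set zs)))"
  using assms(1-3)
 proof (induction zs arbitrary: c)
  case Nil
  thus ?case using ideal_one[of "Idl c"] colen_carrier Idl_ideal by auto
 next
  case (Cons z zs)
  have z: "z \<in> carrier R" "set zs <= carrier R" "c <= carrier R" using Cons ideal_sub by auto
  let ?I = "Idl (c \<union> set (pw k (z # zs)))" and ?c = "Idl (insert z c)"
  have IS: "c \<union> set (pw k (z # zs)) <= carrier R" using z pw_carr[of "z # zs" k] by auto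
  have I: "ideal ?I R" using IS by (rule genideal_ideal)
  have memI: "x \<in> ?I" if "x \<in> c \<union> set (pw k (z # zs))" for x using that IS by (rule Idl_mem)
  have zc: "insert z c <= carrier R" using z by auto
  have c': "ideal ?c R" using genideal_ideal[OF zc] .
  have eq: "Idl (?c \<union> S) = Idl (insert z c \<union> S)" if "S <= carrier R" for S
   using Idl_Un_Idl[OF zc that] .
  have prim': "mprim (Idl (?c \<union> set zs))" using Cons(4) eq[OF z(2)] by simp
  note IH = Cons.IH[OF c' z(2) prim']
  have eqn: "colen (Idl (?c \<union> set zs)) = colen (Idl (c \<union> set (z # zs)))" using eq[OF z(2)] by simp
  have primI: "mprim ?I" unfolding mprim_def
  proof
   fix a assume a: "a \<in> m"
   have ac: "a \<in> carrier R" using a m_carr by blast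
   obtain n :: nat where n: "a [^] n \<in> Idl (?c \<union> set (pw k zs))"
    using conjunct1[OF IH] a unfolding mprim_def by (elim ballE[of _ _ a] exE) auto
   hence "a [^] n \<in> Idl (insert z (c \<union> set (pw k zs)))" using eq[OF pw_carr[OF z(2), of k]] by simp
   then obtain r where r: "r \<in> carrier R" "a [^] n \<ominus> r \<otimes> z \<in> Idl (c \<union> set (pw k zs))"
    using Idl_insertE'[of "a [^] n" z "c \<union> set (pw k zs)"] IS z by auto
   have "Idl (c \<union> set (pw k zs)) <= ?I" using IS by (intro Idl_mono) auto
   hence w: "a [^] n \<ominus> r \<otimes> z \<in> ?I" using r(2) by blast
   have "(a [^] n) [^] j \<ominus> (r \<otimes> z) [^] j \<in> ?I" for j :: nat
   proof (induction j)
    case 0 thus ?case using ideal_zero[OF I] by (simp add: minus_eq r_neg)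
   next
    case (Suc j)
    let ?A = "a [^] n" and ?B = "r \<otimes> z"
    have AB: "?A \<in> carrier R" "?B \<in> carrier R" using ac r z by auto
    have "?A [^] Suc j \<ominus> ?B [^] Suc j = ?A \<otimes> (?A [^] j \<ominus> ?B [^] j) \<oplus> ?B [^] j \<otimes> (?A \<ominus> ?B)"
     unfolding nat_pow_Suc using AB nat_pow_closed[OF AB(1), of j] nat_pow_closed[OF AB(2), of j] by algebra
    thus ?case using Suc w AB ideal_add[OF I] ideal_mult[OF I] by simp
   qed
   from this[of k] have 1: "(a [^] n) [^] k \<ominus> (r \<otimes> z) [^] k \<in> ?I" .
   have "(r \<otimes> z) [^] k = r [^] k \<otimes> z [^] k" using r z by (simp add: nat_pow_distrib)
   hence 2: "(r \<otimes> z) [^] k \<in> ?I" using memI[of "z [^] k"] ideal_mult[OF I] r by simp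
   have "(a [^] n) [^] k \<in> ?I" by (rule ideal_minus_cancel[OF I 2 _ 1]) (use ac in simp)
   hence "a [^] (n * k) \<in> ?I" using ac by (simp add: nat_pow_pow)
   thus "\<exists>n::nat. a [^] n \<in> ?I" by blast
  qed
  have fI: "fincolen ?I" using mprim_fincolen[OF I primI] .
  let ?C = "%i::nat. Idl (insert z (colon ?I (z [^] i)))"
  have CS: "insert z (colon ?I (z [^] i)) <= carrier R" for i :: nat using z by (auto simp: colon_def)
  have C: "ideal (?C i) R" for i using CS by (rule genideal_ideal)
  have Isub: "?I <= ?C i" for i
   using colon_sup[OF I, of "z [^] i"] z genideal_self[OF CS, of i] by auto
  have zC: "z \<in> ?C i" for i using Idl_mem[OF _ CS] by blast
  have sub: "Idl (?c \<union> set (pw k zs)) <= ?C i" for i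
  proof -
   have "insert z c \<union> set (pw k zs) <= ?C i" using zC Isub memI by auto
   thus ?thesis using eq[OF pw_carr[OF z(2), of k]] C[of i] Idl_subI by simp
  qed
  have fsub: "fincolen (Idl (?c \<union> set (pw k zs)))"
   using IH mprim_fincolen genideal_ideal c' ideal_sub[OF c'] pw_carr[OF z(2)] by (meson Un_least)
  have le: "colen (?C i) \<le> k ^ length zs * colen (Idl (c \<union> set (z # zs)))" for i
  proof -
   have "colen (?C i) \<le> colen (Idl (?c \<union> set (pw k zs)))" by (rule colen_mono[OF fsub C sub])
   thus ?thesis using IH eqn by simp
  qed
  have zk: "z [^] k \<in> ?I" using memI[of "z [^] k"] by simp
  note layers = colen_layers[OF fI I z(1) zk]
  have 1: "colen ?I \<le> k ^ length (z # zs) * colen (Idl (c \<union> set (z # zs)))"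
  proof -
   have "colen ?I \<le> (\<Sum>i<k. k ^ length zs * colen (Idl (c \<union> set (z # zs))))"
    unfolding layers by (rule sum_mono) (rule le)
   thus ?thesis by simp
  qed
  have 2: "colen ?I \<le> (k ^ length (z # zs) - 1) * colen (Idl (c \<union> set (z # zs)))"
   if top: "lprod (pw (k - 1) (z # zs)) \<in> ?I"
  proof -
   \<comment> \<open>The last layer contains the product of the (k-1)-st powers of the remaining
     parameters, so the sharper bound applies to it by induction with that layer as base ideal; the
     other k - 1 layers receive the plain bound.\<close>
   obtain k' where k': "k = Suc k'" using assms(4) gr0_conv_Suc by blast
   have P: "lprod (pw k' zs) \<in> carrier R" using z by simp
   have "lprod (pw k' zs) \<otimes> z [^] k' \<in> ?I" using top k' P z by (simp add: m_comm)
   hence "lprod (pw k' zs) \<in> colon ?I (z [^] k')" using P by (simp add: colon_def)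
   hence t: "lprod (pw (k - 1) zs) \<in> ?C k'" using Idl_mem[OF _ CS] k' by auto
   have "set (pw k zs) <= ?C k'" using Isub memI by auto
   hence abs: "Idl (?C k' \<union> set (pw k zs)) = ?C k'" using Idl_ideal[OF C] by (simp add: Un_absorb2)
   have subz: "Idl (?c \<union> set zs) <= Idl (?C k' \<union> set zs)"
   proof (rule Idl_mono)
    have "?c <= Idl (?c \<union> set (pw k zs))"
     using genideal_self[of "?c \<union> set (pw k zs)"] ideal_sub[OF c'] pw_carr[OF z(2)] by blast
    thus "?c \<union> set zs <= ?C k' \<union> set zs" using sub by blast
    show "?C k' \<union> set zs <= carrier R" using ideal_sub[OF C] z by blast
   qed
   have I2: "ideal (Idl (?C k' \<union> set zs)) R" using ideal_sub[OF C] z by (intro genideal_ideal) auto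
   have "colen (?C k') \<le> (k ^ length zs - 1) * colen (Idl (?C k' \<union> set zs))"
    using Cons.IH[OF C z(2) mprim_mono[OF prim' subz]] t abs by simp
   also have "colen (Idl (?C k' \<union> set zs)) \<le> colen (Idl (?c \<union> set zs))"
    by (rule colen_mono[OF mprim_fincolen[OF _ prim'] I2 subz])
      (use ideal_sub[OF c'] z in \<open>auto intro: genideal_ideal\<close>)
   finally have last: "colen (?C k') \<le> (k ^ length zs - 1) * colen (Idl (c \<union> set (z # zs)))"
    using eqn by simp
   let ?w = "colen (Idl (c \<union> set (z # zs)))"
   have "(\<Sum>i<k. colen (?C i)) = (\<Sum>i<k'. colen (?C i)) + colen (?C k')" unfolding k' by (rule sum.lessThan_Suc)
   hence "colen ?I = (\<Sum>i<k'. colen (?C i)) + colen (?C k')" using layers by metis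
   also have "\<dots> \<le> (\<Sum>i<k'. k ^ length zs * ?w) + (k ^ length zs - 1) * ?w"
    by (intro add_mono sum_mono le last)
   also have "\<dots> = (k' * k ^ length zs + (k ^ length zs - 1)) * ?w"
    by (simp add: algebra_simps)
   also have "k' * k ^ length zs + (k ^ length zs - 1) = k ^ length (z # zs) - 1"
    using k' by simp
   finally show ?thesis .
  qed
  show ?case using primI 1 2 by blast
 qed
 show "mprim (Idl (c \<union> set (pw k zs)))"
  and "colen (Idl (c \<union> set (pw k zs))) \<le> k ^ length zs * colen (Idl (c \<union> set zs))"
  and "lprod (pw (k - 1) zs) \<in> Idl (c \<union> set (pw k zs)) ==>
   colen (Idl (c \<union> set (pw k zs))) \<le> (k ^ length zs - 1) * colen (Idl (c \<union> set zs))"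
  using A by blast+
qed

end

section \<open>The Artin--Rees lemma\<close>

context cring
begin

text \<open>\<open>mp gs n\<close> is the \<open>n\<close>-th power of the ideal generated by \<open>gs\<close>; the families \<open>A\<close> with
 \<open>gmod S A\<close> are the homogeneous ideals of the Rees algebra $\bigoplus_n S_n$.\<close>

fun mp :: "'a list => nat => 'a set" where
 "mp [] 0 = carrier R"
| "mp [] (Suc n) = {\<zero>}"
| "mp (g # gs) 0 = carrier R"
| "mp (g # gs) (Suc n) = {s \<oplus> g \<otimes> t | s t. s \<in> mp gs (Suc n) \<and> t \<in> mp (g # gs) n}"

definition gmod :: "(nat => 'a set) => (nat => 'a set) => bool"
 where "gmod S A \<longleftrightarrow> (\<forall>n. A n <= S n \<and> \<zero> \<in> A n \<and> (\<forall>a\<in>A n. \<forall>b\<in>A n. a \<oplus> b \<in> A n)) \<and>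
  (\<forall>i n. \<forall>s\<in>S i. \<forall>a\<in>A n. s \<otimes> a \<in> A (i + n))"

text \<open>The degree n part of the homogeneous ideal generated by G. A generator is a pair (d, f),
  since the same ring element can occur in several degrees of the Rees algebra.\<close>

inductive_set gspan :: "(nat => 'a set) => (nat \<times> 'a) set => nat => 'a set"
 for S :: "nat => 'a set" and G :: "(nat \<times> 'a) set" and n :: nat where
 zero: "\<zero> \<in> gspan S G n"
| step: "x \<in> gspan S G n ==> (d, f) \<in> G ==> d \<le> n ==> c \<in> S (n - d) ==> x \<oplus> c \<otimes> f \<in> gspan S G n"

definition gnoeth :: "(nat => 'a set) => bool"
 where "gnoeth S \<longleftrightarrow> (\<forall>A. gmod S A -->
  (\<exists>G. finite G \<and> (\<forall>(d, f)\<in>G. f \<in> A d) \<and> (\<forall>n. A n <= gspan S G n)))"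

lemma gmodD:
 assumes "gmod S A"
 shows "A n <= S n" "\<zero> \<in> A n" "a \<in> A n ==> b \<in> A n ==> a \<oplus> b \<in> A n" "s \<in> S i ==> a \<in> A n ==> s \<otimes> a \<in> A (i + n)"
 using assms unfolding gmod_def by blast+

lemma mp_ideal: "set gs <= carrier R ==> ideal (mp gs n) R"
proof (induction gs n rule: mp.induct)
 case (4 g gs n)
 have g: "g \<in> carrier R" using 4 by simp
 have A: "ideal (mp gs (Suc n)) R" "ideal (mp (g # gs) n) R" using 4 by auto
 show ?case
 proof (rule ideal_intro)
  show "mp (g # gs) (Suc n) <= carrier R" using ideal_carr[OF A(1)] ideal_carr[OF A(2)] g by auto
  have "\<zero> = \<zero> \<oplus> g \<otimes> \<zero>" using g by simp
  thus "\<zero> \<in> mp (g # gs) (Suc n)" using ideal_zero[OF A(1)] ideal_zero[OF A(2)] by (simp, blast)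
 next
  fix a b assume "a \<in> mp (g # gs) (Suc n)" "b \<in> mp (g # gs) (Suc n)"
  then obtain s t u v where *: "a = s \<oplus> g \<otimes> t" "b = u \<oplus> g \<otimes> v" "s \<in> mp gs (Suc n)" "u \<in> mp gs (Suc n)"
   "t \<in> mp (g # gs) n" "v \<in> mp (g # gs) n" by auto
  have c: "s \<in> carrier R" "t \<in> carrier R" "u \<in> carrier R" "v \<in> carrier R"
   using * ideal_carr[OF A(1)] ideal_carr[OF A(2)] by auto
  have "a \<oplus> b = (s \<oplus> u) \<oplus> g \<otimes> (t \<oplus> v)" unfolding * using c g by algebra
  thus "a \<oplus> b \<in> mp (g # gs) (Suc n)" using ideal_add[OF A(1) *(3,4)] ideal_add[OF A(2) *(5,6)] by (simp, blast)
 next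
  fix a r assume "a \<in> mp (g # gs) (Suc n)" and r: "r \<in> carrier R"
  then obtain s t where *: "a = s \<oplus> g \<otimes> t" "s \<in> mp gs (Suc n)" "t \<in> mp (g # gs) n" by auto
  have c: "s \<in> carrier R" "t \<in> carrier R" using * ideal_carr[OF A(1)] ideal_carr[OF A(2)] by auto
  have "r \<otimes> a = r \<otimes> s \<oplus> g \<otimes> (r \<otimes> t)" unfolding * using c g r by algebra
  thus "r \<otimes> a \<in> mp (g # gs) (Suc n)" using ideal_mult[OF A(1) *(2) r] ideal_mult[OF A(2) *(3) r] by (simp, blast)
 qed
qed (auto intro: oneideal zeroideal)

lemma mp_0: "mp gs 0 = carrier R"
 by (cases gs) auto

lemma mp_Cons_sub: "set (g # gs) <= carrier R ==> mp gs n <= mp (g # gs) n"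
proof (cases n)
 case (Suc k)
 assume g: "set (g # gs) <= carrier R"
 show ?thesis
 proof
  fix x assume x: "x \<in> mp gs n"
  have "x = x \<oplus> g \<otimes> \<zero>" using x ideal_carr[OF mp_ideal] g by auto
  moreover have "\<zero> \<in> mp (g # gs) k" using ideal_zero[OF mp_ideal[OF g]] .
  ultimately show "x \<in> mp (g # gs) n" using x unfolding Suc by (simp, blast)
 qed
qed (simp add: mp_0)

lemma mp_mult_gen: "set (g # gs) <= carrier R ==> t \<in> mp (g # gs) n ==> g \<otimes> t \<in> mp (g # gs) (Suc n)"
proof -
 assume g: "set (g # gs) <= carrier R" and t: "t \<in> mp (g # gs) n"
 have "g \<otimes> t = \<zero> \<oplus> g \<otimes> t" using g t ideal_carr[OF mp_ideal[OF g]] by auto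
 moreover have "\<zero> \<in> mp gs (Suc n)" using ideal_zero[OF mp_ideal] g by auto
 ultimately show ?thesis using t by (simp, blast)
qed

lemma mp_mult: "set gs <= carrier R ==> a \<in> mp gs i ==> b \<in> mp gs j ==> a \<otimes> b \<in> mp gs (i + j)"
proof (induction gs i arbitrary: a b j rule: mp.induct)
 case 1 thus ?case using ideal_mult[OF mp_ideal] by auto
next
 case (2 n)
 have "b \<in> carrier R" using 2 ideal_carr[OF mp_ideal] by blast
 thus ?case using 2 by simp
next
 case (3 g gs) thus ?case using ideal_mult[OF mp_ideal] by auto
next
 case (4 g gs n)
 note prem = 4(3-5)
 have IH2: "x \<otimes> y \<in> mp (g # gs) (n + k)" if "x \<in> mp (g # gs) n" "y \<in> mp (g # gs) k" for x y k
  using 4(2) that prem(1) by blast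
 obtain s t where *: "a = s \<oplus> g \<otimes> t" "s \<in> mp gs (Suc n)" "t \<in> mp (g # gs) n" using prem by auto
 have g: "g \<in> carrier R" "set gs <= carrier R" using prem by auto
 note I = mp_ideal[OF prem(1)] and I' = mp_ideal[OF g(2)]
 have c: "s \<in> carrier R" "t \<in> carrier R" using * ideal_carr[OF I] ideal_carr[OF I'] by auto
 have bc: "b \<in> carrier R" using prem(3) ideal_carr[OF I] by blast
 have IH1: "x \<otimes> y \<in> mp gs (Suc n + k)" if "x \<in> mp gs (Suc n)" "y \<in> mp gs k" for x y k
  using 4(1) that g by blast
 have sb: "s \<otimes> y \<in> mp (g # gs) (Suc n + k)" if "y \<in> mp (g # gs) k" for y k using that
 proof (induction k arbitrary: y)
  case 0
  hence "y \<in> carrier R" by simp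
  hence "s \<otimes> y \<in> mp gs (Suc n)" using *(2) ideal_mult'[OF I'] by blast
  thus ?case using mp_Cons_sub[OF prem(1), of "Suc n"] by auto
 next
  case (Suc k)
  then obtain u v where uv: "y = u \<oplus> g \<otimes> v" "u \<in> mp gs (Suc k)" "v \<in> mp (g # gs) k" by auto
  have cc: "u \<in> carrier R" "v \<in> carrier R" using uv ideal_carr[OF I] ideal_carr[OF I'] by auto
  have "s \<otimes> y = s \<otimes> u \<oplus> g \<otimes> (s \<otimes> v)" unfolding uv using cc c g by algebra
  moreover have "s \<otimes> u \<in> mp (g # gs) (Suc n + Suc k)"
   using IH1[OF *(2) uv(2)] mp_Cons_sub[OF prem(1)] by blast
  moreover have "g \<otimes> (s \<otimes> v) \<in> mp (g # gs) (Suc n + Suc k)"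
   using mp_mult_gen[OF prem(1) Suc.IH[OF uv(3)]] by simp
  ultimately show ?case using ideal_add[OF I] by (simp only:)
 qed
 have "a \<otimes> b = s \<otimes> b \<oplus> g \<otimes> (t \<otimes> b)" unfolding * using c g bc by algebra
 moreover have "g \<otimes> (t \<otimes> b) \<in> mp (g # gs) (Suc n + j)"
  using mp_mult_gen[OF prem(1) IH2[OF *(3) prem(3)]] by simp
 ultimately show ?case using sb[OF prem(3)] ideal_add[OF I] by (simp only:)
qed

lemma mp_anti_Suc: "set gs <= carrier R ==> mp gs (Suc n) <= mp gs n"
proof (induction gs n rule: mp.induct)
 case (4 g gs n)
 show ?case
 proof
  fix x assume "x \<in> mp (g # gs) (Suc (Suc n))"
  then obtain s t where *: "x = s \<oplus> g \<otimes> t" "s \<in> mp gs (Suc (Suc n))" "t \<in> mp (g # gs) (Suc n)" by auto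
  have "s \<in> mp gs (Suc n)" "t \<in> mp (g # gs) n" using * 4 by auto
  thus "x \<in> mp (g # gs) (Suc n)" using * by (simp, blast)
 qed
next
 case (3 g gs)
 show ?case using ideal_sub[OF mp_ideal[OF 3], of "Suc 0"] by simp
qed (use ideal_sub[OF mp_ideal] in auto)

lemma mp_anti: "set gs <= carrier R ==> i \<le> j ==> mp gs j <= mp gs i"
 using lift_Suc_antimono_le[of "mp gs" i j] mp_anti_Suc by blast

lemma mp_1: "set gs <= carrier R ==> mp gs 1 = Idl (set gs)"
proof (induction gs)
 case Nil
 have "Idl {} <= {\<zero>}" by (rule genideal_minimal) (auto intro: zeroideal)
 moreover have "\<zero> \<in> Idl {}" using ideal_zero[OF genideal_ideal[of "{}"]] by simp
 ultimately show ?case by auto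
next
 case (Cons g gs)
 hence g: "set gs <= carrier R" "g \<in> carrier R" by auto
 have "mp (g # gs) 1 = {s \<oplus> g \<otimes> t | s t. s \<in> Idl (set gs) \<and> t \<in> carrier R}" using Cons g by simp
 also have "\<dots> = {s \<oplus> t \<otimes> g | s t. s \<in> Idl (set gs) \<and> t \<in> carrier R}"
  using g(2) by (metis (no_types, opaque_lifting) m_comm)
 finally show ?case using Idl_insert[OF g] by simp
qed

lemma mp_pow:
 assumes "set gs <= carrier R" "a \<in> mp gs 1"
 shows "a [^] n \<in> mp gs n"
proof (induction n)
 case 0 thus ?case by (simp add: mp_0)
next
 case (Suc n) thus ?case using mp_mult[OF assms(1) Suc assms(2)] by simp
qed

lemma gnoethE:
 assumes "gnoeth S" "gmod S A"
 obtains G where "finite G" "\<forall>(d, f)\<in>G. f \<in> A d" "\<forall>n. A n <= gspan S G n"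
 using assms unfolding gnoeth_def by metis

lemma gspan_carr:
 assumes "\<And>d f. (d, f) \<in> G ==> f \<in> carrier R" "\<And>n. S n <= carrier R" "x \<in> gspan S G n"
 shows "x \<in> carrier R"
 using assms(3)
proof (induction rule: gspan.induct)
 case (step x d f c)
 have "c \<in> carrier R" "f \<in> carrier R" using step assms(1,2) by blast+
 thus ?case using step by simp
qed simp

lemma gspan_sub:
 assumes "gmod S A" "\<And>d f. (d, f) \<in> G ==> f \<in> A d" "x \<in> gspan S G n"
 shows "x \<in> A n"
 using assms(3)
proof (induction rule: gspan.induct)
 case zero thus ?case by (rule gmodD(2)[OF assms(1)])
next
 case (step x d f c)
 have "c \<otimes> f \<in> A (n - d + d)" using step gmodD(4)[OF assms(1)] assms(2) by blast
 thus ?case using step gmodD(3)[OF assms(1)] by simp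
qed

lemma gspan_add:
 assumes "x \<in> gspan S G n" "y \<in> gspan S G n" "\<And>d f. (d, f) \<in> G ==> f \<in> carrier R" "\<And>n. S n <= carrier R"
 shows "x \<oplus> y \<in> gspan S G n"
 using assms(2)
proof (induction rule: gspan.induct)
 case zero thus ?case using assms gspan_carr[OF assms(3,4)] by simp
next
 case (step y d f c)
 have "x \<in> carrier R" "y \<in> carrier R"
  using gspan_carr[OF assms(3,4) assms(1)] gspan_carr[OF assms(3,4) step(1)] by simp_all
 moreover have "f \<in> carrier R" using assms(3) step(2) .
 moreover have "c \<in> carrier R" using assms(4) step(4) by (rule subsetD)
 ultimately have "x \<oplus> (y \<oplus> c \<otimes> f) = (x \<oplus> y) \<oplus> c \<otimes> f" by (simp add: a_assoc)
 thus ?case using gspan.step step by simp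
qed

text \<open>The union of the chain is again homogeneous, and its finitely many generators all appear
  at some stage I, which therefore works for all degrees n at once.\<close>

lemma gnoeth_acc:
 assumes "gnoeth S" "\<And>i::nat. gmod S (A i)" "\<And>i n. A i n <= A (Suc i) n"
 shows "\<exists>I. \<forall>i\<ge>I. \<forall>n. A i n = A I n"
proof -
 let ?U = "%n. \<Union>i. A i n"
 have up: "A i n <= A j n" if "i \<le> j" for i j n
  using that lift_Suc_mono_le[of "%i. A i n"] assms(3) by blast
 have "gmod S ?U" unfolding gmod_def
 proof (intro conjI allI ballI)
  show "?U n <= S n" for n using gmodD(1)[OF assms(2)] by blast
  show "\<zero> \<in> ?U n" for n using gmodD(2)[OF assms(2)] by blast
  fix n a b assume "a \<in> ?U n" "b \<in> ?U n"
  then obtain i j where "a \<in> A i n" "b \<in> A j n" by blast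
  hence "a \<in> A (max i j) n" "b \<in> A (max i j) n" using up[of i "max i j"] up[of j "max i j"] by auto
  thus "a \<oplus> b \<in> ?U n" using gmodD(3)[OF assms(2)] by blast
 next
  fix i n s a assume "s \<in> S i" "a \<in> ?U n"
  thus "s \<otimes> a \<in> ?U (i + n)" using gmodD(4)[OF assms(2)] by blast
 qed
 with assms(1) obtain G where G: "finite G" "\<forall>(d, f)\<in>G. f \<in> ?U d" "\<forall>n. ?U n <= gspan S G n"
  by (rule gnoethE)
 have "\<forall>x\<in>G. \<exists>i. snd x \<in> A i (fst x)" using G(2) by auto
 then obtain \<iota> where \<iota>: "\<forall>x\<in>G. snd x \<in> A (\<iota> x) (fst x)" by (rule bchoice[THEN exE])
 define I where "I = Max (insert 0 (\<iota> ` G))"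
 have "f \<in> A I d" if df: "(d, f) \<in> G" for d f
 proof -
  have "\<iota> (d, f) \<le> I" unfolding I_def using G(1) df by (intro Max_ge) auto
  thus ?thesis using \<iota> df up by fastforce
 qed
 hence "gspan S G n <= A I n" for n using gspan_sub[OF assms(2)] by blast
 hence "A i n <= A I n" for i n using G(3) by blast
 thus ?thesis using up by blast
qed

text \<open>The sums of s_j g^j over j < i with s_j in the (N-j)-th power of the ideal of
  \<open>gs\<close>: elements of degree N that can be written with degree below i in the new
  generator. Such expressions are not unique, so an element has no leading coefficient of its own,
  only an expression has.\<close>

fun lower :: "'a => 'a list => nat => nat => 'a set" where
 "lower g gs 0 N = {\<zero>}"
| "lower g gs (Suc i) N = {y \<oplus> s \<otimes> g [^] i | y s. y \<in> lower g gs i N \<and> (if i \<le> N then s \<in> mp gs (N - i) else s = \<zero>)}"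

lemma lower_closed:
 assumes g: "set (g # gs) <= carrier R"
 shows "lower g gs i N <= carrier R" "\<zero> \<in> lower g gs i N"
  "a \<in> lower g gs i N ==> b \<in> lower g gs i N ==> a \<oplus> b \<in> lower g gs i N"
  "c \<in> mp gs k ==> a \<in> lower g gs i N ==> c \<otimes> a \<in> lower g gs i (k + N)"
proof -
 have gc: "g \<in> carrier R" "set gs <= carrier R" using g by auto
 note I = mp_ideal[OF gc(2)]
 have sc: "s \<in> carrier R" if "if i \<le> N then s \<in> mp gs (N - i) else s = \<zero>" for s i N
  using that ideal_carr[OF I] by (auto split: if_splits)
 show 1: "lower g gs i N <= carrier R" for i
 proof (induction i)
  case (Suc i)
  show ?case
  proof
   fix x assume "x \<in> lower g gs (Suc i) N"
   then obtain y s where "x = y \<oplus> s \<otimes> g [^] i" "y \<in> lower g gs i N" "if i \<le> N then s \<in> mp gs (N - i) else s = \<zero>" by auto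
   thus "x \<in> carrier R" using Suc sc gc by (metis a_closed m_closed nat_pow_closed subsetD)
  qed
 qed simp
 show 2: "\<zero> \<in> lower g gs i N" for i
 proof (induction i)
  case (Suc i)
  have "\<zero> = \<zero> \<oplus> \<zero> \<otimes> g [^] i" using gc by simp
  moreover have "if i \<le> N then \<zero> \<in> mp gs (N - i) else \<zero> = \<zero>" using ideal_zero[OF I] by simp
  ultimately show ?case using Suc by (simp only: lower.simps) blast
 qed simp
 show "a \<in> lower g gs i N ==> b \<in> lower g gs i N ==> a \<oplus> b \<in> lower g gs i N" for a b
 proof (induction i arbitrary: a b)
  case (Suc i)
  obtain y s where a: "a = y \<oplus> s \<otimes> g [^] i" "y \<in> lower g gs i N" "if i \<le> N then s \<in> mp gs (N - i) else s = \<zero>"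
   using Suc(2) by auto
  obtain z t where b: "b = z \<oplus> t \<otimes> g [^] i" "z \<in> lower g gs i N" "if i \<le> N then t \<in> mp gs (N - i) else t = \<zero>"
   using Suc(3) by auto
  have "y \<in> carrier R" "z \<in> carrier R" using a(2) b(2) 1 by blast+
  hence "a \<oplus> b = (y \<oplus> z) \<oplus> (s \<oplus> t) \<otimes> g [^] i"
   unfolding a b using sc[OF a(3)] sc[OF b(3)] nat_pow_closed[OF gc(1), of i] by algebra
  moreover have "y \<oplus> z \<in> lower g gs i N" using Suc a b by blast
  moreover have "if i \<le> N then s \<oplus> t \<in> mp gs (N - i) else s \<oplus> t = \<zero>"
   using a(3) b(3) ideal_add[OF I] by (auto split: if_splits)
  ultimately show ?case by (simp only: lower.simps) blast
 qed simp
 show "c \<in> mp gs k ==> a \<in> lower g gs i N ==> c \<otimes> a \<in> lower g gs i (k + N)" for a c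
 proof (induction i arbitrary: a)
  case 0 thus ?case using ideal_carr[OF I] by auto
 next
  case (Suc i)
  have c: "c \<in> carrier R" using Suc(2) ideal_carr[OF I] by blast
  obtain y s where a: "a = y \<oplus> s \<otimes> g [^] i" "y \<in> lower g gs i N" "if i \<le> N then s \<in> mp gs (N - i) else s = \<zero>"
   using Suc(3) by auto
  have "y \<in> carrier R" using a(2) 1 by blast
  hence "c \<otimes> a = c \<otimes> y \<oplus> (c \<otimes> s) \<otimes> g [^] i"
   unfolding a using sc[OF a(3)] c nat_pow_closed[OF gc(1), of i] by algebra
  moreover have "c \<otimes> y \<in> lower g gs i (k + N)" using Suc a by blast
  moreover have "if i \<le> k + N then c \<otimes> s \<in> mp gs (k + N - i) else c \<otimes> s = \<zero>"
  proof (cases "i \<le> N")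
   case True
   hence "s \<in> mp gs (N - i)" using a(3) by simp
   hence "c \<otimes> s \<in> mp gs (k + (N - i))" by (rule mp_mult[OF gc(2) Suc(2)])
   moreover have "k + (N - i) = k + N - i" using True by simp
   ultimately have "c \<otimes> s \<in> mp gs (k + N - i)" by (simp only:)
   thus ?thesis using True by simp
  next
   case False
   hence "s = \<zero>" using a(3) by simp
   thus ?thesis using c ideal_zero[OF I] by simp
  qed
  ultimately show ?case by (simp only: lower.simps) blast
 qed
qed

lemma lower_shift:
 assumes g: "set (g # gs) <= carrier R"
 shows "a \<in> lower g gs i N ==> g \<otimes> a \<in> lower g gs (Suc i) (Suc N)"
proof (induction i arbitrary: a)
 case 0
 have "g \<in> carrier R" using g by simp
 hence "g \<otimes> a = \<zero>" using 0 by simp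
 thus ?case using lower_closed(2)[OF g, of "Suc 0" "Suc N"] by simp
next
 case (Suc i)
 have gc: "g \<in> carrier R" "set gs <= carrier R" using g by auto
 note I = mp_ideal[OF gc(2)]
 obtain y s where a: "a = y \<oplus> s \<otimes> g [^] i" "y \<in> lower g gs i N" "if i \<le> N then s \<in> mp gs (N - i) else s = \<zero>"
  using Suc(2) by auto
 have c: "y \<in> carrier R" "s \<in> carrier R" using a lower_closed(1)[OF g] ideal_carr[OF I] by (auto split: if_splits)
 have "g \<otimes> a = g \<otimes> y \<oplus> s \<otimes> (g [^] i \<otimes> g)" unfolding a using c gc nat_pow_closed[of g i] by algebra
 hence "g \<otimes> a = g \<otimes> y \<oplus> s \<otimes> g [^] Suc i" by simp
 moreover have "g \<otimes> y \<in> lower g gs (Suc i) (Suc N)" using Suc a by blast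
 moreover have "if Suc i \<le> Suc N then s \<in> mp gs (Suc N - Suc i) else s = \<zero>" using a by simp
 ultimately show ?case unfolding lower.simps(2)[of g gs "Suc i"] by blast
qed

lemma lower_Suc_sup:
 assumes g: "set (g # gs) <= carrier R"
 shows "lower g gs i N <= lower g gs (Suc i) N"
proof
 fix x assume x: "x \<in> lower g gs i N"
 have gc: "g \<in> carrier R" "set gs <= carrier R" using g by auto
 have "x \<in> carrier R" using x lower_closed(1)[OF g] by blast
 hence "x = x \<oplus> \<zero> \<otimes> g [^] i" using gc by simp
 moreover have "if i \<le> N then \<zero> \<in> mp gs (N - i) else \<zero> = \<zero>" using ideal_zero[OF mp_ideal[OF gc(2)]] by simp
 ultimately show "x \<in> lower g gs (Suc i) N" unfolding lower.simps(2) using x by blast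
qed

lemma mp_lower:
 assumes g: "set (g # gs) <= carrier R"
 shows "mp (g # gs) N <= lower g gs (Suc N) N"
proof (induction N)
 case 0
 have gc: "g \<in> carrier R" using g by simp
 show ?case
 proof
  fix x assume "x \<in> mp (g # gs) 0"
  hence "x \<in> carrier R" by simp
  hence "x = \<zero> \<oplus> x \<otimes> g [^] (0::nat)" by simp
  moreover have "x \<in> mp gs (0 - 0)" using \<open>x \<in> carrier R\<close> mp_0 by simp
  ultimately show "x \<in> lower g gs (Suc 0) 0" unfolding lower.simps by (simp only: if_True le_refl) blast
 qed
next
 case (Suc N)
 show ?case
 proof
  fix x assume "x \<in> mp (g # gs) (Suc N)"
  then obtain s t where *: "x = s \<oplus> g \<otimes> t" "s \<in> mp gs (Suc N)" "t \<in> mp (g # gs) N" by auto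
  have gc: "g \<in> carrier R" "set gs <= carrier R" using g by auto
  have "g \<otimes> t \<in> lower g gs (Suc (Suc N)) (Suc N)" using * Suc lower_shift[OF g] by blast
  moreover have "s \<in> lower g gs (Suc i) (Suc N)" for i
  proof (induction i)
   case 0
   have "s \<in> carrier R" using * ideal_carr[OF mp_ideal[OF gc(2)]] by blast
   hence "s = \<zero> \<oplus> s \<otimes> g [^] (0::nat)" by simp
   thus ?case unfolding lower.simps using *(2) by auto
  next
   case (Suc i) thus ?case using lower_Suc_sup[OF g] by blast
  qed
  ultimately show "x \<in> lower g gs (Suc (Suc N)) (Suc N)" unfolding *(1) using lower_closed(3)[OF g] by blast
 qed
qed

end

lemma (in noeth) gnoeth_mp_Nil: "gnoeth (mp [])"
 unfolding gnoeth_def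
proof (intro allI impI)
 fix A assume A: "gmod (mp []) A"
 have z: "A (Suc n) = {\<zero>}" for n using gmodD(1,2)[OF A, of "Suc n"] by auto
 have I: "ideal (A 0) R"
 proof (rule ideal_intro)
  show "A 0 <= carrier R" using gmodD(1)[OF A, of 0] by simp
  show "\<zero> \<in> A 0" by (rule gmodD(2)[OF A])
  show "a \<oplus> b \<in> A 0" if "a \<in> A 0" "b \<in> A 0" for a b using gmodD(3)[OF A that] .
  show "r \<otimes> a \<in> A 0" if "a \<in> A 0" "r \<in> carrier R" for a r using gmodD(4)[OF A, of r 0 a 0] that by simp
 qed
 obtain xs where xs: "set xs <= carrier R" "A 0 = Idl (set xs)" using ideal_fin_gen[OF I] by blast
 let ?G = "(%x. (0, x)) ` set xs"
 have Gc: "f \<in> carrier R" if "(d, f) \<in> ?G" for d f using that xs by auto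
 have Sc: "mp [] n <= carrier R" for n using ideal_sub[OF mp_ideal[of "[]"]] by simp
 have "ideal (gspan (mp []) ?G 0) R"
 proof (rule ideal_intro)
  show "gspan (mp []) ?G 0 <= carrier R" using gspan_carr[OF Gc Sc] by (rule subsetI)
  show "\<zero> \<in> gspan (mp []) ?G 0" by (rule gspan.zero)
  show "a \<oplus> b \<in> gspan (mp []) ?G 0" if "a \<in> gspan (mp []) ?G 0" "b \<in> gspan (mp []) ?G 0" for a b
   using gspan_add[OF that Gc Sc] .
  fix a r assume "a \<in> gspan (mp []) ?G 0" and r: "r \<in> carrier R"
  thus "r \<otimes> a \<in> gspan (mp []) ?G 0"
  proof (induction rule: gspan.induct)
   case zero thus ?case using r gspan.zero by simp
  next
   case (step x d f c)
   have c: "x \<in> carrier R" "c \<in> carrier R" "f \<in> carrier R"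
    using gspan_carr[OF Gc Sc step(1)] subsetD[OF Sc step(4)] Gc[OF step(2)] by simp_all
   have eq: "r \<otimes> (x \<oplus> c \<otimes> f) = r \<otimes> x \<oplus> (r \<otimes> c) \<otimes> f" using c r by algebra
   have m: "r \<otimes> c \<in> mp [] (0 - d)" using c r by simp
   have rx: "r \<otimes> x \<in> gspan (mp []) ?G 0" using step(5) r by blast
   show ?case using gspan.step[OF rx step(2,3) m] by (simp only: eq)
  qed
 qed
 moreover have "set xs <= gspan (mp []) ?G 0"
 proof
  fix x assume x: "x \<in> set xs"
  have "\<zero> \<oplus> \<one> \<otimes> x \<in> gspan (mp []) ?G 0"
   by (rule gspan.step[OF gspan.zero, of 0 x]) (use x in auto)
  thus "x \<in> gspan (mp []) ?G 0" using x xs by auto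
 qed
 ultimately have "A 0 <= gspan (mp []) ?G 0" unfolding xs(2) by (simp add: Idl_subI)
 moreover have "A (Suc n) <= gspan (mp []) ?G (Suc n)" for n using z gspan.zero by simp
 ultimately have "A n <= gspan (mp []) ?G n" for n by (cases n) auto
 moreover have "\<forall>(d, f)\<in>?G. f \<in> A d" using xs Idl_mem by auto
 ultimately show "\<exists>G. finite G \<and> (\<forall>(d, f)\<in>G. f \<in> A d) \<and> (\<forall>n. A n <= gspan (mp []) G n)"
  by (intro exI[of _ ?G]) auto
qed

text \<open>Hilbert's basis theorem for adjoining one generator to the Rees algebra, by leading coefficients.\<close>

lemma (in cring) gnoeth_mp_Cons:
 assumes g: "set (g # gs) <= carrier R" and N: "gnoeth (mp gs)"
 shows "gnoeth (mp (g # gs))"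
 unfolding gnoeth_def
proof (intro allI impI)
 have gc: "g \<in> carrier R" "set gs <= carrier R" using g by auto
 note I = mp_ideal[OF gc(2)] and I' = mp_ideal[OF g]
 fix A assume A: "gmod (mp (g # gs)) A"
 have Ac: "A n <= carrier R" for n using gmodD(1)[OF A] ideal_sub[OF I'] by blast
 \<comment> \<open>Coefficients of g^i, in degree n, of elements of \<open>A (n + i)\<close> written
   modulo lower powers of g. Multiplying by g shows that these families increase with i.\<close>
 define L where "L i n = {s \<in> mp gs n. \<exists>y\<in>lower g gs i (n + i). y \<oplus> s \<otimes> g [^] i \<in> A (n + i)}" for i n :: nat
 have Lg: "gmod (mp gs) (L i)" for i
  unfolding gmod_def
 proof (intro conjI allI ballI)
  show "L i n <= mp gs n" for n by (auto simp: L_def)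
  have "\<zero> \<oplus> \<zero> \<otimes> g [^] i \<in> A (n + i)" for n using gmodD(2)[OF A] gc by simp
  thus "\<zero> \<in> L i n" for n using ideal_zero[OF I] lower_closed(2)[OF g] unfolding L_def by blast
 next
  fix n a b assume "a \<in> L i n" "b \<in> L i n"
  then obtain y z where *: "a \<in> mp gs n" "b \<in> mp gs n" "y \<in> lower g gs i (n + i)" "z \<in> lower g gs i (n + i)"
   "y \<oplus> a \<otimes> g [^] i \<in> A (n + i)" "z \<oplus> b \<otimes> g [^] i \<in> A (n + i)" unfolding L_def by blast
  have c: "a \<in> carrier R" "b \<in> carrier R" "y \<in> carrier R" "z \<in> carrier R"
   using * ideal_carr[OF I] lower_closed(1)[OF g] by blast+
  have "(y \<oplus> z) \<oplus> (a \<oplus> b) \<otimes> g [^] i = (y \<oplus> a \<otimes> g [^] i) \<oplus> (z \<oplus> b \<otimes> g [^] i)"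
   using c gc nat_pow_closed[of g i] by algebra
  hence "(y \<oplus> z) \<oplus> (a \<oplus> b) \<otimes> g [^] i \<in> A (n + i)" using gmodD(3)[OF A *(5,6)] by simp
  thus "a \<oplus> b \<in> L i n" unfolding L_def
   using ideal_add[OF I *(1,2)] lower_closed(3)[OF g *(3,4)] by blast
 next
  fix k n s a assume s: "s \<in> mp gs k" and "a \<in> L i n"
  then obtain y where *: "a \<in> mp gs n" "y \<in> lower g gs i (n + i)" "y \<oplus> a \<otimes> g [^] i \<in> A (n + i)" unfolding L_def by blast
  have c: "a \<in> carrier R" "s \<in> carrier R" "y \<in> carrier R"
   using * s ideal_carr[OF I] lower_closed(1)[OF g] by blast+
  have "s \<in> mp (g # gs) k" using s mp_Cons_sub[OF g] by blast
  hence "s \<otimes> (y \<oplus> a \<otimes> g [^] i) \<in> A (k + (n + i))" using gmodD(4)[OF A] * by blast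
  moreover have "s \<otimes> (y \<oplus> a \<otimes> g [^] i) = s \<otimes> y \<oplus> (s \<otimes> a) \<otimes> g [^] i"
   using c gc nat_pow_closed[of g i] by algebra
  ultimately have "s \<otimes> y \<oplus> (s \<otimes> a) \<otimes> g [^] i \<in> A (k + n + i)" by (simp add: add.assoc)
  moreover have "s \<otimes> y \<in> lower g gs i (k + n + i)" using lower_closed(4)[OF g s *(2)] by (simp add: add.assoc)
  ultimately show "s \<otimes> a \<in> L i (k + n)" unfolding L_def using mp_mult[OF gc(2) s *(1)] by blast
 qed
 have Lup: "L i n <= L (Suc i) n" for i n
 proof
  fix a assume "a \<in> L i n"
  then obtain y where *: "a \<in> mp gs n" "y \<in> lower g gs i (n + i)" "y \<oplus> a \<otimes> g [^] i \<in> A (n + i)" unfolding L_def by blast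
  have c: "a \<in> carrier R" "y \<in> carrier R" using * ideal_carr[OF I] lower_closed(1)[OF g] by blast+
  have "\<one> \<in> mp (g # gs) 0" by simp
  have "g \<in> mp (g # gs) 1" using mp_mult_gen[OF g \<open>\<one> \<in> mp (g # gs) 0\<close>] gc by simp
  hence "g \<otimes> (y \<oplus> a \<otimes> g [^] i) \<in> A (1 + (n + i))" using gmodD(4)[OF A] * by blast
  moreover have "g \<otimes> (y \<oplus> a \<otimes> g [^] i) = g \<otimes> y \<oplus> a \<otimes> (g [^] i \<otimes> g)"
   using c gc nat_pow_closed[of g i] by algebra
  ultimately have "g \<otimes> y \<oplus> a \<otimes> g [^] Suc i \<in> A (n + Suc i)" by simp
  moreover have "g \<otimes> y \<in> lower g gs (Suc i) (n + Suc i)" using lower_shift[OF g *(2)] by simp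
  ultimately show "a \<in> L (Suc i) n" unfolding L_def using * by blast
 qed
 obtain J where J: "\<forall>i\<ge>J. \<forall>n. L i n = L J n" using gnoeth_acc[of "mp gs" L, OF N Lg Lup] by blast
 have "\<forall>i. \<exists>G. finite G \<and> (\<forall>(d, s)\<in>G. s \<in> L i d) \<and> (\<forall>n. L i n <= gspan (mp gs) G n)"
  using N Lg unfolding gnoeth_def by blast
 then obtain G where G: "\<forall>i. finite (G i) \<and> (\<forall>(d, s)\<in>G i. s \<in> L i d) \<and> (\<forall>n. L i n <= gspan (mp gs) (G i) n)"
  by (rule choice[THEN exE])
 have "\<forall>i. \<forall>x\<in>G i. \<exists>y\<in>lower g gs i (fst x + i). y \<oplus> snd x \<otimes> g [^] i \<in> A (fst x + i)"
  using G unfolding L_def by fastforce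
 hence "\<forall>i. \<exists>Y. \<forall>x\<in>G i. Y x\<in>lower g gs i (fst x + i) \<and> Y x \<oplus> snd x \<otimes> g [^] i \<in> A (fst x + i)"
  by (metis bchoice)
 then obtain Y where Y: "\<forall>i. \<forall>x\<in>G i. Y i x\<in>lower g gs i (fst x + i) \<and> Y i x \<oplus> snd x \<otimes> g [^] i \<in> A (fst x + i)"
  by (rule choice[THEN exE])
 define H where "H = (\<Union>i\<le>J. (%x. (fst x + i, Y i x \<oplus> snd x \<otimes> g [^] i)) ` G i)"
 have H: "finite H" "\<forall>(d, f)\<in>H. f \<in> A d" unfolding H_def using G Y by auto
 have Hc: "f \<in> carrier R" if "(d, f) \<in> H" for d f using that H(2) Ac by blast
 have Sc: "mp (g # gs) n <= carrier R" for n using ideal_sub[OF I'] .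
 have key: "x \<in> gspan (mp (g # gs)) H n" if "x \<in> A n" "x \<in> lower g gs i n" for x i n
  using that
 proof (induction i arbitrary: x)
  case 0 thus ?case using gspan.zero by simp
 next
  case (Suc i)
  then obtain y s where x: "x = y \<oplus> s \<otimes> g [^] i" "y \<in> lower g gs i n" "if i \<le> n then s \<in> mp gs (n - i) else s = \<zero>" by auto
  show ?case
  proof (cases "i \<le> n")
   case False
   have "y \<in> carrier R" using x(2) lower_closed(1)[OF g] by blast
   hence "x = y" using False x gc by simp
   thus ?thesis using Suc x by blast
  next
   case True
   hence s: "s \<in> L i (n - i)" using x Suc(2) unfolding L_def by auto
   \<comment> \<open>Beyond J the leading coefficients are those of stage J, so generators lifted at
     stage k are brought to degree i in g by the factor g^(i-k).\<close>
   define k where "k = min i J"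
   have "L i (n - i) = L k (n - i)"
   proof (cases "i \<le> J")
    case True thus ?thesis by (simp add: k_def)
   next
    case False thus ?thesis using J[rule_format, of i "n - i"] by (simp add: k_def)
   qed
   hence "s \<in> L k (n - i)" using s by simp
   moreover have "L k (n - i) <= gspan (mp gs) (G k) (n - i)" using G by simp
   ultimately have sk: "s \<in> gspan (mp gs) (G k) (n - i)" by (rule rev_subsetD)
   have kJ: "k \<le> J" "k \<le> i" unfolding k_def by auto
   have "\<exists>h\<in>gspan (mp (g # gs)) H n. \<exists>z\<in>lower g gs i n. h = z \<oplus> t \<otimes> g [^] i" if "t \<in> gspan (mp gs) (G k) (n - i)" for t
    using that
   proof (induction rule: gspan.induct)
    case zero
    have "\<zero> = \<zero> \<oplus> \<zero> \<otimes> g [^] i" using gc by simp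
    thus ?case using gspan.zero lower_closed(2)[OF g] by blast
   next
    case (step t d f c)
    obtain h z where hz: "h \<in> gspan (mp (g # gs)) H n" "z \<in> lower g gs i n" "h = z \<oplus> t \<otimes> g [^] i" using step by blast
    let ?y = "Y k (d, f)"
    have y: "?y \<in> lower g gs k (d + k)" "?y \<oplus> f \<otimes> g [^] k \<in> A (d + k)" using Y step(2) by force+
    have Hm: "(d + k, ?y \<oplus> f \<otimes> g [^] k) \<in> H" unfolding H_def using step(2) kJ(1) by force
    have fL: "f \<in> mp gs d" using G step(2) unfolding L_def by blast
    have tc: "t \<in> carrier R"
    proof (rule gspan_carr[OF _ _ step(1)])
     show "f' \<in> carrier R" if "(d', f') \<in> G k" for d' f' using that G ideal_carr[OF I] unfolding L_def by blast
     show "mp gs n <= carrier R" for n using ideal_sub[OF I] .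
    qed
    have cc: "c \<in> carrier R" "f \<in> carrier R" "?y \<in> carrier R" "z \<in> carrier R"
     using step fL y hz ideal_carr[OF I] lower_closed(1)[OF g] by blast+
    have gk: "c \<otimes> g [^] (i - k) \<in> mp (g # gs) (n - d - i + (i - k))"
    proof -
     have "c \<in> mp (g # gs) (n - d - i)" using step(4) mp_Cons_sub[OF g] by (metis diff_commute subsetD)
     moreover have "g \<in> mp (g # gs) 1" using mp_mult_gen[OF g, of \<one> 0] gc by simp
     hence "g [^] (i - k) \<in> mp (g # gs) (i - k)" by (rule mp_pow[OF g])
     ultimately show ?thesis using mp_mult[OF g] by blast
    qed
    have dn: "d \<le> n - i" using step(3) .
    hence e1: "n - d - i + (i - k) = n - (d + k)" "d + k \<le> n" using kJ(2) True by auto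
    let ?h = "h \<oplus> (c \<otimes> g [^] (i - k)) \<otimes> (?y \<oplus> f \<otimes> g [^] k)"
    have "?h \<in> gspan (mp (g # gs)) H n"
     by (rule gspan.step[OF hz(1) Hm e1(2)]) (use gk e1 in simp)
    moreover have "?h = (z \<oplus> (c \<otimes> (g [^] (i - k) \<otimes> ?y))) \<oplus> (t \<oplus> c \<otimes> f) \<otimes> g [^] i"
    proof -
     have "g [^] i = g [^] (i - k) \<otimes> g [^] k" using gc kJ by (simp add: nat_pow_mult)
     thus ?thesis unfolding hz(3)
      using cc tc nat_pow_closed[OF gc(1), of "i - k"] nat_pow_closed[OF gc(1), of k] by algebra
    qed
    moreover have "z \<oplus> (c \<otimes> (g [^] (i - k) \<otimes> ?y)) \<in> lower g gs i n"
    proof (rule lower_closed(3)[OF g hz(2)])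
     have "g [^] j \<otimes> ?y \<in> lower g gs (k + j) (d + k + j)" for j :: nat
     proof (induction j)
      case 0 thus ?case using y cc by simp
     next
      case (Suc j)
      have "g [^] Suc j \<otimes> ?y = g \<otimes> (g [^] j \<otimes> ?y)" using gc cc by (simp add: m_ac)
      thus ?case using lower_shift[OF g Suc] by simp
     qed
     from this[of "i - k"] have "g [^] (i - k) \<otimes> ?y \<in> lower g gs i (d + i)" using kJ by simp
     from lower_closed(4)[OF g step(4) this] have "c \<otimes> (g [^] (i - k) \<otimes> ?y) \<in> lower g gs i (n - i - d + (d + i))" .
     moreover have "n - i - d + (d + i) = n" using dn True by simp
     ultimately show "c \<otimes> (g [^] (i - k) \<otimes> ?y) \<in> lower g gs i n" by simp
    qed
    ultimately show ?case by blast
   qed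
   then obtain h z where hz: "h \<in> gspan (mp (g # gs)) H n" "z \<in> lower g gs i n" "h = z \<oplus> s \<otimes> g [^] i" using sk by blast
   have c: "s \<in> carrier R" "y \<in> carrier R" "z \<in> carrier R"
    using s x hz ideal_carr[OF I] lower_closed(1)[OF g] unfolding L_def by blast+
   have one: "\<ominus> \<one> \<in> mp gs 0" "\<ominus> \<one> \<in> mp (g # gs) 0" by (simp_all add: mp_0)
   have "\<ominus> \<one> \<otimes> z \<in> lower g gs i (0 + n)" by (rule lower_closed(4)[OF g one(1) hz(2)])
   hence "y \<oplus> (\<ominus> \<one> \<otimes> z) \<in> lower g gs i n" using lower_closed(3)[OF g x(2)] by simp
   moreover have "h \<in> A n" using gspan_sub[OF A _ hz(1)] H(2) by blast
   hence "\<ominus> \<one> \<otimes> h \<in> A (0 + n)" using gmodD(4)[OF A one(2)] by blast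
   hence "x \<oplus> (\<ominus> \<one> \<otimes> h) \<in> A n" using gmodD(3)[OF A Suc(2)] by simp
   moreover have "x \<oplus> (\<ominus> \<one> \<otimes> h) = y \<oplus> (\<ominus> \<one> \<otimes> z)"
    unfolding x(1) hz(3) using c nat_pow_closed[OF gc(1), of i] by algebra
   ultimately have "x \<oplus> (\<ominus> \<one> \<otimes> h) \<in> gspan (mp (g # gs)) H n" using Suc.IH by simp
   hence "(x \<oplus> (\<ominus> \<one> \<otimes> h)) \<oplus> h \<in> gspan (mp (g # gs)) H n" by (rule gspan_add[OF _ hz(1) _ Sc]) (erule Hc)
   moreover have "h \<in> carrier R" "x \<in> carrier R" using \<open>h \<in> A n\<close> Suc(2) Ac by blast+
   hence "(x \<oplus> (\<ominus> \<one> \<otimes> h)) \<oplus> h = x" by algebra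
   ultimately show ?thesis by simp
  qed
 qed
 have "A n <= gspan (mp (g # gs)) H n" for n
  using key[of _ n "Suc n"] mp_lower[OF g, of n] gmodD(1)[OF A, of n] by blast
 thus "\<exists>G. finite G \<and> (\<forall>(d, f)\<in>G. f \<in> A d) \<and> (\<forall>n. A n <= gspan (mp (g # gs)) G n)" using H by blast
qed

context noeth
begin

lemma gnoeth_mp: "set gs <= carrier R ==> gnoeth (mp gs)"
proof (induction gs)
 case Nil show ?case by (rule gnoeth_mp_Nil)
next
 case (Cons g gs) thus ?case using gnoeth_mp_Cons[of g gs] by simp
qed

text \<open>The intersections of V with the powers of the ideal form a homogeneous ideal of the Rees
  algebra. The constant \<open>a\<close> is the largest degree of its finitely many
  generators.\<close>

lemma artin_rees:
 assumes gs: "set gs <= carrier R" and V: "ideal V R"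
 shows "\<exists>a. \<forall>n\<ge>a. mp gs n \<inter> V <= Idl {c \<otimes> v | c v. c \<in> mp gs (n - a) \<and> v \<in> V}"
proof -
 note I = mp_ideal[OF gs]
 let ?A = "%n. mp gs n \<inter> V"
 have "gmod (mp gs) ?A" unfolding gmod_def
  using ideal_zero[OF I] ideal_zero[OF V] ideal_add[OF I] ideal_add[OF V] ideal_mult[OF V] mp_mult[OF gs] ideal_carr[OF I]
  by auto
 with gnoeth_mp[OF gs] obtain G where G: "finite G" "\<forall>(d, f)\<in>G. f \<in> ?A d" "\<forall>n. ?A n <= gspan (mp gs) G n"
  by (rule gnoethE)
 define a where "a = Max (insert 0 (fst ` G))"
 have "mp gs n \<inter> V <= Idl {c \<otimes> v | c v. c \<in> mp gs (n - a) \<and> v \<in> V}" for n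
 proof
  let ?S = "{c \<otimes> v | c v. c \<in> mp gs (n - a) \<and> v \<in> V}"
  have S: "?S <= carrier R" using ideal_carr[OF I] ideal_carr[OF V] by auto
  note K = genideal_ideal[OF S]
  fix x assume "x \<in> mp gs n \<inter> V"
  hence "x \<in> gspan (mp gs) G n" using G(3) by blast
  thus "x \<in> Idl ?S"
  proof (induction rule: gspan.induct)
   case zero thus ?case using ideal_zero[OF K] .
  next
   case (step x d f c)
   have "d \<le> a" unfolding a_def using G(1) step(2) by (intro Max_ge) (auto simp: image_iff intro: bexI[of _ "(d, f)"])
   hence "c \<in> mp gs (n - a)" using step(4) mp_anti[OF gs, of "n - a" "n - d"] diff_le_mono2[of d a n] by blast
   moreover have "f \<in> V" using G(2) step(2) by auto
   ultimately have "c \<otimes> f \<in> ?S" by (intro CollectI exI conjI) simp_all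
   hence "c \<otimes> f \<in> Idl ?S" using S by (rule Idl_mem)
   thus ?case using step(5) by (intro ideal_add[OF K])
  qed
 qed
 thus ?thesis by blast
qed

end

section \<open>Krull's intersection theorem and the growth of colengths\<close>

context nlocal
begin

definition mgens :: "'a list"
 where "mgens = (SOME gs. set gs <= carrier R \<and> m = Idl (set gs))"

abbreviation mpow :: "nat => 'a set"
 where "mpow n \<equiv> mp mgens n"

lemma mgens: "set mgens <= carrier R" "m = Idl (set mgens)"
proof -
 have "\<exists>gs. set gs <= carrier R \<and> m = Idl (set gs)" using ideal_fin_gen[OF m_ideal] by metis
 hence "set mgens <= carrier R \<and> m = Idl (set mgens)" unfolding mgens_def by (rule someI_ex)
 thus "set mgens <= carrier R" "m = Idl (set mgens)" by blast+
qed

lemma mpow_1: "mpow 1 = m"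
 using mp_1[OF mgens(1)] mgens(2) by simp

lemma mpow_ideal: "ideal (mpow n) R"
 by (rule mp_ideal[OF mgens(1)])

lemma mpow_pow: "a \<in> m ==> a [^] n \<in> mpow n"
 using mp_pow[OF mgens(1)] mpow_1 by simp

lemma mpow_sub_m: "n > 0 ==> mpow n <= m"
 using mp_anti[OF mgens(1), of 1 n] mpow_1 by simp

text \<open>Instead of a determinant: an ideal L maximal among those over c and strictly inside d
  has a simple quotient d/L, hence contains m d. Then d, being contained in c + m d, lies in
  L.\<close>

lemma nakayama:
 assumes c: "ideal c R" "ideal d R" "c <= d" and sub: "d <= Idl (c \<union> {a \<otimes> x | a x. a \<in> m \<and> x \<in> d})"
 shows "d = c"
proof (rule ccontr)
 assume "d \<noteq> c"
 let ?S = "{L. ideal L R \<and> c <= L \<and> L \<subset> d}"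
 have "c \<in> ?S" using c \<open>d \<noteq> c\<close> by auto
 hence "\<exists>M\<in>?S. \<forall>K\<in>?S. M <= K --> K = M" by (intro noeth_maximal) auto
 then obtain L where L: "L \<in> ?S" "\<forall>K\<in>?S. L <= K --> K = L" by (rule bexE)
 have Li: "ideal L R" "c <= L" "L \<subset> d" using L(1) by auto
 have max: "Idl (insert x L) = d" if x: "x \<in> d" "x \<notin> L" for x
 proof (rule ccontr)
  assume neg: "Idl (insert x L) \<noteq> d"
  have S: "insert x L <= carrier R" using x Li ideal_sub[OF c(2)] by auto
  have sub: "insert x L <= Idl (insert x L)" by (rule genideal_self[OF S])
  have "Idl (insert x L) <= d" using x Li c by (intro Idl_subI) auto
  hence "Idl (insert x L) \<in> ?S" using neg genideal_ideal[OF S] Li sub by auto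
  hence "Idl (insert x L) = L" using L(2) sub by auto
  thus False using sub x by blast
 qed
 have mL: "a \<otimes> x \<in> L" if ax: "a \<in> m" "x \<in> d" for a x
 proof (rule ccontr)
  assume neg: "a \<otimes> x \<notin> L"
  have ac: "a \<in> carrier R" "x \<in> carrier R" using ax m_carr ideal_carr[OF c(2)] by auto
  have "a \<otimes> x \<in> d" using ax ac ideal_mult[OF c(2)] by blast
  hence "x \<in> Idl (insert (a \<otimes> x) L)" using max neg ax by blast
  moreover have "L <= carrier R" "a \<otimes> x \<in> carrier R" using ideal_sub[OF Li(1)] ac by auto
  ultimately obtain r where r: "r \<in> carrier R" "x \<ominus> r \<otimes> (a \<otimes> x) \<in> Idl L" by (rule Idl_insertE')
  have "x \<ominus> r \<otimes> (a \<otimes> x) = (\<one> \<ominus> r \<otimes> a) \<otimes> x" using r ac by algebra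
  hence 1: "(\<one> \<ominus> r \<otimes> a) \<otimes> x \<in> L" using r Idl_ideal[OF Li(1)] by simp
  have ra: "r \<otimes> a \<in> m" using ideal_mult[OF m_ideal ax(1) r(1)] .
  have "\<one> \<ominus> r \<otimes> a \<notin> m"
   using ideal_minus_cancel[OF m_ideal ra one_closed] one_notin_m by blast
  then obtain b where b: "b \<in> carrier R" "b \<otimes> (\<one> \<ominus> r \<otimes> a) = \<one>"
   using unit_inverse[of "\<one> \<ominus> r \<otimes> a"] r ac by auto
  have "b \<otimes> ((\<one> \<ominus> r \<otimes> a) \<otimes> x) = x" using b r ac by (simp flip: m_assoc)
  hence "x \<in> L" using ideal_mult[OF Li(1) 1 b(1)] by simp
  thus False using neg ideal_mult[OF Li(1) _ ac(1)] by blast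
 qed
 have "Idl (c \<union> {a \<otimes> x | a x. a \<in> m \<and> x \<in> d}) <= L"
  by (rule Idl_subI) (use Li mL in auto)
 thus False using sub Li by blast
qed

text \<open>For d the intersection of all c + m^n, Artin-Rees puts d into c + m d, and Nakayama
  gives d = c.\<close>

lemma krull_intersection:
 assumes c: "ideal c R" and x: "x \<in> carrier R" "\<And>n. x \<in> Idl (c \<union> mpow n)"
 shows "x \<in> c"
proof -
 have cm: "c \<union> mpow n <= carrier R" for n using ideal_sub[OF c] ideal_sub[OF mpow_ideal] by auto
 let ?d = "\<Inter>n. Idl (c \<union> mpow n)"
 have d: "ideal ?d R" by (rule i_Intersect) (use genideal_ideal[OF cm] in auto)
 have cd: "c <= ?d" using genideal_self[OF cm] by blast
 obtain a where a: "\<And>n. n \<ge> a ==> mpow n \<inter> ?d <= Idl {s \<otimes> v | s v. s \<in> mpow (n - a) \<and> v \<in> ?d}"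
  using artin_rees[OF mgens(1) d] by blast
 let ?T = "{s \<otimes> v | s v. s \<in> m \<and> v \<in> ?d}"
 have Tc: "?T <= carrier R" using m_carr ideal_carr[OF d] by auto
 have cT: "c \<union> ?T <= carrier R" using Tc ideal_sub[OF c] by auto
 have "?d <= Idl (c \<union> ?T)"
 proof
  fix y assume y: "y \<in> ?d"
  have "Idl (c \<union> mpow (Suc a)) = c <+> mpow (Suc a)"
   using union_genideal[OF c mpow_ideal] by blast
  hence "y \<in> c <+> mpow (Suc a)" using y by blast
  then obtain u v where uv: "u \<in> c" "v \<in> mpow (Suc a)" "y = u \<oplus> v" by (rule set_addE)
  have cc: "u \<in> carrier R" "v \<in> carrier R" using uv ideal_carr[OF c] ideal_carr[OF mpow_ideal] by auto
  have "v \<oplus> u \<in> ?d" using y uv cc by (simp add: a_comm)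
  hence "v \<in> ?d" using ideal_add_cancel[OF d _ cc(2)] uv(1) cd by blast
  hence "v \<in> Idl {s \<otimes> v | s v. s \<in> mpow (Suc a - a) \<and> v \<in> ?d}" using a[of "Suc a"] uv(2) by auto
  hence "v \<in> Idl ?T" using mpow_1 by simp
  moreover have "Idl ?T <= Idl (c \<union> ?T)" by (rule Idl_mono[OF _ cT]) auto
  ultimately have "v \<in> Idl (c \<union> ?T)" by blast
  moreover have "u \<in> Idl (c \<union> ?T)" using uv(1) by (intro Idl_mem[OF _ cT]) auto
  ultimately show "y \<in> Idl (c \<union> ?T)" unfolding uv(3) by (intro ideal_add[OF genideal_ideal[OF cT]])
 qed
 hence "?d = c" by (rule nakayama[OF c d cd])
 thus ?thesis using x by blast
qed

lemma mprim_mpow: "ideal c R ==> mprim (Idl (c \<union> mpow n))"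
 unfolding mprim_def
 using mpow_pow Idl_mem[of _ "c \<union> mpow n"] ideal_sub[of c] ideal_sub[OF mpow_ideal, of n] by (metis Un_iff Un_least)

lemma fincolen_mpow: "ideal c R ==> fincolen (Idl (c \<union> mpow n))"
 using mprim_fincolen[OF genideal_ideal mprim_mpow] ideal_sub[of c] ideal_sub[OF mpow_ideal, of n] by simp

lemma power_diff_bound:
 fixes x y :: real
 assumes "0 \<le> y" "y \<le> x"
 shows "x ^ Suc k - y ^ Suc k \<le> (Suc k) * (x - y) * x ^ k"
proof (induction k)
 case (Suc k)
 have "x ^ Suc (Suc k) - y ^ Suc (Suc k) = x * (x ^ Suc k - y ^ Suc k) + (x - y) * y ^ Suc k"
  by (simp add: algebra_simps)
 also have "\<dots> \<le> x * ((Suc k) * (x - y) * x ^ k) + (x - y) * x ^ Suc k"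
  using assms Suc by (intro add_mono mult_left_mono power_mono) auto
 also have "\<dots> = (Suc (Suc k)) * (x - y) * x ^ Suc k" by (simp add: algebra_simps)
 finally show ?case .
qed simp

text \<open>A discrete integration: increments of order n^k over steps of fixed length a add up to
  order n^(k+1).\<close>

lemma growth_step:
 fixes h :: "nat => nat" and C :: real
 assumes C: "C > 0" and a: "a > 0" and pos: "\<And>n. n \<ge> 1 ==> h n \<ge> 1"
  and rec: "\<And>n. n \<ge> a ==> C * real n ^ k + h (n - a) \<le> h n"
 shows "\<exists>c>0. \<forall>n. c * real n ^ Suc k \<le> h n"
proof -
 \<comment> \<open>The first bound carries the induction step through the estimate of n^(k+1) -
   (n-a)^(k+1); the second covers 0 < n < a, where only \<open>h n \<ge> 1\<close> is known.\<close>
 define c where "c = min (C / (real (Suc k) * a)) (1 / real a ^ Suc k)"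
 have c: "c > 0" unfolding c_def using C a by simp
 have c1: "c * (real (Suc k) * a) \<le> C"
 proof -
  have "c \<le> C / (real (Suc k) * a)" unfolding c_def by simp
  thus ?thesis using a by (subst (asm) pos_le_divide_eq) auto
 qed
 have c2: "c * real a ^ Suc k \<le> 1"
 proof -
  have "c \<le> 1 / real a ^ Suc k" unfolding c_def by simp
  thus ?thesis using a by (subst (asm) pos_le_divide_eq) auto
 qed
 have "c * real n ^ Suc k \<le> h n" for n
 proof (induction n rule: less_induct)
  case (less n)
  show ?case
  proof (cases "n \<ge> a")
   case True
   have "real n ^ Suc k - real (n - a) ^ Suc k \<le> Suc k * (real n - real (n - a)) * real n ^ k"
    by (rule power_diff_bound) auto
   also have "real n - real (n - a) = a" using True by simp
   finally have "c * (real n ^ Suc k - real (n - a) ^ Suc k) \<le> c * (Suc k * real a * real n ^ k)"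
    using c by (intro mult_left_mono) auto
   also have "\<dots> = (c * (real (Suc k) * a)) * real n ^ k" by simp
   also have "\<dots> \<le> C * real n ^ k" using c1 by (intro mult_right_mono) auto
   finally have "c * real n ^ Suc k \<le> c * real (n - a) ^ Suc k + C * real n ^ k"
    by (simp only: right_diff_distrib)
   moreover have "c * real (n - a) ^ Suc k \<le> h (n - a)" by (rule less) (use a True in simp)
   ultimately show ?thesis using rec[OF True] by linarith
  next
   case False
   show ?thesis
   proof (cases "n = 0")
    case True thus ?thesis by simp
   next
    case n0: False
    have "c * real n ^ Suc k \<le> c * real a ^ Suc k" using False c by (intro mult_left_mono power_mono) auto
    thus ?thesis using c2 pos[of n] n0 by linarith
   qed
  qed
 qed
 thus ?thesis using c by blast
qed

text \<open>With P the first prime of the chain and y in the second prime outside P, Artin-Rees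
  bounds (P + m^n) : y by P + m^(n-a). The colon formula for colengths becomes a recursion whose
  increments are colengths over the second prime, so each prime of the chain raises the exponent by
  one. n = 0 is exempt because m^0 is the unit ideal.\<close>

lemma chain_growth:
 assumes "prime_chain R k f"
 shows "\<exists>C>0. \<forall>n. C * real n ^ k \<le> colen (Idl (f 0 \<union> mpow n)) \<or> n = 0"
 using assms
proof (induction k arbitrary: f)
 case 0
 have P: "primeideal (f 0) R" using prime_chain_head[OF 0] .
 have S: "f 0 \<union> mpow n <= carrier R" for n using ideal_sub[OF prime_ideal[OF P]] ideal_sub[OF mpow_ideal] by auto
 have "colen (Idl (f 0 \<union> mpow n)) \<ge> 1" if "n > 0" for n
 proof (rule colen_pos[OF fincolen_mpow[OF prime_ideal[OF P]] genideal_ideal[OF S]])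
  have "Idl (f 0 \<union> mpow n) <= m" using prime_sub_m[OF P] mpow_sub_m[OF that] m_ideal by (intro Idl_subI) auto
  thus "\<one> \<notin> Idl (f 0 \<union> mpow n)" using one_notin_m by blast
 qed
 thus ?case by (intro exI[of _ 1]) force
next
 case (Suc k)
 let ?P = "f 0" and ?h = "%n. colen (Idl (f 0 \<union> mpow n))"
 have P: "primeideal ?P R" and sub: "?P \<subset> f 1"
  using Suc(2) by (auto simp: prime_chain_def)
 note Pi = prime_ideal[OF P]
 have S: "?P \<union> mpow n <= carrier R" for n using ideal_sub[OF Pi] ideal_sub[OF mpow_ideal] by auto
 have "prime_chain R k (%i. f (Suc i))" using Suc(2) by (auto simp: prime_chain_def)
 from Suc.IH[OF this] obtain C where C: "C > 0" "\<forall>n. C * real n ^ k \<le> colen (Idl (f (Suc 0) \<union> mpow n)) \<or> n = 0" by blast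
 have P1: "primeideal (f 1) R" using Suc(2) by (auto simp: prime_chain_def)
 obtain y where y: "y \<in> f 1" "y \<notin> ?P" using sub by blast
 have yc: "y \<in> carrier R" using y ideal_carr[OF prime_ideal[OF P1]] by blast
 have yP: "insert y ?P <= carrier R" using yc ideal_sub[OF Pi] by auto
 let ?V = "Idl (insert y ?P)"
 have V: "ideal ?V R" by (rule genideal_ideal[OF yP])
 obtain a0 where a0: "\<And>n. n \<ge> a0 ==> mpow n \<inter> ?V <= Idl {s \<otimes> v | s v. s \<in> mpow (n - a0) \<and> v \<in> ?V}"
  using artin_rees[OF mgens(1) V] by blast
 \<comment> \<open>The successor makes \<open>a\<close> positive: the recursion has to descend, and
   n >= a has to exclude n = 0.\<close>
 define a where "a = Suc a0"
 have pos: "?h n \<ge> 1" if "n \<ge> 1" for n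
 proof (rule colen_pos[OF fincolen_mpow[OF Pi] genideal_ideal[OF S]])
  have "Idl (?P \<union> mpow n) <= m" using prime_sub_m[OF P] mpow_sub_m[of n] that m_ideal by (intro Idl_subI) auto
  thus "\<one> \<notin> Idl (?P \<union> mpow n)" using one_notin_m by blast
 qed
 have colon: "colon (Idl (?P \<union> mpow n)) y <= Idl (?P \<union> mpow (n - a))" if n: "n \<ge> a" for n
 proof
  fix r assume "r \<in> colon (Idl (?P \<union> mpow n)) y"
  hence r: "r \<in> carrier R" "r \<otimes> y \<in> Idl (?P \<union> mpow n)" by (auto simp: colon_def)
  have "r \<otimes> y \<in> ?P <+> mpow n" using r(2) union_genideal[OF Pi mpow_ideal] by blast
  then obtain u v where uv: "u \<in> ?P" "v \<in> mpow n" "r \<otimes> y = u \<oplus> v" by (rule set_addE)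
  have cc: "u \<in> carrier R" "v \<in> carrier R" using uv ideal_carr[OF Pi] ideal_carr[OF mpow_ideal] by auto
  have yV: "y \<in> ?V" "?P <= ?V" using genideal_self[OF yP] by auto
  have "v \<oplus> u \<in> ?V" using ideal_mult[OF V yV(1) r(1)] uv cc by (simp add: a_comm)
  hence "v \<in> ?V" using ideal_add_cancel[OF V _ cc(2)] uv(1) yV by blast
  hence "v \<in> Idl {s \<otimes> v | s v. s \<in> mpow (n - a0) \<and> v \<in> ?V}" using a0[of n] uv(2) n a_def by auto
  \<comment> \<open>Elements of m^(n-a0) (P + (y)) are, modulo P, multiples of y by elements of
    m^(n-a0). As y is outside the prime P, the factor y is cancelled afterwards.\<close>
  moreover have "Idl {s \<otimes> v | s v. s \<in> mpow (n - a0) \<and> v \<in> ?V} <= {z \<in> carrier R. \<exists>c\<in>mpow (n - a0). z \<ominus> c \<otimes> y \<in> ?P}"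
   (is "_ <= ?E")
  proof (rule Idl_subI)
   show "ideal ?E R"
   proof (rule ideal_intro)
    show "?E <= carrier R" by auto
    have "\<zero> \<ominus> \<zero> \<otimes> y \<in> ?P" using yc ideal_zero[OF Pi] by (simp add: minus_eq)
    thus "\<zero> \<in> ?E" using ideal_zero[OF mpow_ideal] by auto
   next
    fix z w assume "z \<in> ?E" "w \<in> ?E"
    then obtain c d where *: "z \<in> carrier R" "w \<in> carrier R" "c \<in> mpow (n - a0)" "d \<in> mpow (n - a0)"
     "z \<ominus> c \<otimes> y \<in> ?P" "w \<ominus> d \<otimes> y \<in> ?P" by auto
    have c: "c \<in> carrier R" "d \<in> carrier R" using * ideal_carr[OF mpow_ideal] by auto
    have "(z \<oplus> w) \<ominus> (c \<oplus> d) \<otimes> y = (z \<ominus> c \<otimes> y) \<oplus> (w \<ominus> d \<otimes> y)" using * c yc by algebra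
    hence "(z \<oplus> w) \<ominus> (c \<oplus> d) \<otimes> y \<in> ?P" using ideal_add[OF Pi *(5,6)] by simp
    thus "z \<oplus> w \<in> ?E" using * ideal_add[OF mpow_ideal *(3,4)] by auto
   next
    fix z t assume "z \<in> ?E" and t: "t \<in> carrier R"
    then obtain c where *: "z \<in> carrier R" "c \<in> mpow (n - a0)" "z \<ominus> c \<otimes> y \<in> ?P" by auto
    have c: "c \<in> carrier R" using * ideal_carr[OF mpow_ideal] by auto
    have "(t \<otimes> z) \<ominus> (t \<otimes> c) \<otimes> y = t \<otimes> (z \<ominus> c \<otimes> y)" using * c yc t by algebra
    hence "(t \<otimes> z) \<ominus> (t \<otimes> c) \<otimes> y \<in> ?P" using ideal_mult[OF Pi *(3) t] by simp
    thus "t \<otimes> z \<in> ?E" using * t ideal_mult[OF mpow_ideal *(2) t] by auto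
   qed
   show "{s \<otimes> v | s v. s \<in> mpow (n - a0) \<and> v \<in> ?V} <= ?E"
   proof clarify
    fix s v assume s: "s \<in> mpow (n - a0)" and v: "v \<in> ?V"
    obtain r where r: "r \<in> carrier R" "v \<ominus> r \<otimes> y \<in> Idl ?P"
     using v ideal_sub[OF Pi] yc by (rule Idl_insertE')
    have c: "s \<in> carrier R" "v \<in> carrier R" using s v ideal_carr[OF mpow_ideal] ideal_carr[OF V] by auto
    have "s \<otimes> v \<ominus> (r \<otimes> s) \<otimes> y = s \<otimes> (v \<ominus> r \<otimes> y)" using c r(1) yc by algebra
    hence "s \<otimes> v \<ominus> (r \<otimes> s) \<otimes> y \<in> ?P" using ideal_mult[OF Pi] r(2) Idl_ideal[OF Pi] c by simp
    thus "s \<otimes> v \<in> carrier R \<and> (\<exists>c\<in>mpow (n - a0). s \<otimes> v \<ominus> c \<otimes> y \<in> ?P)"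
     using ideal_mult[OF mpow_ideal s r(1)] c by auto
   qed
  qed
  ultimately obtain c where c: "c \<in> mpow (n - a0)" "v \<ominus> c \<otimes> y \<in> ?P" by auto
  have ccc: "c \<in> carrier R" using c ideal_carr[OF mpow_ideal] by auto
  have "(r \<ominus> c) \<otimes> y = r \<otimes> y \<ominus> c \<otimes> y" using r(1) ccc yc by algebra
  also have "\<dots> = u \<oplus> (v \<ominus> c \<otimes> y)" unfolding uv(3) using cc ccc yc by algebra
  finally have "(r \<ominus> c) \<otimes> y \<in> ?P" using ideal_add[OF Pi uv(1) c(2)] by simp
  hence "r \<ominus> c \<in> ?P" using primeD[OF P] y(2) r(1) ccc yc by blast
  hence 1: "r \<ominus> c \<in> Idl (?P \<union> mpow (n - a))" using Idl_mem[OF _ S] by blast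
  have "c \<in> mpow (n - a)" using c(1) mp_anti[OF mgens(1), of "n - a" "n - a0"] diff_le_mono2[of a0 a n] a_def by auto
  hence 2: "c \<in> Idl (?P \<union> mpow (n - a))" using Idl_mem[OF _ S] by blast
  show "r \<in> Idl (?P \<union> mpow (n - a))" by (rule ideal_minus_cancel[OF genideal_ideal[OF S] 2 r(1) 1])
 qed
 have rec: "C * real n ^ k + ?h (n - a) \<le> ?h n" if n: "n \<ge> a" for n
 proof -
  have I: "ideal (Idl (?P \<union> mpow n)) R" by (rule genideal_ideal[OF S])
  have f: "fincolen (Idl (?P \<union> mpow n))" by (rule fincolen_mpow[OF Pi])
  have "?h n = colen (Idl (insert y (Idl (?P \<union> mpow n)))) + colen (colon (Idl (?P \<union> mpow n)) y)"
   by (rule colen_colon[OF f I yc])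
  moreover have "?h (n - a) \<le> colen (colon (Idl (?P \<union> mpow n)) y)"
   by (rule colen_mono[OF _ genideal_ideal[OF S] colon[OF n]])
     (use fincolen_mono[OF f colon_sup[OF I yc]] in simp)
  moreover have "colen (Idl (f (Suc 0) \<union> mpow n)) \<le> colen (Idl (insert y (Idl (?P \<union> mpow n))))"
  proof (rule colen_mono)
   have S1: "f (Suc 0) \<union> mpow n <= carrier R" using ideal_sub[OF prime_ideal[OF P1]] ideal_sub[OF mpow_ideal] by auto
   show "ideal (Idl (f (Suc 0) \<union> mpow n)) R" by (rule genideal_ideal[OF S1])
   have S2: "insert y (Idl (?P \<union> mpow n)) <= carrier R" using yc ideal_sub[OF I] by auto
   have "Idl (?P \<union> mpow n) <= Idl (insert y (Idl (?P \<union> mpow n)))" using genideal_self[OF S2] by auto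
   thus "fincolen (Idl (insert y (Idl (?P \<union> mpow n))))" by (rule fincolen_mono[OF f])
   have "Idl (?P \<union> mpow n) <= Idl (f (Suc 0) \<union> mpow n)" using sub by (intro Idl_mono[OF _ S1]) auto
   moreover have "y \<in> Idl (f (Suc 0) \<union> mpow n)" using y by (intro Idl_mem[OF _ S1]) simp
   ultimately show "Idl (insert y (Idl (?P \<union> mpow n))) <= Idl (f (Suc 0) \<union> mpow n)"
    using genideal_ideal[OF S1] by (intro Idl_subI) auto
  qed
  moreover have "n \<noteq> 0" using n a_def by simp
  hence "C * real n ^ k \<le> colen (Idl (f (Suc 0) \<union> mpow n))" using C(2) by blast
  ultimately show ?thesis by linarith
 qed
 have "\<exists>c>0. \<forall>n. c * real n ^ Suc k \<le> ?h n"
  by (rule growth_step[OF C(1) _ pos rec]) (simp_all add: a_def)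
 thus ?case by blast
qed

end

section \<open>Prime characteristic\<close>

locale ncharp = nlocal +
 fixes p :: nat
 assumes p_prime: "Factorial_Ring.prime p" and charp: "[p] \<cdot> \<one> = \<zero>"
begin

lemma binomial_ring:
 assumes "a \<in> carrier R" "b \<in> carrier R"
 shows "(a \<oplus> b) [^] (n::nat) = (\<Oplus>k\<in>{..n}. [(n choose k)] \<cdot> (a [^] k \<otimes> b [^] (n - k)))"
proof (induction n)
 case 0 thus ?case using assms by (simp add: add.nat_pow_Suc)
next
 case (Suc n)
 let ?T = "%n k. [(n choose k)] \<cdot> (a [^] k \<otimes> b [^] (n - k))"
 let ?M = "%k. a [^] k \<otimes> b [^] (Suc n - k)"
 have M: "?M k \<in> carrier R" for k using assms by simp
 have 1: "a \<otimes> ?T n k = [(n choose k)] \<cdot> ?M (Suc k)" if "k \<le> n" for k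
  using assms by (simp add: add_pow_rdistr m_ac)
 have 2: "b \<otimes> ?T n k = [(n choose k)] \<cdot> ?M k" if "k \<le> n" for k
  using assms that by (simp add: add_pow_rdistr Suc_diff_le m_ac)
 have cl: "[c] \<cdot> ?M k \<in> carrier R" for c k :: nat using M by simp
 have "(a \<oplus> b) [^] Suc n = (a \<oplus> b) \<otimes> (\<Oplus>k\<in>{..n}. ?T n k)" using Suc assms by (simp add: m_comm)
 also have "\<dots> = (\<Oplus>k\<in>{..n}. a \<otimes> ?T n k) \<oplus> (\<Oplus>k\<in>{..n}. b \<otimes> ?T n k)"
  using assms by (simp add: l_distr finsum_rdistr)
 also have "(\<Oplus>k\<in>{..n}. a \<otimes> ?T n k) = (\<Oplus>k\<in>{..n}. [(n choose k)] \<cdot> ?M (Suc k))"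
  by (rule finsum_cong') (use 1 assms in auto)
 also have "(\<Oplus>k\<in>{..n}. b \<otimes> ?T n k) = (\<Oplus>k\<in>{..n}. [(n choose k)] \<cdot> ?M k)"
  by (rule finsum_cong') (use 2 assms in auto)
 also have "(\<Oplus>k\<in>{..n}. [(n choose k)] \<cdot> ?M k) = (\<Oplus>k\<in>{..Suc n}. [(n choose k)] \<cdot> ?M k)"
  using assms by (simp add: finsum_Suc binomial_eq_0)
 also have "\<dots> = (\<Oplus>k\<in>{..n}. [(n choose Suc k)] \<cdot> ?M (Suc k)) \<oplus> [(n choose 0)] \<cdot> ?M 0"
  by (rule finsum_Suc2) (use assms in auto)
 also have "(\<Oplus>k\<in>{..n}. [(n choose k)] \<cdot> ?M (Suc k)) \<oplus> ((\<Oplus>k\<in>{..n}. [(n choose Suc k)] \<cdot> ?M (Suc k)) \<oplus> [(n choose 0)] \<cdot> ?M 0)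
  = (\<Oplus>k\<in>{..n}. [(n choose k)] \<cdot> ?M (Suc k) \<oplus> [(n choose Suc k)] \<cdot> ?M (Suc k)) \<oplus> [(n choose 0)] \<cdot> ?M 0"
  using assms by (simp add: finsum_addf a_assoc Pi_def)
 also have "(\<Oplus>k\<in>{..n}. [(n choose k)] \<cdot> ?M (Suc k) \<oplus> [(n choose Suc k)] \<cdot> ?M (Suc k)) = (\<Oplus>k\<in>{..n}. [(Suc n choose Suc k)] \<cdot> ?M (Suc k))"
  by (rule finsum_cong') (use assms in \<open>auto simp: add.nat_pow_mult\<close>)
 also have "\<dots> \<oplus> [(n choose 0)] \<cdot> ?M 0 = (\<Oplus>k\<in>{..Suc n}. [(Suc n choose k)] \<cdot> ?M k)"
  using finsum_Suc2[of "%k. [(Suc n choose k)] \<cdot> ?M k" n] cl by (simp del: finsum_Suc)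
 finally show ?case .
qed

lemma charp_mult: "p dvd n ==> a \<in> carrier R ==> [n] \<cdot> a = \<zero>"
proof -
 assume n: "p dvd n" and a: "a \<in> carrier R"
 then obtain k where k: "n = p * k" by blast
 have "[n] \<cdot> a = [k] \<cdot> ([p] \<cdot> a)" using a k by (simp add: add.nat_pow_pow)
 moreover have "[p] \<cdot> a = ([p] \<cdot> \<one>) \<otimes> a" using a by (simp add: add_pow_ldistr)
 ultimately show ?thesis using charp a by simp
qed

lemma frobenius_p:
 assumes "a \<in> carrier R" "b \<in> carrier R"
 shows "(a \<oplus> b) [^] p = a [^] p \<oplus> b [^] p"
proof -
 obtain n where n: "p = Suc n" using p_prime prime_gt_0_nat gr0_conv_Suc by blast
 obtain k where k: "n = Suc k" using p_prime n by (metis One_nat_def not0_implies_Suc not_prime_1)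
 let ?F = "%k. [(p choose k)] \<cdot> (a [^] k \<otimes> b [^] (p - k))"
 have F: "?F i \<in> carrier R" for i using assms by simp
 have "?F (Suc i) = \<zero>" if "i \<in> {..k}" for i
 proof -
  have "p dvd (p choose Suc i)" by (rule dvd_choose_prime) (use p_prime that n k in auto)
  thus ?thesis using charp_mult assms by simp
 qed
 hence "(\<Oplus>i\<in>{..k}. ?F (Suc i)) = \<zero>" by (intro add.finprod_one_eqI) auto
 moreover have "(\<Oplus>i\<in>{..p}. ?F i) = ?F p \<oplus> ((\<Oplus>i\<in>{..k}. ?F (Suc i)) \<oplus> ?F 0)"
 proof -
  have "(\<Oplus>i\<in>{..p}. ?F i) = ?F p \<oplus> (\<Oplus>i\<in>{..n}. ?F i)" using finsum_Suc[of ?F n] F n by auto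
  also have "(\<Oplus>i\<in>{..n}. ?F i) = (\<Oplus>i\<in>{..k}. ?F (Suc i)) \<oplus> ?F 0" using finsum_Suc2[of ?F k] F k by auto
  finally show ?thesis .
 qed
 ultimately show ?thesis using binomial_ring[OF assms, of p] assms by simp
qed

lemma frobenius:
 assumes "a \<in> carrier R" "b \<in> carrier R"
 shows "(a \<oplus> b) [^] (p ^ e) = a [^] (p ^ e) \<oplus> b [^] (p ^ e)"
proof (induction e)
 case (Suc e)
 have "(a \<oplus> b) [^] (p ^ Suc e) = ((a \<oplus> b) [^] (p ^ e)) [^] p" using assms by (simp add: nat_pow_pow mult.commute)
 also have "\<dots> = a [^] (p ^ Suc e) \<oplus> b [^] (p ^ Suc e)"
  unfolding Suc using assms by (simp add: frobenius_p nat_pow_pow mult.commute)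
 finally show ?case .
qed (use assms in simp)

lemma p_gt_1: "p > 1"
 using p_prime prime_gt_1_nat by blast

lemma p_pow_pos: "p ^ e > 0"
 using p_gt_1 by simp

lemma frobenius_zero: "\<zero> [^] (p ^ e) = \<zero>"
 using p_pow_pos[of e] by (metis nat_pow_zero neq0_conv)

lemma frobenius_minus:
 assumes "a \<in> carrier R" "b \<in> carrier R"
 shows "(a \<ominus> b) [^] (p ^ e) = a [^] (p ^ e) \<ominus> b [^] (p ^ e)"
proof -
 have "(a \<ominus> b \<oplus> b) [^] (p ^ e) = (a \<ominus> b) [^] (p ^ e) \<oplus> b [^] (p ^ e)"
  using assms by (intro frobenius) auto
 moreover have "a \<ominus> b \<oplus> b = a" using assms by algebra
 ultimately show ?thesis using assms by (simp add: minus_eq a_assoc r_neg)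
qed

text \<open>In characteristic p the elements whose q-th power lies in K form an ideal, so generators
  suffice.\<close>

lemma frobenius_Idl:
 assumes S: "S <= carrier R" and x: "x \<in> Idl S" and K: "ideal K R" and sub: "\<And>s. s \<in> S ==> s [^] (p ^ e) \<in> K"
 shows "x [^] (p ^ e) \<in> K"
proof -
 have "Idl S <= {x \<in> carrier R. x [^] (p ^ e) \<in> K}"
 proof (rule Idl_subI)
  show "S <= {x \<in> carrier R. x [^] (p ^ e) \<in> K}" using S sub by auto
  show "ideal {x \<in> carrier R. x [^] (p ^ e) \<in> K} R"
   by (rule ideal_intro)
     (auto simp: frobenius frobenius_zero ideal_zero[OF K] ideal_add[OF K] nat_pow_distrib ideal_mult[OF K])
 qed
 thus ?thesis using x by blast
qed

lemma lprod_pow: "set xs <= carrier R ==> lprod xs [^] (n::nat) = lprod (pw n xs)"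
 by (induction xs) (auto simp: nat_pow_distrib)

lemma Idl_pw_carr: "ideal c R ==> set xs <= carrier R ==> c \<union> set (pw n xs) <= carrier R"
 using ideal_sub pw_carr by blast

lemma frobenius_pw:
 assumes c: "ideal c R" "set xs <= carrier R" and x: "x \<in> Idl (c \<union> set (pw n xs))"
 shows "x [^] (p ^ e) \<in> Idl (c \<union> set (pw (n * p ^ e) xs))"
proof (rule frobenius_Idl[OF Idl_pw_carr[OF c] x genideal_ideal[OF Idl_pw_carr[OF c]]])
 fix s assume "s \<in> c \<union> set (pw n xs)"
 hence "s [^] (p ^ e) \<in> c \<union> set (pw (n * p ^ e) xs)"
  using c ideal_pow[OF c(1) _ p_pow_pos, of s e] by (auto simp: set_pw nat_pow_pow)
 thus "s [^] (p ^ e) \<in> Idl (c \<union> set (pw (n * p ^ e) xs))" by (rule Idl_mem[OF _ Idl_pw_carr[OF c]])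
qed

lemma lprod_pow_frobenius:
 assumes c: "ideal c R" "set xs <= carrier R" and x: "lprod (pw k xs) \<in> Idl (c \<union> set (pw n xs))"
 shows "lprod (pw (k * p ^ e) xs) \<in> Idl (c \<union> set (pw (n * p ^ e) xs))"
 using frobenius_pw[OF c x, of e] lprod_pow[OF pw_carr[OF c(2)], of k "p ^ e"] pw_pw[OF c(2), of "p ^ e" k] by simp

text \<open>The relation behind \<open>\<one> \<in> lim c xs\<close> says that the product of the
  t-th powers lies in (c, x^(t+1)). It persists for larger exponents, in particular for t = Q - 1
  with Q a power of p, and Frobenius then yields it for the Q^e-th powers of the entries. So every
  passage from Q^e to Q^(e+1) loses one of the Q^d layers.\<close>

lemma lim_one_small:
 assumes c: "ideal c R" "set xs <= m" "mprim (Idl (c \<union> set xs))" and one: "\<one> \<in> lim c xs"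
 obtains f where "f > 0" "\<And>e. colen (Idl (c \<union> set (pw (p ^ (f * e)) xs)))
   \<le> (p ^ (f * length xs) - 1) ^ e * colen (Idl (c \<union> set xs))"
proof -
 have xc: "set xs <= carrier R" using c m_carr by blast
 obtain t where "\<one> \<otimes> lprod (pw t xs) \<in> Idl (c \<union> set (pw (Suc t) xs))" using one by (auto simp: lim_def)
 note t = lim_up[OF c(1) xc one_closed this]
 define f where "f = Suc t"
 define Q where "Q = p ^ f"
 have "t < p ^ t" using p_gt_1 less_exp[of t] power_mono[of 2 p t] by linarith
 also have "p ^ t < Q" unfolding Q_def f_def using p_gt_1 by (intro power_strict_increasing) auto
 finally have Q: "Suc t \<le> Q" "t \<le> Q - 1" "Q > 0" by auto
 have "\<one> \<otimes> lprod (pw (Q - 1) xs) \<in> Idl (c \<union> set (pw (Suc (Q - 1)) xs))" using t[OF Q(2)] .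
 hence 1: "lprod (pw (Q - 1) xs) \<in> Idl (c \<union> set (pw Q xs))" using Q xc by simp
 have pe: "Q ^ e = p ^ (f * e)" for e unfolding Q_def by (simp add: power_mult)
 let ?w = "%e. colen (Idl (c \<union> set (pw (Q ^ e) xs)))"
 have "mprim (Idl (c \<union> set (pw (Q ^ e) xs))) \<and> ?w e \<le> (Q ^ length xs - 1) ^ e * colen (Idl (c \<union> set xs))" for e
 proof (induction e)
  case 0
  have "pw (Q ^ 0) xs = xs" using pw_1[OF xc] by simp
  thus ?case using c(3) by simp
 next
  case (Suc e)
  let ?z = "pw (Q ^ e) xs"
  have z: "set ?z <= carrier R" using xc by simp
  have zQ: "pw Q ?z = pw (Q ^ Suc e) xs" "pw (Q - 1) ?z = pw ((Q - 1) * Q ^ e) xs"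
   using pw_pw[OF xc] by (simp_all add: mult.commute)
  have "lprod (pw (Q - 1) ?z) \<in> Idl (c \<union> set (pw Q ?z))"
   unfolding zQ using lprod_pow_frobenius[OF c(1) xc 1, of "f * e"] pe[of e] by (simp add: power_mult)
  note * = colen_power_list[OF c(1) z conjunct1[OF Suc] Q(3)]
  have "?w (Suc e) \<le> (Q ^ length xs - 1) * ?w e" using *(3) \<open>lprod (pw (Q - 1) ?z) \<in> _\<close> zQ(1) by simp
  also have "\<dots> \<le> (Q ^ length xs - 1) * ((Q ^ length xs - 1) ^ e * colen (Idl (c \<union> set xs)))"
   using Suc by (intro mult_left_mono) auto
  finally show ?case using *(1) zQ(1) by (simp add: mult.assoc)
 qed
 moreover have "Q ^ length xs = p ^ (f * length xs)" by (rule pe)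
 ultimately show ?thesis using that[of f] pe f_def by simp
qed

lemma pw_sub_mpow:
 assumes "ideal c R" "set xs <= m"
 shows "Idl (c \<union> set (pw n xs)) <= Idl (c \<union> mpow n)"
proof (rule Idl_mono)
 show "c \<union> set (pw n xs) <= c \<union> mpow n" using mpow_pow assms by (auto simp: set_pw)
 show "c \<union> mpow n <= carrier R" using ideal_sub[OF assms(1)] ideal_sub[OF mpow_ideal] by auto
qed

lemma colen_pw_mpow:
 assumes "ideal c R" "set xs <= m" "mprim (Idl (c \<union> set xs))" "n > 0"
 shows "colen (Idl (c \<union> mpow n)) \<le> colen (Idl (c \<union> set (pw n xs)))"
proof (rule colen_mono[OF _ _ pw_sub_mpow[OF assms(1,2)]])
 have xc: "set xs <= carrier R" using assms m_carr by blast
 show "fincolen (Idl (c \<union> set (pw n xs)))"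
  by (rule mprim_fincolen[OF genideal_ideal[OF Idl_pw_carr[OF assms(1) xc]] colen_power_list(1)[OF assms(1) xc assms(3,4)]])
 show "ideal (Idl (c \<union> mpow n)) R"
  using ideal_sub[OF assms(1)] ideal_sub[OF mpow_ideal] by (intro genideal_ideal) auto
qed

lemma geometric_contra:
 fixes C :: real
 assumes "C > 0" "\<And>e::nat. C * real N ^ e \<le> real (N - 1) ^ e * real w" "N \<ge> (1::nat)"
 shows False
proof (cases "N = 1")
 case True
 thus False using assms(1) assms(2)[of 1] by simp
next
 case False
 hence N: "N \<ge> 2" using assms(3) by simp
 let ?r = "real N / real (N - 1)"
 have r: "?r > 1" using N by simp
 have "?r ^ e \<le> real w / C" for e
 proof -
  have "C * (real N ^ e / real (N - 1) ^ e) \<le> real w" using assms(2)[of e] N by (simp add: field_simps)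
  thus ?thesis using assms(1) by (simp add: power_divide field_simps)
 qed
 moreover obtain e where "real w / C < ?r ^ e" using real_arch_pow[OF r] by blast
 ultimately show False by (meson not_le)
qed

text \<open>Grothendieck nonvanishing: if \<open>1 \<in> lim P xs\<close> then by Frobenius the colengths grow too slowly.\<close>

lemma one_notin_lim:
 assumes f: "prime_chain R (length xs) f" and x: "set xs <= m" "mprim (Idl (f 0 \<union> set xs))"
 shows "\<one> \<notin> lim (f 0) xs"
proof
 assume one: "\<one> \<in> lim (f 0) xs"
 have P: "ideal (f 0) R" using prime_ideal[OF prime_chain_head[OF f]] .
 obtain g where g: "g > 0" "\<And>e. colen (Idl (f 0 \<union> set (pw (p ^ (g * e)) xs)))
   \<le> (p ^ (g * length xs) - 1) ^ e * colen (Idl (f 0 \<union> set xs))"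
  using lim_one_small[OF P x one] by blast
 obtain C where C: "C > 0" "\<And>n. C * real n ^ length xs \<le> colen (Idl (f 0 \<union> mpow n)) \<or> n = 0"
  using chain_growth[OF f] by blast
 let ?N = "p ^ (g * length xs)"
 have "C * real ?N ^ e \<le> real (?N - 1) ^ e * real (colen (Idl (f 0 \<union> set xs)))" for e
 proof -
  let ?n = "p ^ (g * e)"
  have n: "?n > 0" using p_pow_pos .
  have "C * real ?n ^ length xs \<le> colen (Idl (f 0 \<union> mpow ?n))" using C(2)[of ?n] n by linarith
  also have "\<dots> \<le> colen (Idl (f 0 \<union> set (pw ?n xs)))" using colen_pw_mpow[OF P x n] by simp
  also have "\<dots> \<le> (?N - 1) ^ e * colen (Idl (f 0 \<union> set xs))" using g(2)[of e] by (simp only: of_nat_le_iff)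
  finally have "C * real ?n ^ length xs \<le> real ((?N - 1) ^ e * colen (Idl (f 0 \<union> set xs)))" .
  moreover have "real ?n ^ length xs = real ?N ^ e"
   by (simp add: power_mult[symmetric] mult.commute mult.left_commute mult.assoc)
  ultimately show ?thesis by simp
 qed
 thus False using geometric_contra[OF C(1)] p_pow_pos[of "g * length xs"] by fastforce
qed

text \<open>If the chain were longer than the list, padding the list with zeros to the length of the
  chain would make the product of its entries vanish, so 1 would lie in the limit closure, against
  the nonvanishing just proved.\<close>

lemma krull_height:
 assumes f: "prime_chain R k f" and x: "set xs <= m" "mprim (Idl (f 0 \<union> set xs))"
 shows "k \<le> length xs"
proof (rule ccontr)
 assume k: "\<not> k \<le> length xs"
 let ?ys = "xs @ replicate (k - length xs) \<zero>"
 have P: "ideal (f 0) R" using prime_ideal[OF prime_chain_head[OF f]] .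
 have l: "length ?ys = k" using k by simp
 have ys: "set ?ys <= m" using x ideal_zero[OF m_ideal] by auto
 have yc: "set ?ys <= carrier R" using ys m_carr by blast
 have "Idl (f 0 \<union> set xs) <= Idl (f 0 \<union> set ?ys)"
  by (rule Idl_mono) (use yc ideal_sub[OF P] in auto)
 hence prim: "mprim (Idl (f 0 \<union> set ?ys))" using mprim_mono[OF x(2)] by blast
 have "\<one> \<in> lim (f 0) ?ys"
 proof -
  have "\<zero> \<in> set ?ys" using k by auto
  hence "\<zero> \<in> set (pw 1 ?ys)" using yc pw_1 by simp
  then obtain r where "r \<in> carrier R" "lprod (pw 1 ?ys) = \<zero> \<otimes> r" using lprod_mem[OF pw_carr[OF yc]] by blast
  hence "\<one> \<otimes> lprod (pw 1 ?ys) = \<zero>" by simp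
  moreover have "\<zero> \<in> Idl (f 0 \<union> set (pw (Suc 1) ?ys))"
   using ideal_zero[OF genideal_ideal[OF Idl_pw_carr[OF P yc]]] .
  ultimately have "\<one> \<otimes> lprod (pw 1 ?ys) \<in> Idl (f 0 \<union> set (pw (Suc 1) ?ys))" by simp
  thus ?thesis unfolding lim_def by blast
 qed
 thus False using one_notin_lim[of ?ys f] f l ys prim by simp
qed

end

section \<open>Regular sequences\<close>

context cring
begin

text \<open>Weakly regular sequences on R/c: the ideal generated in the end may be the unit ideal.
  Each entry is moved into the base ideal, which suits induction on the list.\<close>

fun regs :: "'a set => 'a list => bool" where
 "regs c [] = True"
| "regs c (x # xs) = ((\<forall>v\<in>carrier R. x \<otimes> v \<in> c --> v \<in> c) \<and> regs (Idl (insert x c)) xs)"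

lemma regs_append:
 assumes "ideal c R" "set us <= carrier R"
 shows "regs c (us @ xs) \<longleftrightarrow> regs c us \<and> regs (Idl (c \<union> set us)) xs"
 using assms
proof (induction us arbitrary: c)
 case Nil thus ?case by (simp add: Idl_ideal)
next
 case (Cons u us)
 have S: "insert u c <= carrier R" using Cons ideal_sub by auto
 have "Idl (Idl (insert u c) \<union> set us) = Idl (c \<union> set (u # us))" using Idl_Un_Idl[OF S, of "set us"] Cons(3) by simp
 thus ?case using Cons.IH[OF genideal_ideal[OF S]] Cons(3) by simp
qed

end

context nlocal
begin

text \<open>Nakayama applied to c : b. If b v lies in c, then v is r a modulo c by regularity of b
  over a, and cancelling a gives b r in c; hence c : b is contained in c + m (c : b) and equals c.
  The regularity of a modulo b is then a direct computation.\<close>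

lemma regs_swap:
 assumes c: "ideal c R" and ab: "a \<in> m" "b \<in> m" and r: "regs c (a # b # xs)"
 shows "regs c (b # a # xs)"
proof -
 have ac: "a \<in> carrier R" "b \<in> carrier R" using ab m_carr by auto
 have S: "insert a c <= carrier R" "insert b c <= carrier R" using ac ideal_sub[OF c] by auto
 have a: "v \<in> c" if "v \<in> carrier R" "a \<otimes> v \<in> c" for v using r that by simp
 have b: "v \<in> Idl (insert a c)" if "v \<in> carrier R" "b \<otimes> v \<in> Idl (insert a c)" for v using r that by simp
 have sub: "c <= Idl (insert a c)" "c <= Idl (insert b c)" using genideal_self[OF S(1)] genideal_self[OF S(2)] by auto
 let ?K = "colon c b"
 have K: "ideal ?K R" "c <= ?K" using colon_ideal[OF c ac(2)] colon_sup[OF c ac(2)] by auto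
 have KT: "c \<union> {s \<otimes> v | s v. s \<in> m \<and> v \<in> ?K} <= carrier R" using ideal_sub[OF c] ideal_carr[OF K(1)] m_carr by auto
 have "?K <= Idl (c \<union> {s \<otimes> v | s v. s \<in> m \<and> v \<in> ?K})"
 proof
  fix v assume v: "v \<in> ?K"
  have vc: "v \<in> carrier R" "b \<otimes> v \<in> c" using v ac by (auto simp: colon_def m_comm)
  hence "v \<in> Idl (insert a c)" using b sub by blast
  from this ideal_sub[OF c] ac(1) obtain r where r: "r \<in> carrier R" "v \<ominus> r \<otimes> a \<in> Idl c" by (rule Idl_insertE')
  have r2: "v \<ominus> r \<otimes> a \<in> c" using r Idl_ideal[OF c] by simp
  have "a \<otimes> (b \<otimes> r) = b \<otimes> v \<ominus> b \<otimes> (v \<ominus> r \<otimes> a)" using ac r(1) vc by algebra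
  also have "\<dots> \<in> c" using ideal_minus[OF c vc(2) ideal_mult[OF c r2 ac(2)]] .
  finally have "b \<otimes> r \<in> c" using a r(1) ac by simp
  hence "r \<in> ?K" using r(1) ac by (simp add: colon_def m_comm)
  hence "a \<otimes> r \<in> Idl (c \<union> {s \<otimes> v | s v. s \<in> m \<and> v \<in> ?K})" using ab by (intro Idl_mem[OF _ KT]) auto
  moreover have "v \<ominus> r \<otimes> a \<in> Idl (c \<union> {s \<otimes> v | s v. s \<in> m \<and> v \<in> ?K})" using r2 by (intro Idl_mem[OF _ KT]) auto
  ultimately have "(v \<ominus> r \<otimes> a) \<oplus> a \<otimes> r \<in> Idl (c \<union> {s \<otimes> v | s v. s \<in> m \<and> v \<in> ?K})"
   using ideal_add[OF genideal_ideal[OF KT]] by blast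
  moreover have "(v \<ominus> r \<otimes> a) \<oplus> a \<otimes> r = v" using ac r(1) vc by algebra
  ultimately show "v \<in> Idl (c \<union> {s \<otimes> v | s v. s \<in> m \<and> v \<in> ?K})" by simp
 qed
 hence Kc: "?K = c" by (rule nakayama[OF c K])
 have 1: "v \<in> c" if v: "v \<in> carrier R" "b \<otimes> v \<in> c" for v
 proof -
  have "v \<in> ?K" using v ac by (simp add: colon_def m_comm)
  thus ?thesis using Kc by simp
 qed
 have 2: "v \<in> Idl (insert b c)" if v: "v \<in> carrier R" "a \<otimes> v \<in> Idl (insert b c)" for v
 proof -
  from v(2) ideal_sub[OF c] ac(2) obtain w where w: "w \<in> carrier R" "a \<otimes> v \<ominus> w \<otimes> b \<in> Idl c" by (rule Idl_insertE')
  have w2: "a \<otimes> v \<ominus> w \<otimes> b \<in> c" using w Idl_ideal[OF c] by simp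
  have "b \<otimes> w \<in> Idl (insert a c)"
  proof -
   have "a \<otimes> v \<in> Idl (insert a c)" using ideal_mult'[OF genideal_ideal[OF S(1)] _ v(1)] genideal_self[OF S(1)] by blast
   from ideal_minus[OF genideal_ideal[OF S(1)] this subsetD[OF sub(1) w2]]
   have "a \<otimes> v \<ominus> (a \<otimes> v \<ominus> w \<otimes> b) \<in> Idl (insert a c)" .
   moreover have "a \<otimes> v \<ominus> (a \<otimes> v \<ominus> w \<otimes> b) = b \<otimes> w" using ac v(1) w(1) by algebra
   ultimately show ?thesis by simp
  qed
  hence "w \<in> Idl (insert a c)" using b w by blast
  from this ideal_sub[OF c] ac(1) obtain u where u: "u \<in> carrier R" "w \<ominus> u \<otimes> a \<in> Idl c" by (rule Idl_insertE')
  have u2: "w \<ominus> u \<otimes> a \<in> c" using u Idl_ideal[OF c] by simp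
  have "a \<otimes> (v \<ominus> u \<otimes> b) = (a \<otimes> v \<ominus> w \<otimes> b) \<oplus> b \<otimes> (w \<ominus> u \<otimes> a)" using ac v(1) w(1) u(1) by algebra
  also have "\<dots> \<in> c" using ideal_add[OF c w2 ideal_mult[OF c u2 ac(2)]] .
  finally have "v \<ominus> u \<otimes> b \<in> c" using a v(1) u(1) ac by simp
  thus ?thesis using Idl_insertI[OF _ u(1) v(1) ideal_sub[OF c] ac(2)] Idl_ideal[OF c] by simp
 qed
 have eq: "Idl (insert a (Idl (insert b c))) = Idl (insert b (Idl (insert a c)))"
  using Idl_insert_Idl[OF S(2) ac(1)] Idl_insert_Idl[OF S(1) ac(2)] by (simp add: insert_commute)
 show ?thesis using 1 2 r eq by simp
qed

lemma regs_move:
 assumes "ideal c R" "set us <= m" "a \<in> m" "regs c (us @ a # xs)"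
 shows "regs c (a # us @ xs)"
 using assms
proof (induction us arbitrary: c)
 case (Cons u us)
 have S: "insert u c <= carrier R" using Cons(2,3) ideal_sub m_carr by auto
 have "regs (Idl (insert u c)) (a # us @ xs)" using Cons.IH[OF genideal_ideal[OF S]] Cons by simp
 hence "regs c (u # a # us @ xs)" using Cons(5) by simp
 hence "regs c (a # u # us @ xs)" using Cons(3) by (intro regs_swap[OF Cons(2) _ Cons(4)]) auto
 thus ?case by (simp only: append_Cons)
qed simp

lemma regs_mset:
 assumes "ideal c R" "set xs <= m" "mset xs = mset ys" "regs c xs"
 shows "regs c ys"
 using assms
proof (induction ys arbitrary: xs c)
 case Nil thus ?case by simp
next
 case (Cons y ys)
 have "y \<in> set xs" using Cons(4) by (metis list.set_intros(1) set_mset_mset)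
 then obtain us vs where xs: "xs = us @ y # vs" by (metis split_list)
 have ym: "y \<in> m" "set us <= m" "set vs <= m" using xs Cons(3) by auto
 have r: "regs c (y # us @ vs)" using regs_move[OF Cons(2) ym(2,1)] Cons(5) xs by simp
 have S: "insert y c <= carrier R" using Cons(2) ideal_sub m_carr ym by auto
 have "mset (us @ vs) = mset ys" using Cons(4) xs by simp
 hence "regs (Idl (insert y c)) ys" using Cons.IH[OF genideal_ideal[OF S], of "us @ vs"] r ym by simp
 thus ?case using r by simp
qed

lemma nonzerodivisor_pow:
 assumes "x \<in> carrier R" "\<And>v. v \<in> carrier R ==> x \<otimes> v \<in> c ==> v \<in> c" "v \<in> carrier R" "x [^] (n::nat) \<otimes> v \<in> c"
 shows "v \<in> c"
 using assms(4)
proof (induction n)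
 case (Suc n)
 have "x \<otimes> (x [^] n \<otimes> v) = x [^] Suc n \<otimes> v" using assms(1,3) by (simp add: m_ac)
 hence "x [^] n \<otimes> v \<in> c" using Suc(2) assms by simp
 thus ?case by (rule Suc.IH)
qed (use assms in simp)

definition pows :: "'a list => nat list => 'a list"
 where "pows xs ns = map2 (%x n. x [^] n) xs ns"

lemma pows_simps [simp]: "pows [] ns = []" "pows xs [] = []" "pows (x # xs) (n # ns) = x [^] n # pows xs ns"
 by (simp_all add: pows_def)

lemma length_pows [simp]: "length (pows xs ns) = min (length xs) (length ns)"
 by (simp add: pows_def)

lemma pows_append: "length xs = length ns ==> pows (xs @ ys) (ns @ ks) = pows xs ns @ pows ys ks"
 by (simp add: pows_def)

lemma pows_carr: "set xs <= carrier R ==> set (pows xs ns) <= carrier R"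
proof (induction xs arbitrary: ns)
 case (Cons x xs) thus ?case by (cases ns) auto
qed simp

lemma pows_m: "set xs <= m ==> \<forall>n\<in>set ns. n > 0 ==> set (pows xs ns) <= m"
proof (induction xs arbitrary: ns)
 case (Cons x xs) thus ?case using ideal_pow[OF m_ideal] by (cases ns) auto
qed simp

lemma pows_replicate: "pows xs (replicate (length xs) n) = pw n xs"
 by (induction xs) auto

text \<open>A power of a last entry that is regular is again regular. Permutability brings each
  entry to the last place, where it is replaced by its power, and then to the front.\<close>

lemma regs_pows:
 assumes "ideal c R" "set xs <= m" "\<forall>n\<in>set ns. n > 0" "length ns = length xs" "regs c xs"
 shows "regs c (pows xs ns)"
 using assms
proof (induction xs arbitrary: c ns)
 case (Cons x xs)
 obtain n ns' where ns: "ns = n # ns'" "length ns' = length xs" using Cons(5) by (cases ns) auto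
 have x: "x \<in> m" "set xs <= m" "x \<in> carrier R" "set xs <= carrier R" using Cons(3) m_carr by auto
 have "regs c (xs @ [x])" by (rule regs_mset[OF Cons(2,3) _ Cons(6)]) simp
 hence r: "regs c xs" "\<And>v. v \<in> carrier R ==> x \<otimes> v \<in> Idl (c \<union> set xs) ==> v \<in> Idl (c \<union> set xs)"
  using regs_append[OF Cons(2) x(4)] by auto
 have "v \<in> Idl (c \<union> set xs)" if "v \<in> carrier R" "x [^] n \<otimes> v \<in> Idl (c \<union> set xs)" for v
  using nonzerodivisor_pow[OF x(3) r(2)] that by blast
 hence "regs c (xs @ [x [^] n])" using regs_append[OF Cons(2) x(4)] r(1) by simp
 hence r2: "regs c (x [^] n # xs)"
  by (rule regs_mset[OF Cons(2), rotated 2]) (use x ideal_pow[OF m_ideal x(1)] ns Cons(4) in auto)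
 have S: "insert (x [^] n) c <= carrier R" using x ideal_sub[OF Cons(2)] by auto
 have "regs (Idl (insert (x [^] n) c)) (pows xs ns')"
  by (rule Cons.IH[OF genideal_ideal[OF S]]) (use x ns Cons(4) r2 in auto)
 thus ?case using r2 ns by simp
qed simp

text \<open>The head x stays regular modulo powers of the remaining entries, so x^t cancels from the
  relation defining \<open>lim\<close>; this removes the entries one after the other.\<close>

lemma regs_lim:
 assumes "ideal c R" "set xs <= m" "regs c xs"
 shows "lim c xs = Idl (c \<union> set xs)"
proof
 have xc: "set xs <= carrier R" using assms m_carr by blast
 show "Idl (c \<union> set xs) <= lim c xs" by (rule lim_sup[OF assms(1) xc])
 show "lim c xs <= Idl (c \<union> set xs)" using assms
 proof (induction xs arbitrary: c)
  case Nil thus ?case by (auto simp: lim_def)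
 next
  case (Cons x xs)
  have x: "x \<in> m" "set xs <= m" "x \<in> carrier R" "set xs <= carrier R" using Cons(3) m_carr by auto
  have S: "insert x c <= carrier R" using x ideal_sub[OF Cons(2)] by auto
  show ?case
  proof
   fix r assume "r \<in> lim c (x # xs)"
   then obtain t where t: "r \<in> carrier R" "r \<otimes> lprod (pw t (x # xs)) \<in> Idl (c \<union> set (pw (Suc t) (x # xs)))"
    by (auto simp: lim_def)
   let ?d = "Idl (c \<union> set (pw (Suc t) xs))" and ?P = "lprod (pw t xs)"
   have dS: "c \<union> set (pw (Suc t) xs) <= carrier R" using ideal_sub[OF Cons(2)] pw_carr[OF x(4)] by blast
   have P: "?P \<in> carrier R" using x by simp
   have "regs c (pows (x # xs) (1 # replicate (length xs) (Suc t)))"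
    by (rule regs_pows[OF Cons(2,3) _ _ Cons(4)]) auto
   hence "regs c (x # pw (Suc t) xs)" using x by (simp add: pows_replicate)
   hence "regs c (pw (Suc t) xs @ [x])"
    by (rule regs_mset[OF Cons(2), rotated 2]) (use x ideal_pow[OF m_ideal, of _ "Suc t"] in \<open>auto simp: set_pw simp del: nat_pow_Suc\<close>)
   hence nzd: "v \<in> ?d" if "v \<in> carrier R" "x \<otimes> v \<in> ?d" for v
    using regs_append[OF Cons(2) pw_carr[OF x(4)], of "Suc t" "[x]"] that by simp
   have "r \<otimes> (x [^] t \<otimes> ?P) \<in> Idl (insert (x [^] Suc t) (c \<union> set (pw (Suc t) xs)))" using t by simp
   from this dS nat_pow_closed[OF x(3)] obtain s where s: "s \<in> carrier R" "r \<otimes> (x [^] t \<otimes> ?P) \<ominus> s \<otimes> x [^] Suc t \<in> ?d"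
    by (rule Idl_insertE')
   have "x [^] t \<otimes> (r \<otimes> ?P \<ominus> s \<otimes> x) = r \<otimes> (x [^] t \<otimes> ?P) \<ominus> s \<otimes> x [^] Suc t"
    using s(1) t(1) x(3) P nat_pow_closed[OF x(3), of t] unfolding nat_pow_Suc by algebra
   hence 1: "x [^] t \<otimes> (r \<otimes> ?P \<ominus> s \<otimes> x) \<in> ?d" using s by simp
   have "r \<otimes> ?P \<ominus> s \<otimes> x \<in> ?d"
    by (rule nonzerodivisor_pow[OF x(3) nzd _ 1]) (use s t x P in auto)
   hence "r \<otimes> ?P \<in> Idl (insert x (c \<union> set (pw (Suc t) xs)))"
    by (rule Idl_insertI[OF _ s(1) _ dS x(3)]) (use t P in simp)
   moreover have "Idl (Idl (insert x c) \<union> set (pw (Suc t) xs)) = Idl (insert x (c \<union> set (pw (Suc t) xs)))"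
    using Idl_Un_Idl[OF S pw_carr[OF x(4)], of "Suc t"] by simp
   ultimately have "r \<in> lim (Idl (insert x c)) xs" using t(1) unfolding lim_def by auto
   hence "r \<in> Idl (Idl (insert x c) \<union> set xs)"
    using Cons.IH[OF genideal_ideal[OF S] x(2)] Cons(4) by auto
   thus "r \<in> Idl (c \<union> set (x # xs))" using Idl_Un_Idl[OF S x(4)] by simp
  qed
 qed
qed

end

section \<open>Exchanging systems of parameters\<close>

context ncharp
begin

lemma pow_diff_factor:
 assumes "x \<in> carrier R" "y \<in> carrier R"
 shows "\<exists>s\<in>carrier R. x [^] (n::nat) \<ominus> y [^] n = (x \<ominus> y) \<otimes> s"
proof (induction n)
 case 0 thus ?case using assms by (intro bexI[of _ \<zero>]) (auto simp: minus_eq r_neg)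
next
 case (Suc n)
 then obtain s where s: "s \<in> carrier R" "x [^] n \<ominus> y [^] n = (x \<ominus> y) \<otimes> s" by blast
 have c: "x [^] n \<in> carrier R" "y [^] n \<in> carrier R" using assms by auto
 have "x [^] Suc n \<ominus> y [^] Suc n = x \<otimes> (x [^] n \<ominus> y [^] n) \<oplus> (x \<ominus> y) \<otimes> y [^] n"
  unfolding nat_pow_Suc using c assms by algebra
 also have "\<dots> = (x \<ominus> y) \<otimes> (x \<otimes> s \<oplus> y [^] n)" unfolding s(2) using c assms s(1) by algebra
 finally show ?case using c assms s(1) by blast
qed

text \<open>With exponents restricted to powers of p, closure under addition is additivity of
  Frobenius.\<close>

lemma rad_ideal:
 assumes K: "ideal K R"
 shows "ideal {x \<in> carrier R. \<exists>e. x [^] (p ^ e) \<in> K} R"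
proof (rule ideal_intro)
 have up: "x [^] (p ^ e') \<in> K" if "x \<in> carrier R" "x [^] (p ^ e) \<in> K" "e \<le> e'" for x e e'
  using ideal_pow_le[OF K that(1,2)] that(3) p_gt_1 by (simp add: power_increasing)
 show "{x \<in> carrier R. \<exists>e. x [^] (p ^ e) \<in> K} <= carrier R" by auto
 show "\<zero> \<in> {x \<in> carrier R. \<exists>e. x [^] (p ^ e) \<in> K}" using frobenius_zero ideal_zero[OF K] by auto
 fix a b assume "a \<in> {x \<in> carrier R. \<exists>e. x [^] (p ^ e) \<in> K}" "b \<in> {x \<in> carrier R. \<exists>e. x [^] (p ^ e) \<in> K}"
 then obtain e e' where *: "a \<in> carrier R" "a [^] (p ^ e) \<in> K" "b \<in> carrier R" "b [^] (p ^ e') \<in> K" by auto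
 have "a [^] (p ^ max e e') \<in> K" "b [^] (p ^ max e e') \<in> K" using up[OF *(1,2)] up[OF *(3,4)] by auto
 hence "(a \<oplus> b) [^] (p ^ max e e') \<in> K" using * frobenius ideal_add[OF K] by simp
 thus "a \<oplus> b \<in> {x \<in> carrier R. \<exists>e. x [^] (p ^ e) \<in> K}" using * by blast
next
 fix a r assume "a \<in> {x \<in> carrier R. \<exists>e. x [^] (p ^ e) \<in> K}" and r: "r \<in> carrier R"
 then obtain e where *: "a \<in> carrier R" "a [^] (p ^ e) \<in> K" by auto
 have "(r \<otimes> a) [^] (p ^ e) \<in> K" using * r ideal_mult[OF K] by (simp add: nat_pow_distrib)
 thus "r \<otimes> a \<in> {x \<in> carrier R. \<exists>e. x [^] (p ^ e) \<in> K}" using * r by blast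
qed

lemma mprim_radical:
 assumes S: "S <= carrier R" "mprim (Idl S)" and K: "ideal K R" and s: "\<And>s. s \<in> S ==> \<exists>n::nat. s [^] n \<in> K"
 shows "mprim K"
 unfolding mprim_def
proof
 fix a assume a: "a \<in> m"
 have ac: "a \<in> carrier R" using a m_carr by blast
 have "S <= {x \<in> carrier R. \<exists>e. x [^] (p ^ e) \<in> K}"
 proof
  fix x assume x: "x \<in> S"
  then obtain n :: nat where n: "x [^] n \<in> K" using s by blast
  have "n < p ^ n" using p_gt_1 less_exp[of n] power_mono[of 2 p n] by linarith
  hence "x [^] (p ^ n) \<in> K" using ideal_pow_le[OF K _ n] x S by auto
  thus "x \<in> {x \<in> carrier R. \<exists>e. x [^] (p ^ e) \<in> K}" using x S by blast
 qed
 hence "Idl S <= {x \<in> carrier R. \<exists>e. x [^] (p ^ e) \<in> K}" using rad_ideal[OF K] by (intro Idl_subI)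
 moreover obtain n :: nat where "a [^] n \<in> Idl S" using S(2) a unfolding mprim_def by blast
 ultimately obtain e where "(a [^] n) [^] (p ^ e) \<in> K" by blast
 thus "\<exists>n::nat. a [^] n \<in> K" using ac by (metis nat_pow_pow)
qed

lemma pows_mem_pow:
 assumes "length ns = length xs" "x \<in> set xs"
 shows "\<exists>n. x [^] (n::nat) \<in> set (pows xs ns)"
 using assms
proof (induction xs arbitrary: ns)
 case (Cons a xs)
 obtain n ns' where "ns = n # ns'" "length ns' = length xs" using Cons(2) by (cases ns) auto
 thus ?case using Cons by auto
qed simp

lemma mprim_pows:
 assumes "set xs <= carrier R" "mprim (Idl (set xs))" "length ns = length xs"
 shows "mprim (Idl (set (pows xs ns)))"
proof (rule mprim_radical[OF assms(1,2)])
 show "ideal (Idl (set (pows xs ns))) R" using pows_carr[OF assms(1)] by (rule genideal_ideal)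
 fix s assume "s \<in> set xs"
 thus "\<exists>n::nat. s [^] n \<in> Idl (set (pows xs ns))"
  using pows_mem_pow[OF assms(3)] Idl_mem[OF _ pows_carr[OF assms(1)]] by blast
qed

text \<open>Choose the exponent n + 1 = p^t. Then A^(n+1) - A'^(n+1) is the p^t-th power of A - A',
  which Frobenius moves into (c, as^(n+1)). The difference A^n - A'^n is a multiple of A - A' and
  falls into the same ideal after multiplication by the n-th powers of \<open>as\<close>.\<close>

lemma lim_congr:
 assumes c: "ideal c R" "set as <= carrier R" and A: "A \<in> carrier R" "A' \<in> carrier R" "A \<ominus> A' \<in> Idl (c \<union> set as)"
 shows "lim c (A # as) <= lim c (A' # as)"
proof
 fix r assume "r \<in> lim c (A # as)"
 then obtain t where t: "r \<in> carrier R" "r \<otimes> lprod (pw t (A # as)) \<in> Idl (c \<union> set (pw (Suc t) (A # as)))" by (auto simp: lim_def)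
 have "t < p ^ t" using p_gt_1 less_exp[of t] power_mono[of 2 p t] by linarith
 then obtain n where n: "p ^ t = Suc n" "t \<le> n" by (metis less_Suc_eq_le not0_implies_Suc not_less_zero)
 let ?P = "lprod (pw n as)"
 have P: "?P \<in> carrier R" using c by simp
 have Aas: "set (A # as) <= carrier R" "set (A' # as) <= carrier R" using A c by auto
 have r: "r \<otimes> lprod (pw n (A # as)) \<in> Idl (c \<union> set (pw (Suc n) (A # as)))" by (rule lim_up[OF c(1) Aas(1) t n(2)])
 let ?J = "Idl (c \<union> set (pw (Suc n) as))" and ?K = "Idl (c \<union> set (pw (Suc n) (A # as)))" and ?K' = "Idl (c \<union> set (pw (Suc n) (A' # as)))"
 have JS: "c \<union> set (pw (Suc n) as) <= carrier R" "c \<union> set (pw (Suc n) (A # as)) <= carrier R" "c \<union> set (pw (Suc n) (A' # as)) <= carrier R"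
  using Idl_pw_carr[OF c(1)] c(2) Aas by blast+
 note J = genideal_ideal[OF JS(1)] and K' = genideal_ideal[OF JS(3)]
 have JK: "?J <= ?K'" by (rule Idl_mono[OF _ JS(3)]) auto
 have "(A \<ominus> A') [^] (p ^ t) \<in> Idl (c \<union> set (pw (1 * p ^ t) as))"
  by (rule frobenius_pw[OF c]) (use A pw_1[OF c(2)] in simp)
 hence d: "A [^] Suc n \<ominus> A' [^] Suc n \<in> ?J" using frobenius_minus[OF A(1,2), of t] unfolding n(1) by (simp only: mult_1)
 have A'K: "A' [^] Suc n \<in> ?K'" by (rule Idl_mem[OF _ JS(3)]) simp
 have "A [^] Suc n \<in> ?K'"
  by (rule ideal_minus_cancel[OF K' A'K _ subsetD[OF JK d]]) (use A in simp)
 moreover have "s \<in> ?K'" if "s \<in> c \<union> set (pw (Suc n) as)" for s by (rule Idl_mem[OF _ JS(3)]) (use that in auto)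
 ultimately have "?K <= ?K'" by (intro Idl_subI[OF _ K']) auto
 hence 1: "r \<otimes> (A [^] n \<otimes> ?P) \<in> ?K'" using r by auto
 obtain s where s: "s \<in> carrier R" "A [^] n \<ominus> A' [^] n = (A \<ominus> A') \<otimes> s" using pow_diff_factor[OF A(1,2)] by blast
 have "(A \<ominus> A') \<otimes> ?P \<in> Idl (c \<union> set (pw (1 + n) as))"
  by (rule pw_shift'[OF c]) (use A pw_1[OF c(2)] in simp)
 hence "r \<otimes> s \<otimes> ((A \<ominus> A') \<otimes> ?P) \<in> ?K'" using ideal_mult[OF J] JK t(1) s(1) by auto
 moreover have "r \<otimes> s \<otimes> ((A \<ominus> A') \<otimes> ?P) = r \<otimes> (((A \<ominus> A') \<otimes> s) \<otimes> ?P)" using t(1) s(1) A P by algebra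
 ultimately have 2: "r \<otimes> ((A [^] n \<ominus> A' [^] n) \<otimes> ?P) \<in> ?K'" using s(2) by simp
 have "r \<otimes> (A' [^] n \<otimes> ?P) = r \<otimes> (A [^] n \<otimes> ?P) \<ominus> r \<otimes> ((A [^] n \<ominus> A' [^] n) \<otimes> ?P)"
  using t(1) P nat_pow_closed[OF A(1), of n] nat_pow_closed[OF A(2), of n] by algebra
 hence "r \<otimes> lprod (pw n (A' # as)) \<in> ?K'" using ideal_minus[OF K' 1 2] by simp
 thus "r \<in> lim c (A' # as)" using t(1) unfolding lim_def by blast
qed

lemma lim_scale:
 assumes c: "ideal c R" "set as <= carrier R" and b: "b \<in> carrier R" "e \<in> carrier R" and r: "r \<in> lim c (b # as)"
 shows "e \<otimes> r \<in> lim c (e \<otimes> b # as)"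
proof -
 obtain t where t: "r \<in> carrier R" "r \<otimes> lprod (pw t (b # as)) \<in> Idl (c \<union> set (pw (Suc t) (b # as)))" using r by (auto simp: lim_def)
 let ?K = "Idl (c \<union> set (pw (Suc t) (e \<otimes> b # as)))" and ?P = "lprod (pw t as)"
 have P: "?P \<in> carrier R" using c by simp
 have KS: "c \<union> set (pw (Suc t) (e \<otimes> b # as)) <= carrier R" by (rule Idl_pw_carr[OF c(1)]) (use b c in auto)
 note K = genideal_ideal[OF KS]
 have "(r \<otimes> lprod (pw t (b # as))) \<otimes> e [^] Suc t \<in> ?K"
 proof (rule Idl_colon_sub[OF K _ _ _ t(2)])
  show "e [^] Suc t \<in> carrier R" using b by simp
  show "s \<in> carrier R" if "s \<in> c \<union> set (pw (Suc t) (b # as))" for s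
   by (rule subsetD[OF Idl_pw_carr[OF c(1)] that]) (use b c in auto)
  fix s assume s: "s \<in> c \<union> set (pw (Suc t) (b # as))"
  show "s \<otimes> e [^] Suc t \<in> ?K"
  proof (cases "s = b [^] Suc t")
   case True
   have "s \<otimes> e [^] Suc t = (e \<otimes> b) [^] Suc t" unfolding True using nat_pow_distrib[OF b(2,1), of "Suc t"] m_comm[of "b [^] Suc t" "e [^] Suc t"] b by (simp del: nat_pow_Suc)
   thus ?thesis using Idl_mem[OF _ KS, of "(e \<otimes> b) [^] Suc t"] by simp
  next
   case False
   hence "s \<in> c \<union> set (pw (Suc t) (e \<otimes> b # as))" using s by auto
   thus ?thesis using Idl_mem[OF _ KS] ideal_mult'[OF K] b by simp
  qed
 qed
 moreover have "(r \<otimes> lprod (pw t (b # as))) \<otimes> e [^] Suc t = (e \<otimes> r) \<otimes> lprod (pw t (e \<otimes> b # as))"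
  using t(1) b P by (simp add: nat_pow_distrib m_ac)
 ultimately have "(e \<otimes> r) \<otimes> lprod (pw t (e \<otimes> b # as)) \<in> ?K" by simp
 thus ?thesis using t(1) b unfolding lim_def by blast
qed

text \<open>Multiplication by e is the comparison map from R/(b, as) to R/(A, as), and it is
  injective on classes in the limit. One direction only scales by e. For the converse, multiplying
  further by f leads back to b^M, where f e and b^(M-1) have the same effect.\<close>

lemma lim_exchange:
 assumes c: "ideal c R" "set as <= carrier R" and cr: "b \<in> carrier R" "e \<in> carrier R" "A \<in> carrier R" "f \<in> carrier R" "r \<in> carrier R"
  and A: "A \<ominus> e \<otimes> b \<in> Idl (c \<union> set as)" and f: "b [^] (M::nat) \<ominus> f \<otimes> A \<in> Idl (c \<union> set as)" "M > 0"
 shows "r \<in> lim c (b # as) \<longleftrightarrow> e \<otimes> r \<in> lim c (A # as)"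
proof
 have S: "c \<union> set as <= carrier R" using ideal_sub[OF c(1)] c(2) by auto
 note I = genideal_ideal[OF S]
 have neg: "y \<ominus> x \<in> Idl (c \<union> set as)" if "x \<ominus> y \<in> Idl (c \<union> set as)" "x \<in> carrier R" "y \<in> carrier R" for x y
 proof -
  have "\<ominus> (x \<ominus> y) = y \<ominus> x" using that by algebra
  thus ?thesis using ideal_neg[OF I that(1)] by simp
 qed
 {
  assume "r \<in> lim c (b # as)"
  hence "e \<otimes> r \<in> lim c (e \<otimes> b # as)" by (rule lim_scale[OF c cr(1,2)])
  thus "e \<otimes> r \<in> lim c (A # as)" using lim_congr[OF c _ cr(3) neg[OF A]] cr by auto
 next
  assume "e \<otimes> r \<in> lim c (A # as)"
  hence "f \<otimes> (e \<otimes> r) \<in> lim c (f \<otimes> A # as)" by (rule lim_scale[OF c cr(3,4)])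
  hence 1: "f \<otimes> (e \<otimes> r) \<in> lim c (b [^] M # as)" using lim_congr[OF c _ _ neg[OF f(1)]] cr by auto
  obtain N where N: "M = Suc N" using f(2) gr0_conv_Suc by blast
  \<comment> \<open>\<open>?d \<otimes> b\<close> lies in (c, as) by the two congruences; cancelling
    b inside the limit closure puts \<open>?d\<close> into lim(b^M, as), so f e may be replaced by
    b^N there.\<close>
  let ?d = "f \<otimes> e \<ominus> b [^] N"
  have bas: "set (b [^] k # as) <= carrier R" for k :: nat using cr c by auto
  have "?d \<otimes> b = (\<ominus> f) \<otimes> (A \<ominus> e \<otimes> b) \<ominus> (b [^] M \<ominus> f \<otimes> A)"
   unfolding N nat_pow_Suc using cr nat_pow_closed[OF cr(1), of N] by algebra
  also have "\<dots> \<in> Idl (c \<union> set as)" using ideal_minus[OF I ideal_mult[OF I A] f(1)] cr by simp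
  also have "Idl (c \<union> set as) <= Idl (c \<union> set (b [^] (M + 1) # as))"
   by (rule Idl_mono) (use bas[of "M + 1"] ideal_sub[OF c(1)] in auto)
  also have "\<dots> <= lim c (b [^] (M + 1) # as)" by (rule lim_sup[OF c(1) bas])
  finally have "?d \<otimes> b [^] (1::nat) \<in> lim c (b [^] (M + 1) # as)" using cr by simp
  hence "?d \<in> lim c (b [^] M # as)" using lim_shift[OF c cr(1) f(2), of ?d 1] cr by simp
  hence "r \<otimes> ?d \<in> lim c (b [^] M # as)" using ideal_mult[OF lim_ideal[OF c(1) bas]] cr by blast
  hence "f \<otimes> (e \<otimes> r) \<ominus> r \<otimes> ?d \<in> lim c (b [^] M # as)" using ideal_minus[OF lim_ideal[OF c(1) bas] 1] by blast
  moreover have "f \<otimes> (e \<otimes> r) \<ominus> r \<otimes> ?d = r \<otimes> b [^] N" using cr nat_pow_closed[OF cr(1), of N] by algebra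
  ultimately have "r \<otimes> b [^] N \<in> lim c (b [^] (1 + N) # as)" using N by simp
  thus "r \<in> lim c (b # as)" using lim_shift[OF c cr(1) _ cr(5), of 1 N] cr by simp
 }
qed

lemma exchange_witness:
 assumes as: "set as <= carrier R" and ab: "a \<in> m" "b \<in> m"
  and prim: "mprim (Idl (insert a (set as)))" "mprim (Idl (insert b (set as)))"
 obtains N e M f where "N > 0" "M > 0" "e \<in> carrier R" "f \<in> carrier R"
  "a [^] (N::nat) \<ominus> e \<otimes> b \<in> Idl (set as)" "b [^] (M::nat) \<ominus> f \<otimes> a [^] N \<in> Idl (set as)"
proof -
 have c: "a \<in> carrier R" "b \<in> carrier R" using ab m_carr by auto
 have S: "insert a (set as) <= carrier R" "insert b (set as) <= carrier R" using as c by auto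
 obtain N0 :: nat where "a [^] N0 \<in> Idl (insert b (set as))" using prim(2) ab unfolding mprim_def by blast
 hence N: "a [^] Suc N0 \<in> Idl (insert b (set as))"
  using ideal_pow_le[OF genideal_ideal[OF S(2)] c(1), of N0 "Suc N0"] by simp
 from N as c(2) obtain e where e: "e \<in> carrier R" "a [^] Suc N0 \<ominus> e \<otimes> b \<in> Idl (set as)" by (rule Idl_insertE')
 have S3: "insert (a [^] Suc N0) (set as) <= carrier R" using as c by auto
 have "mprim (Idl (insert (a [^] Suc N0) (set as)))"
 proof (rule mprim_radical[OF S(1) prim(1) genideal_ideal[OF S3]])
  fix s assume s: "s \<in> insert a (set as)"
  show "\<exists>n::nat. s [^] n \<in> Idl (insert (a [^] Suc N0) (set as))"
  proof (cases "s = a")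
   case True thus ?thesis using Idl_mem[OF _ S3] by blast
  next
   case False
   hence "s [^] (1::nat) \<in> Idl (insert (a [^] Suc N0) (set as))" using s as by (intro Idl_mem[OF _ S3]) auto
   thus ?thesis by blast
  qed
 qed
 then obtain M0 :: nat where "b [^] M0 \<in> Idl (insert (a [^] Suc N0) (set as))" using ab unfolding mprim_def by blast
 hence M: "b [^] Suc M0 \<in> Idl (insert (a [^] Suc N0) (set as))"
  using ideal_pow_le[OF genideal_ideal[OF S3] c(2), of M0 "Suc M0"] by simp
 from M as nat_pow_closed[OF c(1)] obtain f where f: "f \<in> carrier R" "b [^] Suc M0 \<ominus> f \<otimes> a [^] Suc N0 \<in> Idl (set as)"
  by (rule Idl_insertE')
 show ?thesis by (rule that[of "Suc N0" "Suc M0" e f]) (use e f in auto)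
qed

text \<open>The condition \<open>j \<otimes> z \<in> lim {\<zero>} xs\<close> for all j says that J
  annihilates the class [z + (xs)], so this is Frobenius stability tested on the classes with
  denominator \<open>xs\<close> itself.\<close>

definition fprop :: "'a set => 'a list => bool"
 where "fprop J xs \<longleftrightarrow> (\<forall>z\<in>carrier R. (\<forall>j\<in>J. j \<otimes> z \<in> lim {\<zero>} xs) --> (\<forall>j\<in>J. j \<otimes> z [^] p \<in> lim {\<zero>} (pw p xs)))"

text \<open>The Frobenius stability of $(0 :_H J)$, expressed in one system of parameters and all its powers.\<close>

definition fgood :: "'a set => 'a list => bool"
 where "fgood J xs \<longleftrightarrow> (\<forall>ns. length ns = length xs --> (\<forall>n\<in>set ns. n > 0) --> fprop J (pows xs ns))"

lemma zero_Un: "S <= carrier R ==> Idl ({\<zero>} \<union> S) = Idl S"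
proof
 assume S: "S <= carrier R"
 show "Idl ({\<zero>} \<union> S) <= Idl S"
  by (rule Idl_subI[OF _ genideal_ideal[OF S]]) (use ideal_zero[OF genideal_ideal[OF S]] genideal_self[OF S] in auto)
 show "Idl S <= Idl ({\<zero>} \<union> S)" by (rule Idl_mono) (use S in auto)
qed

text \<open>The hypothesis is carried to (A, as) by the factor e and the conclusion is carried back
  by the factor e^p; the p-th powers of the two congruences make the second transport
  possible.\<close>

lemma fprop_exchange:
 assumes J: "J <= carrier R" and as: "set as <= carrier R"
  and cr: "b \<in> carrier R" "e \<in> carrier R" "A \<in> carrier R" "f \<in> carrier R"
  and A: "A \<ominus> e \<otimes> b \<in> Idl (set as)" and f: "b [^] (M::nat) \<ominus> f \<otimes> A \<in> Idl (set as)" "M > 0"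
  and fp: "fprop J (A # as)"
 shows "fprop J (b # as)"
 unfolding fprop_def
proof (intro ballI impI)
 fix z j assume z: "z \<in> carrier R" "\<forall>j\<in>J. j \<otimes> z \<in> lim {\<zero>} (b # as)" and j: "j \<in> J"
 have z0: "ideal {\<zero>} R" by (rule zeroideal)
 have A': "A \<ominus> e \<otimes> b \<in> Idl ({\<zero>} \<union> set as)" and f': "b [^] M \<ominus> f \<otimes> A \<in> Idl ({\<zero>} \<union> set as)"
  using zero_Un[OF as] A f by auto
 have jc: "j \<in> carrier R" using j J by blast
 have "j' \<otimes> (e \<otimes> z) \<in> lim {\<zero>} (A # as)" if j': "j' \<in> J" for j'
 proof -
  have c: "j' \<in> carrier R" using j' J by blast
  have "e \<otimes> (j' \<otimes> z) \<in> lim {\<zero>} (A # as)"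
   using lim_exchange[OF z0 as cr _ A' f' f(2), of "j' \<otimes> z"] z j' c by auto
  moreover have "e \<otimes> (j' \<otimes> z) = j' \<otimes> (e \<otimes> z)" using c cr z by (simp add: m_lcomm)
  ultimately show ?thesis by simp
 qed
 hence "j \<otimes> (e \<otimes> z) [^] p \<in> lim {\<zero>} (pw p (A # as))" using fp cr z j unfolding fprop_def by simp
 moreover have "j \<otimes> (e \<otimes> z) [^] p = e [^] p \<otimes> (j \<otimes> z [^] p)" using jc cr z by (simp add: nat_pow_distrib m_lcomm)
 ultimately have 1: "e [^] p \<otimes> (j \<otimes> z [^] p) \<in> lim {\<zero>} (A [^] p # pw p as)" by simp
 have fr: "x [^] p \<ominus> y [^] p \<in> Idl ({\<zero>} \<union> set (pw p as))" if "x \<ominus> y \<in> Idl ({\<zero>} \<union> set as)" "x \<in> carrier R" "y \<in> carrier R" for x y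
 proof -
  have "(x \<ominus> y) [^] (p ^ 1) \<in> Idl ({\<zero>} \<union> set (pw (1 * p ^ 1) as))"
   by (rule frobenius_pw[OF z0 as]) (use that pw_1[OF as] in simp)
  thus ?thesis using frobenius_minus[OF that(2,3), of 1] by simp
 qed
 have A2: "A [^] p \<ominus> e [^] p \<otimes> b [^] p \<in> Idl ({\<zero>} \<union> set (pw p as))" using fr[OF A'] cr by (simp add: nat_pow_distrib)
 have "(b [^] M) [^] p = (b [^] p) [^] M" using cr by (simp add: nat_pow_pow mult.commute)
 hence f2: "(b [^] p) [^] M \<ominus> f [^] p \<otimes> A [^] p \<in> Idl ({\<zero>} \<union> set (pw p as))" using fr[OF f'] cr by (simp add: nat_pow_distrib)
 have "j \<otimes> z [^] p \<in> lim {\<zero>} (b [^] p # pw p as)"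
  using lim_exchange[OF z0 pw_carr[OF as] _ _ _ _ _ A2 f2 f(2), of "j \<otimes> z [^] p"] 1 cr jc z by simp
 thus "j \<otimes> z [^] p \<in> lim {\<zero>} (pw p (b # as))" by simp
qed

lemma fprop_mset:
 assumes "mset xs = mset ys" "set xs <= carrier R"
 shows "fprop J xs = fprop J ys"
proof -
 have "mset (pw p xs) = mset (pw p ys)" using assms(1) by (simp add: pw_def)
 thus ?thesis unfolding fprop_def using lim_mset[OF assms, of "{\<zero>}"] lim_mset[OF _ pw_carr[OF assms(2)], of p "pw p ys" "{\<zero>}"] by simp
qed

lemma split_list_at:
 assumes "length (ns :: nat list) = length (us @ a # vs)"
 obtains ns1 n ns2 where "ns = ns1 @ n # ns2" "length ns1 = length us" "length ns2 = length vs"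
proof -
 have "ns = take (length us) ns @ ns ! length us # drop (Suc (length us)) ns"
  using assms by (intro id_take_nth_drop) simp
 thus ?thesis using that[of "take (length us) ns" "ns ! length us" "drop (Suc (length us)) ns"] assms by simp
qed

text \<open>Comparing a with b^n produces an exponent N of a over which there is no control. This is
  why \<open>fgood\<close> asks for the property at all exponent vectors.\<close>

lemma fgood_exchange:
 assumes J: "J <= carrier R" and xs: "set (us @ a # vs) <= m" "set (us @ b # vs) <= m"
  and prim: "mprim (Idl (set (us @ a # vs)))" "mprim (Idl (set (us @ b # vs)))"
  and g: "fgood J (us @ a # vs)"
 shows "fgood J (us @ b # vs)"
 unfolding fgood_def
proof (intro allI impI)
 fix ns :: "nat list" assume ns: "length ns = length (us @ b # vs)" "\<forall>n\<in>set ns. n > 0"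
 obtain ns1 n ns2 where n: "ns = ns1 @ n # ns2" "length ns1 = length us" "length ns2 = length vs"
  using split_list_at[OF ns(1)] by blast
 let ?as = "pows us ns1 @ pows vs ns2"
 have xc: "set us <= carrier R" "set vs <= carrier R" "a \<in> m" "b \<in> m" "a \<in> carrier R" "b \<in> carrier R"
  using xs m_carr by auto
 have as: "set ?as <= carrier R" using pows_carr xc by simp
 have bn: "b [^] n \<in> m" using ideal_pow[OF m_ideal xc(4)] ns(2) n(1) by simp
 have eqs: "set (pows (us @ x # vs) (ns1 @ k # ns2)) = insert (x [^] k) (set ?as)" for x k
  using n by (auto simp: pows_append)
 have ac: "set (us @ a # vs) <= carrier R" "set (us @ b # vs) <= carrier R" using xc by auto
 have p1: "mprim (Idl (insert a (set ?as)))"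
  using mprim_pows[OF ac(1) prim(1), of "ns1 @ 1 # ns2"] eqs[of a 1] n xc by simp
 have p2: "mprim (Idl (insert (b [^] n) (set ?as)))"
  using mprim_pows[OF ac(2) prim(2), of "ns1 @ n # ns2"] eqs[of b n] n by simp
 obtain N e M f where w: "N > 0" "M > 0" "e \<in> carrier R" "f \<in> carrier R"
  "a [^] (N::nat) \<ominus> e \<otimes> b [^] n \<in> Idl (set ?as)" "(b [^] n) [^] (M::nat) \<ominus> f \<otimes> a [^] N \<in> Idl (set ?as)"
  using exchange_witness[OF as xc(3) bn p1 p2] by metis
 have "fprop J (pows (us @ a # vs) (ns1 @ N # ns2))"
  using g n w(1) ns unfolding fgood_def by simp
 moreover have "mset (pows (us @ x # vs) (ns1 @ k # ns2)) = mset (x [^] k # ?as)" for x k using n by (simp add: pows_append)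
 ultimately have "fprop J (a [^] N # ?as)"
  using fprop_mset[of "pows (us @ a # vs) (ns1 @ N # ns2)" "a [^] N # ?as"] pows_carr[OF ac(1)] by simp
 hence "fprop J (b [^] n # ?as)"
  by (intro fprop_exchange[OF J as _ w(3) _ w(4,5,6,2)]) (use xc in auto)
 thus "fprop J (pows (us @ b # vs) ns)"
  using fprop_mset[of "pows (us @ b # vs) (ns1 @ n # ns2)" "b [^] n # ?as"] pows_carr[OF ac(2)] n
   \<open>\<And>x k. mset (pows (us @ x # vs) (ns1 @ k # ns2)) = mset (x [^] k # ?as)\<close> by simp
qed

lemma regs_exchange:
 assumes xs: "set (us @ a # vs) <= m" "set (us @ b # vs) <= m"
  and prim: "mprim (Idl (set (us @ a # vs)))" "mprim (Idl (set (us @ b # vs)))"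
  and g: "regs {\<zero>} (us @ a # vs)"
 shows "regs {\<zero>} (us @ b # vs)"
proof -
 have z0: "ideal {\<zero>} R" by (rule zeroideal)
 have xc: "set (us @ vs) <= carrier R" "a \<in> m" "b \<in> m" "a \<in> carrier R" "b \<in> carrier R"
  using xs m_carr by auto
 have eqs: "set (us @ x # vs) = insert x (set (us @ vs))" for x by auto
 obtain N e M f where w: "N > 0" "M > 0" "e \<in> carrier R" "f \<in> carrier R"
  "a [^] (N::nat) \<ominus> e \<otimes> b \<in> Idl (set (us @ vs))" "b [^] (M::nat) \<ominus> f \<otimes> a [^] N \<in> Idl (set (us @ vs))"
  using exchange_witness[OF xc(1,2,3)] prim unfolding eqs by metis
 let ?c = "Idl (set (us @ vs))"
 note I = genideal_ideal[OF xc(1)]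
 have zu: "Idl ({\<zero>} \<union> set (us @ vs)) = ?c" by (rule zero_Un[OF xc(1)])
 have "regs {\<zero>} ((us @ vs) @ [a])" by (rule regs_mset[OF z0 xs(1) _ g]) simp
 hence r: "regs {\<zero>} (us @ vs)" "\<And>v. v \<in> carrier R ==> a \<otimes> v \<in> ?c ==> v \<in> ?c"
  using regs_append[OF z0 xc(1)] zu by auto
 have "v \<in> ?c" if v: "v \<in> carrier R" "b \<otimes> v \<in> ?c" for v
 proof (rule nonzerodivisor_pow[OF xc(4) r(2) v(1)])
  have "a [^] N \<otimes> v = (a [^] N \<ominus> e \<otimes> b) \<otimes> v \<oplus> e \<otimes> (b \<otimes> v)"
   using v(1) w(3) xc(5) nat_pow_closed[OF xc(4), of N] by algebra
  thus "a [^] N \<otimes> v \<in> ?c" using ideal_add[OF I ideal_mult'[OF I w(5) v(1)] ideal_mult[OF I v(2) w(3)]] by simp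
 qed
 hence "regs {\<zero>} ((us @ vs) @ [b])" using regs_append[OF z0 xc(1)] r(1) zu by simp
 thus ?thesis by (rule regs_mset[OF z0, rotated 2]) (use xs in auto)
qed

text \<open>Two lists with heads x and y are joined through a generic list \<open>ws\<close> that
  completes both: tail of x to \<open>ws\<close>, then x to y, then \<open>ws\<close> to the tail of
  y. The first and last moves have fewer free entries and are done by induction. The height theorem
  supplies the dimension bounds under which such \<open>ws\<close> exist.\<close>

lemma exchange_connected:
 assumes exch: "\<And>us a b vs. set (us @ a # vs) <= m ==> set (us @ b # vs) <= m ==> mprim (Idl (set (us @ a # vs))) ==>
   mprim (Idl (set (us @ b # vs))) ==> Q (us @ a # vs) ==> Q (us @ b # vs)"
  and "length xs = k" "length ys = k" "set (us @ xs) <= m" "set (us @ ys) <= m"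
  "mprim (Idl (set (us @ xs)))" "mprim (Idl (set (us @ ys)))" "Q (us @ xs)"
 shows "Q (us @ ys)"
 using assms(2-)
proof (induction k arbitrary: us xs ys)
 case 0 thus ?case by simp
next
 case (Suc k)
 obtain x xs' where xs: "xs = x # xs'" "length xs' = k" using Suc(2) by (cases xs) auto
 obtain y ys' where ys: "ys = y # ys'" "length ys' = k" using Suc(3) by (cases ys) auto
 let ?c = "Idl (set (us @ [x]))" and ?d = "Idl (set (us @ [y]))"
 have sub: "set us <= m" "x \<in> m" "y \<in> m" "set xs' <= m" "set ys' <= m" using Suc(4,5) xs ys by auto
 have dim: "ideal (Idl (set (us @ [v]))) R \<and> dimlt (Idl (set (us @ [v]))) (Suc (k))"
  if v: "v \<in> m" "set vs <= m" "mprim (Idl (set (us @ v # vs)))" "length vs = k" for v vs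
 proof
  have S: "set (us @ [v]) <= carrier R" using sub v m_carr by auto
  show "ideal (Idl (set (us @ [v]))) R" using genideal_ideal[OF S] .
  show "dimlt (Idl (set (us @ [v]))) (Suc (k))" unfolding dimlt_def
  proof (intro allI impI)
   fix n f assume f: "prime_chain R n f" "Idl (set (us @ [v])) <= f 0"
   have P: "ideal (f 0) R" using prime_ideal[OF prime_chain_head[OF f(1)]] .
   have S2: "f 0 \<union> set vs <= carrier R" using ideal_sub[OF P] v m_carr by auto
   have "Idl (set (us @ v # vs)) <= Idl (f 0 \<union> set vs)"
    by (rule Idl_mono[OF _ S2]) (use f(2) genideal_self[OF S] in auto)
   hence "mprim (Idl (f 0 \<union> set vs))" using mprim_mono[OF v(3)] by blast
   thus "n < Suc (k)" using krull_height[OF f(1) v(2)] v(4) by simp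
  qed
 qed
 have "ideal c R \<and> dimlt c (Suc (k))" if "c \<in> {?c, ?d}" for c
  using that dim[OF sub(2,4)] dim[OF sub(3,5)] Suc(6,7) xs ys by auto
 then obtain ws where ws: "length ws = k" "set ws <= m" "\<And>c. c \<in> {?c, ?d} ==> mprim (Idl (c \<union> set ws))"
  using generic_parameters[of "{?c, ?d}" k] by blast
 have prim: "mprim (Idl (set (us @ v # ws)))" if "v = x \<or> v = y" for v
 proof -
  have S: "set (us @ [v]) <= carrier R" "set ws <= carrier R" using sub ws that m_carr by auto
  have "mprim (Idl (Idl (set (us @ [v])) \<union> set ws))" using ws(3) that by auto
  thus ?thesis using Idl_Un_Idl[OF S] by simp
 qed
 have "Q ((us @ [x]) @ ws)"
  by (rule Suc.IH[of xs' ws]) (use Suc(8) xs Suc(6) sub ws prim in auto)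
 hence "Q (us @ y # ws)"
  using exch[of us x ws y] sub ws prim by auto
 hence "Q ((us @ [y]) @ ws)" by simp
 hence "Q ((us @ [y]) @ ys')"
  by (intro Suc.IH[of ws ys' "us @ [y]"]) (use ys Suc(7) sub ws prim in auto)
 thus ?case using ys by simp
qed

end

section \<open>Vectors\<close>

context cring
begin

text \<open>Vectors and rows of matrices are total functions into the carrier; lengths are passed to
  \<open>dot\<close> separately, and entries beyond them do not count.\<close>

definition tot :: "(nat => 'a) => bool"
 where "tot v \<longleftrightarrow> (\<forall>i. v i \<in> carrier R)"

primrec dot :: "nat => (nat => 'a) => (nat => 'a) => 'a" where
 "dot 0 u v = \<zero>"
| "dot (Suc n) u v = dot n u v \<oplus> u n \<otimes> v n"

lemma totI: "(\<And>i. v i \<in> carrier R) ==> tot v"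
 and totD: "tot v ==> v i \<in> carrier R"
 by (simp_all add: tot_def)

lemma dot_closed [simp]: "tot u ==> tot v ==> dot n u v \<in> carrier R"
 by (induction n) (auto simp: tot_def)

lemma dot_cong: "(\<And>i. i < n ==> u i = u' i) ==> (\<And>i. i < n ==> v i = v' i) ==> dot n u v = dot n u' v'"
 by (induction n) auto

lemma dot_comm: "tot u ==> tot v ==> dot n u v = dot n v u"
 by (induction n) (auto simp: tot_def m_comm)

lemma dot_add: "tot u ==> tot u' ==> tot v ==> dot n (%i. u i \<oplus> u' i) v = dot n u v \<oplus> dot n u' v"
proof (induction n)
 case (Suc n)
 have c: "dot n u v \<in> carrier R" "dot n u' v \<in> carrier R" "u n \<in> carrier R" "u' n \<in> carrier R" "v n \<in> carrier R"
  using Suc by (auto simp: totD)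
 have "dot (Suc n) (%i. u i \<oplus> u' i) v = (dot n u v \<oplus> dot n u' v) \<oplus> (u n \<oplus> u' n) \<otimes> v n" using Suc by simp
 also have "\<dots> = (dot n u v \<oplus> u n \<otimes> v n) \<oplus> (dot n u' v \<oplus> u' n \<otimes> v n)" using c by algebra
 finally show ?case by simp
qed simp

lemma dot_smult: "a \<in> carrier R ==> tot u ==> tot v ==> dot n (%i. a \<otimes> u i) v = a \<otimes> dot n u v"
proof (induction n)
 case (Suc n)
 have c: "dot n u v \<in> carrier R" "u n \<in> carrier R" "v n \<in> carrier R" using Suc by (auto simp: totD)
 have "dot (Suc n) (%i. a \<otimes> u i) v = a \<otimes> dot n u v \<oplus> (a \<otimes> u n) \<otimes> v n" using Suc by simp
 also have "\<dots> = a \<otimes> (dot n u v \<oplus> u n \<otimes> v n)" using c Suc(2) by algebra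
 finally show ?case by simp
qed simp

lemma tot_smult: "a \<in> carrier R ==> tot u ==> tot (%i. a \<otimes> u i)"
 and tot_add: "tot u ==> tot v ==> tot (%i. u i \<oplus> v i)"
 and tot_minus: "tot u ==> tot v ==> tot (%i. u i \<ominus> v i)"
 and tot_zero: "tot (%i. \<zero>)"
 and tot_pow: "tot u ==> tot (%i. u i [^] (n::nat))"
 and tot_delta: "tot (%i. if i = j then \<one> else \<zero>)"
 by (auto simp: tot_def)

lemma dot_minus:
 assumes "tot u" "tot u'" "tot v"
 shows "dot n (%i. u i \<ominus> u' i) v = dot n u v \<ominus> dot n u' v"
proof -
 have "dot n (%i. u i \<ominus> u' i) v = dot n (%i. u i \<oplus> (\<ominus> \<one>) \<otimes> u' i) v"
  by (rule dot_cong) (use assms in \<open>auto simp: totD minus_eq l_minus\<close>)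
 also have "\<dots> = dot n u v \<oplus> (\<ominus> \<one>) \<otimes> dot n u' v"
  using dot_add[OF assms(1) tot_smult[OF _ assms(2)] assms(3), of "\<ominus> \<one>"] dot_smult[OF _ assms(2,3), of "\<ominus> \<one>"] by simp
 also have "\<dots> = dot n u v \<ominus> dot n u' v" using assms by (simp add: minus_eq l_minus)
 finally show ?thesis .
qed

lemma dot_zero: "tot v ==> dot n (%i. \<zero>) v = \<zero>"
 by (induction n) (auto simp: tot_def)

lemma tot_dot: "(\<And>j. tot (D j)) ==> tot w ==> tot (%j. dot n (D j) w)"
 "tot u ==> (\<And>i. tot (D i)) ==> tot (%j. dot n u (%i. D i j))"
 by (auto simp: tot_def intro!: dot_closed)

lemma tot_col: "(\<And>i. tot (D i)) ==> tot (%i. D i j)"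
 by (simp add: tot_def)

lemma dot_dot:
 assumes "tot u" "\<And>i. tot (D i)" "tot w"
 shows "dot n u (%i. dot k (D i) w) = dot k (%j. dot n u (%i. D i j)) w"
proof (induction n)
 case 0 show ?case using assms by (simp add: dot_zero)
next
 case (Suc n)
 have "dot k (%j. dot (Suc n) u (%i. D i j)) w = dot k (%j. dot n u (%i. D i j) \<oplus> u n \<otimes> D n j) w" by simp
 also have "\<dots> = dot k (%j. dot n u (%i. D i j)) w \<oplus> dot k (%j. u n \<otimes> D n j) w"
  by (rule dot_add) (use assms tot_dot(2) tot_smult in \<open>auto simp: totD\<close>)
 also have "dot k (%j. u n \<otimes> D n j) w = u n \<otimes> dot k (D n) w"
  by (rule dot_smult) (use assms in \<open>auto simp: totD\<close>)
 finally show ?case using Suc by simp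
qed

lemma dot_ideal:
 assumes I: "ideal I R" and "tot u" "\<And>i. i < n ==> v i \<in> I"
 shows "dot n u v \<in> I"
 using assms(3)
proof (induction n)
 case 0 show ?case using ideal_zero[OF I] by simp
next
 case (Suc n)
 show ?case using ideal_add[OF I Suc.IH[OF Suc(2)] ideal_mult[OF I Suc(2)[of n] totD[OF assms(2)]]] by simp
qed

lemma dot_ideal':
 assumes I: "ideal I R" and "tot v" "\<And>i. i < n ==> u i \<in> I"
 shows "dot n u v \<in> I"
 using assms(3)
proof (induction n)
 case 0 show ?case using ideal_zero[OF I] by simp
next
 case (Suc n)
 show ?case using ideal_add[OF I Suc.IH[OF Suc(2)] ideal_mult'[OF I Suc(2)[of n] totD[OF assms(2)]]] by simp
qed

lemma dot_delta:
 assumes "tot v" "j < n"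
 shows "dot n (%i. if i = j then \<one> else \<zero>) v = v j"
 using assms(2)
proof (induction n)
 case (Suc n)
 show ?case
 proof (cases "j = n")
  case True
  have "dot n (%i. if i = j then \<one> else \<zero>) v = dot n (%i. \<zero>) v" by (rule dot_cong) (use True in auto)
  thus ?thesis using True assms(1) by (simp add: dot_zero totD)
 next
  case False
  thus ?thesis using Suc assms(1) by (simp add: totD)
 qed
qed simp

text \<open>The submodule H of R x R, read as a relation, makes U(L)/U(B) a subquotient of L/B,
  where U(A) denotes the elements related to some element of A. An ideal V is sent to the elements
  of L congruent modulo B to something related to V; V is recovered from this because it contains
  U(B).\<close>

lemma relation_colen:
 assumes H: "H <= carrier R \<times> carrier R" "(\<zero>, \<zero>) \<in> H"
  "\<And>a v b w. (a, v) \<in> H ==> (b, w) \<in> H ==> (a \<oplus> b, v \<oplus> w) \<in> H"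
  "\<And>a v r. (a, v) \<in> H ==> r \<in> carrier R ==> (r \<otimes> a, r \<otimes> v) \<in> H"
  and BL: "ideal B R" "ideal L R" "B <= L" "fincolen B"
  and fin: "fincolen {a. \<exists>v\<in>B. (a, v) \<in> H}"
 shows "colen {a. \<exists>v\<in>B. (a, v) \<in> H} + colen L \<le> colen {a. \<exists>v\<in>L. (a, v) \<in> H} + colen B"
proof -
 let ?U = "%A. {a. \<exists>v\<in>A. (a, v) \<in> H}"
 have U: "ideal (?U A) R" if A: "ideal A R" for A
 proof (rule ideal_intro)
  show "?U A <= carrier R" using H(1) by blast
  show "\<zero> \<in> ?U A" using H(2) ideal_zero[OF A] by blast
  fix a b assume "a \<in> ?U A" "b \<in> ?U A"
  then obtain v w where "v \<in> A" "(a, v) \<in> H" "w \<in> A" "(b, w) \<in> H" by blast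
  thus "a \<oplus> b \<in> ?U A" using H(3) ideal_add[OF A] by blast
 next
  fix a r assume "a \<in> ?U A" "r \<in> carrier R"
  then obtain v where "v \<in> A" "(a, v) \<in> H" by blast
  thus "r \<otimes> a \<in> ?U A" using H(4) ideal_mult[OF A] \<open>r \<in> carrier R\<close> by blast
 qed
 define T where "T V = {w \<in> L. \<exists>r\<in>V. \<exists>v. (r, v) \<in> H \<and> w \<ominus> v \<in> B}" for V
 have Hc: "a \<in> carrier R" "v \<in> carrier R" if "(a, v) \<in> H" for a v using H(1) that by auto
 have TI: "ideal (T V) R" if V: "ideal V R" for V
 proof (rule ideal_intro)
  show "T V <= carrier R" using ideal_carr[OF BL(2)] unfolding T_def by blast
  have "\<zero> \<ominus> \<zero> \<in> B" using ideal_zero[OF BL(1)] by (simp add: minus_eq)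
  thus "\<zero> \<in> T V" using H(2) ideal_zero[OF V] ideal_zero[OF BL(2)] unfolding T_def by blast
  fix a b assume a: "a \<in> T V" and b: "b \<in> T V"
  obtain r v where r: "a \<in> L" "r \<in> V" "(r, v) \<in> H" "a \<ominus> v \<in> B" using a unfolding T_def by blast
  obtain s w where s: "b \<in> L" "s \<in> V" "(s, w) \<in> H" "b \<ominus> w \<in> B" using b unfolding T_def by blast
  have "(a \<oplus> b) \<ominus> (v \<oplus> w) = (a \<ominus> v) \<oplus> (b \<ominus> w)"
   using Hc(2)[OF r(3)] Hc(2)[OF s(3)] ideal_carr[OF BL(2) r(1)] ideal_carr[OF BL(2) s(1)] by algebra
  hence "(a \<oplus> b) \<ominus> (v \<oplus> w) \<in> B" using ideal_add[OF BL(1) r(4) s(4)] by simp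
  thus "a \<oplus> b \<in> T V"
   using H(3)[OF r(3) s(3)] ideal_add[OF V r(2) s(2)] ideal_add[OF BL(2) r(1) s(1)] unfolding T_def by blast
 next
  fix a x assume a: "a \<in> T V" and x: "x \<in> carrier R"
  obtain r v where r: "a \<in> L" "r \<in> V" "(r, v) \<in> H" "a \<ominus> v \<in> B" using a unfolding T_def by blast
  have "x \<otimes> a \<ominus> x \<otimes> v = x \<otimes> (a \<ominus> v)"
   using Hc(2)[OF r(3)] ideal_carr[OF BL(2) r(1)] x by algebra
  hence "x \<otimes> a \<ominus> x \<otimes> v \<in> B" using ideal_mult[OF BL(1) r(4) x] by simp
  thus "x \<otimes> a \<in> T V"
   using H(4)[OF r(3) x] ideal_mult[OF V r(2) x] ideal_mult[OF BL(2) r(1) x] unfolding T_def by blast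
 qed
 have "finlen (?U B) (?U L) \<and> len (?U B) (?U L) \<le> len B L"
 proof (rule len_transfer[where T = T])
  show "finlen B L" using colen_diff(1)[OF BL(4,1,2,3)] .
  show "ideal (?U B) R" using U[OF BL(1)] .
  show "?U B <= ?U L" using BL(3) by blast
  fix V assume V: "ideal V R" "?U B <= V" "V <= ?U L"
  have "b \<in> T V" if b: "b \<in> B" for b
  proof -
   have "b \<ominus> \<zero> = b" using ideal_carr[OF BL(1) b] by algebra
   thus ?thesis using H(2) ideal_zero[OF V(1)] BL(3) b unfolding T_def by force
  qed
  thus "ideal (T V) R \<and> B <= T V \<and> T V <= L" using TI[OF V(1)] unfolding T_def by blast
 next
  fix V W assume V: "ideal V R" and W: "ideal W R" and sub: "?U B <= V" "V \<subset> W" "W <= ?U L"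
  have "T V <= T W" using sub(2) unfolding T_def by blast
  moreover have "T V \<noteq> T W"
  proof
   assume eq: "T V = T W"
   have "W <= V"
   proof
    fix r assume r: "r \<in> W"
    then obtain v where v: "v \<in> L" "(r, v) \<in> H" using sub(3) by blast
    have "v \<ominus> v \<in> B" using Hc(2)[OF v(2)] ideal_zero[OF BL(1)] by (simp add: minus_eq r_neg)
    hence "v \<in> T V" using v r eq unfolding T_def by blast
    then obtain s w where s: "s \<in> V" "(s, w) \<in> H" "v \<ominus> w \<in> B" unfolding T_def by blast
    have c: "r \<in> carrier R" "v \<in> carrier R" "s \<in> carrier R" "w \<in> carrier R" using Hc v s by auto
    have "(r \<oplus> (\<ominus> \<one>) \<otimes> s, v \<oplus> (\<ominus> \<one>) \<otimes> w) \<in> H" using H(3)[OF v(2) H(4)[OF s(2), of "\<ominus> \<one>"]] by simp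
    moreover have "v \<oplus> (\<ominus> \<one>) \<otimes> w = v \<ominus> w" "r \<oplus> (\<ominus> \<one>) \<otimes> s = r \<ominus> s" using c by algebra+
    ultimately have "r \<ominus> s \<in> ?U B" using s(3) by auto
    thus "r \<in> V" using ideal_minus_cancel[OF V s(1) c(1)] sub(1) by blast
   qed
   thus False using sub(2) by blast
  qed
  ultimately show "T V \<subset> T W" by blast
 qed
 hence "len (?U B) (?U L) \<le> len B L" by blast
 moreover have "colen (?U B) = len (?U B) (?U L) + colen (?U L)"
  using colen_diff(2)[OF fin U[OF BL(1)] U[OF BL(2)]] BL(3) by blast
 moreover have "colen B = len B L + colen L" using colen_diff(2)[OF BL(4,1,2,3)] .
 ultimately show ?thesis by linarith
qed

text \<open>The ideal of all \<open>r\<close> for which \<open>r \<phi>\<close> lies in the row space of \<open>E\<close> modulo the ideals \<open>A k\<close>.\<close>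

definition urow :: "nat => nat => (nat => nat => 'a) => (nat => 'a) => (nat => 'a set) => 'a set"
 where "urow n0 n1 E \<phi> A = {r \<in> carrier R. \<exists>\<rho>. tot \<rho> \<and> (\<forall>k<n1. r \<otimes> \<phi> k \<ominus> dot n0 \<rho> (%l. E l k) \<in> A k)}"

lemma urow_add:
 assumes "tot \<phi>" "\<And>l. tot (E l)" "ideal I R" "r \<in> carrier R" "r' \<in> carrier R" "tot \<rho>" "tot \<rho>'"
 shows "(r \<oplus> r') \<otimes> \<phi> k \<ominus> dot n (%i. \<rho> i \<oplus> \<rho>' i) (%l. E l k) =
  (r \<otimes> \<phi> k \<ominus> dot n \<rho> (%l. E l k)) \<oplus> (r' \<otimes> \<phi> k \<ominus> dot n \<rho>' (%l. E l k))"
proof -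
 have c: "dot n \<rho> (%l. E l k) \<in> carrier R" "dot n \<rho>' (%l. E l k) \<in> carrier R" "\<phi> k \<in> carrier R"
  using assms tot_col by (auto simp: totD)
 have "(r \<oplus> r') \<otimes> z \<ominus> (x \<oplus> y) = (r \<otimes> z \<ominus> x) \<oplus> (r' \<otimes> z \<ominus> y)" if "x \<in> carrier R" "y \<in> carrier R" "z \<in> carrier R" for x y z
  using that assms(4,5) by algebra
 from this[OF c] show ?thesis unfolding dot_add[OF assms(6,7) tot_col[of E, OF assms(2)]] .
qed

lemma urow_smult:
 assumes "tot \<phi>" "\<And>l. tot (E l)" "ideal I R" "r \<in> carrier R" "a \<in> carrier R" "tot \<rho>"
 shows "(a \<otimes> r) \<otimes> \<phi> k \<ominus> dot n (%i. a \<otimes> \<rho> i) (%l. E l k) = a \<otimes> (r \<otimes> \<phi> k \<ominus> dot n \<rho> (%l. E l k))"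
proof -
 have c: "dot n \<rho> (%l. E l k) \<in> carrier R" "\<phi> k \<in> carrier R" using assms tot_col by (auto simp: totD)
 have "(a \<otimes> r) \<otimes> z \<ominus> a \<otimes> x = a \<otimes> (r \<otimes> z \<ominus> x)" if "x \<in> carrier R" "z \<in> carrier R" for x z
  using that assms(4,5) by algebra
 from this[OF c] show ?thesis unfolding dot_smult[OF assms(5,6) tot_col[of E, OF assms(2)]] .
qed

lemma urow_ideal:
 assumes \<phi>: "tot \<phi>" and E: "\<And>l. tot (E l)" and A: "\<And>k. ideal (A k) R"
 shows "ideal (urow n0 n1 E \<phi> A) R"
proof (rule ideal_intro)
 show "urow n0 n1 E \<phi> A <= carrier R" by (auto simp: urow_def)
 have "\<zero> \<otimes> \<phi> k \<ominus> dot n0 (%i. \<zero>) (%l. E l k) \<in> A k" for k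
  using dot_zero[OF tot_col[of E, OF E]] totD[OF \<phi>] ideal_zero[OF A] by (simp add: minus_eq)
 thus "\<zero> \<in> urow n0 n1 E \<phi> A" using tot_zero unfolding urow_def by blast
 fix a b assume "a \<in> urow n0 n1 E \<phi> A" "b \<in> urow n0 n1 E \<phi> A"
 then obtain \<rho> \<rho>' where *: "a \<in> carrier R" "tot \<rho>" "b \<in> carrier R" "tot \<rho>'"
  "\<forall>k<n1. a \<otimes> \<phi> k \<ominus> dot n0 \<rho> (%l. E l k) \<in> A k" "\<forall>k<n1. b \<otimes> \<phi> k \<ominus> dot n0 \<rho>' (%l. E l k) \<in> A k"
  unfolding urow_def by blast
 have "\<forall>k<n1. (a \<oplus> b) \<otimes> \<phi> k \<ominus> dot n0 (%i. \<rho> i \<oplus> \<rho>' i) (%l. E l k) \<in> A k"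
  unfolding urow_add[OF \<phi> E A *(1,3,2,4)] using *(5,6) ideal_add[OF A] by blast
 thus "a \<oplus> b \<in> urow n0 n1 E \<phi> A" using *(1,3) tot_add[OF *(2,4)] unfolding urow_def by blast
next
 fix a r assume "a \<in> urow n0 n1 E \<phi> A" and r: "r \<in> carrier R"
 then obtain \<rho> where *: "a \<in> carrier R" "tot \<rho>" "\<forall>k<n1. a \<otimes> \<phi> k \<ominus> dot n0 \<rho> (%l. E l k) \<in> A k"
  unfolding urow_def by blast
 have "\<forall>k<n1. (r \<otimes> a) \<otimes> \<phi> k \<ominus> dot n0 (%i. r \<otimes> \<rho> i) (%l. E l k) \<in> A k"
  unfolding urow_smult[OF \<phi> E A *(1) r *(2)] using *(3) ideal_mult[OF A _ r] by blast
 thus "r \<otimes> a \<in> urow n0 n1 E \<phi> A" using *(1) r tot_smult[OF r *(2)] unfolding urow_def by blast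
qed

lemma urow_sup:
 assumes \<phi>: "tot \<phi>" and E: "\<And>l. tot (E l)" and B: "ideal B R" and A: "\<And>k. B <= A k"
 shows "B <= urow n0 n1 E \<phi> A"
proof
 fix r assume r: "r \<in> B"
 have rc: "r \<in> carrier R" using ideal_carr[OF B r] .
 have "r \<otimes> \<phi> k \<ominus> dot n0 (%i. \<zero>) (%l. E l k) = r \<otimes> \<phi> k" for k
  using dot_zero[OF tot_col[of E, OF E]] totD[OF \<phi>] rc by (simp add: minus_eq)
 hence "r \<otimes> \<phi> k \<ominus> dot n0 (%i. \<zero>) (%l. E l k) \<in> A k" for k
  using ideal_mult'[OF B r totD[OF \<phi>]] A by auto
 thus "r \<in> urow n0 n1 E \<phi> A" using rc tot_zero unfolding urow_def by blast
qed

text \<open>The pairs of r and its remainder in coordinate j form a relation to which the length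
  comparison applies; the conditions on all other coordinates are built into the relation.\<close>

lemma urow_step:
 assumes \<phi>: "tot \<phi>" and E: "\<And>l. tot (E l)" and BL: "ideal B R" "ideal L R" "B <= L" "fincolen B" and j: "j < n1"
  and A: "\<And>k. ideal (A k) R" "\<And>k. B <= A k"
 shows "colen (urow n0 n1 E \<phi> (A(j := B))) + colen L \<le> colen (urow n0 n1 E \<phi> (A(j := L))) + colen B"
proof -
 let ?f = "%r \<rho> k. r \<otimes> \<phi> k \<ominus> dot n0 \<rho> (%l. E l k)"
 let ?H = "{(r, v). r \<in> carrier R \<and> (\<exists>\<rho>. tot \<rho> \<and> v = ?f r \<rho> j \<and> (\<forall>k<n1. k \<noteq> j --> ?f r \<rho> k \<in> A k))}"
 have fc: "?f r \<rho> k \<in> carrier R" if "r \<in> carrier R" "tot \<rho>" for r \<rho> k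
  using that \<phi> tot_col[of E, OF E] by (simp add: totD)
 have eq: "urow n0 n1 E \<phi> (A(j := Y)) = {a. \<exists>v\<in>Y. (a, v) \<in> ?H}" for Y
 proof (intro subset_antisym subsetI)
  fix r assume "r \<in> urow n0 n1 E \<phi> (A(j := Y))"
  then obtain \<rho> where \<rho>: "r \<in> carrier R" "tot \<rho>" "\<forall>k<n1. ?f r \<rho> k \<in> (A(j := Y)) k" unfolding urow_def by blast
  have "?f r \<rho> j \<in> Y" using \<rho>(3) j by auto
  moreover have "\<forall>k<n1. k \<noteq> j --> ?f r \<rho> k \<in> A k" using \<rho>(3) by auto
  ultimately show "r \<in> {a. \<exists>v\<in>Y. (a, v) \<in> ?H}" using \<rho>(1,2) by blast
 next
  fix r assume "r \<in> {a. \<exists>v\<in>Y. (a, v) \<in> ?H}"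
  then obtain \<rho> where \<rho>: "r \<in> carrier R" "tot \<rho>" "?f r \<rho> j \<in> Y" "\<forall>k<n1. k \<noteq> j --> ?f r \<rho> k \<in> A k" by blast
  hence "\<forall>k<n1. ?f r \<rho> k \<in> (A(j := Y)) k" by simp
  thus "r \<in> urow n0 n1 E \<phi> (A(j := Y))" using \<rho>(1,2) unfolding urow_def by blast
 qed
 have z: "?f \<zero> (%i. \<zero>) k = \<zero>" for k
  using dot_zero[OF tot_col[of E, OF E]] totD[OF \<phi>] by (simp add: minus_eq)
 show ?thesis unfolding eq
 proof (rule relation_colen[OF _ _ _ _ BL])
  show "?H <= carrier R \<times> carrier R" using fc by auto
  have "?f \<zero> (%i. \<zero>) k \<in> A k" for k unfolding z using ideal_zero[OF A(1)] .
  thus "(\<zero>, \<zero>) \<in> ?H" using z[of j, symmetric] tot_zero by blast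
  show "(a \<oplus> b, v \<oplus> w) \<in> ?H" if a: "(a, v) \<in> ?H" and b: "(b, w) \<in> ?H" for a v b w
  proof -
   obtain \<rho> where \<rho>: "a \<in> carrier R" "tot \<rho>" "v = ?f a \<rho> j" "\<forall>k<n1. k \<noteq> j --> ?f a \<rho> k \<in> A k" using a by blast
   obtain \<rho>' where \<rho>': "b \<in> carrier R" "tot \<rho>'" "w = ?f b \<rho>' j" "\<forall>k<n1. k \<noteq> j --> ?f b \<rho>' k \<in> A k" using b by blast
   note ad = urow_add[OF \<phi> E A(1) \<rho>(1) \<rho>'(1) \<rho>(2) \<rho>'(2), of _ n0]
   have "v \<oplus> w = ?f (a \<oplus> b) (%i. \<rho> i \<oplus> \<rho>' i) j" unfolding ad \<rho>(3) \<rho>'(3) ..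
   moreover have "\<forall>k<n1. k \<noteq> j --> ?f (a \<oplus> b) (%i. \<rho> i \<oplus> \<rho>' i) k \<in> A k"
    unfolding ad using \<rho>(4) \<rho>'(4) ideal_add[OF A(1)] by blast
   ultimately show ?thesis using \<rho>(1) \<rho>'(1) tot_add[OF \<rho>(2) \<rho>'(2)] by blast
  qed
  show "(r \<otimes> a, r \<otimes> v) \<in> ?H" if a: "(a, v) \<in> ?H" and r: "r \<in> carrier R" for a v r
  proof -
   obtain \<rho> where \<rho>: "a \<in> carrier R" "tot \<rho>" "v = ?f a \<rho> j" "\<forall>k<n1. k \<noteq> j --> ?f a \<rho> k \<in> A k" using a by blast
   note sm = urow_smult[OF \<phi> E A(1) \<rho>(1) r \<rho>(2), of _ n0]
   have "r \<otimes> v = ?f (r \<otimes> a) (%i. r \<otimes> \<rho> i) j" unfolding sm \<rho>(3) ..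
   moreover have "\<forall>k<n1. k \<noteq> j --> ?f (r \<otimes> a) (%i. r \<otimes> \<rho> i) k \<in> A k"
    unfolding sm using \<rho>(4) ideal_mult[OF A(1) _ r] by blast
   ultimately show ?thesis using \<rho>(1) r tot_smult[OF r \<rho>(2)] by blast
  qed
  have "B <= urow n0 n1 E \<phi> (A(j := B))" by (rule urow_sup[OF \<phi> E BL(1)]) (use A(2) in auto)
  thus "fincolen {a. \<exists>v\<in>B. (a, v) \<in> ?H}" unfolding eq[symmetric] using fincolen_mono[OF BL(4)] by blast
 qed
qed

text \<open>The n1 coordinates are relaxed from B to L one at a time, and each costs at most colen B
  - colen L.\<close>

lemma urow_colen:
 assumes \<phi>: "tot \<phi>" and E: "\<And>l. tot (E l)" and BL: "ideal B R" "ideal L R" "B <= L" "fincolen B"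
 shows "colen (urow n0 n1 E \<phi> (%k. B)) + n1 * colen L \<le> colen (urow n0 n1 E \<phi> (%k. L)) + n1 * colen B"
proof -
 let ?U = "%j. urow n0 n1 E \<phi> (%k. if k < j then B else L)"
 have "colen (?U j) + j * colen L \<le> colen (?U 0) + j * colen B" if "j \<le> n1" for j
  using that
 proof (induction j)
  case (Suc j)
  have "(%k. if k < j then B else L)(j := L) = (%k. if k < j then B else L)"
   "(%k. if k < j then B else L)(j := B) = (%k. if k < Suc j then B else L)" by (auto simp: fun_eq_iff)
  hence "colen (?U (Suc j)) + colen L \<le> colen (?U j) + colen B"
   using urow_step[OF \<phi> E BL, of j n1 "%k. if k < j then B else L" n0] Suc(2) BL by simp
  thus ?case using Suc by simp
 qed simp
 moreover have "?U n1 = urow n0 n1 E \<phi> (%k. B)" unfolding urow_def by auto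
 ultimately show ?thesis by fastforce
qed

end

section \<open>The ladder\<close>

context ncharp
begin

lemma frobenius_dot:
 assumes "tot u" "tot v"
 shows "dot n u v [^] (p ^ e) = dot n (%i. u i [^] (p ^ e)) (%i. v i [^] (p ^ e))"
 by (induction n) (use assms in \<open>simp_all add: frobenius_zero frobenius totD nat_pow_distrib\<close>)

text \<open>Write r \<psi>^q = \<rho> D^q + y^q \<sigma> modulo lim(y^(pq), as^q) and multiply by
  D'^q. The term with D disappears since Frobenius powers of a complex form a complex, and \<psi>^q
  D'^q is y^q \<psi>'^q modulo as^q. Cancelling y^q leaves r \<psi>'^q = \<sigma> D'^q modulo a
  limit closure.\<close>

lemma ladder_step:
 assumes c: "ideal c R" "set as <= carrier R" "y \<in> carrier R"
  and tot: "tot \<psi>" "tot \<psi>'" "\<And>l. tot (D l)" "\<And>l. tot (D' l)"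
  and complex: "\<And>j k. j < n0 ==> k < n2 ==> dot n1 (D j) (%l. D' l k) = \<zero>"
  and step: "\<And>k. k < n2 ==> y \<otimes> \<psi>' k \<ominus> dot n1 \<psi> (%l. D' l k) \<in> Idl (set as)"
  and q: "q = p ^ e"
 shows "urow n0 n1 (%l k. D l k [^] q) (%k. \<psi> k [^] q) (%k. Idl (insert (y [^] q) (lim c (y [^] (p * q) # pw q as))))
  <= urow n1 n2 (%l k. D' l k [^] q) (%k. \<psi>' k [^] q) (%k. lim c (y [^] q # pw q as))"
proof
 let ?M = "lim c (y [^] (p * q) # pw q as)"
 have Mc: "set (y [^] n # pw q as) <= carrier R" for n :: nat using c by auto
 note M = lim_ideal[OF c(1) Mc[of "p * q"]]
 have yq: "y [^] q \<in> carrier R" using c by simp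
 have T: "tot (%k. \<psi> k [^] q)" "tot (%k. \<psi>' k [^] q)" "tot (%k. D l k [^] q)" "tot (%k. D' l k [^] q)" for l
  using tot by (auto intro!: tot_pow)
 have TC: "tot (%l. D l k [^] q)" "tot (%l. D' l k [^] q)" for k using T(3,4) by (auto simp: tot_def)
 fix r assume "r \<in> urow n0 n1 (%l k. D l k [^] q) (%k. \<psi> k [^] q) (%k. Idl (insert (y [^] q) ?M))"
 then obtain \<rho> where \<rho>: "r \<in> carrier R" "tot \<rho>"
  "\<And>k. k < n1 ==> r \<otimes> \<psi> k [^] q \<ominus> dot n0 \<rho> (%l. D l k [^] q) \<in> Idl (insert (y [^] q) ?M)" unfolding urow_def by blast
 let ?w = "%k. r \<otimes> \<psi> k [^] q \<ominus> dot n0 \<rho> (%l. D l k [^] q)"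
 have tl: "tot ?w" using \<rho> T TC by (auto simp: tot_def)
 have "\<exists>s. s \<in> carrier R \<and> (k < n1 --> ?w k \<ominus> s \<otimes> y [^] q \<in> ?M)" for k
 proof (cases "k < n1")
  case True
  from \<rho>(3)[OF True] ideal_sub[OF M] yq obtain s where "s \<in> carrier R" "?w k \<ominus> s \<otimes> y [^] q \<in> Idl ?M" by (rule Idl_insertE')
  thus ?thesis using Idl_ideal[OF M] by auto
 next
  case False thus ?thesis by auto
 qed
 \<comment> \<open>\<sigma> is the quotient of the remainder by y^q and becomes the coefficient row
   one level higher.\<close>
 then obtain \<sigma> where \<sigma>: "\<And>k. \<sigma> k \<in> carrier R" "\<And>k. k < n1 ==> ?w k \<ominus> \<sigma> k \<otimes> y [^] q \<in> ?M" by metis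
 have ts: "tot \<sigma>" using \<sigma>(1) by (rule totI)
 have "r \<otimes> \<psi>' k [^] q \<ominus> dot n1 \<sigma> (%l. D' l k [^] q) \<in> lim c (y [^] q # pw q as)" if k: "k < n2" for k
 proof -
  let ?d = "dot n1 (%l. \<psi> l [^] q) (%l. D' l k [^] q)" and ?s = "dot n1 \<sigma> (%l. D' l k [^] q)"
  have cc: "\<psi>' k [^] q \<in> carrier R" "?d \<in> carrier R" "?s \<in> carrier R" using T(1) TC ts totD[OF T(2), of k] by auto
  have "(y \<otimes> \<psi>' k \<ominus> dot n1 \<psi> (%l. D' l k)) [^] (p ^ e) \<in> Idl (c \<union> set (pw (1 * p ^ e) as))"
  proof (rule frobenius_pw[OF c(1,2)])
   have "Idl (set as) <= Idl (c \<union> set (pw 1 as))" using Idl_pw_carr[OF c(1,2), of 1] pw_1[OF c(2)] by (intro Idl_mono) auto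
   thus "y \<otimes> \<psi>' k \<ominus> dot n1 \<psi> (%l. D' l k) \<in> Idl (c \<union> set (pw 1 as))" using step[OF k] by blast
  qed
  moreover have "(y \<otimes> \<psi>' k \<ominus> dot n1 \<psi> (%l. D' l k)) [^] (p ^ e) = y [^] q \<otimes> \<psi>' k [^] q \<ominus> ?d"
   using frobenius_minus[of "y \<otimes> \<psi>' k" "dot n1 \<psi> (%l. D' l k)" e] frobenius_dot[OF tot(1) tot_col[of D', OF tot(4)]]
    tot c tot_col[of D', OF tot(4)] q by (simp add: totD nat_pow_distrib)
  moreover have "Idl (c \<union> set (pw (1 * p ^ e) as)) <= Idl (c \<union> set (y [^] (p * q) # pw q as))"
   by (rule Idl_mono) (use Mc[of "p * q"] ideal_sub[OF c(1)] q in auto)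
  ultimately have 1: "y [^] q \<otimes> \<psi>' k [^] q \<ominus> ?d \<in> ?M" using lim_sup[OF c(1) Mc[of "p * q"]] by auto
  have "dot n1 (%l. ?w l \<ominus> y [^] q \<otimes> \<sigma> l) (%l. D' l k [^] q) \<in> ?M"
   by (rule dot_ideal'[OF M TC(2)]) (use \<sigma> m_comm yq in auto)
  hence 2: "dot n1 ?w (%l. D' l k [^] q) \<ominus> y [^] q \<otimes> ?s \<in> ?M"
   using dot_minus[OF tl tot_smult[OF yq ts] TC(2)] dot_smult[OF yq ts TC(2)] by simp
  have "dot n1 (%l. dot n0 \<rho> (%j. D j l [^] q)) (%l. D' l k [^] q) = dot n0 \<rho> (%j. dot n1 (%l. D j l [^] q) (%l. D' l k [^] q))"
   using dot_dot[OF \<rho>(2) T(3) TC(2)] by simp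
  also have "\<dots> = dot n0 \<rho> (%j. \<zero>)"
  proof (rule dot_cong)
   fix j assume "j < n0"
   hence "dot n1 (D j) (%l. D' l k) [^] (p ^ e) = \<zero>" using complex k frobenius_zero by simp
   thus "dot n1 (%l. D j l [^] q) (%l. D' l k [^] q) = \<zero>" using frobenius_dot[OF tot(3) tot_col[of D', OF tot(4)]] q by simp
  qed simp
  also have "\<dots> = \<zero>" using dot_comm[OF \<rho>(2) tot_zero] dot_zero[OF \<rho>(2)] by simp
  finally have "dot n1 ?w (%l. D' l k [^] q) = r \<otimes> ?d"
   using dot_minus[OF tot_smult[OF \<rho>(1) T(1)] _ TC(2), of "%k. dot n0 \<rho> (%l. D l k [^] q)"] dot_smult[OF \<rho>(1) T(1) TC(2)]
    tot_dot(2)[OF \<rho>(2) T(3)] \<rho>(1) cc by (simp add: minus_eq)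
  hence 2: "r \<otimes> ?d \<ominus> y [^] q \<otimes> ?s \<in> ?M" using 2 by simp
  have "(r \<otimes> g \<ominus> t) \<otimes> h = r \<otimes> (h \<otimes> g \<ominus> d) \<oplus> (r \<otimes> d \<ominus> h \<otimes> t)"
   if "g \<in> carrier R" "d \<in> carrier R" "t \<in> carrier R" "h \<in> carrier R" for g d t h
   using that \<rho>(1) by algebra
  from this[OF cc yq] have "(r \<otimes> \<psi>' k [^] q \<ominus> ?s) \<otimes> y [^] q = r \<otimes> (y [^] q \<otimes> \<psi>' k [^] q \<ominus> ?d) \<oplus> (r \<otimes> ?d \<ominus> y [^] q \<otimes> ?s)" .
  also have "\<dots> \<in> ?M" using ideal_add[OF M ideal_mult[OF M 1 \<rho>(1)] 2] .
  finally have 3: "(r \<otimes> \<psi>' k [^] q \<ominus> ?s) \<otimes> y [^] q \<in> ?M" .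
  \<comment> \<open>Cancelling y^q turns the exponent p q into (p - 1) q, which is still at least q
    as p >= 2. The exponent p q in the error ideal also matches the next Frobenius level, where its
    colength is compared.\<close>
  have pq: "p * q = (p - 1) * q + q" "0 < (p - 1) * q" "0 < q" "q \<le> (p - 1) * q"
  proof -
   obtain t where t: "p - 1 = Suc t" using p_gt_1 by (cases "p - 1") auto
   show q0: "0 < q" using p_pow_pos[of e] q by simp
   show "q \<le> (p - 1) * q" "0 < (p - 1) * q" unfolding t using q0 by simp_all
   have "p = Suc t + 1" using t by linarith
   thus "p * q = (p - 1) * q + q" unfolding t by (metis add_mult_distrib nat_mult_1)
  qed
  have asq: "set (pw q as) <= carrier R" using c by simp
  have "r \<otimes> \<psi>' k [^] q \<ominus> ?s \<in> lim c (y [^] ((p - 1) * q) # pw q as)"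
   using iffD1[OF lim_shift[OF c(1) asq c(3) pq(2), of "r \<otimes> \<psi>' k [^] q \<ominus> ?s" q]] 3 cc \<rho>(1) pq(1) by simp
  thus ?thesis using lim_Cons_mono[OF c(1) asq c(3) pq(3,4)] by blast
 qed
 thus "r \<in> urow n1 n2 (%l k. D' l k [^] q) (%k. \<psi>' k [^] q) (%k. lim c (y [^] q # pw q as))"
  using \<rho>(1) ts unfolding urow_def by blast
qed

lemma mprim_over:
 assumes c: "ideal c R" "set xs <= carrier R" "mprim (Idl (c \<union> set xs))" and K: "ideal K R" "c <= K"
  and x: "\<And>x. x \<in> set xs ==> \<exists>n::nat. x [^] n \<in> K"
 shows "mprim K"
proof (rule mprim_radical[OF _ c(3) K(1)])
 show "c \<union> set xs <= carrier R" using ideal_sub[OF c(1)] c(2) by blast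
 fix s assume "s \<in> c \<union> set xs"
 thus "\<exists>n::nat. s [^] n \<in> K"
 proof
  assume "s \<in> c"
  hence "s [^] (1::nat) \<in> K" using K(2) ideal_carr[OF c(1)] by auto
  thus ?thesis by blast
 qed (rule x)
qed

text \<open>The prefix \<open>us\<close> collects the entries already raised, and permutation
  invariance brings the next one to the head.\<close>

lemma lim_superadd:
 assumes c: "ideal c R" "set (us @ vs) <= carrier R" "mprim (Idl (c \<union> set (us @ vs)))" and k: "k > 0"
 shows "k ^ length vs * colen (lim c (us @ vs)) \<le> colen (lim c (us @ pw k vs))"
 using c
proof (induction vs arbitrary: us)
 case (Cons v vs)
 have vc: "v \<in> carrier R" "set (us @ vs) <= carrier R" "set (us @ [v [^] k] @ vs) <= carrier R" "set (v [^] k # us @ vs) <= carrier R"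
  using Cons(3) by auto
 have S: "c \<union> set (v [^] k # us @ vs) <= carrier R" using ideal_sub[OF c(1)] vc(4) by blast
 have "mprim (Idl (c \<union> set (v [^] k # us @ vs)))"
 proof (rule mprim_over[OF c(1) Cons(3,4) genideal_ideal[OF S]])
  show "c <= Idl (c \<union> set (v [^] k # us @ vs))" using genideal_self[OF S] by auto
  fix x assume x: "x \<in> set (us @ v # vs)"
  show "\<exists>n::nat. x [^] n \<in> Idl (c \<union> set (v [^] k # us @ vs))"
  proof (cases "x = v")
   case True thus ?thesis using Idl_mem[OF _ S, of "v [^] k"] by auto
  next
   case False
   hence "x [^] (1::nat) \<in> Idl (c \<union> set (v [^] k # us @ vs))" using x Cons(3) by (intro Idl_mem[OF _ S]) auto
   thus ?thesis by blast
  qed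
 qed
 hence prim: "mprim (Idl (c \<union> set (v [^] (k * 1) # us @ vs)))" by simp
 have "k * colen (lim c (v [^] (1::nat) # us @ vs)) \<le> colen (lim c (v [^] (k * 1) # us @ vs))"
  by (rule colen_lim_shift(1)[OF c(1) vc(2,1) _ k prim]) simp
 moreover have "lim c (us @ v # vs) = lim c (v [^] (1::nat) # us @ vs)"
  using vc Cons(3) by (intro lim_mset) auto
 moreover have m: "lim c (v [^] (k * 1) # us @ vs) = lim c ((us @ [v [^] k]) @ vs)"
  using vc(4) by (intro lim_mset) auto
 ultimately have "k * colen (lim c (us @ v # vs)) \<le> colen (lim c ((us @ [v [^] k]) @ vs))" by simp
 hence "k ^ length vs * (k * colen (lim c (us @ v # vs))) \<le> k ^ length vs * colen (lim c ((us @ [v [^] k]) @ vs))" by simp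
 also have "\<dots> \<le> colen (lim c ((us @ [v [^] k]) @ pw k vs))"
 proof (rule Cons.IH)
  have "set ((us @ [v [^] k]) @ vs) = set (v [^] (k * 1) # us @ vs)" by auto
  thus "mprim (Idl (c \<union> set ((us @ [v [^] k]) @ vs)))" using prim by simp
 qed (use c(1) vc(3) in auto)
 finally show ?case by (simp add: mult_ac)
qed simp

lemma lim_pw_mono:
 assumes c: "ideal c R" "set (us @ vs) <= carrier R" and n: "n > 0" "n \<le> (k::nat)"
 shows "lim c (us @ pw k vs) <= lim c (us @ pw n vs)"
 using c(2)
proof (induction vs arbitrary: us)
 case (Cons v vs)
 have vc: "v \<in> carrier R" "set (us @ vs) <= carrier R" "set (us @ [v [^] i] @ vs) <= carrier R" for i :: nat
  using Cons(2) by auto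
 have "lim c (us @ pw k (v # vs)) = lim c (v [^] k # us @ pw k vs)" using vc by (intro lim_mset) auto
 also have "\<dots> <= lim c (v [^] n # us @ pw k vs)"
  by (rule lim_Cons_mono[OF c(1) _ vc(1) n]) (use vc in auto)
 also have "\<dots> = lim c ((us @ [v [^] n]) @ pw k vs)" using vc by (intro lim_mset) auto
 also have "\<dots> <= lim c ((us @ [v [^] n]) @ pw n vs)" by (rule Cons.IH) (use vc in auto)
 finally show ?case by simp
qed simp

text \<open>A finite free complex with indices shifted by one: \<open>D (Suc i)\<close> goes between
  the ranks \<open>b (Suc i)\<close> and \<open>b (Suc (Suc i))\<close>, and \<open>b 0 = 0\<close>
  makes level 0 free of relations. The row \<psi> s has a unit entry, whose column in D s lies in m;
  \<psi> 0 is a single ring element because \<open>b 1 = 1\<close>. Each congruence omits the i-th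
  parameter from its modulus, so that this parameter can be cancelled.\<close>

definition ladder :: "nat => (nat => nat) => (nat => nat => nat => 'a) => (nat => nat => 'a) => 'a list => bool"
 where "ladder s b D \<psi> xs \<longleftrightarrow> s \<le> length xs \<and> b 0 = 0 \<and> b 1 = 1 \<and> b (Suc s) > 0 \<and>
  (\<forall>i. tot (\<psi> i)) \<and> (\<forall>i l. tot (D i l)) \<and>
  (\<forall>i<s. \<forall>j<b i. \<forall>k<b (Suc (Suc i)). dot (b (Suc i)) (D i j) (%l. D (Suc i) l k) = \<zero>) \<and>
  (\<forall>i<s. \<forall>k<b (Suc (Suc i)). xs ! i \<otimes> \<psi> (Suc i) k \<ominus> dot (b (Suc i)) (\<psi> i) (%l. D (Suc i) l k)
    \<in> Idl (set (take i xs @ drop (Suc i) xs))) \<and>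
  \<psi> s 0 = \<one> \<and> (\<forall>l. D s l 0 \<in> m)"

abbreviation rung :: "(nat => nat) => (nat => nat => nat => 'a) => (nat => nat => 'a) => nat => nat => 'a set => 'a set"
 where "rung b D \<psi> i q A \<equiv> urow (b i) (b (Suc i)) (%l k. D i l k [^] q) (%k. \<psi> i k [^] q) (%_. A)"

lemma ladder_rung:
 assumes L: "ladder s b D \<psi> xs" and c: "ideal c R" "set xs <= carrier R" and i: "i < s"
 shows "rung b D \<psi> i (p ^ e) (Idl (insert ((xs ! i) [^] (p ^ e)) (lim c ((xs ! i) [^] (p * p ^ e) # pw (p ^ e) (take i xs @ drop (Suc i) xs)))))
  <= rung b D \<psi> (Suc i) (p ^ e) (lim c (pw (p ^ e) xs))"
proof -
 let ?as = "take i xs @ drop (Suc i) xs"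
 have il: "i < length xs" using L i by (auto simp: ladder_def)
 have xs: "xs = take i xs @ xs ! i # drop (Suc i) xs" using id_take_nth_drop[OF il] .
 have as: "set ?as <= carrier R" using c(2) by (auto dest: in_set_takeD in_set_dropD)
 have y: "xs ! i \<in> carrier R" using c(2) il by auto
 have tot: "tot (\<psi> i)" "tot (\<psi> (Suc i))" "\<And>l. tot (D i l)" "\<And>l. tot (D (Suc i) l)" using L by (auto simp: ladder_def)
 have 1: "dot (b (Suc i)) (D i j) (%l. D (Suc i) l k) = \<zero>" if "j < b i" "k < b (Suc (Suc i))" for j k
  using L i that unfolding ladder_def by blast
 have 2: "xs ! i \<otimes> \<psi> (Suc i) k \<ominus> dot (b (Suc i)) (\<psi> i) (%l. D (Suc i) l k) \<in> Idl (set ?as)" if "k < b (Suc (Suc i))" for k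
  using L i that unfolding ladder_def by blast
 have "mset xs = mset (xs ! i # ?as)" by (subst xs) simp
 hence "mset (map (%x. x [^] (p ^ e)) xs) = mset (map (%x. x [^] (p ^ e)) (xs ! i # ?as))" by (metis mset_map)
 hence "mset (pw (p ^ e) xs) = mset ((xs ! i) [^] (p ^ e) # pw (p ^ e) ?as)" by (simp add: pw_def)
 hence "lim c ((xs ! i) [^] (p ^ e) # pw (p ^ e) ?as) = lim c (pw (p ^ e) xs)" using lim_mset[OF _ pw_carr[OF c(2)]] by metis
 thus ?thesis using ladder_step[OF c(1) as y tot 1 2, where q = "p ^ e" and e = e] by simp
qed

lemma maximal_ideal_exponent:
 assumes K: "ideal K R" "mprim K"
 shows "\<exists>e. \<forall>a\<in>m. a [^] (p ^ e) \<in> K"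
proof -
 have "\<exists>e. \<forall>a\<in>set gs. a [^] (p ^ e) \<in> K" if "set gs <= m" for gs
  using that
 proof (induction gs)
  case (Cons g gs)
  then obtain e where e: "\<And>a. a \<in> set gs ==> a [^] (p ^ e) \<in> K" by auto
  obtain n :: nat where n: "g [^] n \<in> K" using K(2) Cons(2) unfolding mprim_def by auto
  have "n < p ^ n" using p_gt_1 less_exp[of n] power_mono[of 2 p n] by linarith
  moreover have "p ^ n \<le> p ^ max n e" "p ^ e \<le> p ^ max n e" using p_gt_1 by (auto intro: power_increasing)
  ultimately have "a [^] (p ^ max n e) \<in> K" if "a \<in> set (g # gs)" for a
   using ideal_pow_le[OF K(1) _ n, of "p ^ max n e"] ideal_pow_le[OF K(1) _ e, of a "p ^ max n e"] that Cons(2) m_carr by auto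
  thus ?case by blast
 qed auto
 moreover have "set mgens <= m" using genideal_self[OF mgens(1)] mgens(2) by simp
 ultimately obtain e where e: "\<And>a. a \<in> set mgens ==> a [^] (p ^ e) \<in> K" by blast
 have "a [^] (p ^ e) \<in> K" if "a \<in> m" for a
  by (rule frobenius_Idl[OF mgens(1) _ K(1) e]) (use that mgens(2) in auto)
 thus ?thesis by blast
qed

text \<open>At the unit entry the condition reads: r is a combination of q-th powers of elements of
  m, modulo lim(x^q). With q = p^(e+e0) these powers lie in (c, x^(p^e)), so the ascent ends with a
  fixed loss of e0 Frobenius levels.\<close>

lemma ladder_top:
 assumes L: "ladder s b D \<psi> xs" and c: "ideal c R" "set xs <= carrier R"
  and e0: "\<forall>a\<in>m. a [^] (p ^ e0) \<in> Idl (c \<union> set xs)"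
 shows "rung b D \<psi> s (p ^ (e + e0)) (lim c (pw (p ^ (e + e0)) xs)) <= lim c (pw (p ^ e) xs)"
proof
 let ?q = "p ^ (e + e0)" and ?M = "lim c (pw (p ^ e) xs)"
 have M: "ideal ?M R" using lim_ideal[OF c(1)] c(2) by simp
 fix r assume "r \<in> rung b D \<psi> s ?q (lim c (pw ?q xs))"
 then obtain \<rho> where \<rho>: "r \<in> carrier R" "tot \<rho>"
  "\<forall>k<b (Suc s). r \<otimes> \<psi> s k [^] ?q \<ominus> dot (b s) \<rho> (%l. D s l k [^] ?q) \<in> lim c (pw ?q xs)" unfolding urow_def by blast
 have "0 < b (Suc s)" "\<psi> s 0 = \<one>" and D: "\<And>l. D s l 0 \<in> m" using L by (auto simp: ladder_def)
 hence "r \<ominus> dot (b s) \<rho> (%l. D s l 0 [^] ?q) \<in> lim c (pw ?q xs)" using \<rho>(1,3) by fastforce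
 also have "\<dots> <= ?M" using lim_pw_mono[OF c(1), of "[]" xs "p ^ e" ?q] c(2) p_gt_1 p_pow_pos
  by (simp add: power_increasing)
 finally have 1: "r \<ominus> dot (b s) \<rho> (%l. D s l 0 [^] ?q) \<in> ?M" .
 have "a [^] ?q \<in> ?M" if a: "a \<in> m" for a
 proof -
  have "(a [^] (p ^ e0)) [^] (p ^ e) \<in> Idl (c \<union> set (pw (1 * p ^ e) xs))"
   by (rule frobenius_pw[OF c]) (use e0 a pw_1[OF c(2)] in auto)
  also have "\<dots> <= ?M" using lim_sup[OF c(1) pw_carr[OF c(2)]] by simp
  finally show ?thesis using a m_carr by (simp add: nat_pow_pow power_add mult.commute subset_iff)
 qed
 hence "dot (b s) \<rho> (%l. D s l 0 [^] ?q) \<in> ?M" using D by (intro dot_ideal[OF M \<rho>(2)]) auto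
 thus "r \<in> ?M" using ideal_minus_cancel[OF M _ \<rho>(1) 1] by blast
qed

lemma fgood_pow:
 assumes g: "fgood J xs" and xs: "set xs <= carrier R" and z: "z \<in> carrier R" "\<forall>j\<in>J. j \<otimes> z \<in> Idl (set xs)"
 shows "\<forall>j\<in>J. j \<otimes> z [^] (p ^ e) \<in> lim {\<zero>} (pw (p ^ e) xs)"
proof (induction e)
 case 0
 have "Idl (set xs) <= lim {\<zero>} xs" using lim_sup[OF zeroideal xs] zero_Un[OF xs] by simp
 thus ?case using z xs pw_1[OF xs] by auto
next
 case (Suc e)
 have "fprop J (pows xs (replicate (length xs) (p ^ e)))" using g p_pow_pos unfolding fgood_def by simp
 hence "fprop J (pw (p ^ e) xs)" by (simp add: pows_replicate)
 hence "\<forall>j\<in>J. j \<otimes> (z [^] (p ^ e)) [^] p \<in> lim {\<zero>} (pw p (pw (p ^ e) xs))"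
  using Suc z(1) unfolding fprop_def by blast
 thus ?case using z(1) xs by (simp add: nat_pow_pow pw_pw mult.commute)
qed

text \<open>J annihilates the class of \<psi> 0 0, hence all its Frobenius powers. Level 0 has no
  relations, so this is precisely membership in the lowest rung.\<close>

lemma ladder_bottom:
 assumes L: "ladder s b D \<psi> xs" and c: "ideal c R" "set xs <= carrier R" and J: "ideal J R" "fgood J xs"
  and z: "\<forall>j\<in>J. j \<otimes> \<psi> 0 0 \<in> Idl (set xs)"
 shows "J <= rung b D \<psi> 0 (p ^ e) (lim c (pw (p ^ e) xs))"
proof
 fix j assume j: "j \<in> J"
 have b: "b 0 = 0" "b 1 = 1" "tot (\<psi> 0)" using L by (auto simp: ladder_def)
 have jc: "j \<in> carrier R" using ideal_carr[OF J(1) j] .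
 have "{\<zero>} <= c" using ideal_zero[OF c(1)] by simp
 hence "j \<otimes> \<psi> 0 0 [^] (p ^ e) \<in> lim c (pw (p ^ e) xs)"
  using fgood_pow[OF J(2) c(2) totD[OF b(3)] z] j lim_base_mono[OF zeroideal c(1) _ pw_carr[OF c(2)]] by blast
 hence "\<forall>k<b (Suc 0). j \<otimes> \<psi> 0 k [^] (p ^ e) \<ominus> dot (b 0) (%_. \<zero>) (%l. D 0 l k [^] (p ^ e)) \<in> lim c (pw (p ^ e) xs)"
  using b jc by (auto simp: minus_eq totD)
 thus "j \<in> rung b D \<psi> 0 (p ^ e) (lim c (pw (p ^ e) xs))" using jc tot_zero unfolding urow_def by blast
qed

text \<open>For a regular sequence limit closures are the ideals themselves, so lim(x^q) is
  contained in the ideal generated by y^q and lim(y^(pq), ...), and no error arises. J climbs the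
  ladder into the p^n-th powers of the parameters for every n, hence into all powers of m.\<close>

lemma ladder_regular:
 assumes L: "ladder s b D \<psi> xs" and xs: "set xs <= m" "mprim (Idl (set xs))" "regs {\<zero>} xs"
  and J: "ideal J R" "fgood J xs" and z: "\<forall>j\<in>J. j \<otimes> \<psi> 0 0 \<in> Idl (set xs)"
 shows "J = {\<zero>}"
proof -
 note z0 = zeroideal
 have xc: "set xs <= carrier R" using xs(1) m_carr by blast
 have limI: "lim {\<zero>} ys = Idl ({\<zero>} \<union> set ys)"
  if n: "length ns = length xs" "\<forall>n\<in>set ns. 0 < n" "mset (pows xs ns) = mset ys" for ys ns
 proof (rule regs_lim[OF z0])
  show "set ys <= m" using pows_m[OF xs(1) n(2)] mset_eq_setD[OF n(3)] by simp
  show "regs {\<zero>} ys" by (rule regs_mset[OF z0 pows_m[OF xs(1) n(2)] n(3) regs_pows[OF z0 xs(1) n(2,1) xs(3)]])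
 qed
 have step: "rung b D \<psi> i (p ^ e) (lim {\<zero>} (pw (p ^ e) xs)) <= rung b D \<psi> (Suc i) (p ^ e) (lim {\<zero>} (pw (p ^ e) xs))" if i: "i < s" for i e
 proof -
  let ?q = "p ^ e"
  \<comment> \<open>Exponent p q at the place i and q elsewhere: the list over which the error ideal
    is formed.\<close>
  let ?ns = "replicate i ?q @ (p * ?q) # replicate (length xs - Suc i) ?q"
  let ?as = "take i xs @ drop (Suc i) xs"
  have il: "i < length xs" using L i by (auto simp: ladder_def)
  have dec: "xs = take i xs @ xs ! i # drop (Suc i) xs" using id_take_nth_drop[OF il] .
  let ?ys = "(xs ! i) [^] (p * ?q) # pw ?q ?as"
  have ms: "mset (pows xs ?ns) = mset ?ys"
  proof -
   have "pows xs ?ns = pows (take i xs @ xs ! i # drop (Suc i) xs) ?ns" using dec by simp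
   also have "\<dots> = pows (take i xs) (replicate (length (take i xs)) ?q) @ (xs ! i) [^] (p * ?q) #
     pows (drop (Suc i) xs) (replicate (length (drop (Suc i) xs)) ?q)" using il by (simp add: pows_append)
   finally show ?thesis unfolding pows_replicate by simp
  qed
  have ln: "length ?ns = length xs" "\<forall>n\<in>set ?ns. 0 < n" using il p_pow_pos p_gt_1 by auto
  have l1: "lim {\<zero>} ?ys = Idl ({\<zero>} \<union> set ?ys)" by (rule limI[OF ln ms])
  have l2: "lim {\<zero>} (pw ?q xs) = Idl ({\<zero>} \<union> set (pw ?q xs))"
   by (rule limI[of "replicate (length xs) ?q"]) (use p_pow_pos in \<open>auto simp: pows_replicate\<close>)
  have yc: "xs ! i \<in> carrier R" "set ?as <= carrier R" using xc il by (auto dest: in_set_takeD in_set_dropD)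
  hence yc: "set ?ys <= carrier R" "xs ! i \<in> carrier R" using pw_carr[OF yc(2)] by auto
  have S: "{\<zero>} \<union> set ?ys <= carrier R" "insert ((xs ! i) [^] ?q) (Idl ({\<zero>} \<union> set ?ys)) <= carrier R"
   using yc genideal_ideal[of "{\<zero>} \<union> set ?ys"] ideal_sub by auto
  have "set (pw ?q xs) = insert ((xs ! i) [^] ?q) (set (pw ?q ?as))"
  proof -
   have "set xs = insert (xs ! i) (set ?as)" by (subst dec) auto
   thus ?thesis unfolding set_pw by simp
  qed
  hence "Idl ({\<zero>} \<union> set (pw ?q xs)) <= Idl (insert ((xs ! i) [^] ?q) (Idl ({\<zero>} \<union> set ?ys)))"
   using genideal_self[OF S(1)] by (intro Idl_mono[OF _ S(2)]) auto
  hence "rung b D \<psi> i ?q (lim {\<zero>} (pw ?q xs)) <= rung b D \<psi> i ?q (Idl (insert ((xs ! i) [^] ?q) (lim {\<zero>} ?ys)))"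
   unfolding l1 l2 urow_def by blast
  thus ?thesis using ladder_rung[OF L z0 xc i, of e] by blast
 qed
 have up: "rung b D \<psi> 0 (p ^ e) (lim {\<zero>} (pw (p ^ e) xs)) <= rung b D \<psi> i (p ^ e) (lim {\<zero>} (pw (p ^ e) xs))" if "i \<le> s" for i e
  using that
 proof (induction i)
  case (Suc i) thus ?case using step[of i e] by auto
 qed auto
 have Sx: "{\<zero>} \<union> set xs <= carrier R" using xc by auto
 have "mprim (Idl ({\<zero>} \<union> set xs))" using xs(2) zero_Un[OF xc] by simp
 from maximal_ideal_exponent[OF genideal_ideal[OF Sx] this]
 obtain e0 where e0: "\<forall>a\<in>m. a [^] (p ^ e0) \<in> Idl ({\<zero>} \<union> set xs)" by blast
 have "J <= {\<zero>}"
 proof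
  fix j assume j: "j \<in> J"
  show "j \<in> {\<zero>}"
  proof (rule krull_intersection[OF z0])
   show "j \<in> carrier R" using ideal_carr[OF J(1) j] .
   fix n
   have np: "n < p ^ n" using p_gt_1 less_exp[of n] power_mono[of 2 p n] by linarith
   have "j \<in> lim {\<zero>} (pw (p ^ n) xs)"
    using ladder_bottom[OF L z0 xc J z, of "n + e0"] up[of s "n + e0"] ladder_top[OF L z0 xc e0, of n] j by blast
   also have "lim {\<zero>} (pw (p ^ n) xs) = Idl ({\<zero>} \<union> set (pw (p ^ n) xs))"
    by (rule limI[of "replicate (length xs) (p ^ n)"]) (use p_pow_pos in \<open>auto simp: pows_replicate\<close>)
   also have "\<dots> <= Idl ({\<zero>} \<union> mpow (p ^ n))" by (rule pw_sub_mpow[OF z0 xs(1)])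
   also have "\<dots> <= Idl ({\<zero>} \<union> mpow n)"
    by (rule Idl_mono) (use mp_anti[OF mgens(1), of n "p ^ n"] np ideal_sub[OF mpow_ideal] in auto)
   finally show "j \<in> Idl ({\<zero>} \<union> mpow n)" .
  qed
 qed
 thus ?thesis using ideal_zero[OF J(1)] by blast
qed

text \<open>An element j of J outside the prime P = f 0 would make the colength of the lowest rung
  geometrically small against q^d. The highest rung has colength at least a fixed fraction of q^d,
  and each step of the ladder changes colengths only by o(q^d); these are incompatible.\<close>

lemma ladder_domain:
 assumes L: "ladder s b D \<psi> xs" and xs: "set xs <= m" "mprim (Idl (set xs))" "length xs > 0"
  and f: "prime_chain R (length xs) f"
  and J: "ideal J R" "fgood J xs" and z: "\<forall>j\<in>J. j \<otimes> \<psi> 0 0 \<in> Idl (set xs)"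
 shows "J <= f 0"
proof (rule ccontr)
 assume "\<not> J <= f 0"
 then obtain j where j: "j \<in> J" "j \<notin> f 0" by blast
 have jc: "j \<in> carrier R" using ideal_carr[OF J(1) j(1)] .
 define c where "c = f 0"
 have P: "primeideal c R" "ideal c R" using prime_chain_head[OF f] prime_ideal unfolding c_def by auto
 have xc: "set xs <= carrier R" using xs(1) m_carr by blast
 have primc: "mprim (Idl (c \<union> set xs))"
  using mprim_mono[OF xs(2)] Idl_mono[of "set xs" "c \<union> set xs"] ideal_sub[OF P(2)] xc by auto
 define c' where "c' = Idl (insert j c)"
 have Sj: "insert j c <= carrier R" using jc ideal_sub[OF P(2)] by blast
 have c': "ideal c' R" "c <= c'" "j \<in> c'" using genideal_ideal[OF Sj] genideal_self[OF Sj] unfolding c'_def by auto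
 have primc': "mprim (Idl (c' \<union> set xs))"
  using mprim_mono[OF primc] Idl_mono[of "c \<union> set xs" "c' \<union> set xs"] ideal_sub[OF c'(1)] xc c'(2) by blast
 let ?d = "length xs"
 \<comment> \<open>Prepending P to a chain over P + (j) lengthens it, so this base ideal has
   dimension below d and 1 lies in its limit closure.\<close>
 have "dimlt c' ?d" unfolding dimlt_def
 proof (intro allI impI)
  fix n h assume h: "prime_chain R n h" "c' <= h 0"
  have "c \<subset> h 0" using h(2) c' j(2) unfolding c_def by blast
  from prime_chain_Cons[OF h(1) P(1) this] have "prime_chain R (Suc n) (case_nat c h)" .
  from krull_height[OF this xs(1)] primc show "n < ?d" by simp
 qed
 hence one: "\<one> \<in> lim c' xs" using lim_one_of_dimlt[OF c'(1) _ xc] by blast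
 obtain g where g: "g > 0" "\<And>e. colen (Idl (c' \<union> set (pw (p ^ (g * e)) xs))) \<le> (p ^ (g * ?d) - 1) ^ e * colen (Idl (c' \<union> set xs))"
  using lim_one_small[OF c'(1) xs(1) primc' one] by blast
 define M where "M e = lim c (pw (p ^ e) xs)" for e
 define u where "u e = colen (M e)" for e
 define U where "U i e = rung b D \<psi> i (p ^ e) (M e)" for i e
 have pwc: "set (pw n xs) <= carrier R" for n using xc by simp
 have M: "ideal (M e) R" "fincolen (M e)" for e
  using lim_ideal[OF P(2) pwc] mprim_lim(2)[OF P(2) pwc colen_power_list(1)[OF P(2) xc primc p_pow_pos]] unfolding M_def by auto
 have tot: "tot (%k. \<psi> i k [^] (p ^ e))" "tot (%k. D i l k [^] (p ^ e))" for i l e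
  using L by (auto simp: ladder_def intro: tot_pow)
 have U: "ideal (U i e) R" "M e <= U i e" "fincolen (U i e)" for i e
 proof -
  show 1: "ideal (U i e) R" unfolding U_def by (rule urow_ideal[OF tot M(1)])
  show 2: "M e <= U i e" unfolding U_def by (rule urow_sup[OF tot M(1) order_refl])
  show "fincolen (U i e)" by (rule fincolen_mono[OF M(2) 2])
 qed
 \<comment> \<open>Superadditivity starting from colength at least 1, which is the nonvanishing of
   top local cohomology.\<close>
 have lower: "(p ^ e) ^ ?d \<le> u e" for e
 proof -
  have "(p ^ e) ^ ?d * colen (lim c xs) \<le> u e"
   using lim_superadd[OF P(2), of "[]" xs] xc primc p_pow_pos unfolding u_def M_def by simp
  moreover have "colen (lim c xs) \<ge> 1"
   using one_notin_lim[OF f xs(1)] primc unfolding c_def[symmetric]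
   by (intro colen_pos[OF mprim_lim(2)[OF P(2) xc primc] lim_ideal[OF P(2) xc]]) auto
  ultimately show ?thesis by (metis le_trans mult_le_mono2 mult.right_neutral)
 qed
 have upper: "u e \<le> (p ^ e) ^ ?d * colen (Idl (c \<union> set xs))" for e
 proof -
  have S: "c \<union> set (pw (p ^ e) xs) <= carrier R" using Idl_pw_carr[OF P(2) xc] .
  have "u e \<le> colen (Idl (c \<union> set (pw (p ^ e) xs)))"
   unfolding u_def using mprim_fincolen[OF genideal_ideal[OF S] colen_power_list(1)[OF P(2) xc primc p_pow_pos]] M(1) lim_sup[OF P(2) pwc]
   by (intro colen_mono) (auto simp: M_def)
  also have "\<dots> \<le> (p ^ e) ^ ?d * colen (Idl (c \<union> set xs))" using colen_power_list(2)[OF P(2) xc primc p_pow_pos] .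
  finally show ?thesis .
 qed
 have incr: "p ^ ?d * u e \<le> u (Suc e)" for e
  using lim_superadd[OF P(2), of "[]" "pw (p ^ e) xs" p] pwc colen_power_list(1)[OF P(2) xc primc p_pow_pos] p_gt_1 xc
  unfolding u_def M_def by (simp add: pw_pw mult.commute)
 \<comment> \<open>Relaxing the remainder ideal from \<open>?B\<close> to \<open>M e\<close> costs b
   (colen ?B - u e), the slicing estimate bounds colen ?B by colen ?N - (p - 1) u e, and p^(d-1)
   colen ?N is at most u (e + 1). Multiplication by p^(d-1) keeps everything in the natural
   numbers.\<close>
 have step: "p ^ (?d - 1) * colen (U (Suc i) e) + p ^ (?d - 1) * b (Suc i) * (p * u e) \<le> p ^ (?d - 1) * colen (U i e) + b (Suc i) * u (Suc e)"
  if i: "i < s" for i e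
 proof -
  let ?q = "p ^ e" and ?y = "xs ! i" and ?as = "take i xs @ drop (Suc i) xs"
  have il: "i < ?d" using L i by (auto simp: ladder_def)
  have dec: "xs = take i xs @ ?y # drop (Suc i) xs" using id_take_nth_drop[OF il] .
  have yc: "?y \<in> carrier R" "set ?as <= carrier R" using xc il by (auto dest: in_set_takeD in_set_dropD)
  let ?N = "lim c (?y [^] (p * ?q) # pw ?q ?as)"
  let ?B = "Idl (insert (?y [^] ?q) ?N)"
  have msx: "mset xs = mset (?y # ?as)" by (subst dec) simp
  hence "mset (map (%x. x [^] k) xs) = mset (map (%x. x [^] k) (?y # ?as))" for k :: nat by (metis mset_map)
  hence ms: "mset (pw k xs) = mset (?y [^] k # pw k ?as)" for k by (simp add: pw_def)
  have Me: "M e = lim c (?y [^] ?q # pw ?q ?as)" unfolding M_def using lim_mset[OF ms pwc] .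
  have asq: "set (pw ?q ?as) <= carrier R" using yc(2) by simp
  have cc: "set (?y [^] (p * ?q) # pw ?q ?as) <= carrier R" using yc asq by auto
  have S: "c \<union> set (?y [^] (p * ?q) # pw ?q ?as) <= carrier R" using ideal_sub[OF P(2)] cc by blast
  have prim: "mprim (Idl (c \<union> set (?y [^] (p * ?q) # pw ?q ?as)))"
  proof (rule mprim_over[OF P(2) xc primc genideal_ideal[OF S]])
   show "c <= Idl (c \<union> set (?y [^] (p * ?q) # pw ?q ?as))" using genideal_self[OF S] by auto
   fix x assume "x \<in> set xs"
   hence "x \<in> set (?y # ?as)" using mset_eq_setD[OF msx] by blast
   hence "x [^] (p * ?q) \<in> set (?y [^] (p * ?q) # pw ?q ?as) \<or> x [^] ?q \<in> set (?y [^] (p * ?q) # pw ?q ?as)" by (auto simp: set_pw)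
   hence "x [^] (p * ?q) \<in> Idl (c \<union> set (?y [^] (p * ?q) # pw ?q ?as)) \<or> x [^] ?q \<in> Idl (c \<union> set (?y [^] (p * ?q) # pw ?q ?as))"
    using Idl_mem[OF _ S] by blast
   thus "\<exists>n::nat. x [^] n \<in> Idl (c \<union> set (?y [^] (p * ?q) # pw ?q ?as))" by blast
  qed
  have N: "ideal ?N R" "fincolen ?N" using lim_ideal[OF P(2) cc] mprim_lim(2)[OF P(2) cc prim] by auto
  have SN: "insert (?y [^] ?q) ?N <= carrier R" using ideal_sub[OF N(1)] yc by auto
  have B: "ideal ?B R" "?N <= ?B" "fincolen ?B"
   using genideal_ideal[OF SN] genideal_self[OF SN] fincolen_mono[OF N(2)] by auto
  have 1: "colen ?B + (p - 1) * u e \<le> colen ?N"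
   using colen_lim_shift(2)[OF P(2) asq yc(1) _ _ prim] p_pow_pos p_gt_1 unfolding u_def Me by simp
  have BM: "?B <= M e"
  proof (rule Idl_subI[OF _ M(1)])
   have "?q \<le> p * ?q" "0 < ?q" using p_gt_1 p_pow_pos by auto
   hence "?N <= M e" unfolding Me by (intro lim_Cons_mono[OF P(2) asq yc(1)])
   moreover have "?y [^] ?q \<in> M e"
    unfolding Me using lim_sup[OF P(2), of "?y [^] ?q # pw ?q ?as"] asq yc(1) ideal_sub[OF P(2)]
     Idl_mem[of "?y [^] ?q" "c \<union> set (?y [^] ?q # pw ?q ?as)"] by auto
   ultimately show "insert (?y [^] ?q) ?N <= M e" by blast
  qed
  \<comment> \<open>In \<open>?N\<close> the i-th parameter already has its exponent p q; raising
    the remaining d - 1 parameters to the same exponent gives M (e + 1).\<close>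
  have 2: "p ^ (?d - 1) * colen ?N \<le> u (Suc e)"
  proof -
   have ll: "length ?as = ?d - 1" using il by simp
   have "p ^ length (pw ?q ?as) * colen (lim c ([?y [^] (p * ?q)] @ pw ?q ?as)) \<le> colen (lim c ([?y [^] (p * ?q)] @ pw p (pw ?q ?as)))"
    by (rule lim_superadd[OF P(2)]) (use cc prim p_gt_1 in auto)
   moreover have "lim c ([?y [^] (p * ?q)] @ pw p (pw ?q ?as)) = M (Suc e)"
    unfolding M_def pw_pw[OF yc(2)] using lim_mset[OF ms[of "p ^ Suc e"] pwc] by (simp add: mult.commute)
   ultimately show ?thesis using ll unfolding u_def by simp
  qed
  have "rung b D \<psi> i ?q ?B <= U (Suc i) e" unfolding U_def M_def by (rule ladder_rung[OF L P(2) xc i])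
  moreover have "fincolen (rung b D \<psi> i ?q ?B)"
   by (rule fincolen_mono[OF B(3) urow_sup[OF tot B(1)]]) simp
  ultimately have "colen (U (Suc i) e) \<le> colen (rung b D \<psi> i ?q ?B)" using U(1) by (intro colen_mono) auto
  moreover have "colen (rung b D \<psi> i ?q ?B) + b (Suc i) * u e \<le> colen (U i e) + b (Suc i) * colen ?B"
   unfolding U_def u_def by (rule urow_colen[OF tot B(1) M(1) BM B(3)])
  ultimately have 3: "colen (U (Suc i) e) + b (Suc i) * u e \<le> colen (U i e) + b (Suc i) * colen ?B" by linarith
  have "b (Suc i) * colen ?B + b (Suc i) * ((p - 1) * u e) \<le> b (Suc i) * colen ?N"
   using mult_le_mono2[OF 1, of "b (Suc i)"] by (simp add: algebra_simps)
  with 3 have "colen (U (Suc i) e) + b (Suc i) * (u e + (p - 1) * u e) \<le> colen (U i e) + b (Suc i) * colen ?N"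
   by (simp add: algebra_simps)
  moreover have "u e + (p - 1) * u e = p * u e" using p_gt_1 by (cases p) auto
  ultimately have "colen (U (Suc i) e) + b (Suc i) * (p * u e) \<le> colen (U i e) + b (Suc i) * colen ?N" by simp
  from mult_le_mono2[OF this, of "p ^ (?d - 1)"]
  have "p ^ (?d - 1) * colen (U (Suc i) e) + p ^ (?d - 1) * b (Suc i) * (p * u e) \<le>
    p ^ (?d - 1) * colen (U i e) + b (Suc i) * (p ^ (?d - 1) * colen ?N)" by (simp add: algebra_simps)
  also have "\<dots> \<le> p ^ (?d - 1) * colen (U i e) + b (Suc i) * u (Suc e)" using mult_le_mono2[OF 2, of "b (Suc i)"] by simp
  finally show ?thesis .
 qed
 let ?b = "%i. \<Sum>k<i. b (Suc k)"
 have total: "p ^ (?d - 1) * colen (U i e) + p ^ (?d - 1) * ?b i * (p * u e) \<le> p ^ (?d - 1) * colen (U 0 e) + ?b i * u (Suc e)"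
  if "i \<le> s" for i e
  using that
 proof (induction i)
  case (Suc i)
  thus ?case using step[of i e] by (simp add: algebra_simps)
 qed simp
 have "\<exists>e0. \<forall>a\<in>m. a [^] (p ^ e0) \<in> Idl (c \<union> set xs)"
  by (rule maximal_ideal_exponent[OF genideal_ideal primc]) (use ideal_sub[OF P(2)] xc in auto)
 then obtain e0 where e0: "\<forall>a\<in>m. a [^] (p ^ e0) \<in> Idl (c \<union> set xs)" by blast
 have top: "u k \<le> colen (U s (k + e0))" for k
  unfolding u_def using ladder_top[OF L P(2) xc e0, of k] by (intro colen_mono[OF U(3) M(1)]) (simp add: U_def M_def)
 \<comment> \<open>The lowest rung contains j as well as P and the q-th powers of the parameters,
   hence the ideal whose colength decays.\<close>
 have bot: "colen (U 0 e) \<le> colen (Idl (c' \<union> set (pw (p ^ e) xs)))" for e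
 proof (rule colen_mono[OF _ U(1)])
  have S: "c' \<union> set (pw (p ^ e) xs) <= carrier R" using Idl_pw_carr[OF c'(1) xc] .
  show "fincolen (Idl (c' \<union> set (pw (p ^ e) xs)))"
   using mprim_fincolen[OF genideal_ideal[OF S] colen_power_list(1)[OF c'(1) xc primc' p_pow_pos]] .
  have "c \<union> set (pw (p ^ e) xs) <= M e"
   using lim_sup[OF P(2) pwc] genideal_self[OF Idl_pw_carr[OF P(2) xc]] unfolding M_def by blast
  moreover have "j \<in> U 0 e" using ladder_bottom[OF L P(2) xc J z, of e] j(1) unfolding U_def M_def by blast
  ultimately have *: "insert j c <= U 0 e" "set (pw (p ^ e) xs) <= U 0 e" using U(2)[of e 0] by auto
  have "c' <= U 0 e" unfolding c'_def by (rule Idl_subI[OF *(1) U(1)])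
  with *(2) show "Idl (c' \<union> set (pw (p ^ e) xs)) <= U 0 e" by (intro Idl_subI[OF _ U(1)]) auto
 qed
 \<comment> \<open>The normalized colength. It is increasing and bounded, so consecutive differences
   tend to 0; up to constants these differences are the normalized errors of the ladder.\<close>
 define F where "F e = real (u e) / real p ^ (e * ?d)" for e
 have p0: "real p > 0" using p_gt_1 by simp
 have "incseq F"
 proof (rule incseq_SucI)
  fix e
  have "real p ^ ?d * real (u e) \<le> real (u (Suc e))" using incr[of e] by (metis of_nat_le_iff of_nat_mult of_nat_power)
  thus "F e \<le> F (Suc e)" unfolding F_def using p0 by (simp add: power_add divide_simps mult.commute)
 qed
 moreover have "F e \<le> real (colen (Idl (c \<union> set xs)))" for e
 proof -
  have "real (u e) \<le> real p ^ (e * ?d) * real (colen (Idl (c \<union> set xs)))"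
   using upper[of e] by (metis of_nat_le_iff of_nat_mult of_nat_power power_mult)
  thus ?thesis unfolding F_def using p0 by (simp add: divide_simps mult.commute)
 qed
 ultimately obtain l where l: "F \<longlonglongrightarrow> l" using incseq_convergent by metis
 have diff: "(%e. F (Suc e) - F e) \<longlonglongrightarrow> 0" using tendsto_diff[OF LIMSEQ_Suc[OF l] l] by simp
 let ?N = "p ^ (g * ?d)"
 let ?W = "real (colen (Idl (c' \<union> set xs)))"
 \<comment> \<open>The normalized upper bound: geometric decay at the bottom plus total error. Only
   levels e = g t are used, as the decay is known just for those.\<close>
 define h where "h t = ((real ?N - 1) / real ?N) ^ t * ?W + real (?b s) * (real p * (F (Suc (g * t)) - F (g * t)))" for t
 have N1: "?N \<ge> 1" using p_pow_pos[of "g * ?d"] by linarith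
 have "(%t. F (Suc (g * t)) - F (g * t)) \<longlonglongrightarrow> 0"
  using LIMSEQ_subseq_LIMSEQ[OF diff, of "%t. g * t"] g(1) by (simp add: strict_mono_def o_def)
 moreover have "(%t. ((real ?N - 1) / real ?N) ^ t) \<longlonglongrightarrow> 0"
 proof (rule LIMSEQ_realpow_zero)
  have "real ?N \<ge> 1" using N1 by (simp only: of_nat_1 flip: of_nat_le_iff[where 'a = real])
  thus "0 \<le> (real ?N - 1) / real ?N" "(real ?N - 1) / real ?N < 1" by (auto simp only: divide_simps split: if_splits)
 qed
 ultimately have "h \<longlonglongrightarrow> 0 * ?W + real (?b s) * (real p * 0)"
  unfolding h_def by (intro tendsto_add tendsto_mult tendsto_const)
 hence h0: "h \<longlonglongrightarrow> 0" by simp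
 have "1 / real p ^ (e0 * ?d) \<le> h t" if t: "t \<ge> e0" for t
 proof -
  let ?e = "g * t"
  have "t \<le> ?e" using g(1) by simp
  \<comment> \<open>The top of the ladder loses e0 levels: at level g t it sees u(k) >= p^(kd) with
    k = g t - e0, whence the constant 1 / p^(e0 d).\<close>
  then obtain k where k: "?e = k + e0" using t by (metis add.commute le_Suc_ex le_trans)
  let ?Q = "real p ^ (?e * ?d)"
  have d1: "p ^ ?d = p * p ^ (?d - 1)" using xs(3) by (cases ?d) auto
  have "(p ^ k) ^ ?d \<le> colen (U s ?e)" using lower[of k] top[of k] k by (metis le_trans)
  hence "p ^ (?d - 1) * (p ^ k) ^ ?d + p ^ (?d - 1) * ?b s * (p * u ?e) \<le> p ^ (?d - 1) * colen (U 0 ?e) + ?b s * u (Suc ?e)"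
   using total[of s ?e] mult_le_mono2[of "(p ^ k) ^ ?d" "colen (U s ?e)" "p ^ (?d - 1)"] by linarith
  also have "\<dots> \<le> p ^ (?d - 1) * ((?N - 1) ^ t * colen (Idl (c' \<union> set xs))) + ?b s * u (Suc ?e)"
   using le_trans[OF bot[of ?e] g(2)[of t]] by simp
  finally have "real (p ^ (?d - 1) * (p ^ k) ^ ?d + p ^ (?d - 1) * ?b s * (p * u ?e))
   \<le> real (p ^ (?d - 1) * ((?N - 1) ^ t * colen (Idl (c' \<union> set xs))) + ?b s * u (Suc ?e))" by (rule of_nat_mono)
  hence "real p ^ (?d - 1) * real p ^ (k * ?d) + real p ^ (?d - 1) * real (?b s) * (real p * real (u ?e))
   \<le> real p ^ (?d - 1) * ((real ?N - 1) ^ t * ?W) + real (?b s) * real (u (Suc ?e))"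
   using N1 by (simp add: of_nat_diff power_mult)
  moreover have "real (u ?e) = ?Q * F ?e" unfolding F_def using p0 by simp
  moreover have "real (u (Suc ?e)) = real p ^ (?d - 1) * (?Q * (real p * F (Suc ?e)))"
  proof -
   have "real (u (Suc ?e)) = real p ^ ?d * ?Q * F (Suc ?e)" unfolding F_def using p0 by (simp add: power_add)
   also have "real p ^ ?d = real p * real p ^ (?d - 1)" using d1 by (metis of_nat_mult of_nat_power)
   finally show ?thesis by simp
  qed
  moreover have "(real ?N - 1) ^ t = ?Q * ((real ?N - 1) / real ?N) ^ t"
   using p0 by (simp add: power_divide power_mult[symmetric] mult_ac)
  ultimately have "real p ^ (?d - 1) * (real p ^ (k * ?d) + ?Q * (real (?b s) * (real p * F ?e)))
   \<le> real p ^ (?d - 1) * (?Q * (((real ?N - 1) / real ?N) ^ t * ?W) + ?Q * (real (?b s) * (real p * F (Suc ?e))))"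
   by (simp add: algebra_simps)
  hence "real p ^ (k * ?d) + ?Q * (real (?b s) * (real p * F ?e))
   \<le> ?Q * (((real ?N - 1) / real ?N) ^ t * ?W) + ?Q * (real (?b s) * (real p * F (Suc ?e)))"
   using p0 by simp
  hence "real p ^ (k * ?d) \<le> ?Q * h t" unfolding h_def by (simp add: algebra_simps)
  moreover have "?Q = real p ^ (k * ?d) * real p ^ (e0 * ?d)" unfolding k by (simp add: power_add distrib_right)
  ultimately have "real p ^ (k * ?d) * 1 \<le> real p ^ (k * ?d) * (real p ^ (e0 * ?d) * h t)" by simp
  hence "1 \<le> real p ^ (e0 * ?d) * h t" using p0 by (simp del: mult_1_right)
  thus ?thesis using p0 by (simp add: divide_simps mult.commute)
 qed
 hence "1 / real p ^ (e0 * ?d) \<le> 0" using LIMSEQ_le_const[OF h0] by blast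
 thus False using p0 by (simp add: divide_simps)
qed

end

section \<open>Minimal free resolutions\<close>

context cring
begin

lemma dot_add_right:
 assumes "tot u" "tot v" "tot w"
 shows "dot n u (%i. v i \<oplus> w i) = dot n u v \<oplus> dot n u w"
 using dot_add[OF assms(2,3,1), of n] dot_comm[OF assms(1), of _ n] assms tot_add by simp

lemma dot_smult_right:
 assumes "a \<in> carrier R" "tot u" "tot v"
 shows "dot n u (%i. a \<otimes> v i) = a \<otimes> dot n u v"
 using dot_smult[OF assms(1,3,2), of n] dot_comm[OF assms(2), of _ n] assms tot_smult by simp

lemma dot_zero_right: "tot u ==> dot n u (%i. \<zero>) = \<zero>"
 using dot_comm[OF _ tot_zero] dot_zero by simp

lemma dot_minus_right:
 assumes "tot u" "tot v" "tot w"
 shows "dot n u (%i. v i \<ominus> w i) = dot n u v \<ominus> dot n u w"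
 using dot_minus[OF assms(2,3,1), of n] dot_comm[OF assms(1), of _ n] assms tot_minus by simp

lemma dot_delta_right:
 assumes "tot u" "j < n"
 shows "dot n u (%i. if i = j then \<one> else \<zero>) = u j"
 using dot_delta[OF assms] dot_comm[OF assms(1) tot_delta] by simp

definition submod :: "(nat => 'a) set => bool"
 where "submod Z \<longleftrightarrow> (\<forall>v\<in>Z. tot v) \<and> (%_. \<zero>) \<in> Z \<and> (\<forall>v\<in>Z. \<forall>w\<in>Z. (%k. v k \<oplus> w k) \<in> Z) \<and>
  (\<forall>a\<in>carrier R. \<forall>v\<in>Z. (%k. a \<otimes> v k) \<in> Z)"

text \<open>Generation is required only in the first n coordinates, so total functions can stand for
  elements of R^n.\<close>

definition gens :: "nat => (nat => 'a) set => nat => (nat => nat => 'a) => bool"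
 where "gens n Z r w \<longleftrightarrow> (\<forall>i. w i \<in> Z) \<and> (\<forall>v\<in>Z. \<exists>u. tot u \<and> (\<forall>k<n. v k = dot r u (%i. w i k)))"

lemma gensD: "gens n Z r w ==> v \<in> Z ==> \<exists>u. tot u \<and> (\<forall>k<n. v k = dot r u (%i. w i k))"
 unfolding gens_def by (elim conjE) (drule (1) bspec)

lemma submodD:
 assumes "submod Z"
 shows submod_tot: "v \<in> Z ==> tot v" and submod_zero: "(%_. \<zero>) \<in> Z"
  and submod_add: "v \<in> Z ==> w \<in> Z ==> (%k. v k \<oplus> w k) \<in> Z"
  and submod_smult: "a \<in> carrier R ==> v \<in> Z ==> (%k. a \<otimes> v k) \<in> Z"
 using assms unfolding submod_def by blast+

lemma submod_dot:
 assumes Z: "submod Z" "tot u" "\<And>i. w i \<in> Z"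
 shows "(%k. dot n u (%i. w i k)) \<in> Z"
proof (induction n)
 case 0 thus ?case using submod_zero[OF Z(1)] by simp
next
 case (Suc n)
 show ?case using submod_add[OF Z(1) Suc submod_smult[OF Z(1) totD[OF Z(2)] Z(3)]] by simp
qed

lemma submod_minus:
 assumes Z: "submod Z" "v \<in> Z" "w \<in> Z"
 shows "(%k. v k \<ominus> w k) \<in> Z"
proof -
 have "(%k. v k \<oplus> (\<ominus> \<one>) \<otimes> w k) \<in> Z" using submod_add[OF Z(1,2) submod_smult[OF Z(1) _ Z(3)]] by simp
 moreover have "(%k. v k \<oplus> (\<ominus> \<one>) \<otimes> w k) = (%k. v k \<ominus> w k)"
  using submod_tot[OF Z(1,2)] submod_tot[OF Z(1,3)] by (simp add: fun_eq_iff minus_eq l_minus totD)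
 ultimately show ?thesis by simp
qed

lemma dot_append:
 assumes "tot u" "tot v"
 shows "dot (n + k) u v = dot n u v \<oplus> dot k (%i. u (n + i)) (%i. v (n + i))"
proof (induction k)
 case (Suc k)
 have "tot (%i. u (n + i))" "tot (%i. v (n + i))" using assms by (auto simp: tot_def)
 thus ?case using Suc assms by (simp add: a_assoc totD)
qed (use assms in simp)

lemma Idl_dot:
 assumes "set xs <= carrier R" "x \<in> Idl (set xs)"
 shows "\<exists>u. tot u \<and> x = dot (length xs) u (%i. if i < length xs then xs ! i else \<zero>)"
 using assms
proof (induction xs arbitrary: x rule: rev_induct)
 case Nil
 have "Idl {} <= {\<zero>}" by (rule Idl_subI[OF _ zeroideal]) simp
 thus ?case using Nil tot_zero by auto
next
 case (snoc a xs)
 have c: "set xs <= carrier R" "a \<in> carrier R" using snoc(2) by auto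
 have "x \<in> Idl (insert a (set xs))" using snoc(3) by simp
 from this c obtain i r where i: "i \<in> Idl (set xs)" "r \<in> carrier R" "x = i \<oplus> r \<otimes> a" by (rule Idl_insertE)
 obtain u where u: "tot u" "i = dot (length xs) u (%i. if i < length xs then xs ! i else \<zero>)"
  using snoc.IH[OF c(1) i(1)] by blast
 let ?u = "u(length xs := r)"
 have "dot (length xs) ?u (%i. if i < Suc (length xs) then (xs @ [a]) ! i else \<zero>) =
   dot (length xs) u (%i. if i < length xs then xs ! i else \<zero>)"
  by (rule dot_cong) (auto simp: nth_append)
 hence "x = dot (length (xs @ [a])) ?u (%i. if i < length (xs @ [a]) then (xs @ [a]) ! i else \<zero>)"
  using i u by simp
 moreover have "tot ?u" using u(1) i(2) by (auto simp: tot_def)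
 ultimately show ?case by blast
qed

definition skip :: "nat => (nat => 'x) => nat => 'x"
 where "skip j f = (%i. f (if i < j then i else Suc i))"

lemma tot_skip: "tot u ==> tot (skip j u)"
 by (simp add: tot_def skip_def)

lemma dot_skip:
 assumes "tot u" "tot v" "j \<le> n"
 shows "dot (Suc n) u v = dot n (skip j u) (skip j v) \<oplus> u j \<otimes> v j"
 using assms(3)
proof (induction n)
 case 0 thus ?case using assms by (simp add: totD)
next
 case (Suc n)
 show ?case
 proof (cases "j = Suc n")
  case True
  have "dot (Suc n) (skip j u) (skip j v) = dot (Suc n) u v" by (rule dot_cong) (use True in \<open>auto simp: skip_def\<close>)
  thus ?thesis using True by simp
 next
  case False
  have c: "dot n (skip j u) (skip j v) \<in> carrier R" "u j \<otimes> v j \<in> carrier R" "u (Suc n) \<otimes> v (Suc n) \<in> carrier R"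
   using assms tot_skip by (auto simp: totD)
  have "dot (Suc (Suc n)) u v = (dot n (skip j u) (skip j v) \<oplus> u j \<otimes> v j) \<oplus> u (Suc n) \<otimes> v (Suc n)"
   using Suc False by simp
  also have "\<dots> = (dot n (skip j u) (skip j v) \<oplus> u (Suc n) \<otimes> v (Suc n)) \<oplus> u j \<otimes> v j" using c by (simp add: a_ac)
  also have "dot n (skip j u) (skip j v) \<oplus> u (Suc n) \<otimes> v (Suc n) = dot (Suc n) (skip j u) (skip j v)"
   using False Suc(2) by (simp add: skip_def)
  finally show ?thesis .
 qed
qed

end

context noeth
begin

text \<open>The coordinates with index n form a finitely generated ideal. After subtracting a
  combination of lifts of its generators, an element has vanishing last coordinate, and the
  submodule of such elements is covered by induction.\<close>

lemma submod_fin_gen: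
 assumes "submod Z"
 shows "\<exists>r w. gens n Z r w"
 using assms
proof (induction n arbitrary: Z)
 case 0
 have "gens 0 Z 0 (%_ _. \<zero>)" using submod_zero[OF 0] tot_zero unfolding gens_def by auto
 thus ?case by blast
next
 case (Suc n)
 note Z = Suc(2)
 let ?A = "(%v. v n) ` Z"
 have "ideal ?A R"
 proof (rule ideal_intro)
  show "?A <= carrier R" using submod_tot[OF Z] by (auto simp: totD)
  show "\<zero> \<in> ?A" using submod_zero[OF Z] by (auto intro: rev_image_eqI)
  show "a \<oplus> b \<in> ?A" if a: "a \<in> ?A" and b: "b \<in> ?A" for a b
  proof -
   obtain v w where vw: "v \<in> Z" "a = v n" "w \<in> Z" "b = w n" using a b by blast
   from submod_add[OF Z vw(1,3)] show ?thesis unfolding vw by (rule rev_image_eqI) simp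
  qed
  show "r \<otimes> a \<in> ?A" if a: "a \<in> ?A" and r: "r \<in> carrier R" for a r
  proof -
   obtain v where v: "v \<in> Z" "a = v n" using a by blast
   from submod_smult[OF Z r v(1)] show ?thesis unfolding v by (rule rev_image_eqI) simp
  qed
 qed
 then obtain xs where xs: "set xs <= carrier R" "?A = Idl (set xs)" by (rule ideal_fin_gen)
 let ?x = "%i. if i < length xs then xs ! i else \<zero>"
 have "\<exists>z\<in>Z. z n = ?x i" for i
 proof (cases "i < length xs")
  case True
  hence "xs ! i \<in> ?A" using xs genideal_self[OF xs(1)] by auto
  thus ?thesis using True by auto
 next
  case False thus ?thesis using submod_zero[OF Z] by auto
 qed
 then obtain z where z: "\<And>i. z i \<in> Z" "\<And>i. z i n = ?x i" by metis
 have tz: "tot (%i. z i k)" for k using submod_tot[OF Z z(1)] by (auto simp: tot_def)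
 let ?Z' = "{v \<in> Z. v n = \<zero>}"
 have Z': "submod ?Z'" unfolding submod_def
 proof (intro conjI ballI)
  show "tot v" if "v \<in> ?Z'" for v using that submod_tot[OF Z] by blast
  show "(%_. \<zero>) \<in> ?Z'" using submod_zero[OF Z] by simp
  show "(%k. v k \<oplus> w k) \<in> ?Z'" if "v \<in> ?Z'" "w \<in> ?Z'" for v w using that submod_add[OF Z] by simp
  show "(%k. a \<otimes> v k) \<in> ?Z'" if "a \<in> carrier R" "v \<in> ?Z'" for a v using that submod_smult[OF Z] by simp
 qed
 obtain r w where w: "gens n ?Z' r w" using Suc.IH[OF Z'] by blast
 have wZ: "w i \<in> Z" "w i n = \<zero>" for i using w unfolding gens_def by blast+
 have tw: "tot (%i. w i k)" for k using submod_tot[OF Z wZ(1)] by (auto simp: tot_def)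
 let ?w = "%i. if i < r then w i else z (i - r)"
 have "gens (Suc n) Z (r + length xs) ?w" unfolding gens_def
 proof (intro conjI allI ballI)
  show "?w i \<in> Z" for i using wZ z by simp
  fix v assume v: "v \<in> Z"
  have "v n \<in> Idl (set xs)" using v xs(2) by blast
  then obtain u where u: "tot u" "v n = dot (length xs) u ?x" using Idl_dot[OF xs(1)] by blast
  let ?c = "%k. dot (length xs) u (%i. z i k)"
  have cZ: "?c \<in> Z" by (rule submod_dot[OF Z u(1) z(1)])
  have cn: "?c n = v n" using u z(2) by simp
  have vc: "v k \<in> carrier R" "?c k \<in> carrier R" for k using submod_tot[OF Z v] totD[OF submod_tot[OF Z cZ], of k] by (auto simp: totD)
  have "(%k. v k \<ominus> ?c k) \<in> ?Z'" using submod_minus[OF Z v cZ] cn vc by (simp add: minus_eq r_neg)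
  from gensD[OF w this] obtain u' where u': "tot u'" "\<forall>k<n. v k \<ominus> ?c k = dot r u' (%i. w i k)" by blast
  let ?u = "%i. if i < r then u' i else u (i - r)"
  have tu: "tot ?u" using u u' by (auto simp: tot_def)
  have "v k = dot (r + length xs) ?u (%i. ?w i k)" if k: "k < Suc n" for k
  proof -
   have "dot r u' (%i. w i k) = v k \<ominus> ?c k"
   proof (cases "k = n")
    case True
    have "dot r u' (%i. w i n) = \<zero>" unfolding wZ(2) using dot_comm[OF u'(1) tot_zero] dot_zero[OF u'(1)] by simp
    thus ?thesis using True cn vc by (simp add: minus_eq r_neg)
   next
    case False thus ?thesis using u'(2) k by simp
   qed
   moreover have "dot (r + length xs) ?u (%i. ?w i k) = dot r u' (%i. w i k) \<oplus> ?c k"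
   proof -
    have tww: "tot (%i. ?w i k)" using totD[OF tw] totD[OF tz] by (auto simp: tot_def)
    have "dot r ?u (%i. ?w i k) = dot r u' (%i. w i k)" by (rule dot_cong) auto
    thus ?thesis unfolding dot_append[OF tu tww] by simp
   qed
   moreover have "v k = (v k \<ominus> ?c k) \<oplus> ?c k" using vc[of k] by (simp add: minus_eq a_assoc l_neg)
   ultimately show ?thesis by simp
  qed
  thus "\<exists>u. tot u \<and> (\<forall>k<Suc n. v k = dot (r + length xs) u (%i. ?w i k))" using tu by blast
 qed
 thus ?case by blast
qed

end

section \<open>Minimal systems of generators and minimal resolutions over the local ring\<close>

context nlocal
begin

text \<open>With the least possible number r of generators no relation can have a unit coefficient,
  since the generator belonging to it could be eliminated.\<close>

lemma submod_min_gens: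
 assumes Z: "submod Z"
 shows "\<exists>r w. gens n Z r w \<and> (\<forall>u. tot u --> (\<forall>k<n. dot r u (%i. w i k) = \<zero>) --> (\<forall>i<r. u i \<in> m))"
proof -
 define r where "r = (LEAST r. \<exists>w. gens n Z r w)"
 have "\<exists>w. gens n Z r w" unfolding r_def using submod_fin_gen[OF Z] by (rule LeastI_ex)
 then obtain w where w: "gens n Z r w" by blast
 have wZ: "w i \<in> Z" for i using w unfolding gens_def by blast
 have tw: "tot (%i. w i k)" for k using submod_tot[OF Z wZ] by (auto simp: tot_def)
 have least: "\<not> gens n Z r' w'" if "r' < r" for r' w' using not_less_Least[of r'] that unfolding r_def by blast
 have "u j \<in> m" if u: "tot u" "\<And>k. k < n ==> dot r u (%i. w i k) = \<zero>" and j: "j < r" for u j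
 proof (rule ccontr)
  assume "u j \<notin> m"
  then obtain b where b: "b \<in> carrier R" "b \<otimes> u j = \<one>" using unit_inverse[OF totD[OF u(1)]] by metis
  obtain r' where r: "r = Suc r'" "j \<le> r'" using j by (cases r) auto
  let ?w = "skip j w"
  have skw: "skip j (%i. w i k) = (%i. ?w i k)" for k by (simp add: skip_def)
  have tw': "tot (%i. ?w i k)" for k unfolding skw[symmetric] by (rule tot_skip[OF tw])
  let ?S = "%x k. dot r' (skip j x) (%i. ?w i k)"
  have Sc: "?S x k \<in> carrier R" if "tot x" for x k using tw' tot_skip[OF that] by simp
  have "gens n Z r' ?w" unfolding gens_def
  proof (intro conjI allI ballI)
   show "?w i \<in> Z" for i using wZ by (simp add: skip_def)
   fix v assume v: "v \<in> Z"
   from gensD[OF w this] obtain x where x: "tot x" "\<forall>k<n. v k = dot r x (%i. w i k)" by blast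
   let ?a = "x j \<otimes> b"
   have c: "x j \<in> carrier R" "u j \<in> carrier R" "?a \<in> carrier R" using x u b by (auto simp: totD)
   have t: "tot (%i. skip j x i \<ominus> ?a \<otimes> skip j u i)"
    by (rule tot_minus[OF tot_skip[OF x(1)] tot_smult[OF c(3) tot_skip[OF u(1)]]])
   have "v k = dot r' (%i. skip j x i \<ominus> ?a \<otimes> skip j u i) (%i. ?w i k)" if k: "k < n" for k
   proof -
    have wc: "w j k \<in> carrier R" using totD[OF tw] .
    have 1: "?S u k \<oplus> u j \<otimes> w j k = \<zero>" using u(2)[OF k] dot_skip[OF u(1) tw r(2), of k] skw r(1) by simp
    have 2: "v k = ?S x k \<oplus> x j \<otimes> w j k" using x(2)[rule_format, OF k] dot_skip[OF x(1) tw r(2), of k] skw r(1) by simp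
    have "dot r' (%i. skip j x i \<ominus> ?a \<otimes> skip j u i) (%i. ?w i k) = ?S x k \<ominus> ?a \<otimes> ?S u k"
     using dot_minus[OF tot_skip[OF x(1)] tot_smult[OF c(3) tot_skip[OF u(1)]] tw'] dot_smult[OF c(3) tot_skip[OF u(1)] tw'] by simp
    also have "\<dots> = (?S x k \<oplus> x j \<otimes> w j k) \<ominus> (?a \<otimes> (?S u k \<oplus> u j \<otimes> w j k) \<oplus> (x j \<otimes> w j k \<ominus> x j \<otimes> ((b \<otimes> u j) \<otimes> w j k)))"
    proof -
     have "A \<ominus> (Z \<otimes> b) \<otimes> B = (A \<oplus> Z \<otimes> W) \<ominus> ((Z \<otimes> b) \<otimes> (B \<oplus> Y \<otimes> W) \<oplus> (Z \<otimes> W \<ominus> Z \<otimes> ((b \<otimes> Y) \<otimes> W)))"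
      if "A \<in> carrier R" "B \<in> carrier R" "Z \<in> carrier R" "Y \<in> carrier R" "W \<in> carrier R" for A B Z Y W
      using that b(1) by algebra
     from this[OF Sc[OF x(1)] Sc[OF u(1)] c(1,2) wc] show ?thesis .
    qed
    also have "\<dots> = ?S x k \<oplus> x j \<otimes> w j k" unfolding 1 b(2) using c wc Sc[OF x(1)] by (simp add: minus_eq r_neg)
    finally show ?thesis using 2 by simp
   qed
   thus "\<exists>u. tot u \<and> (\<forall>k<n. v k = dot r' u (%i. ?w i k))" using t by blast
  qed
  thus False using least[of r' ?w] r(1) by simp
 qed
 thus ?thesis using w by blast
qed

text \<open>A complex of free modules \<open>R\<^bsup>r i\<^esup>\<close> with differentials the matrices \<open>M i\<close>, which is a minimal
 free resolution of \<open>R / I\<close> when \<open>r 0 = 1\<close> and the row \<open>M 0\<close> generates \<open>I\<close>.\<close>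

definition minres :: "'a set => (nat => nat) => (nat => nat => nat => 'a) => bool"
 where "minres I r M \<longleftrightarrow> r 0 = 1 \<and> (\<forall>i l k. M i l k \<in> m) \<and> (\<forall>k. M 0 0 k \<in> I) \<and>
  (\<forall>x\<in>I. \<exists>u. tot u \<and> x = dot (r 1) (M 0 0) u) \<and>
  (\<forall>i. \<forall>k l. l < r i --> dot (r (Suc i)) (M i l) (%j. M (Suc i) j k) = \<zero>) \<and>
  (\<forall>i v. tot v --> (\<forall>l<r i. dot (r (Suc i)) (M i l) v = \<zero>) -->
    (\<forall>k<r (Suc i). v k \<in> m) \<and> (\<exists>u. tot u \<and> (\<forall>k<r (Suc i). v k = dot (r (Suc (Suc i))) (M (Suc i) k) u)))"

text \<open>The columns of M' are minimal generators of the syzygies of M. Minimality one step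
  earlier puts their entries into m, and minimality of the new generators reproduces the same
  hypothesis for M'.\<close>

lemma minres_step:
 assumes M: "\<And>l. tot (M l)" and syz: "\<forall>u. tot u --> (\<forall>l<c. dot b (M l) u = \<zero>) --> (\<forall>k<b. u k \<in> m)"
 shows "\<exists>r M'. (\<forall>k i. M' k i \<in> m) \<and> (\<forall>l<c. \<forall>k. dot b (M l) (%j. M' j k) = \<zero>) \<and>
  (\<forall>v. tot v --> (\<forall>l<c. dot b (M l) v = \<zero>) --> (\<exists>u. tot u \<and> (\<forall>k<b. v k = dot r (M' k) u))) \<and>
  (\<forall>u. tot u --> (\<forall>k<b. dot r (M' k) u = \<zero>) --> (\<forall>i<r. u i \<in> m))"
proof -
 let ?Z = "{v. tot v \<and> (\<forall>l<c. dot b (M l) v = \<zero>)}"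
 have "submod ?Z" unfolding submod_def
 proof (intro conjI ballI)
  show "tot v" if "v \<in> ?Z" for v using that by blast
  show "(%_. \<zero>) \<in> ?Z" using dot_zero_right[OF M] tot_zero by simp
  show "(%k. v k \<oplus> w k) \<in> ?Z" if "v \<in> ?Z" "w \<in> ?Z" for v w
   using that dot_add_right[OF M] tot_add by simp
  show "(%k. a \<otimes> v k) \<in> ?Z" if "a \<in> carrier R" "v \<in> ?Z" for a v
   using that dot_smult_right[OF _ M] tot_smult by simp
 qed
 from submod_min_gens[OF this, of b]
 obtain r w where w: "gens b ?Z r w" and min: "\<And>u. tot u ==> \<forall>k<b. dot r u (%i. w i k) = \<zero> ==> \<forall>i<r. u i \<in> m" by blast
 have wZ: "tot (w i)" "\<And>l. l < c ==> dot b (M l) (w i) = \<zero>" for i using w unfolding gens_def by blast+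
 let ?M = "%k i. if k < b then w i k else \<zero>"
 have tM: "tot (?M k)" for k using wZ(1) by (auto simp: tot_def)
 have Mw: "dot r (?M k) u = dot r u (%i. w i k)" if "k < b" "tot u" for k u
  using dot_comm[OF that(2) tM[of k]] that(1) by simp
 have "?M k i \<in> m" for k i
 proof (cases "k < b")
  case True
  have "w i k \<in> m" using syz[rule_format, of "w i" k] wZ True by blast
  thus ?thesis using True by simp
 qed (use ideal_zero[OF m_ideal] in simp)
 moreover have "dot b (M l) (%j. ?M j k) = \<zero>" if "l < c" for l k
 proof -
  have "dot b (M l) (%j. ?M j k) = dot b (M l) (w k)" by (rule dot_cong) auto
  thus ?thesis using wZ(2)[OF that] by simp
 qed
 moreover have "\<exists>u. tot u \<and> (\<forall>k<b. v k = dot r (?M k) u)" if "tot v" "\<forall>l<c. dot b (M l) v = \<zero>" for v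
 proof -
  have "v \<in> ?Z" using that by blast
  from gensD[OF w this] obtain u where "tot u" "\<forall>k<b. v k = dot r u (%i. w i k)" by blast
  thus ?thesis using Mw by metis
 qed
 moreover have "\<forall>i<r. u i \<in> m" if "tot u" "\<forall>k<b. dot r (?M k) u = \<zero>" for u
  using min[OF that(1)] that Mw by metis
 ultimately show ?thesis by (intro exI[of _ r] exI[of _ ?M]) blast
qed

lemma minres_exists:
 assumes I: "ideal I R" "I \<noteq> carrier R"
 shows "\<exists>r M. minres I r M"
proof -
 have Im: "I <= m" using proper_sub_m[OF I(1)] ideal_one[OF I(1)] I(2) by blast
 define syz where "syz c b N \<longleftrightarrow> (\<forall>l k. N l k \<in> m) \<and> (\<forall>u. tot u --> (\<forall>l<c. dot b (N l) u = \<zero>) --> (\<forall>k<b. u k \<in> m))"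
  for c b :: nat and N :: "nat => nat => 'a"
 define nxt where "nxt c b N r N' \<longleftrightarrow> (\<forall>l<c. \<forall>k. dot b (N l) (%j. N' j k) = \<zero>) \<and>
  (\<forall>v. tot v --> (\<forall>l<c. dot b (N l) v = \<zero>) --> (\<exists>u. tot u \<and> (\<forall>k<b. v k = dot r (N' k) u)))"
  for c b r :: nat and N N' :: "nat => nat => 'a"
 have mt: "\<forall>l k. N l k \<in> m ==> tot (N l)" for N :: "nat => nat => 'a" and l using m_carr by (auto simp: tot_def)
 \<comment> \<open>The ideal I as a submodule of R^1: only coordinate 0 is constrained.\<close>
 let ?Z = "{v. tot v \<and> v 0 \<in> I}"
 have "submod ?Z" unfolding submod_def
  using ideal_zero[OF I(1)] ideal_add[OF I(1)] ideal_mult[OF I(1)] tot_zero tot_add tot_smult by auto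
 from submod_min_gens[OF this, of 1]
 obtain r0 w where w: "gens 1 ?Z r0 w" and min: "\<And>u. tot u ==> \<forall>k<1. dot r0 u (%i. w i k) = \<zero> ==> \<forall>i<r0. u i \<in> m" by blast
 have wZ: "tot (w i)" "w i 0 \<in> I" for i using w unfolding gens_def by blast+
 define N0 where "N0 = (%(l::nat) k. if l = 0 then w k 0 else \<zero>)"
 have N0m: "N0 l k \<in> m" for l k using wZ(2) Im ideal_zero[OF m_ideal] unfolding N0_def by auto
 have tN0: "tot (N0 l)" for l using N0m m_carr by (auto simp: tot_def)
 have N0w: "dot r0 (N0 0) u = dot r0 u (%i. w i 0)" if "tot u" for u
  using dot_comm[OF that tN0[of 0]] by (simp add: N0_def)
 have s0: "syz 1 r0 N0" unfolding syz_def using N0m min N0w by simp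
 \<comment> \<open>A state (c, b, N) is a c by b matrix with entries in m whose syzygies also have
   entries in m; dependent choice iterates the syzygy step from the row that generates I.\<close>
 let ?P = "%n (x :: nat \<times> nat \<times> (nat => nat => 'a)). syz (fst x) (fst (snd x)) (snd (snd x)) \<and> (n = (0::nat) --> x = (1, r0, N0))"
 let ?Q = "%(n::nat) (x :: nat \<times> nat \<times> (nat => nat => 'a)) (y :: nat \<times> nat \<times> (nat => nat => 'a)).
   fst y = fst (snd x) \<and> nxt (fst x) (fst (snd x)) (snd (snd x)) (fst (snd y)) (snd (snd y))"
 have "\<exists>f. \<forall>n. ?P n (f n) \<and> ?Q n (f n) (f (Suc n))"
 proof (rule dependent_nat_choice)
  show "\<exists>x. ?P 0 x" using s0 by (intro exI[of _ "(1, r0, N0)"]) simp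
  fix x :: "nat \<times> nat \<times> (nat => nat => 'a)" and n :: nat
  assume P: "?P n x"
  obtain c b N where x: "x = (c, b, N)" by (cases x) auto
  have sN: "\<forall>l k. N l k \<in> m" "\<forall>u. tot u --> (\<forall>l<c. dot b (N l) u = \<zero>) --> (\<forall>k<b. u k \<in> m)"
   using P unfolding x syz_def by auto
  obtain r N' where N': "\<forall>k i. N' k i \<in> m" "\<forall>l<c. \<forall>k. dot b (N l) (%j. N' j k) = \<zero>"
   "\<forall>v. tot v --> (\<forall>l<c. dot b (N l) v = \<zero>) --> (\<exists>u. tot u \<and> (\<forall>k<b. v k = dot r (N' k) u))"
   "\<forall>u. tot u --> (\<forall>k<b. dot r (N' k) u = \<zero>) --> (\<forall>i<r. u i \<in> m)"
   using minres_step[of N c b, OF mt[OF sN(1)] sN(2)] by blast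
  have "?P (Suc n) (b, r, N')" using N'(1,4) unfolding syz_def by simp
  moreover have "?Q n x (b, r, N')" using N'(2,3) unfolding x nxt_def by simp
  ultimately show "\<exists>y. ?P (Suc n) y \<and> ?Q n x y" by blast
 qed
 then obtain f where f: "\<And>n. ?P n (f n)" "\<And>n. ?Q n (f n) (f (Suc n))" by blast
 define r where "r i = fst (f i)" for i
 define M where "M i = snd (snd (f i))" for i
 have rS: "fst (snd (f i)) = r (Suc i)" for i using f(2)[of i] unfolding r_def by simp
 have f0: "f 0 = (1, r0, N0)" using f(1)[of 0] by simp
 have r01: "r 0 = 1" "r 1 = r0" "M 0 = N0" using f0 rS[of 0] unfolding r_def M_def by auto
 have "minres I r M" unfolding minres_def
 proof (intro conjI allI ballI impI)
  show "r 0 = 1" by (rule r01)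
  show "M i l k \<in> m" for i l k using f(1)[of i] unfolding syz_def M_def by blast
  show "M 0 0 k \<in> I" for k unfolding r01 N0_def using wZ(2) by simp
  show "\<exists>u. tot u \<and> x = dot (r 1) (M 0 0) u" if x: "x \<in> I" for x
  proof -
   have "(%_. x) \<in> ?Z" using x ideal_carr[OF I(1) x] by (simp add: tot_def)
   from gensD[OF w this] obtain u where "tot u" "\<forall>k<1. x = dot r0 u (%i. w i k)" by blast
   thus ?thesis using N0w r01 by auto
  qed
  show "dot (r (Suc i)) (M i l) (%j. M (Suc i) j k) = \<zero>" if "l < r i" for i l k
   using f(2)[of i] that unfolding nxt_def rS M_def by (simp add: r_def)
  show "v k \<in> m" if "tot v" "\<forall>l<r i. dot (r (Suc i)) (M i l) v = \<zero>" "k < r (Suc i)" for i v k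
   using f(1)[of i] that unfolding syz_def rS M_def by (simp add: r_def)
  show "\<exists>u. tot u \<and> (\<forall>k<r (Suc i). v k = dot (r (Suc (Suc i))) (M (Suc i) k) u)"
   if "tot v" "\<forall>l<r i. dot (r (Suc i)) (M i l) v = \<zero>" for i v
   using f(2)[of i] that unfolding nxt_def rS M_def by (simp add: r_def)
 qed
 thus ?thesis by blast
qed

end

section \<open>Comparison with a projective resolution\<close>

context cring
begin

lemma hom_closed: "f \<in> module_hom R P N ==> x \<in> carrier P ==> f x \<in> carrier N"
 and hom_add: "f \<in> module_hom R P N ==> x \<in> carrier P ==> y \<in> carrier P ==> f (x \<oplus>\<^bsub>P\<^esub> y) = f x \<oplus>\<^bsub>N\<^esub> f y"
 and hom_smult: "f \<in> module_hom R P N ==> a \<in> carrier R ==> x \<in> carrier P ==> f (a \<odot>\<^bsub>P\<^esub> x) = a \<odot>\<^bsub>N\<^esub> f x"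
 and hom_id: "(%x. x) \<in> module_hom R P P"
 unfolding module_hom_def by auto

lemma hom_comp: "f \<in> module_hom R P N ==> g \<in> module_hom R N Q ==> (%x. g (f x)) \<in> module_hom R P Q"
 by (simp add: module_hom_def Pi_iff)

lemma hom_zero:
 assumes "module R P" "module R N" "f \<in> module_hom R P N"
 shows "f \<zero>\<^bsub>P\<^esub> = \<zero>\<^bsub>N\<^esub>"
proof -
 interpret P: module R P by fact
 interpret N: module R N by fact
 show ?thesis using hom_smult[OF assms(3) zero_closed P.zero_closed] hom_closed[OF assms(3) P.zero_closed] by simp
qed

section \<open>Free modules, their homomorphisms, and lifting from retracts of free modules\<close>

definition unitv :: "'m => 'm => 'a"
 where "unitv b = (%x. if x = b then \<one> else \<zero>)"

lemma free_carrier: "f \<in> carrier (free_module R B) \<longleftrightarrow>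
  (\<forall>b\<in>B. f b \<in> carrier R) \<and> (\<forall>b. b \<notin> B --> f b = \<zero>) \<and> finite {b. f b \<noteq> \<zero>}"
 and free_add: "f \<oplus>\<^bsub>free_module R B\<^esub> g = (%b. f b \<oplus> g b)"
 and free_smult: "a \<odot>\<^bsub>free_module R B\<^esub> f = (%b. a \<otimes> f b)"
 and free_zero: "\<zero>\<^bsub>free_module R B\<^esub> = (%_. \<zero>)"
 by (simp_all add: free_module_def)

lemma free_closed [simp]: "f \<in> carrier (free_module R B) ==> f b \<in> carrier R"
 by (cases "b \<in> B") (auto simp: free_carrier)

lemma unitv_free: "b \<in> B ==> unitv b \<in> carrier (free_module R B)"
 by (auto simp: free_carrier unitv_def)

lemma free_hom_agree:
 fixes B :: "'m set"
 assumes N: "module R N" and \<phi>: "\<phi> \<in> module_hom R (free_module R B) N" "\<phi>' \<in> module_hom R (free_module R B) N"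
  and eq: "\<And>b. b \<in> B ==> \<phi> (unitv b) = \<phi>' (unitv b)" and f: "f \<in> carrier (free_module R B)"
 shows "\<phi> f = \<phi>' f"
proof -
 interpret N: module R N by fact
 let ?F = "free_module R B"
 have "f \<in> carrier ?F --> {b. f b \<noteq> \<zero>} <= S --> \<phi> f = \<phi>' f" if "finite S" for S f
  using that
 proof (induction S arbitrary: f)
  case empty
  have z: "(%_. \<zero>) \<in> carrier ?F" by (simp add: free_carrier)
  have "\<psi> (%_. \<zero>) = \<zero>\<^bsub>N\<^esub>" if "\<psi> \<in> module_hom R ?F N" for \<psi>
   using hom_smult[OF that zero_closed z] hom_closed[OF that z] by (simp add: free_smult)
  from this[OF \<phi>(1)] this[OF \<phi>(2)] have "\<phi> (%_. \<zero>) = \<phi>' (%_. \<zero>)" by simp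
  moreover have "f = (%_. \<zero>)" if "{b. f b \<noteq> \<zero>} <= {}" using that by auto
  ultimately show ?case by blast
 next
  case (insert s S)
  show ?case
  proof (intro impI)
   assume f: "f \<in> carrier ?F" and sub: "{b. f b \<noteq> \<zero>} <= insert s S"
   let ?g = "f(s := \<zero>)"
   have g: "?g \<in> carrier ?F" using f unfolding free_carrier by (auto intro: finite_subset[of _ "{b. f b \<noteq> \<zero>}"])
   have "{b. ?g b \<noteq> \<zero>} <= S" using sub by auto
   hence eq2: "\<phi> ?g = \<phi>' ?g" using insert.IH[of ?g] g by blast
   show "\<phi> f = \<phi>' f"
   proof (cases "s \<in> B")
    case False
    hence "?g = f" using f by (auto simp: free_carrier fun_eq_iff)
    thus ?thesis using eq2 by simp
   next
    case True
    have fg: "f = ?g \<oplus>\<^bsub>?F\<^esub> f s \<odot>\<^bsub>?F\<^esub> unitv s"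
     using f by (auto simp: free_add free_smult unitv_def fun_eq_iff)
    have us: "f s \<odot>\<^bsub>?F\<^esub> unitv s \<in> carrier ?F"
     using f True by (auto simp: free_carrier free_smult unitv_def intro: finite_subset[of _ "{s}"])
    have "\<psi> f = \<psi> ?g \<oplus>\<^bsub>N\<^esub> f s \<odot>\<^bsub>N\<^esub> \<psi> (unitv s)" if "\<psi> \<in> module_hom R ?F N" for \<psi>
     by (subst fg) (use hom_add[OF that g us] hom_smult[OF that _ unitv_free[OF True]] f in simp)
    from this[OF \<phi>(1)] this[OF \<phi>(2)] show ?thesis using eq2 eq[OF True] by simp
   qed
  qed
 qed
 moreover have "finite {b. f b \<noteq> \<zero>}" using f by (simp add: free_carrier)
 ultimately show ?thesis using f by blast
qed

lemma free_hom_exists: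
 assumes N: "module R N" and w: "\<And>b. b \<in> B ==> w b \<in> carrier N"
 shows "\<exists>\<phi>\<in>module_hom R (free_module R B) N. \<forall>b\<in>B. \<phi> (unitv b) = w b"
proof -
 interpret N: module R N by fact
 let ?F = "free_module R B"
 define \<phi> where "\<phi> f = (\<Oplus>\<^bsub>N\<^esub>b\<in>{b. f b \<noteq> \<zero>}. f b \<odot>\<^bsub>N\<^esub> w b)" for f
 have fin: "finite {b. f b \<noteq> \<zero>}" "{b. f b \<noteq> \<zero>} <= B" if "f \<in> carrier ?F" for f using that by (auto simp: free_carrier)
 have cl: "(%b. f b \<odot>\<^bsub>N\<^esub> w b) \<in> S \<rightarrow> carrier N" if "f \<in> carrier ?F" "S <= B" for f S using that w by auto
 have ext: "\<phi> f = (\<Oplus>\<^bsub>N\<^esub>b\<in>S. f b \<odot>\<^bsub>N\<^esub> w b)" if f: "f \<in> carrier ?F" and S: "finite S" "{b. f b \<noteq> \<zero>} <= S" "S <= B" for f S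
  unfolding \<phi>_def by (rule N.add.finprod_mono_neutral_cong_left) (use S w cl[OF f S(3)] in auto)
 have "\<phi> \<in> module_hom R ?F N" unfolding module_hom_def
 proof (intro CollectI conjI ballI Pi_I)
  fix f assume f: "f \<in> carrier ?F"
  note finf = fin[OF f]
  show "\<phi> f \<in> carrier N" unfolding \<phi>_def by (rule N.finsum_closed[OF cl[OF f finf(2)]])
  {
   fix g assume g: "g \<in> carrier ?F"
   let ?S = "{b. f b \<noteq> \<zero>} \<union> {b. g b \<noteq> \<zero>}"
   have S: "finite ?S" "?S <= B" using finf fin[OF g] by auto
   have fg: "f \<oplus>\<^bsub>?F\<^esub> g \<in> carrier ?F"
    using f g finite_subset[OF _ S(1), of "{b. f b \<oplus> g b \<noteq> \<zero>}"] unfolding free_carrier free_add by force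
   have "\<phi> (f \<oplus>\<^bsub>?F\<^esub> g) = (\<Oplus>\<^bsub>N\<^esub>b\<in>?S. (f \<oplus>\<^bsub>?F\<^esub> g) b \<odot>\<^bsub>N\<^esub> w b)"
    by (rule ext[OF fg S(1) _ S(2)]) (auto simp: free_add)
   also have "\<dots> = (\<Oplus>\<^bsub>N\<^esub>b\<in>?S. f b \<odot>\<^bsub>N\<^esub> w b \<oplus>\<^bsub>N\<^esub> g b \<odot>\<^bsub>N\<^esub> w b)"
    unfolding free_add using f g w S(2) by (intro N.finsum_cong') (auto simp: N.smult_l_distr)
   also have "\<dots> = \<phi> f \<oplus>\<^bsub>N\<^esub> \<phi> g"
    using N.finsum_addf[OF cl[OF f S(2)] cl[OF g S(2)]] ext[OF f S(1) _ S(2)] ext[OF g S(1) _ S(2)] by simp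
   finally show "\<phi> (f \<oplus>\<^bsub>?F\<^esub> g) = \<phi> f \<oplus>\<^bsub>N\<^esub> \<phi> g" .
  }
  fix a assume a: "a \<in> carrier R"
  let ?S = "{b. f b \<noteq> \<zero>}"
  have af: "a \<odot>\<^bsub>?F\<^esub> f \<in> carrier ?F"
   using f a finite_subset[OF _ finf(1), of "{b. a \<otimes> f b \<noteq> \<zero>}"] unfolding free_carrier free_smult by force
  have "\<phi> (a \<odot>\<^bsub>?F\<^esub> f) = (\<Oplus>\<^bsub>N\<^esub>b\<in>?S. (a \<odot>\<^bsub>?F\<^esub> f) b \<odot>\<^bsub>N\<^esub> w b)"
   by (rule ext[OF af finf(1) _ finf(2)]) (use a in \<open>auto simp: free_smult\<close>)
  also have "\<dots> = (\<Oplus>\<^bsub>N\<^esub>b\<in>?S. a \<odot>\<^bsub>N\<^esub> (f b \<odot>\<^bsub>N\<^esub> w b))"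
   unfolding free_smult using f a w finf(2) by (intro N.finsum_cong') (auto simp: N.smult_assoc1)
  also have "\<dots> = a \<odot>\<^bsub>N\<^esub> \<phi> f" unfolding \<phi>_def using N.finsum_smult_ldistr[OF finf(1) a cl[OF f finf(2)]] by simp
  finally show "\<phi> (a \<odot>\<^bsub>?F\<^esub> f) = a \<odot>\<^bsub>N\<^esub> \<phi> f" .
 qed
 moreover have "\<phi> (unitv b) = w b" if b: "b \<in> B" for b
 proof -
  have "\<phi> (unitv b) = (\<Oplus>\<^bsub>N\<^esub>x\<in>{b}. unitv b x \<odot>\<^bsub>N\<^esub> w x)"
   by (rule ext[OF unitv_free[OF b]]) (use b in \<open>auto simp: unitv_def\<close>)
  thus ?thesis using w[OF b] by (simp add: unitv_def)
 qed
 ultimately show ?thesis by blast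
qed

text \<open>The lifting property of projectives: lifts of the images of basis vectors are chosen,
  extended to the free module, and restricted along the retraction. It is enough that the image of f
  lies in the image of g.\<close>

lemma free_retract_lift:
 fixes B :: "'k set"
 assumes P: "\<iota> \<in> module_hom R P (free_module R B)" "\<pi> \<in> module_hom R (free_module R B) P" "\<And>x. x \<in> carrier P ==> \<pi> (\<iota> x) = x"
  and N: "module R Q" "module R N" and f: "f \<in> module_hom R P N" and g: "g \<in> module_hom R Q N"
  and im: "\<And>x. x \<in> carrier P ==> f x \<in> g ` carrier Q"
 shows "\<exists>h\<in>module_hom R P Q. \<forall>x\<in>carrier P. g (h x) = f x"
proof -
 note \<pi>u = hom_closed[OF P(2) unitv_free]
 have "\<forall>b\<in>B. \<exists>y. y \<in> carrier Q \<and> g y = f (\<pi> (unitv b))" using im[OF \<pi>u] by (metis imageE)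
 then obtain w where w: "\<And>b. b \<in> B ==> w b \<in> carrier Q \<and> g (w b) = f (\<pi> (unitv b))" by metis
 obtain \<phi> where \<phi>: "\<phi> \<in> module_hom R (free_module R B) Q" "\<forall>b\<in>B. \<phi> (unitv b) = w b"
  using free_hom_exists[OF N(1), of B w] w by blast
 have "g (\<phi> v) = f (\<pi> v)" if "v \<in> carrier (free_module R B)" for v
  using free_hom_agree[OF N(2) hom_comp[OF \<phi>(1) g] hom_comp[OF P(2) f] _ that] \<phi>(2) w by simp
 hence "g (\<phi> (\<iota> x)) = f x" if "x \<in> carrier P" for x using hom_closed[OF P(1) that] P(3)[OF that] by simp
 thus ?thesis by (intro bexI[OF _ hom_comp[OF P(1) \<phi>(1)]]) simp
qed

lemma free_module_module: "module R (free_module R B)"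
proof (rule module.intro[OF is_cring abelian_groupI module_axioms.intro])
 let ?F = "free_module R B"
 have fin: "finite {b. f b \<oplus> g b \<noteq> \<zero>}" if "f \<in> carrier ?F" "g \<in> carrier ?F" for f g
  by (rule finite_subset[of _ "{b. f b \<noteq> \<zero>} \<union> {b. g b \<noteq> \<zero>}"]) (use that in \<open>auto simp: free_carrier\<close>)
 show "f \<oplus>\<^bsub>?F\<^esub> g \<in> carrier ?F" if "f \<in> carrier ?F" "g \<in> carrier ?F" for f g
  using fin[OF that] that unfolding free_carrier free_add by simp
 show "a \<odot>\<^bsub>?F\<^esub> f \<in> carrier ?F" if "a \<in> carrier R" "f \<in> carrier ?F" for a f
  using that finite_subset[of "{b. a \<otimes> f b \<noteq> \<zero>}" "{b. f b \<noteq> \<zero>}"] unfolding free_carrier free_smult by force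
 show "\<exists>g\<in>carrier ?F. g \<oplus>\<^bsub>?F\<^esub> f = \<zero>\<^bsub>?F\<^esub>" if f: "f \<in> carrier ?F" for f
 proof (rule bexI)
  show "(%b. \<ominus> f b) \<oplus>\<^bsub>?F\<^esub> f = \<zero>\<^bsub>?F\<^esub>" using f by (simp add: free_add free_zero l_neg)
  show "(%b. \<ominus> f b) \<in> carrier ?F"
   using f finite_subset[of "{b. \<ominus> f b \<noteq> \<zero>}" "{b. f b \<noteq> \<zero>}"] unfolding free_carrier by force
 qed
qed (auto simp: free_add free_smult free_zero a_ac l_distr r_distr m_assoc fun_eq_iff, simp add: free_carrier)

lemma free_hom_minus:
 assumes f: "f \<in> module_hom R P (free_module R B)" and g: "g \<in> module_hom R P (free_module R B)"
 shows "(%x b. f x b \<ominus> g x b) \<in> module_hom R P (free_module R B)"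
proof -
 note c = free_closed[OF hom_closed[OF f]] free_closed[OF hom_closed[OF g]]
 have "(%b. f x b \<ominus> g x b) \<in> carrier (free_module R B)" if x: "x \<in> carrier P" for x
 proof -
  note fx = hom_closed[OF f x, unfolded free_carrier] hom_closed[OF g x, unfolded free_carrier]
  have "{b. f x b \<ominus> g x b \<noteq> \<zero>} <= {b. f x b \<noteq> \<zero>} \<union> {b. g x b \<noteq> \<zero>}" by (auto simp: minus_eq)
  thus ?thesis using fx finite_subset[of "{b. f x b \<ominus> g x b \<noteq> \<zero>}"] unfolding free_carrier by (auto simp: minus_eq)
 qed
 moreover have "(a \<oplus> b) \<ominus> (a' \<oplus> b') = (a \<ominus> a') \<oplus> (b \<ominus> b')"
  if "a \<in> carrier R" "b \<in> carrier R" "a' \<in> carrier R" "b' \<in> carrier R" for a b a' b'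
  using that by algebra
 moreover have "c \<otimes> a \<ominus> c \<otimes> b = c \<otimes> (a \<ominus> b)"
  if "a \<in> carrier R" "b \<in> carrier R" "c \<in> carrier R" for a b c
  using that by algebra
 ultimately show ?thesis using c hom_add[OF f] hom_add[OF g] hom_smult[OF f] hom_smult[OF g]
  unfolding module_hom_def by (auto simp: free_add free_smult)
qed

abbreviation Fr :: "nat => ('a, nat => 'a) module"
 where "Fr n \<equiv> free_module R {..<n}"

text \<open>Zero beyond k, which is the normal form of elements of \<open>Fr k\<close>.\<close>

definition mat :: "nat => nat => (nat => nat => 'a) => (nat => 'a) => nat => 'a"
 where "mat n k D v = (%l. if l < k then dot n (D l) v else \<zero>)"

lemma Fr_carrier: "v \<in> carrier (Fr n) \<longleftrightarrow> tot v \<and> (\<forall>i\<ge>n. v i = \<zero>)"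
proof -
 have "finite {i. v i \<noteq> \<zero>}" if "\<forall>i\<ge>n. v i = \<zero>" by (rule finite_subset[of _ "{..<n}"]) (use that not_less in auto)
 moreover have "v i \<in> carrier R" if "\<forall>i<n. v i \<in> carrier R" "\<forall>i\<ge>n. v i = \<zero>" for i
  using that by (cases "i < n") auto
 ultimately show ?thesis unfolding free_carrier tot_def by auto
qed

lemma mat_hom:
 assumes D: "\<And>l. tot (D l)"
 shows "mat n k D \<in> module_hom R (Fr n) (Fr k)"
proof -
 have "mat n k D v \<in> carrier (Fr k)" if "tot v" for v
  using that D by (auto simp: Fr_carrier mat_def tot_def[of "%l. if _ l then _ l else \<zero>"])
 thus ?thesis unfolding module_hom_def
  by (auto simp: Fr_carrier free_add free_smult mat_def dot_add_right dot_smult_right D)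
qed

lemma hom_mat:
 assumes f: "f \<in> module_hom R (Fr n) (Fr k)"
 shows "\<exists>D. (\<forall>l. tot (D l)) \<and> (\<forall>v\<in>carrier (Fr n). f v = mat n k D v)"
proof -
 let ?D = "%l i. if i < n then f (unitv i) l else \<zero>"
 have fu: "f (unitv i) \<in> carrier (Fr k)" if "i < n" for i using hom_closed[OF f unitv_free] that by simp
 have tD: "tot (?D l)" for l using fu by (auto simp: tot_def Fr_carrier)
 have "f v = mat n k ?D v" if "v \<in> carrier (Fr n)" for v
 proof (rule free_hom_agree[OF free_module_module f mat_hom[OF tD] _ that])
  fix i :: nat assume i: "i \<in> {..<n}"
  show "f (unitv i) = mat n k ?D (unitv i)"
   using fu[of i] i dot_delta_right[OF tD, of i n] by (auto simp: mat_def unitv_def Fr_carrier fun_eq_iff)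
 qed
 thus ?thesis by (intro exI[where x = ?D] conjI allI tD ballI)
qed

end

section \<open>Homotopy comparison of the minimal resolution with a projective resolution\<close>

context nlocal
begin

text \<open>The two complexes ending in \<open>Q\<close> and in \<open>R\<^bsup>a\<^esup>\<close> are homotopy equivalent up to this degree, where \<open>B\<close>
 and \<open>D\<close> describe the boundaries and \<open>y\<close> is the part of the homotopy coming from the previous degree, with entries in \<open>m\<close> by minimality.\<close>

definition equiv_upto :: "('a, 'm) module => 'm set => nat => nat => (nat => nat => 'a) => bool"
 where "equiv_upto Q B a b D \<longleftrightarrow> (\<exists>\<beta>\<in>module_hom R Q (Fr a). \<exists>\<alpha>\<in>module_hom R (Fr a) Q. \<exists>h\<in>module_hom R (Fr a) (Fr b). \<exists>y.
  (\<forall>x\<in>B. \<beta> x \<in> mat b a D ` carrier (Fr b)) \<and> (\<forall>g\<in>carrier (Fr b). \<alpha> (mat b a D g) \<in> B \<and> (\<forall>l. y (mat b a D g) l = \<zero>)) \<and>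
  (\<forall>g\<in>carrier (Fr a). \<forall>l. y g l \<in> m \<and> g l = \<beta> (\<alpha> g) l \<oplus> y g l \<oplus> mat b a D (h g) l))"

text \<open>The usual comparison maps \<alpha>' and \<beta>' are lifted one degree. By the old
  homotopy relation the defect id - \<beta>' \<alpha>' - h D is annihilated by D, so it lifts
  through D' to the next homotopy. The summand inherited from the previous degree is h D, and its
  values lie in m because D has entries in m.\<close>

lemma equiv_upto_step:
 fixes Q :: "('a, 'm) module" and Q' :: "('a, 'q) module"
 assumes E: "equiv_upto Q (d ` carrier Q') a b D" and Q: "module R Q" "projective_module R Q'" "d \<in> module_hom R Q' Q"
  and D: "\<And>l k. D l k \<in> m" "\<And>l. tot (D' l)"
  and ex: "\<And>v. v \<in> carrier (Fr b) ==> (\<forall>l. mat b a D v l = \<zero>) \<longleftrightarrow> v \<in> mat c b D' ` carrier (Fr c)"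
 shows "equiv_upto Q' (module_ker Q' Q d) b c D'"
proof -
 let ?D = "mat b a D" and ?D' = "mat c b D'"
 have tD: "tot (D l)" for l using D(1) m_carr by (auto simp: tot_def)
 note D_hom = mat_hom[of D, OF tD, of b a] and D'_hom = mat_hom[of D', OF D(2), of c b]
 note F = free_module_module
 have z: "?D (%_. \<zero>) = (%_. \<zero>)" using dot_zero_right[OF tD] by (simp add: mat_def fun_eq_iff)
 obtain B :: "'q set" and \<iota> \<pi> where Q': "\<iota> \<in> module_hom R Q' (free_module R B)" "\<pi> \<in> module_hom R (free_module R B) Q'"
  "\<And>x. x \<in> carrier Q' ==> \<pi> (\<iota> x) = x" "module R Q'" using Q(2) unfolding projective_module_def by blast
 obtain \<beta> \<alpha> h y where \<beta>: "\<beta> \<in> module_hom R Q (Fr a)" "\<And>x. x \<in> carrier Q' ==> \<beta> (d x) \<in> ?D ` carrier (Fr b)"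
  and \<alpha>: "\<alpha> \<in> module_hom R (Fr a) Q" "\<And>g. g \<in> carrier (Fr b) ==> \<alpha> (?D g) \<in> d ` carrier Q'"
  and h: "h \<in> module_hom R (Fr a) (Fr b)" and y: "\<And>g l. g \<in> carrier (Fr b) ==> y (?D g) l = \<zero>"
  and eq: "\<And>g l. g \<in> carrier (Fr a) ==> g l = \<beta> (\<alpha> g) l \<oplus> y g l \<oplus> ?D (h g) l"
  using E unfolding equiv_upto_def by blast
 obtain \<beta>' where \<beta>': "\<beta>' \<in> module_hom R Q' (Fr b)" "\<And>x. x \<in> carrier Q' ==> ?D (\<beta>' x) = \<beta> (d x)"
  using free_retract_lift[OF Q'(1-3) F F hom_comp[OF Q(3) \<beta>(1)] D_hom \<beta>(2)] by blast
 obtain \<alpha>' where \<alpha>': "\<alpha>' \<in> module_hom R (Fr b) Q'" "\<And>g. g \<in> carrier (Fr b) ==> d (\<alpha>' g) = \<alpha> (?D g)"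
  using free_retract_lift[OF hom_id hom_id refl Q'(4) Q(1) hom_comp[OF D_hom \<alpha>(1)] Q(3) \<alpha>(2)] by blast
 note Dc = hom_closed[OF D_hom] and ba' = hom_comp[OF \<alpha>'(1) \<beta>'(1)] and hD = hom_comp[OF D_hom h]
 define u where "u g = (%l. g l \<ominus> \<beta>' (\<alpha>' g) l \<ominus> h (?D g) l)" for g
 have u: "u \<in> module_hom R (Fr b) (Fr b)"
  unfolding u_def using free_hom_minus[OF free_hom_minus[OF hom_id ba'] hD] .
 have Du: "?D (u g) l = \<zero>" if g: "g \<in> carrier (Fr b)" for g l
 proof (cases "l < a")
  case True
  note tots = hom_closed[OF ba' g] hom_closed[OF hD g] g
  note t = tots[unfolded Fr_carrier, THEN conjunct1]
  have "?D (u g) l = ?D g l \<ominus> ?D (\<beta>' (\<alpha>' g)) l \<ominus> ?D (h (?D g)) l"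
   using True dot_minus_right[OF tD tot_minus[OF t(3,1)] t(2)] dot_minus_right[OF tD t(3,1)] by (simp add: mat_def u_def)
  also have "?D (\<beta>' (\<alpha>' g)) = \<beta> (\<alpha> (?D g))" using \<beta>'(2)[OF hom_closed[OF \<alpha>'(1) g]] \<alpha>'(2)[OF g] by simp
  also have "?D g l = \<beta> (\<alpha> (?D g)) l \<oplus> \<zero> \<oplus> ?D (h (?D g)) l" using eq[OF Dc[OF g], of l] y[OF g] by simp
  also have "(x \<oplus> \<zero> \<oplus> z) \<ominus> x \<ominus> z = \<zero>" if "x \<in> carrier R" "z \<in> carrier R" for x z using that by algebra
  finally show ?thesis using hom_closed[OF \<beta>(1) hom_closed[OF \<alpha>(1) Dc[OF g]]] Dc[OF hom_closed[OF hD g]] by simp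
 qed (simp add: mat_def)
 obtain h' where h': "h' \<in> module_hom R (Fr b) (Fr c)" "\<And>g. g \<in> carrier (Fr b) ==> ?D' (h' g) = u g"
  using free_retract_lift[OF hom_id hom_id refl F F u D'_hom] ex[OF hom_closed[OF u]] Du by blast
 obtain H where H: "\<And>l. tot (H l)" "\<And>v. v \<in> carrier (Fr a) ==> h v = mat a b H v" using hom_mat[OF h] by blast
 show ?thesis unfolding equiv_upto_def
 proof (intro bexI[OF _ \<beta>'(1)] bexI[OF _ \<alpha>'(1)] bexI[OF _ h'(1)] exI[of _ "%g. h (?D g)"] conjI ballI allI)
  fix x assume "x \<in> module_ker Q' Q d"
  hence x: "x \<in> carrier Q'" "d x = \<zero>\<^bsub>Q\<^esub>" by (auto simp: module_ker_def)
  show "\<beta>' x \<in> ?D' ` carrier (Fr c)"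
   using ex[OF hom_closed[OF \<beta>'(1) x(1)]] \<beta>'(2)[OF x(1)] x(2) hom_zero[OF Q(1) F \<beta>(1)] by (simp add: free_zero)
 next
  fix g assume "g \<in> carrier (Fr c)"
  hence g: "?D' g \<in> carrier (Fr b)" "?D (?D' g) = (%_. \<zero>)" using hom_closed[OF D'_hom] ex by (auto simp: fun_eq_iff)
  show "\<alpha>' (?D' g) \<in> module_ker Q' Q d"
   using hom_closed[OF \<alpha>'(1) g(1)] \<alpha>'(2)[OF g(1)] g(2) hom_zero[OF F Q(1) \<alpha>(1)] by (simp add: module_ker_def free_zero)
  show "h (?D (?D' g)) l = \<zero>" for l using g(2) hom_zero[OF F F h] by (simp add: free_zero)
 next
  fix g l assume g: "g \<in> carrier (Fr b)"
  have tg: "tot g" using g by (simp add: Fr_carrier)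
  have "?D g i \<in> m" for i
   using dot_ideal'[OF m_ideal tg] D(1) ideal_zero[OF m_ideal] by (simp add: mat_def)
  hence "dot a (H l) (?D g) \<in> m" by (intro dot_ideal[OF m_ideal H(1)])
  thus "h (?D g) l \<in> m" using H(2)[OF Dc[OF g]] ideal_zero[OF m_ideal] by (simp add: mat_def)
  have "g' = x \<oplus> z \<oplus> (g' \<ominus> x \<ominus> z)" if "x \<in> carrier R" "z \<in> carrier R" "g' \<in> carrier R" for x z g' using that by algebra
  thus "g l = \<beta>' (\<alpha>' g) l \<oplus> h (?D g) l \<oplus> ?D' (h' g) l"
   using hom_closed[OF ba' g] hom_closed[OF hD g] g unfolding h'(2)[OF g] u_def by simp
 qed
qed

text \<open>Where the projective resolution has become zero, the identity of the free module is a
  sum of a homotopy part and an inherited part, both with values in m by minimality; a basis vector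
  would give 1 in m. The given resolution is one of I rather than R/I, so \<open>P i\<close> is
  compared with rank \<open>r (Suc i)\<close>, and \<open>P (Suc n) = 0\<close> yields the index n +
  2.\<close>

lemma minres_vanishes:
 fixes P :: "nat => ('a, 'm) module"
 assumes I: "ideal I R" and M: "minres I r M" and res: "projective_resolution R (ideal_module R I) n P \<epsilon> d"
 shows "r (n + 2) = 0"
proof (rule ccontr)
 assume r: "r (n + 2) \<noteq> 0"
 have Mm: "M i l k \<in> m" and MI: "M 0 0 k \<in> I" and r0: "r 0 = 1" for i l k using M unfolding minres_def by blast+
 have tM: "tot (M i l)" for i l using Mm m_carr by (auto simp: tot_def)
 have trunc: "dot k D (%l. if l < k then u l else \<zero>) = dot k D u" for k D u by (rule dot_cong) auto
 have trF: "(%l. if l < k then u l else \<zero>) \<in> carrier (Fr k)" if "tot u" for u k using that by (auto simp: Fr_carrier tot_def)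
 let ?M = "%i. mat (r (Suc i)) (r i) (M i)"
 have ex: "(\<forall>l. ?M i v l = \<zero>) \<longleftrightarrow> v \<in> ?M (Suc i) ` carrier (Fr (r (Suc (Suc i))))" (is "?L \<longleftrightarrow> ?R")
  if v: "v \<in> carrier (Fr (r (Suc i)))" for i v
 proof
  have tv: "tot v" and v0: "\<And>k. k \<ge> r (Suc i) ==> v k = \<zero>" using v by (auto simp: Fr_carrier)
  {
   assume L: ?L
   have "\<forall>l<r i. dot (r (Suc i)) (M i l) v = \<zero>"
   proof (intro allI impI)
    fix l assume "l < r i"
    thus "dot (r (Suc i)) (M i l) v = \<zero>" using L[rule_format, of l] by (simp add: mat_def)
   qed
   then obtain u where u: "tot u" "\<forall>k<r (Suc i). v k = dot (r (Suc (Suc i))) (M (Suc i) k) u"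
    using M tv unfolding minres_def by blast
   have "v = ?M (Suc i) (%l. if l < r (Suc (Suc i)) then u l else \<zero>)"
    using u(2) v0 by (auto simp: mat_def trunc fun_eq_iff)
   thus ?R using trF[OF u(1)] by blast
  next
   assume ?R
   then obtain u where u: "tot u" "v = ?M (Suc i) u" by (auto simp: Fr_carrier)
   have "dot (r (Suc i)) (M i l) v = \<zero>" if l: "l < r i" for l
   proof -
    have "dot (r (Suc i)) (M i l) v = dot (r (Suc i)) (M i l) (%j. dot (r (Suc (Suc i))) (M (Suc i) j) u)"
     unfolding u(2) mat_def by (rule dot_cong) auto
    also have "\<dots> = dot (r (Suc (Suc i))) (%j. dot (r (Suc i)) (M i l) (%k. M (Suc i) k j)) u"
     by (rule dot_dot[OF tM tM u(1)])
    also have "\<dots> = dot (r (Suc (Suc i))) (%j. \<zero>) u" by (rule dot_cong) (use M l in \<open>auto simp: minres_def\<close>)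
    finally show ?thesis using dot_zero[OF u(1)] by simp
   qed
   thus ?L by (simp add: mat_def)
  }
 qed
 have P: "projective_module R (P i)" "d i \<in> module_hom R (P (Suc i)) (P i)"
  "module_ker (P (Suc i)) (P i) (d i) = d (Suc i) ` carrier (P (Suc (Suc i)))" for i
  using res unfolding projective_resolution_def by auto
 have Pm: "module R (P i)" for i using P(1) unfolding projective_module_def by blast
 have \<epsilon>: "\<epsilon> \<in> module_hom R (P 0) (ideal_module R I)" "\<epsilon> ` carrier (P 0) = I"
  "module_ker (P 0) (ideal_module R I) \<epsilon> = d 0 ` carrier (P 1)" and Pn: "\<And>i. i > n ==> carrier (P i) = {\<zero>\<^bsub>P i\<^esub>}"
  using res unfolding projective_resolution_def by (auto simp: regular_module_def)
 \<comment> \<open>The augmentation followed by the inclusion of I into R = \<open>Fr 1\<close>.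
   Degree 0 of the comparison is then R with itself, the boundaries being I on both sides.\<close>
 define \<eta> where "\<eta> x = (%l::nat. if l = 0 then \<epsilon> x else \<zero>)" for x
 have \<eta>: "\<eta> \<in> module_hom R (P 0) (Fr 1)" "module_ker (P 0) (Fr 1) \<eta> = d 0 ` carrier (P 1)"
 proof -
  have "\<epsilon> x \<in> carrier R" if "x \<in> carrier (P 0)" for x using that \<epsilon>(2) ideal_carr[OF I] by auto
  thus "\<eta> \<in> module_hom R (P 0) (Fr 1)" using hom_add[OF \<epsilon>(1)] hom_smult[OF \<epsilon>(1)]
   unfolding module_hom_def \<eta>_def by (auto simp: Fr_carrier tot_def free_add free_smult regular_module_def fun_eq_iff)
  have "\<eta> x = \<zero>\<^bsub>Fr 1\<^esub> \<longleftrightarrow> \<epsilon> x = \<zero>" for x unfolding \<eta>_def free_zero by (auto simp: fun_eq_iff)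
  thus "module_ker (P 0) (Fr 1) \<eta> = d 0 ` carrier (P 1)" unfolding \<epsilon>(3)[symmetric] module_ker_def by (simp add: regular_module_def)
 qed
 have "equiv_upto (Fr 1) (\<eta> ` carrier (P 0)) (r 0) (r 1) (M 0)" unfolding equiv_upto_def r0
 proof (intro bexI[OF _ hom_id] bexI[OF _ mat_hom[of "%_ _. \<zero>"]] exI[of _ "%_ _. \<zero>"] conjI ballI allI)
  fix x assume "x \<in> \<eta> ` carrier (P 0)"
  then obtain i where i: "i \<in> I" "x = (%l. if l = 0 then i else \<zero>)" using \<epsilon>(2) unfolding \<eta>_def by blast
  then obtain u where u: "tot u" "i = dot (r 1) (M 0 0) u" using M unfolding minres_def by blast
  have "x = mat (r 1) 1 (M 0) (%l. if l < r 1 then u l else \<zero>)" unfolding i(2) u(2) by (auto simp: mat_def trunc fun_eq_iff)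
  thus "x \<in> mat (r 1) 1 (M 0) ` carrier (Fr (r 1))" using trF[OF u(1)] by blast
 next
  fix g assume g: "g \<in> carrier (Fr (r 1))"
  have "dot (r 1) (M 0 0) g \<in> I" by (rule dot_ideal'[OF I]) (use g MI in \<open>auto simp: Fr_carrier\<close>)
  then obtain x where x: "x \<in> carrier (P 0)" "dot (r 1) (M 0 0) g = \<epsilon> x" using \<epsilon>(2) by blast
  have "mat (r 1) 1 (M 0) g = \<eta> x" unfolding mat_def \<eta>_def x(2)[symmetric] by (auto simp: fun_eq_iff)
  thus "mat (r 1) 1 (M 0) g \<in> \<eta> ` carrier (P 0)" using x(1) by blast
 next
  fix g l assume g: "g \<in> carrier (Fr 1)"
  have "mat (r 1) 1 (M 0) (mat 1 (r 1) (%_ _. \<zero>) g) l = \<zero>"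
   using dot_zero[of g] dot_zero_right[OF tM] g by (simp add: mat_def Fr_carrier cong: if_cong)
  thus "g l = g l \<oplus> \<zero> \<oplus> mat (r 1) 1 (M 0) (mat 1 (r 1) (%_ _. \<zero>) g) l" using g by simp
 qed (use ideal_zero[OF m_ideal] tot_zero in auto)
 from equiv_upto_step[OF this free_module_module P(1) \<eta>(1) Mm tM ex[of _ 0, folded One_nat_def]]
 have base: "equiv_upto (P 0) (d 0 ` carrier (P 1)) (r 1) (r 2) (M 1)" using r0 \<eta>(2) by (simp add: numeral_2_eq_2)
 have "equiv_upto (P i) (d i ` carrier (P (Suc i))) (r (Suc i)) (r (Suc (Suc i))) (M (Suc i))" for i
 proof (induction i)
  case (Suc i)
  from equiv_upto_step[OF this Pm P(1,2) Mm tM ex] show ?case unfolding P(3) .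
 qed (use base in \<open>simp add: numeral_2_eq_2\<close>)
 note E = this[of "Suc n", unfolded equiv_upto_def]
 let ?F = "Fr (r (Suc (Suc n)))"
 from E obtain \<beta> \<alpha> h y where \<beta>: "\<beta> \<in> module_hom R (P (Suc n)) ?F" and \<alpha>: "\<alpha> \<in> module_hom R ?F (P (Suc n))"
  and h: "h \<in> module_hom R ?F (Fr (r (Suc (Suc (Suc n)))))"
  and y: "\<forall>g\<in>carrier ?F. \<forall>l. y g l \<in> m \<and> g l = \<beta> (\<alpha> g) l \<oplus> y g l \<oplus> ?M (Suc (Suc n)) (h g) l"
  by (elim bexE exE conjE)
 let ?e = "unitv (0::nat)"
 have e: "?e \<in> carrier ?F" by (rule unitv_free) (use r in \<open>simp add: numeral_2_eq_2\<close>)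
 have "\<beta> (\<alpha> ?e) = (%_. \<zero>)"
  using hom_closed[OF \<alpha> e] Pn[of "Suc n"] hom_zero[OF Pm free_module_module \<beta>] by (simp add: free_zero)
 moreover have "?M (Suc (Suc n)) (h ?e) 0 \<in> m"
  using dot_ideal'[OF m_ideal] hom_closed[OF h e] Mm ideal_zero[OF m_ideal] by (simp add: mat_def Fr_carrier)
 moreover have "y ?e 0 \<in> m" "?e 0 = \<beta> (\<alpha> ?e) 0 \<oplus> y ?e 0 \<oplus> ?M (Suc (Suc n)) (h ?e) 0" using y e by auto
 ultimately have "?e 0 \<in> m" using ideal_add[OF m_ideal, of "y ?e 0"] ideal_carr[OF m_ideal, of "y ?e 0"] by simp
 thus False using one_notin_m by (simp add: unitv_def)
qed

end

section \<open>Annihilators of the dual complex\<close>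

context cring
begin

section \<open>Fraction-free linear algebra modulo a prime\<close>

lemma urowI: "r \<in> carrier R ==> tot \<rho> ==> (\<And>k. k < n1 ==> r \<otimes> \<phi> k \<ominus> dot n0 \<rho> (%l. E l k) \<in> A k) ==> r \<in> urow n0 n1 E \<phi> A"
 unfolding urow_def by blast

text \<open>One elimination step with pivot \<open>D n j\<close>: a solution of the reduced system
  is scaled by the pivot, and the coefficient of the pivot row is read off from column j.\<close>

lemma urow_pivot:
 assumes f: "tot f" and D: "\<And>l. tot (D l)"
  and w: "w \<in> urow n b (%l k. D n j \<otimes> D l k \<ominus> D l j \<otimes> D n k) (%k. D n j \<otimes> f k \<ominus> f j \<otimes> D n k) A"
 shows "w \<otimes> D n j \<in> urow (Suc n) b D f A"
proof -
 let ?a = "D n j" and ?d = "D n"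
 have Dc: "tot (%l. D l k)" for k by (rule tot_col[of D, OF D])
 have a: "?a \<in> carrier R" using totD[OF D] .
 obtain g where g: "w \<in> carrier R" "tot g" "\<And>k. k < b ==> w \<otimes> (?a \<otimes> f k \<ominus> f j \<otimes> ?d k) \<ominus> dot n g (%l. ?a \<otimes> D l k \<ominus> D l j \<otimes> ?d k) \<in> A k"
  using w unfolding urow_def by blast
 let ?e = "w \<otimes> f j \<ominus> dot n g (%l. D l j)"
 let ?g = "%l. if l < n then ?a \<otimes> g l else ?e"
 have tg: "tot ?g" using g(1) a totD[OF g(2)] totD[OF f] dot_closed[OF g(2) Dc] by (auto simp: tot_def)
 show ?thesis
 proof (rule urowI[OF m_closed[OF g(1) a] tg])
  fix k assume k: "k < b"
  have c: "f k \<in> carrier R" "f j \<in> carrier R" "?d k \<in> carrier R" "dot n g (%l. D l k) \<in> carrier R" "dot n g (%l. D l j) \<in> carrier R"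
   using totD[OF f] totD[OF D] dot_closed[OF g(2) Dc] by auto
  have "dot n ?g (%l. D l k) = dot n (%l. ?a \<otimes> g l) (%l. D l k)" by (rule dot_cong) auto
  hence 1: "dot (Suc n) ?g (%l. D l k) = ?a \<otimes> dot n g (%l. D l k) \<oplus> ?e \<otimes> ?d k"
   using dot_smult[OF a g(2) Dc] by simp
  have "dot n g (%l. ?a \<otimes> D l k \<ominus> D l j \<otimes> ?d k) = dot n g (%l. ?a \<otimes> D l k \<ominus> ?d k \<otimes> D l j)"
   by (rule dot_cong) (use totD[OF D] in \<open>simp_all add: m_comm\<close>)
  also have "\<dots> = ?a \<otimes> dot n g (%l. D l k) \<ominus> ?d k \<otimes> dot n g (%l. D l j)"
   using dot_minus_right[OF g(2) tot_smult[OF a Dc] tot_smult[OF c(3) Dc]] dot_smult_right[OF a g(2) Dc] dot_smult_right[OF c(3) g(2) Dc] by simp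
  finally have 2: "dot n g (%l. ?a \<otimes> D l k \<ominus> D l j \<otimes> ?d k) = ?a \<otimes> dot n g (%l. D l k) \<ominus> ?d k \<otimes> dot n g (%l. D l j)" .
  have "w \<otimes> A \<otimes> F \<ominus> (A \<otimes> G \<oplus> (w \<otimes> F' \<ominus> G') \<otimes> E) = w \<otimes> (A \<otimes> F \<ominus> F' \<otimes> E) \<ominus> (A \<otimes> G \<ominus> E \<otimes> G')"
   if "F \<in> carrier R" "F' \<in> carrier R" "E \<in> carrier R" "G \<in> carrier R" "G' \<in> carrier R" "A \<in> carrier R" for F F' E G G' A
   using that g(1) by algebra
  from this[OF c a] show "w \<otimes> ?a \<otimes> f k \<ominus> dot (Suc n) ?g (%l. D l k) \<in> A k" using g(3)[OF k] unfolding 1 2 by simp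
 qed
qed

text \<open>Over the fraction field of R/P this is the double annihilator of a row space: a
  functional that vanishes on the kernel of D is a combination of the rows of D. Clearing
  denominators costs a factor outside P. Elimination proceeds by rows, and a row that vanishes
  modulo P is dropped.\<close>

lemma row_space:
 assumes P: "primeideal P R" and f: "tot f" and D: "\<And>l. tot (D l)"
  and ker: "\<And>v. tot v ==> (\<And>l. l < n ==> dot b (D l) v \<in> P) ==> dot b f v \<in> P"
 shows "\<not> urow n b D f (%_. P) <= P"
 using f D ker
proof (induction n arbitrary: f D)
 case 0
 have "f k \<in> P" if "k < b" for k
  using 0(3)[OF tot_delta[of k]] dot_delta_right[OF 0(1) that] by simp
 hence "\<one> \<in> urow 0 b D f (%_. P)" using totD[OF 0(1)] by (intro urowI[OF _ tot_zero]) (auto simp: minus_eq)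
 thus ?case using prime_one[OF P] by blast
next
 case (Suc n)
 note PI = prime_ideal[OF P] and f = Suc.prems(1) and D = Suc.prems(2)
 show ?case
 proof (cases "\<forall>k<b. D n k \<in> P")
  case True
  have "\<not> urow n b D f (%_. P) <= P"
  proof (rule Suc.IH[OF f D])
   fix v assume v: "tot v" "\<And>l. l < n ==> dot b (D l) v \<in> P"
   have "dot b (D n) v \<in> P" using dot_ideal'[OF PI v(1)] True by blast
   thus "dot b f v \<in> P" using Suc.prems(3)[OF v(1)] v(2) by (auto simp: less_Suc_eq)
  qed
  moreover have "urow n b D f (%_. P) <= urow (Suc n) b D f (%_. P)"
  proof
   fix w assume "w \<in> urow n b D f (%_. P)"
   then obtain g where g: "w \<in> carrier R" "tot g" "\<And>k. k < b ==> w \<otimes> f k \<ominus> dot n g (%l. D l k) \<in> P" unfolding urow_def by blast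
   have "dot n (g(n := \<zero>)) (%l. D l k) = dot n g (%l. D l k)" for k by (rule dot_cong) auto
   hence "dot (Suc n) (g(n := \<zero>)) (%l. D l k) = dot n g (%l. D l k)" for k
    using totD[OF D] dot_closed[OF g(2) tot_col[of D, OF D]] by simp
   thus "w \<in> urow (Suc n) b D f (%_. P)" using g by (intro urowI[of _ "g(n := \<zero>)"]) (auto simp: tot_def)
  qed
  ultimately show ?thesis by blast
 next
  case False
  then obtain j where j: "j < b" "D n j \<notin> P" by blast
  let ?a = "D n j" and ?d = "D n"
  have a: "?a \<in> carrier R" using totD[OF D] .
  let ?f = "%h k. ?a \<otimes> h k \<ominus> h j \<otimes> ?d k"
  have tf: "tot (?f h)" if "tot h" for h using that D by (auto simp: tot_def)
  have "\<not> urow n b (%l. ?f (D l)) (?f f) (%_. P) <= P"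
  proof (rule Suc.IH[OF tf[OF f] tf[OF D]])
   fix v assume v: "tot v" "\<And>l. l < n ==> dot b (?f (D l)) v \<in> P"
   let ?v = "%i. ?a \<otimes> v i \<ominus> dot b ?d v \<otimes> (if i = j then \<one> else \<zero>)"
   have dv: "dot b ?d v \<in> carrier R" using D v(1) by simp
   have tv: "tot ?v" using tot_minus[OF tot_smult[OF a v(1)] tot_smult[OF dv tot_delta]] .
   have val: "dot b (?f h) v = dot b h ?v" if h: "tot h" for h
   proof -
    have c: "dot b h v \<in> carrier R" "h j \<in> carrier R" using h v by (auto simp: totD)
    have "dot b (?f h) v = ?a \<otimes> dot b h v \<ominus> h j \<otimes> dot b ?d v"
     using dot_minus[OF tot_smult[OF a h] tot_smult[OF c(2) D] v(1)] dot_smult[OF a h v(1)] dot_smult[OF c(2) D v(1)] by simp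
    moreover have "dot b h ?v = ?a \<otimes> dot b h v \<ominus> dot b ?d v \<otimes> h j"
     using dot_minus_right[OF h tot_smult[OF a v(1)] tot_smult[OF dv tot_delta]] dot_smult_right[OF a h v(1)]
      dot_smult_right[OF dv h tot_delta] dot_delta_right[OF h j(1)] by simp
    ultimately show ?thesis using c dv by (simp add: m_comm)
   qed
   have "?f ?d = (%k. \<zero>)" using totD[OF D] by (simp add: minus_eq r_neg)
   hence "dot b ?d ?v \<in> P" using val[OF D[of n]] dot_zero[OF v(1)] ideal_zero[OF PI] by simp
   hence "dot b (D l) ?v \<in> P" if "l < Suc n" for l
    using that val[OF D[of l]] v(2)[of l] by (cases "l = n") auto
   thus "dot b (?f f) v \<in> P" using Suc.prems(3)[OF tv] val[OF f] by simp
  qed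
  then obtain w where w: "w \<in> urow n b (%l. ?f (D l)) (?f f) (%_. P)" "w \<notin> P" by blast
  have "w \<otimes> ?a \<notin> P" using w j(2) a primeD[OF P, of w ?a] by (auto simp: urow_def)
  thus ?thesis using urow_pivot[of f D, OF f D w(1)] by blast
 qed
qed

text \<open>A matrix congruent modulo P to a unit multiple of the identity is invertible over R_P.
  Elimination along the diagonal keeps this congruence, with w replaced by pivot times w, and the
  solution is exact over R and not just modulo P.\<close>

lemma row_solve:
 assumes P: "primeideal P R" and f: "tot f" and A: "\<And>l. tot (A l)" and w: "w \<in> carrier R - P"
  and cong: "\<And>l k. l < n ==> k < n ==> A l k \<ominus> w \<otimes> (if l = k then \<one> else \<zero>) \<in> P"
 shows "\<not> urow n n A f (%_. {\<zero>}) <= P"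
 using f A w cong
proof (induction n arbitrary: f A w)
 case 0
 have "\<one> \<in> urow 0 0 A f (%_. {\<zero>})" by (rule urowI[OF _ tot_zero]) auto
 thus ?case using prime_one[OF P] by blast
next
 case (Suc n)
 note PI = prime_ideal[OF P] and f = Suc.prems(1) and A = Suc.prems(2) and w = Suc.prems(3) and cong = Suc.prems(4)
 let ?a = "A n n" and ?d = "A n"
 have a: "?a \<in> carrier R" using totD[OF A] .
 have "?a \<notin> P" using cong[of n n] w ideal_minus_cancel'[OF PI, of ?a w] by auto
 hence aP: "?a \<in> carrier R - P" using a by blast
 let ?f = "%h k. ?a \<otimes> h k \<ominus> h n \<otimes> ?d k"
 have tf: "tot (?f h)" if "tot h" for h using that A by (auto simp: tot_def)
 have aw: "?a \<otimes> w \<in> carrier R - P" using aP w primeD[OF P, of ?a w] by auto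
 have "?f (A l) k \<ominus> (?a \<otimes> w) \<otimes> (if l = k then \<one> else \<zero>) \<in> P" if lk: "l < n" "k < n" for l k
 proof -
  let ?\<delta> = "if l = k then \<one> else \<zero>"
  have c: "A l k \<in> carrier R" "A l n \<in> carrier R" "?d k \<in> carrier R" "?\<delta> \<in> carrier R" "w \<in> carrier R" using totD[OF A] w by auto
  have Aln: "A l n \<in> P" using cong[of l n] lk c by (simp add: minus_eq)
  have "a \<otimes> x \<ominus> y \<otimes> z \<ominus> (a \<otimes> w') \<otimes> d = a \<otimes> (x \<ominus> w' \<otimes> d) \<ominus> y \<otimes> z"
   if "x \<in> carrier R" "y \<in> carrier R" "z \<in> carrier R" "d \<in> carrier R" "w' \<in> carrier R" "a \<in> carrier R" for x y z d w' a
   using that by algebra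
  from this[OF c a] show ?thesis using ideal_minus[OF PI ideal_mult[OF PI cong[of l k] a] ideal_mult'[OF PI Aln c(3)]] lk by simp
 qed
 from Suc.IH[OF tf[OF f] tf[OF A] aw this] obtain v where v: "v \<in> urow n n (%l. ?f (A l)) (?f f) (%_. {\<zero>})" "v \<notin> P" by blast
 obtain g where g: "v \<in> carrier R" "tot g" "\<And>k. k < n ==> v \<otimes> ?f f k \<ominus> dot n g (%l. ?f (A l) k) \<in> {\<zero>}" using v(1) unfolding urow_def by blast
 have "?f h n = \<zero>" if "tot h" for h using totD[OF that] a by (simp add: m_comm minus_eq r_neg)
 hence "v \<otimes> ?f f n \<ominus> dot n g (%l. ?f (A l) n) = \<zero>" using f A g(1) dot_zero_right[OF g(2)] by (simp add: minus_eq)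
 hence "v \<in> urow n (Suc n) (%l. ?f (A l)) (?f f) (%_. {\<zero>})" using g by (intro urowI[OF g(1,2)]) (auto simp: less_Suc_eq)
 moreover have "v \<otimes> ?a \<notin> P" using v(2) g(1) aP primeD[OF P, of v ?a] by auto
 ultimately show ?case using urow_pivot[of f A, OF f A] by blast
qed

text \<open>w annihilates the cohomology at R^b of the complex obtained modulo K by letting A and B
  act on row vectors from the right.\<close>

definition killed :: "'a set => 'a => nat => nat => nat => (nat => nat => 'a) => (nat => nat => 'a) => bool"
 where "killed K w a b c A B \<longleftrightarrow> (\<forall>f. tot f --> (\<forall>k<c. dot b f (%l. B l k) \<in> K) --> w \<in> urow a b A f (%_. K))"

lemma killedD: "killed K w a b c A B ==> tot f ==> (\<And>k. k < c ==> dot b f (%l. B l k) \<in> K) ==> w \<in> urow a b A f (%_. K)"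
 unfolding killed_def by blast

lemma killed_ideal:
 assumes "ideal K R" "\<And>l. tot (A l)"
 shows "ideal {w \<in> carrier R. killed K w a b c A B} R"
proof -
 have "ideal (urow a b A f (%_. K)) R" if "tot f" for f by (rule urow_ideal[OF that assms(2,1)])
 thus ?thesis by (intro ideal_intro) (auto simp: killed_def ideal_zero ideal_add ideal_mult)
qed

text \<open>The long exact cohomology sequence for multiplication by y on R/K: cohomology modulo (K,
  y) lies between cohomology modulo K in the same and in the next degree, so the product of the two
  annihilators works.\<close>

lemma killed_step:
 assumes K: "ideal K R" and y: "y \<in> carrier R" "\<And>v. v \<in> carrier R ==> y \<otimes> v \<in> K ==> v \<in> K"
  and tot: "\<And>l. tot (A l)" "\<And>l. tot (B l)" "\<And>l. tot (C l)" and w: "w \<in> carrier R" "w' \<in> carrier R"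
  and BC: "\<And>l k. l < b ==> k < e ==> dot c (B l) (%j. C j k) = \<zero>"
  and k: "killed K w a b c A B" "killed K w' b c e B C"
 shows "killed (Idl (insert y K)) (w \<otimes> w') a b c A B"
 unfolding killed_def
proof (intro allI impI)
 note KS = ideal_sub[OF K] and Ac = tot_col[of A, OF tot(1)] and Bc = tot_col[of B, OF tot(2)] and Cc = tot_col[of C, OF tot(3)]
 fix f assume f: "tot f" "\<forall>k<c. dot b f (%l. B l k) \<in> Idl (insert y K)"
 let ?V = "%k. dot b f (%l. B l k)"
 have tV: "tot ?V" by (rule tot_dot(2)[OF f(1) tot(2)])
 have "\<exists>a. a \<in> carrier R \<and> (k < c --> ?V k \<ominus> y \<otimes> a \<in> K)" for k
 proof (cases "k < c")
  case True
  from f(2)[rule_format, OF True] KS y(1) obtain a where "a \<in> carrier R" "?V k \<ominus> a \<otimes> y \<in> Idl K" by (rule Idl_insertE')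
  thus ?thesis using Idl_ideal[OF K] m_comm[of _ y] y(1) by auto
 qed auto
 then obtain h where h: "\<And>k. h k \<in> carrier R" "\<And>k. k < c ==> ?V k \<ominus> y \<otimes> h k \<in> K" by metis
 have th: "tot h" using h(1) by (rule totI)
 have "dot c h (%j. C j k) \<in> K" if j: "k < e" for k
 proof (rule y(2))
  show hc: "dot c h (%j. C j k) \<in> carrier R" using th Cc by simp
  have "dot c ?V (%j. C j k) = dot b f (%l. dot c (B l) (%j. C j k))" by (rule dot_dot[OF f(1) tot(2) Cc, symmetric])
  also have "\<dots> = dot b f (%l. \<zero>)" by (rule dot_cong) (use BC j in auto)
  finally have "dot c (%k. ?V k \<ominus> y \<otimes> h k) (%j. C j k) = \<ominus> (y \<otimes> dot c h (%j. C j k))"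
   using dot_minus[OF tV tot_smult[OF y(1) th] Cc] dot_smult[OF y(1) th Cc] dot_zero_right[OF f(1)] hc y(1) by (simp add: minus_eq)
  moreover have "dot c (%k. ?V k \<ominus> y \<otimes> h k) (%j. C j k) \<in> K" by (rule dot_ideal'[OF K Cc]) (rule h(2))
  ultimately show "y \<otimes> dot c h (%j. C j k) \<in> K" using ideal_neg[OF K, of "\<ominus> (y \<otimes> dot c h (%j. C j k))"] hc y(1) by simp
 qed
 from killedD[OF k(2) th this] obtain g where g: "tot g" "\<And>k. k < c ==> w' \<otimes> h k \<ominus> dot b g (%l. B l k) \<in> K" unfolding urow_def by blast
 let ?f = "%k. w' \<otimes> f k \<ominus> y \<otimes> g k"
 have tf: "tot ?f" by (rule tot_minus[OF tot_smult[OF w(2) f(1)] tot_smult[OF y(1) g(1)]])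
 have "dot b ?f (%l. B l k) \<in> K" if k: "k < c" for k
 proof -
  have "dot b ?f (%l. B l k) = w' \<otimes> ?V k \<ominus> y \<otimes> dot b g (%l. B l k)"
   using dot_minus[OF tot_smult[OF w(2) f(1)] tot_smult[OF y(1) g(1)] Bc] dot_smult[OF w(2) f(1) Bc] dot_smult[OF y(1) g(1) Bc] by simp
  also have "w' \<otimes> v \<ominus> y \<otimes> x = w' \<otimes> (v \<ominus> y \<otimes> z) \<oplus> y \<otimes> (w' \<otimes> z \<ominus> x)"
   if "v \<in> carrier R" "x \<in> carrier R" "z \<in> carrier R" for v x z using that w(2) y(1) by algebra
  also have "w' \<otimes> (?V k \<ominus> y \<otimes> h k) \<oplus> y \<otimes> (w' \<otimes> h k \<ominus> dot b g (%l. B l k)) \<in> K"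
   by (rule ideal_add[OF K ideal_mult[OF K h(2)[OF k] w(2)] ideal_mult[OF K g(2)[OF k] y(1)]])
  finally show ?thesis using totD[OF tV] dot_closed[OF g(1) Bc] h(1) by simp
 qed
 from killedD[OF k(1) tf this] obtain g' where g': "tot g'" "\<And>k. k < b ==> w \<otimes> ?f k \<ominus> dot a g' (%l. A l k) \<in> K" unfolding urow_def by blast
 show "w \<otimes> w' \<in> urow a b A f (%_. Idl (insert y K))"
 proof (rule urowI[OF _ g'(1)])
  fix k assume k: "k < b"
  have c: "f k \<in> carrier R" "dot a g' (%l. A l k) \<in> carrier R" "g k \<in> carrier R"
   using totD[OF f(1)] dot_closed[OF g'(1) Ac] totD[OF g(1)] by auto
  have "(w \<otimes> w') \<otimes> x \<ominus> u \<ominus> (w \<otimes> z) \<otimes> y = w \<otimes> (w' \<otimes> x \<ominus> y \<otimes> z) \<ominus> u"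
   if "x \<in> carrier R" "u \<in> carrier R" "z \<in> carrier R" for x u z using that w y(1) by algebra
  from this[OF c] show "(w \<otimes> w') \<otimes> f k \<ominus> dot a g' (%l. A l k) \<in> Idl (insert y K)"
   using g'(2)[OF k] Idl_ideal[OF K] w c by (intro Idl_insertI[OF _ _ _ KS y(1), of _ "w \<otimes> g k"]) auto
 qed (use w in simp)
qed

text \<open>P is an associated prime of K. Near P a splitting h of N and exactness modulo K split D
  as well: \<pi> = w - N h vanishes on the image of N, and its rows have to lie in the row space of
  D. That is first seen modulo P, using that u carries vectors annihilated by D modulo P to vectors
  annihilated modulo K; a correction with entries in P is then inverted away.\<close>

lemma splitting_step:
 assumes P: "primeideal P R" and K: "ideal K R" and u: "u \<in> carrier R" "P = colon K u"
  and D: "\<And>l. tot (D l)" and N: "\<And>l. tot (N l)" and h: "\<And>l. tot (h l)" and w: "w \<in> carrier R - P"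
  and DN: "\<And>l k. l < a ==> dot b (D l) (%j. N j k) = \<zero>"
  and NhN: "\<And>l k. l < b ==> k < e ==> w \<otimes> N l k = dot e (N l) (%j. dot b (h j) (%i. N i k))"
  and ex: "killed K \<one> e b a (%j k. N k j) (%k l. D l k)"
 shows "\<exists>v\<in>carrier R - P. \<exists>G. (\<forall>l. tot (G l)) \<and> (\<forall>l<b. \<forall>k<b.
  v \<otimes> (w \<otimes> (if l = k then \<one> else \<zero>) \<ominus> dot e (N l) (%j. h j k)) = dot a (G l) (%i. D i k))"
proof -
 note PI = prime_ideal[OF P]
 have wc: "w \<in> carrier R" using w by blast
 have Dc: "tot (%l. D l k)" and Nc: "tot (%l. N l k)" and hc: "tot (%l. h l k)" for k using D N h by (auto simp: tot_def)
 let ?\<delta> = "%l k :: nat. if l = k then \<one> else \<zero>"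
 have t\<delta>: "tot (?\<delta> l)" "tot (%l. ?\<delta> l k)" for l k by (auto simp: tot_def)
 define \<pi> where "\<pi> l k = w \<otimes> ?\<delta> l k \<ominus> dot e (N l) (%j. h j k)" for l k
 have t\<pi>: "tot (\<pi> l)" "tot (%l. \<pi> l k)" for l k
  unfolding \<pi>_def using wc N hc by (auto simp: tot_def intro!: minus_closed dot_closed)
 have \<delta>dot: "dot b (?\<delta> l) v = v l" if "l < b" "tot v" for l v
  using dot_delta[OF that(2,1)] by (simp add: eq_commute[of l])
 have \<pi>N: "dot b (\<pi> l) (%j. N j k) = \<zero>" if l: "l < b" and k: "k < e" for l k
 proof -
  have "dot b (\<pi> l) (%j. N j k) = dot b (%i. w \<otimes> ?\<delta> l i) (%j. N j k) \<ominus> dot b (%i. dot e (N l) (%j. h j i)) (%j. N j k)"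
   unfolding \<pi>_def by (rule dot_minus[OF tot_smult[OF wc t\<delta>(1)] tot_dot(2)[OF N h] Nc])
  also have "dot b (%i. dot e (N l) (%j. h j i)) (%j. N j k) = w \<otimes> N l k"
   using dot_dot[OF N h Nc, symmetric] NhN[OF l k] by simp
  also have "dot b (%i. w \<otimes> ?\<delta> l i) (%j. N j k) = w \<otimes> N l k"
   using dot_smult[OF wc t\<delta>(1) Nc] \<delta>dot[OF l Nc] by simp
  finally show ?thesis using wc totD[OF N] by (simp add: minus_eq r_neg)
 qed
 have zdot: "dot n z x = \<zero>" if "\<And>j. j < n ==> z j = \<zero>" "tot x" for n z x
  using dot_cong[of n z "%j. \<zero>" x x] that dot_zero by simp
 have "\<exists>w'\<in>carrier R - P. \<forall>l\<in>{..<b}. w' \<in> urow a b D (\<pi> l) (%_. P)"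
 proof (rule prime_Inter_sub[OF P])
  show "ideal (urow a b D (\<pi> l) (%_. P)) R" for l by (rule urow_ideal[OF t\<pi>(1) D PI])
  show "\<not> urow a b D (\<pi> l) (%_. P) <= P" if "l \<in> {..<b}" for l
  proof (rule row_space[OF P t\<pi>(1) D])
   fix v assume v: "tot v" "\<And>l. l < a ==> dot b (D l) v \<in> P"
   have uv: "tot (%k. u \<otimes> v k)" by (rule tot_smult[OF u(1) v(1)])
   have "dot b (%k. u \<otimes> v k) (D l) \<in> K" if "l < a" for l
    using v(2)[OF that] dot_smult[OF u(1) v(1) D] dot_comm[OF v(1) D] m_comm[OF u(1) dot_closed[OF D v(1)]]
    unfolding u(2) colon_def by simp
   from killedD[OF ex uv this] have "\<one> \<in> urow e b (%j k. N k j) (%k. u \<otimes> v k) (%_. K)" .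
   then obtain x where x: "tot x" "\<And>k. k < b ==> \<one> \<otimes> (u \<otimes> v k) \<ominus> dot e x (N k) \<in> K" unfolding urow_def by blast
   have "dot b (\<pi> l) (%k. u \<otimes> v k \<ominus> dot e (N k) x) \<in> K"
    by (rule dot_ideal[OF K t\<pi>(1)]) (use x dot_comm[OF x(1) N] totD[OF uv] in auto)
   also have "dot b (\<pi> l) (%k. u \<otimes> v k \<ominus> dot e (N k) x) = u \<otimes> dot b (\<pi> l) v \<ominus> dot b (\<pi> l) (%k. dot e (N k) x)"
    using dot_minus_right[OF t\<pi>(1) uv tot_dot(1)[OF N x(1)]] dot_smult_right[OF u(1) t\<pi>(1) v(1)] by simp
   also have "dot b (\<pi> l) (%k. dot e (N k) x) = \<zero>"
    using dot_dot[OF t\<pi>(1) N x(1)] zdot[OF \<pi>N x(1)] that by simp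
   finally have "u \<otimes> dot b (\<pi> l) v \<in> K" using u(1) t\<pi>(1) v(1) by (simp add: minus_eq)
   thus "dot b (\<pi> l) v \<in> P" unfolding u(2) colon_def using u(1) t\<pi>(1) v(1) by (simp add: m_comm)
  qed
 qed simp
 then obtain w' where w': "w' \<in> carrier R - P" "\<And>l. l < b ==> w' \<in> urow a b D (\<pi> l) (%_. P)" by auto
 have "\<forall>l. \<exists>g. tot g \<and> (l < b --> (\<forall>k<b. w' \<otimes> \<pi> l k \<ominus> dot a g (%i. D i k) \<in> P))"
  using w'(2) tot_zero unfolding urow_def by blast
 then obtain g where g: "\<And>l. tot (g l)" and gP: "\<And>l k. l < b ==> k < b ==> w' \<otimes> \<pi> l k \<ominus> dot a (g l) (%i. D i k) \<in> P" by metis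
 have w'c: "w' \<in> carrier R" using w' by blast
 \<comment> \<open>The failure of w' \<pi> = g D. Its entries lie in P and it vanishes on the image
   of N, whence Q \<pi> = w Q.\<close>
 define Q where "Q l k = dot a (g l) (%i. D i k) \<ominus> w' \<otimes> \<pi> l k" for l k
 have tQ: "tot (Q l)" "tot (%l. Q l k)" for l k
  unfolding Q_def using g Dc w'c totD[OF t\<pi>(1)] by (auto simp: tot_def intro!: minus_closed dot_closed)
 have QP: "Q l k \<in> P" if "l < b" "k < b" for l k
 proof -
  have "\<ominus> (x \<ominus> y) = y \<ominus> x" if "x \<in> carrier R" "y \<in> carrier R" for x y using that by algebra
  from this[of "w' \<otimes> \<pi> l k" "dot a (g l) (%i. D i k)"] show ?thesis
   using ideal_neg[OF PI gP[OF that]] w'c totD[OF t\<pi>(1)] dot_closed[OF g Dc] unfolding Q_def by simp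
 qed
 have QN: "dot b (Q l) (%i. N i k) = \<zero>" if l: "l < b" and k: "k < e" for l k
 proof -
  have "dot b (Q l) (%i. N i k) = dot b (%j. dot a (g l) (%i. D i j)) (%i. N i k) \<ominus> w' \<otimes> dot b (\<pi> l) (%i. N i k)"
   unfolding Q_def using dot_minus[OF tot_dot(2)[OF g D] tot_smult[OF w'c t\<pi>(1)] Nc] dot_smult[OF w'c t\<pi>(1) Nc] by simp
  also have "dot b (%j. dot a (g l) (%i. D i j)) (%i. N i k) = \<zero>"
   using dot_dot[OF g D Nc, symmetric] zdot[of a "%i. dot b (D i) (%i. N i k)" "g l"] DN dot_comm[OF g tot_dot(1)[OF D Nc]] g by simp
  also have "dot b (\<pi> l) (%i. N i k) = \<zero>" by (rule \<pi>N[OF l k])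
  finally show ?thesis using w'c by (simp add: minus_eq)
 qed
 have Q\<pi>: "dot b (Q l) (%i. \<pi> i k) = w \<otimes> Q l k" if l: "l < b" and k: "k < b" for l k
 proof -
  have "dot b (Q l) (%i. \<pi> i k) = w \<otimes> dot b (Q l) (%i. ?\<delta> i k) \<ominus> dot b (Q l) (%i. dot e (N i) (%j. h j k))"
   unfolding \<pi>_def using dot_minus_right[OF tQ(1) tot_smult[OF wc t\<delta>(2)] tot_dot(1)[OF N hc]] dot_smult_right[OF wc tQ(1) t\<delta>(2)] by simp
  also have "dot b (Q l) (%i. dot e (N i) (%j. h j k)) = \<zero>"
   unfolding dot_dot[OF tQ(1) N hc] by (rule zdot[OF QN[OF l] hc])
  also have "dot b (Q l) (%i. ?\<delta> i k) = Q l k" by (rule dot_delta_right[OF tQ(1) k])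
  finally show ?thesis using wc totD[OF tQ(1)] by (simp add: minus_eq)
 qed
 \<comment> \<open>Multiplying \<pi> by A gives w w' \<pi> + w Q = w g D exactly. As A is w w' times
   the identity modulo P, it is invertible near P, and \<pi> itself becomes a multiple of D.\<close>
 define A where "A l k = (w \<otimes> w') \<otimes> ?\<delta> l k \<oplus> Q l k" for l k
 have ww': "w \<otimes> w' \<in> carrier R - P" using w w'(1) primeD[OF P, of w w'] by auto
 have wwc: "w \<otimes> w' \<in> carrier R" using ww' by blast
 have tA: "tot (A l)" "tot (%l. A l k)" for l k unfolding A_def using wwc totD[OF tQ(1)] by (auto simp: tot_def)
 have A\<pi>: "dot b (A l) (%i. \<pi> i k) = w \<otimes> dot a (g l) (%i. D i k)" if l: "l < b" and k: "k < b" for l k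
 proof -
  have "dot b (A l) (%i. \<pi> i k) = (w \<otimes> w') \<otimes> \<pi> l k \<oplus> w \<otimes> Q l k"
   unfolding A_def using dot_add[OF tot_smult[OF wwc t\<delta>(1)] tQ(1) t\<pi>(2)] dot_smult[OF wwc t\<delta>(1) t\<pi>(2)] \<delta>dot[OF l t\<pi>(2)] Q\<pi>[OF l k] by simp
  moreover have "(w \<otimes> w') \<otimes> x \<oplus> w \<otimes> (y \<ominus> w' \<otimes> x) = w \<otimes> y" if "x \<in> carrier R" "y \<in> carrier R" for x y
   using that wc w'c by algebra
  ultimately show ?thesis using totD[OF t\<pi>(1)] dot_closed[OF g Dc] unfolding Q_def by simp
 qed
 have "\<exists>v\<in>carrier R - P. \<forall>l\<in>{..<b}. v \<in> urow b b A (?\<delta> l) (%_. {\<zero>})"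
 proof (rule prime_Inter_sub[OF P])
  show "ideal (urow b b A (?\<delta> l) (%_. {\<zero>})) R" for l by (rule urow_ideal[OF t\<delta>(1) tA(1) zeroideal])
  have "A i k \<ominus> (w \<otimes> w') \<otimes> ?\<delta> i k \<in> P" if "i < b" "k < b" for i k
  proof -
   have "(x \<oplus> y) \<ominus> x = y" if "x \<in> carrier R" "y \<in> carrier R" for x y using that by algebra
   from this[OF m_closed[OF wwc totD[OF t\<delta>(1)]] totD[OF tQ(1)]] show ?thesis unfolding A_def using QP[OF that] by metis
  qed
  thus "\<not> urow b b A (?\<delta> l) (%_. {\<zero>}) <= P" for l by (rule row_solve[OF P t\<delta>(1) tA(1) ww'])
 qed simp
 then obtain v where v: "v \<in> carrier R - P" "\<And>l. l < b ==> v \<in> urow b b A (?\<delta> l) (%_. {\<zero>})" by auto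
 have "\<forall>l. \<exists>\<beta>. tot \<beta> \<and> (l < b --> (\<forall>k<b. v \<otimes> ?\<delta> l k \<ominus> dot b \<beta> (%i. A i k) \<in> {\<zero>}))"
  using v(2) tot_zero unfolding urow_def by blast
 then obtain \<beta> where \<beta>: "\<And>l. tot (\<beta> l)" and v\<beta>: "\<And>l k. l < b ==> k < b ==> v \<otimes> ?\<delta> l k \<ominus> dot b (\<beta> l) (%i. A i k) \<in> {\<zero>}" by metis
 have vc: "v \<in> carrier R" using v by blast
 let ?G = "%l i. w \<otimes> dot b (\<beta> l) (%j. g j i)"
 have "v \<otimes> \<pi> l k = dot a (?G l) (%i. D i k)" if l: "l < b" and k: "k < b" for l k
 proof -
  have "v \<otimes> \<pi> l k = dot b (%i. v \<otimes> ?\<delta> l i) (%i. \<pi> i k)"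
   using dot_smult[OF vc t\<delta>(1) t\<pi>(2)] \<delta>dot[OF l t\<pi>(2)] by simp
  also have "\<dots> = dot b (%i. dot b (\<beta> l) (%j. A j i)) (%i. \<pi> i k)"
  proof (rule dot_cong)
   fix i assume "i < b"
   from v\<beta>[OF l this] show "v \<otimes> ?\<delta> l i = dot b (\<beta> l) (%j. A j i)"
    using r_right_minus_eq[of "v \<otimes> ?\<delta> l i" "dot b (\<beta> l) (%j. A j i)"] vc totD[OF t\<delta>(1)] dot_closed[OF \<beta> tA(2)] by simp
  qed simp
  also have "\<dots> = dot b (\<beta> l) (%j. dot b (A j) (%i. \<pi> i k))" by (rule dot_dot[OF \<beta> tA(1) t\<pi>(2), symmetric])
  also have "\<dots> = dot b (\<beta> l) (%j. w \<otimes> dot a (g j) (%i. D i k))" by (rule dot_cong) (use A\<pi> k in auto)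
  also have "\<dots> = w \<otimes> dot b (\<beta> l) (%j. dot a (g j) (%i. D i k))" by (rule dot_smult_right[OF wc \<beta> tot_dot(1)[OF g Dc]])
  also have "\<dots> = dot a (?G l) (%i. D i k)"
   unfolding dot_dot[OF \<beta> g Dc] by (rule dot_smult[OF wc tot_dot(2)[OF \<beta> g] Dc, symmetric])
  finally show ?thesis .
 qed
 moreover have "tot (?G l)" for l by (rule tot_smult[OF wc tot_dot(2)[OF \<beta> g]])
 ultimately show ?thesis using v(1) unfolding \<pi>_def by (intro bexI[of _ v] exI[of _ ?G]) blast+
qed

end

section \<open>Finite minimal resolutions: exactness modulo regular elements and annihilation of
  Ext\<close>

locale finite_resolution = nlocal +
 fixes I r M s
 assumes minres: "minres I r M" and rank_top: "r s > 0" "r (Suc s) = 0"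
begin

lemma tot_M: "tot (M i l)" "tot (%l. M i l k)"
 using minres m_carr unfolding minres_def tot_def by blast+

lemma M_m: "M i l k \<in> m"
 using minres unfolding minres_def by blast

lemma complex: "l < r i ==> dot (r (Suc i)) (M i l) (%j. M (Suc i) j k) = \<zero>"
 using minres unfolding minres_def by blast

text \<open>Exactness of the resolution modulo \<open>K\<close> in the degrees above \<open>n\<close>.\<close>

definition exact_mod :: "'a set => nat => bool"
 where "exact_mod K n \<longleftrightarrow> (\<forall>c\<ge>n. killed K \<one> (r (Suc (Suc c))) (r (Suc c)) (r c) (%j k. M (Suc c) k j) (%k l. M c l k))"

lemma exact_mod_zero: "exact_mod {\<zero>} 0"
 unfolding exact_mod_def killed_def
proof (intro allI impI)
 fix c v assume v: "tot v" "\<forall>l<r c. dot (r (Suc c)) v (%k. M c l k) \<in> {\<zero>}"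
 have "\<forall>l<r c. dot (r (Suc c)) (M c l) v = \<zero>" using v dot_comm[OF v(1) tot_M(1)] by simp
 then obtain u where u: "tot u" "\<forall>k<r (Suc c). v k = dot (r (Suc (Suc c))) (M (Suc c) k) u"
  using minres v(1) unfolding minres_def by blast
 show "\<one> \<in> urow (r (Suc (Suc c))) (r (Suc c)) (%j k. M (Suc c) k j) v (%_. {\<zero>})"
 proof (rule urowI[OF one_closed u(1)])
  fix k assume "k < r (Suc c)"
  hence "dot (r (Suc (Suc c))) u (M (Suc c) k) = v k" using u dot_comm[OF u(1) tot_M(1)] by simp
  thus "\<one> \<otimes> v k \<ominus> dot (r (Suc (Suc c))) u (%j. M (Suc c) k j) \<in> {\<zero>}" using totD[OF v(1)] by (simp add: minus_eq r_neg)
 qed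
qed

text \<open>The same long exact sequence for the resolution instead of its dual, hence the
  transposed matrices. Exactness modulo y in one degree uses exactness in that degree and the one
  below, which raises the bound by one.\<close>

lemma exact_mod_step:
 assumes K: "ideal K R" and y: "y \<in> carrier R" "\<And>v. v \<in> carrier R ==> y \<otimes> v \<in> K ==> v \<in> K" and ex: "exact_mod K n"
 shows "exact_mod (Idl (insert y K)) (Suc n)"
 unfolding exact_mod_def
proof (intro allI impI)
 fix c assume "c \<ge> Suc n"
 then obtain e where e: "c = Suc e" "e \<ge> n" by (cases c) auto
 have *: "killed K \<one> (r (Suc (Suc c))) (r (Suc c)) (r c) (%j k. M (Suc c) k j) (%k l. M c l k)" if "c \<ge> n" for c
  using ex that unfolding exact_mod_def by blast
 have "killed (Idl (insert y K)) (\<one> \<otimes> \<one>) (r (Suc (Suc c))) (r (Suc c)) (r c) (%j k. M (Suc c) k j) (%k l. M c l k)"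
 proof (rule killed_step[OF K y tot_M(2) tot_M(2) tot_M(2)[of e] one_closed one_closed _ *])
  fix l k assume "k < r e"
  thus "dot (r c) (%j. M c j l) (%j. M e k j) = \<zero>" using complex dot_comm[OF tot_M(2,1)] e(1) by simp
 qed (use e * in auto)
 thus "killed (Idl (insert y K)) \<one> (r (Suc (Suc c))) (r (Suc c)) (r c) (%j k. M (Suc c) k j) (%k l. M c l k)" by simp
qed

text \<open>Multiplication by \<open>w\<close> annihilates $\mathrm{Ext}^{c+1}(R/I, R/K)$.\<close>

abbreviation kills :: "'a set => 'a => nat => bool"
 where "kills K w c \<equiv> killed K w (r c) (r (Suc c)) (r (Suc (Suc c))) (M c) (M (Suc c))"

lemma kills_top: "w \<in> carrier R ==> kills K w s"
 unfolding killed_def using tot_zero rank_top by (auto intro: urowI)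

text \<open>Descending from the top of the finite resolution, where nothing has to be split, each
  differential M c is split near the associated prime. If v (w - N h) = G D with D = M c and N = M
  (c + 1), then D N = 0 gives v w D = D G D, the next splitting, and every f with f N = 0 satisfies
  v w f = (f G) D, the annihilation. Both hold over R although exactness is known only modulo
  K.\<close>

lemma kills_above:
 assumes K: "ideal K R" and u: "u \<in> carrier R" "primeideal (colon K u) R" and ex: "exact_mod K n" and c: "n \<le> c" "c \<le> s"
 shows "\<exists>w\<in>carrier R - colon K u. kills {\<zero>} w c \<and> (\<exists>h. (\<forall>j. tot (h j)) \<and> (\<forall>l<r c. \<forall>k<r (Suc c).
  w \<otimes> M c l k = dot (r (Suc c)) (M c l) (%j. dot (r c) (h j) (%i. M c i k))))"
 using c(2,1)
proof (induction c rule: inc_induct)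
 case base
 have "\<one> \<in> carrier R - colon K u" using prime_one[OF u(2)] by simp
 \<comment> \<open>The matrix M s has r (s + 1) = 0 columns, so both claims are empty at the
   top.\<close>
 thus ?case using kills_top[OF one_closed] rank_top(2) tot_zero by (intro bexI[of _ \<one>] conjI exI[of _ "%_ _. \<zero>"]) auto
next
 case (step c)
 let ?P = "colon K u" and ?\<delta> = "%l k :: nat. if l = k then \<one> else \<zero>"
 have t\<delta>: "tot (?\<delta> l)" "tot (%l. ?\<delta> l k)" for l k by (auto simp: tot_def)
 let ?a = "r c" and ?b = "r (Suc c)" and ?e = "r (Suc (Suc c))" and ?N = "M (Suc c)"
 obtain w h where w: "w \<in> carrier R - ?P" and h: "\<And>j. tot (h j)"
  and NhN: "\<And>l k. l < ?b ==> k < ?e ==> w \<otimes> ?N l k = dot ?e (?N l) (%j. dot ?b (h j) (%i. ?N i k))"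
  using step.IH step.prems by force
 have "killed K \<one> ?e ?b ?a (%j k. ?N k j) (%k l. M c l k)" using ex step.prems unfolding exact_mod_def by blast
 from splitting_step[OF u(2) K u(1) refl tot_M(1) tot_M(1) h w complex NhN this]
 obtain v G where v: "v \<in> carrier R - ?P" and G: "\<And>l. tot (G l)"
  and vG: "\<And>l k. l < ?b ==> k < ?b ==> v \<otimes> (w \<otimes> ?\<delta> l k \<ominus> dot ?e (?N l) (%j. h j k)) = dot ?a (G l) (%i. M c i k)" by blast
 have c: "v \<in> carrier R" "w \<in> carrier R" using v w by auto
 have vw: "v \<otimes> w \<in> carrier R - ?P" using v w primeD[OF u(2), of v w] by auto
 have key: "(v \<otimes> w) \<otimes> f k = dot ?b f (%l. dot ?a (G l) (%i. M c i k))"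
  if f: "tot f" "\<And>j. j < ?e ==> dot ?b f (%l. ?N l j) = \<zero>" and k: "k < ?b" for f k
 proof -
  have hc: "tot (%j. h j k)" by (rule tot_col[of h, OF h])
  have "dot ?b f (%l. dot ?e (?N l) (%j. h j k)) = dot ?e (%j. dot ?b f (%l. ?N l j)) (%j. h j k)"
   by (rule dot_dot[OF f(1) tot_M(1) hc])
  also have "\<dots> = dot ?e (%j. \<zero>) (%j. h j k)" by (rule dot_cong) (use f(2) in auto)
  also have "\<dots> = \<zero>" by (rule dot_zero[OF hc])
  finally have "dot ?b f (%l. w \<otimes> ?\<delta> l k \<ominus> dot ?e (?N l) (%j. h j k)) = w \<otimes> f k"
   using dot_minus_right[OF f(1) tot_smult[OF c(2) t\<delta>(2)] tot_dot(1)[OF tot_M(1) hc]] dot_smult_right[OF c(2) f(1) t\<delta>(2)]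
    dot_delta_right[OF f(1) k] totD[OF f(1)] c by (simp add: minus_eq)
  moreover have "tot (%l. w \<otimes> ?\<delta> l k \<ominus> dot ?e (?N l) (%j. h j k))"
   by (rule tot_minus[OF tot_smult[OF c(2) t\<delta>(2)] tot_dot(1)[OF tot_M(1) hc]])
  ultimately have "(v \<otimes> w) \<otimes> f k = dot ?b f (%l. v \<otimes> (w \<otimes> ?\<delta> l k \<ominus> dot ?e (?N l) (%j. h j k)))"
   using dot_smult_right[OF c(1) f(1)] totD[OF f(1)] c by (simp add: m_assoc)
  also have "\<dots> = dot ?b f (%l. dot ?a (G l) (%i. M c i k))" by (rule dot_cong) (use vG k in auto)
  finally show ?thesis .
 qed
 show ?case
 proof (intro bexI[OF _ vw] conjI exI[of _ G] allI impI G)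
  fix l k assume "l < ?a" "k < ?b"
  thus "(v \<otimes> w) \<otimes> M c l k = dot ?b (M c l) (%j. dot ?a (G j) (%i. M c i k))" by (intro key[OF tot_M(1) complex])
 next
  show "kills {\<zero>} (v \<otimes> w) c" unfolding killed_def
  proof (intro allI impI urowI)
   fix f assume f: "tot f" "\<forall>k<?e. dot ?b f (%l. ?N l k) \<in> {\<zero>}"
   show "tot (%j. dot ?b f (%l. G l j))" by (rule tot_dot(2)[OF f(1) G])
   fix k assume k: "k < ?b"
   have "dot ?a (%j. dot ?b f (%l. G l j)) (%l. M c l k) = (v \<otimes> w) \<otimes> f k"
    using key[OF f(1) _ k] f(2) dot_dot[OF f(1) G tot_M(2)] by simp
   thus "(v \<otimes> w) \<otimes> f k \<ominus> dot ?a (%j. dot ?b f (%l. G l j)) (%l. M c l k) \<in> {\<zero>}"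
    using c totD[OF f(1)] by (simp add: minus_eq r_neg)
  qed (use c in simp)
 qed
qed

text \<open>The elements annihilating all degrees from n to s form an ideal that lies in no
  associated prime of the ideal generated so far, so it contains a regular element. Exactness modulo
  the enlarged ideal then holds from degree n + 1 on, and the construction continues.\<close>

lemma regular_killers:
 assumes "n \<le> s"
 shows "\<exists>ys. length ys = n \<and> set ys <= m \<and> regs {\<zero>} ys \<and> exact_mod (Idl ({\<zero>} \<union> set ys)) n \<and>
  (\<forall>i<n. \<forall>c. i \<le> c \<longrightarrow> c \<le> s \<longrightarrow> kills {\<zero>} (ys ! i) c)"
 using assms
proof (induction n)
 case 0
 have "Idl ({\<zero>} \<union> set []) = {\<zero>}" using Idl_ideal[OF zeroideal] by simp
 thus ?case using exact_mod_zero by auto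
next
 case (Suc n)
 then obtain ys where ys: "length ys = n" "set ys <= m" "regs {\<zero>} ys" "exact_mod (Idl ({\<zero>} \<union> set ys)) n"
  "\<And>i c. i < n ==> i \<le> c ==> c \<le> s ==> kills {\<zero>} (ys ! i) c" by auto
 let ?K = "Idl ({\<zero>} \<union> set ys)" and ?A = "{w \<in> carrier R. \<forall>c\<in>{n..s}. kills {\<zero>} w c}"
 have yc: "set ys <= carrier R" using ys(2) m_carr by blast
 have KS: "{\<zero>} \<union> set ys <= carrier R" using yc by auto
 note K = genideal_ideal[OF KS]
 note kid = killed_ideal[OF zeroideal tot_M(1)]
 have A: "ideal ?A R"
 proof (rule ideal_intro)
  show "\<zero> \<in> ?A" using ideal_zero[OF kid] by simp
  show "a \<oplus> b \<in> ?A" if "a \<in> ?A" "b \<in> ?A" for a b using that ideal_add[OF kid] by simp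
  show "x \<otimes> a \<in> ?A" if "a \<in> ?A" "x \<in> carrier R" for a x using that ideal_mult[OF kid, of a] by simp
 qed blast
 have "\<exists>a\<in>?A. \<forall>v\<in>carrier R. a \<otimes> v \<in> ?K --> v \<in> ?K"
 proof (rule exists_nonzerodivisor[OF K A])
  fix u assume u: "u \<in> carrier R" "primeideal (colon ?K u) R"
  have "\<exists>a\<in>carrier R - colon ?K u. \<forall>c\<in>{n..s}. a \<in> {w \<in> carrier R. kills {\<zero>} w c}"
  proof (rule prime_Inter_sub[OF u(2)])
   show "\<not> {w \<in> carrier R. kills {\<zero>} w c} <= colon ?K u" if "c \<in> {n..s}" for c
    using kills_above[OF K u ys(4), of c] that by auto
  qed (use kid in auto)
  thus "\<not> ?A <= colon ?K u" by blast
 qed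
 then obtain y where y: "y \<in> ?A" "\<And>v. v \<in> carrier R ==> y \<otimes> v \<in> ?K ==> v \<in> ?K" by blast
 have yR: "y \<in> carrier R" using y(1) by blast
 obtain s' where s': "s = Suc s'" "n \<le> s'" using Suc.prems by (cases s) auto
 \<comment> \<open>To see that y lies in m: the first basis vector of R^(r s) is a cocycle since r
   (s + 1) = 0, so its multiple by y lies in the row space of M s', whose entries are in m.\<close>
 have "kills {\<zero>} y s'" using y(1) s' by simp
 hence "y \<in> urow (r s') (r s) (M s') (%i. if i = 0 then \<one> else \<zero>) (%_. {\<zero>})"
  using killedD[OF _ tot_delta[of 0]] rank_top s'(1) by simp
 then obtain g where g: "tot g" "y \<otimes> \<one> \<ominus> dot (r s') g (%l. M s' l 0) \<in> m"
  using rank_top(1) ideal_zero[OF m_ideal] unfolding urow_def by fastforce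
 have "dot (r s') g (%l. M s' l 0) \<in> m" by (rule dot_ideal[OF m_ideal g(1) M_m])
 hence ym: "y \<in> m" using ideal_minus_cancel[OF m_ideal _ yR] g(2) yR by simp
 have eq: "Idl (insert y ?K) = Idl ({\<zero>} \<union> set (ys @ [y]))"
  using Idl_insert_Idl[OF KS yR] by (simp add: insert_commute)
 have "regs {\<zero>} (ys @ [y])" using regs_append[OF zeroideal yc, of "[y]"] ys(3) y(2) by simp
 moreover have "exact_mod (Idl ({\<zero>} \<union> set (ys @ [y]))) (Suc n)" using exact_mod_step[OF K yR y(2) ys(4)] eq by simp
 moreover have "kills {\<zero>} ((ys @ [y]) ! i) c" if "i < Suc n" "i \<le> c" "c \<le> s" for i c
  using ys(1,5) y(1) that by (cases "i = n") (auto simp: nth_append)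
 moreover have "length (ys @ [y]) = Suc n" "set (ys @ [y]) <= m" using ys ym by auto
 ultimately show ?case by blast
qed

text \<open>Each regular element uses the annihilator in two neighbouring degrees, which squares it;
  the exponent is therefore 2 to the length of the sequence. The range of degrees is closed upwards
  because degree s is annihilated by everything.\<close>

lemma kills_mod_regular:
 assumes "set zs <= carrier R" "regs {\<zero>} zs" "w \<in> carrier R" "\<And>c. i \<le> c ==> c \<le> s ==> kills {\<zero>} w c" "i \<le> c" "c \<le> s"
 shows "kills (Idl ({\<zero>} \<union> set zs)) (w [^] ((2::nat) ^ length zs)) c"
 using assms(1,2,5,6)
proof (induction zs arbitrary: c rule: rev_induct)
 case Nil thus ?case using assms(3,4) Idl_ideal[OF zeroideal] by simp
next
 case (snoc y zs)
 let ?K = "Idl ({\<zero>} \<union> set zs)" and ?w = "w [^] ((2::nat) ^ length zs)"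
 have zc: "set zs <= carrier R" "y \<in> carrier R" using snoc(2) by auto
 hence S: "{\<zero>} \<union> set zs <= carrier R" by auto
 have y: "regs {\<zero>} zs" "\<And>v. v \<in> carrier R ==> y \<otimes> v \<in> ?K ==> v \<in> ?K" using snoc(3) regs_append[OF zeroideal zc(1), of "[y]"] by auto
 have w: "?w \<in> carrier R" "?w \<otimes> ?w = w [^] ((2::nat) ^ length (zs @ [y]))" using assms(3) by (simp_all add: nat_pow_mult mult_2)
 have "kills (Idl (insert y ?K)) (?w \<otimes> ?w) c"
 proof (cases "c = s")
  case True show ?thesis unfolding True by (rule kills_top[OF m_closed[OF w(1) w(1)]])
 next
  case False
  thus ?thesis using snoc.IH[OF zc(1) y(1)] snoc(4,5)
   by (intro killed_step[where e = "r (Suc (Suc (Suc c)))", OF genideal_ideal[OF S] zc(2) y(2) tot_M(1) tot_M(1) tot_M(1) w(1,1) complex]) auto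
 qed
 moreover have "Idl (insert y ?K) = Idl ({\<zero>} \<union> set (zs @ [y]))" using Idl_insert_Idl[OF S zc(2)] by (simp add: insert_commute)
 ultimately show ?case using w(2) by simp
qed

text \<open>Built downwards from a basis vector in top degree. \<psi> (i + 1) is a cocycle modulo
  the later parameters, and a power of the i-th annihilator makes it a coboundary, whose preimage is
  \<psi> i. The powers are absorbed into the sequence, which stays regular.\<close>

lemma dual_ladder:
 "\<exists>ys \<psi>. length ys = s \<and> set ys <= m \<and> regs {\<zero>} ys \<and> (\<forall>i. tot (\<psi> i)) \<and> \<psi> s 0 = \<one> \<and>
  (\<forall>i<s. \<forall>k<r (Suc i). ys ! i \<otimes> \<psi> (Suc i) k \<ominus> dot (r i) (\<psi> i) (%l. M i l k) \<in> Idl ({\<zero>} \<union> set (drop (Suc i) ys)))"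
proof -
 obtain ys where ys: "length ys = s" "set ys <= m" "regs {\<zero>} ys" "\<And>i c. i < s ==> i \<le> c ==> c \<le> s ==> kills {\<zero>} (ys ! i) c"
  using regular_killers[OF order_refl] by blast
 have yc: "set ys <= carrier R" using ys(2) m_carr by blast
 \<comment> \<open>The part of the sequence from place i on, with entries raised to the exponents
   n.\<close>
 let ?Y = "%(n :: nat => nat) i. map (%j. (ys ! j) [^] n j) [i..<s]"
 have Y: "set (?Y n i) <= m" "regs {\<zero>} (?Y n i)" if n: "\<And>j. 0 < n j" for n :: "nat => nat" and i
 proof -
  have eq: "?Y n i = pows (drop i ys) (map n [i..<s])" using ys(1) by (auto simp: pows_def intro!: nth_equalityI)
  have "regs {\<zero>} (drop i ys @ take i ys)"
   by (rule regs_mset[OF zeroideal ys(2) _ ys(3)]) (metis add.commute append_take_drop_id mset_append)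
  hence "regs {\<zero>} (drop i ys)" using regs_append[OF zeroideal, of "drop i ys"] yc by (auto dest: in_set_dropD)
  thus "regs {\<zero>} (?Y n i)" unfolding eq
   by (rule regs_pows[OF zeroideal, rotated -1]) (use n ys in \<open>auto dest: in_set_dropD\<close>)
  show "set (?Y n i) <= m" unfolding eq by (rule pows_m) (use n ys(2) in \<open>auto dest: in_set_dropD\<close>)
 qed
 have "\<exists>(n :: nat => nat) \<psi>. (\<forall>k. 0 < n k) \<and> (\<forall>k. tot (\<psi> k)) \<and> \<psi> s 0 = \<one> \<and> (\<forall>k. i \<le> k --> k < s --> (\<forall>l<r (Suc k).
   (ys ! k) [^] n k \<otimes> \<psi> (Suc k) l \<ominus> dot (r k) (\<psi> k) (%j. M k j l) \<in> Idl ({\<zero>} \<union> set (?Y n (Suc k)))))"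
  if "i \<le> s" for i using that
 proof (induction i rule: inc_induct)
  case base
  show ?case by (rule exI[where x = "%_. 1"], rule exI[where x = "%_ i. if i = 0 then \<one> else \<zero>"]) (auto simp: tot_def)
 next
  case (step i)
  then obtain n \<psi> where n: "\<And>k. 0 < n k" and \<psi>: "\<And>k. tot (\<psi> k)" "\<psi> s 0 = \<one>"
   and eq: "\<And>k l. Suc i \<le> k ==> k < s ==> l < r (Suc k) ==>
    (ys ! k) [^] n k \<otimes> \<psi> (Suc k) l \<ominus> dot (r k) (\<psi> k) (%j. M k j l) \<in> Idl ({\<zero>} \<union> set (?Y n (Suc k)))" by blast
  let ?zs = "?Y n (Suc i)"
  have zc: "set ?zs <= carrier R" using Y(1)[of n, OF n] m_carr by blast
  let ?K = "Idl ({\<zero>} \<union> set ?zs)" and ?q = "(2::nat) ^ length ?zs"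
  have S: "{\<zero>} \<union> set ?zs <= carrier R" using zc by auto
  note K = genideal_ideal[OF S]
  have yi: "ys ! i \<in> carrier R" using yc ys(1) step(2) by auto
  have "kills ?K ((ys ! i) [^] ?q) i"
   using kills_mod_regular[OF zc Y(2)[of n, OF n] yi ys(4)] step(2) by simp
  \<comment> \<open>The cocycle property: the congruence of the previous stage expresses this
    product as a multiple of the next parameter power modulo the later ones, and both are in the
    ideal.\<close>
  moreover have "dot (r (Suc i)) (\<psi> (Suc i)) (%l. M (Suc i) l k) \<in> ?K" if k: "k < r (Suc (Suc i))" for k
  proof (cases "Suc i = s")
   case True thus ?thesis using k rank_top by simp
  next
   case False
   hence si: "Suc i < s" using step(2) by simp
   let ?y = "(ys ! Suc i) [^] n (Suc i)"
   have zs: "?zs = ?y # ?Y n (Suc (Suc i))" using si by (simp add: upt_conv_Cons)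
   have "?y \<in> ?K" by (rule Idl_mem[OF _ S]) (simp add: zs)
   moreover have "Idl ({\<zero>} \<union> set (?Y n (Suc (Suc i)))) <= ?K" by (rule Idl_mono[OF _ S]) (auto simp: zs)
   moreover note eq[OF order_refl si k]
   ultimately show ?thesis
    using ideal_minus_cancel'[OF K ideal_mult'[OF K _ totD[OF \<psi>(1)]] dot_closed[OF \<psi>(1) tot_M(2)]] by blast
  qed
  ultimately have "(ys ! i) [^] ?q \<in> urow (r i) (r (Suc i)) (M i) (\<psi> (Suc i)) (%_. ?K)" using killedD[OF _ \<psi>(1)] by blast
  then obtain g where g: "tot g" "\<And>k. k < r (Suc i) ==> (ys ! i) [^] ?q \<otimes> \<psi> (Suc i) k \<ominus> dot (r i) g (%l. M i l k) \<in> ?K"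
   unfolding urow_def by blast
  let ?n = "n(i := ?q)" and ?\<psi> = "\<psi>(i := g)"
  have same: "?Y ?n k = ?Y n k" if "k > i" for k using that by auto
  show ?case
  proof (intro exI[of _ ?n] exI[of _ ?\<psi>] conjI allI impI)
   fix k l assume k: "i \<le> k" "k < s" "l < r (Suc k)"
   show "(ys ! k) [^] ?n k \<otimes> ?\<psi> (Suc k) l \<ominus> dot (r k) (?\<psi> k) (%j. M k j l) \<in> Idl ({\<zero>} \<union> set (?Y ?n (Suc k)))"
    unfolding same[OF le_imp_less_Suc[OF k(1)]] using g(2) eq[of k l] k by (cases "k = i") auto
  qed (use n \<psi> g step(2) in auto)
 qed
 from this[OF le0] obtain n \<psi> where n: "\<forall>k. 0 < n k" and \<psi>: "\<forall>k. tot (\<psi> k)" "\<psi> s 0 = \<one>"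
  and eq: "\<forall>k. 0 \<le> k --> k < s --> (\<forall>l<r (Suc k).
   (ys ! k) [^] n k \<otimes> \<psi> (Suc k) l \<ominus> dot (r k) (\<psi> k) (%j. M k j l) \<in> Idl ({\<zero>} \<union> set (?Y n (Suc k))))" by (elim exE conjE)
 have "drop (Suc k) (?Y n 0) = ?Y n (Suc k)" for k by (simp add: drop_map)
 thus ?thesis using Y[of n 0] n eq \<psi> by (intro exI[of _ "?Y n 0"] exI[of _ \<psi>]) simp
qed

end

section \<open>The Frobenius action on local cohomology\<close>

locale parameters = ncharp +
 fixes xs assumes xs: "set xs <= carrier R"
begin

abbreviation I :: "nat => 'a set"
 where "I n \<equiv> param_ideal R xs n"

text \<open>The classes $[z + (x_1^n, \dots, x_d^n)]$ and $[y + (x_1^k, \dots, x_d^k)]$ agree.\<close>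

definition same :: "nat => 'a => nat => 'a => bool"
 where "same n z k y \<longleftrightarrow> (\<exists>l. n \<le> l \<and> k \<le> l \<and> z \<otimes> lprod (pw (l - n) xs) \<ominus> y \<otimes> lprod (pw (l - k) xs) \<in> I l)"

lemma I_eq: "I n = Idl ({\<zero>} \<union> set (pw n xs))"
 unfolding param_ideal_def set_pw[symmetric] using zero_Un pw_carr[OF xs] by simp

lemma I_ideal: "ideal (I n) R"
 unfolding I_eq by (rule genideal_ideal[OF Idl_pw_carr[OF zeroideal xs]])

lemma P_closed [simp]: "lprod (pw n xs) \<in> carrier R"
 using xs by simp

lemma P_0: "lprod (pw 0 ys) = \<one>"
 by (induction ys) auto

lemma P_add: "lprod (pw (s + t) xs) = lprod (pw s xs) \<otimes> lprod (pw t xs)"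
 by (rule lprod_pw_add[OF xs])

lemma I_shift: "y \<in> I n ==> y \<otimes> lprod (pw l xs) \<in> I (n + l)"
 unfolding I_eq by (rule pw_shift'[OF zeroideal xs])

lemma coset_eq: "a \<in> carrier R ==> b \<in> carrier R ==> I n +> a = I n +> b \<longleftrightarrow> a \<ominus> b \<in> I n"
 using quotient_eq_iff_same_a_r_cos[OF I_ideal] by metis

lemma coset_memD:
 assumes "c \<in> I n +> a" "a \<in> carrier R"
 shows "c \<in> carrier R" "I n +> c = I n +> a"
proof -
 interpret J: ideal "I n" R by (rule I_ideal)
 show "c \<in> carrier R" by (rule J.a_elemrcos_carrier[OF assms(2,1)])
 show "I n +> c = I n +> a" using J.a_repr_independence'[OF assms] by simp
qed

lemma coset_UN:
 assumes "a \<in> carrier R" "\<And>c. c \<in> carrier R ==> I n +> c = I n +> a ==> f c = f a"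
 shows "(\<Union>c\<in>I n +> a. f c) = f a"
proof -
 interpret J: ideal "I n" R by (rule I_ideal)
 have "a \<in> I n +> a" by (rule J.a_rcos_self[OF assms(1)])
 moreover have "f c = f a" if "c \<in> I n +> a" for c using assms(2) coset_memD[OF that assms(1)] by blast
 ultimately show ?thesis by blast
qed

lemma same_minus:
 assumes "z \<in> carrier R" "y \<in> carrier R" "n \<le> l" "k \<le> l" "l \<le> l'"
  "z \<otimes> lprod (pw (l - n) xs) \<ominus> y \<otimes> lprod (pw (l - k) xs) \<in> I l"
 shows "z \<otimes> lprod (pw (l' - n) xs) \<ominus> y \<otimes> lprod (pw (l' - k) xs) \<in> I l'"
proof -
 let ?Q = "lprod (pw (l' - l) xs)"
 have "l' - n = (l - n) + (l' - l)" "l' - k = (l - k) + (l' - l)" "l' = l + (l' - l)" using assms(3-5) by auto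
 hence e: "lprod (pw (l' - n) xs) = lprod (pw (l - n) xs) \<otimes> ?Q" "lprod (pw (l' - k) xs) = lprod (pw (l - k) xs) \<otimes> ?Q"
  "I l' = I (l + (l' - l))" using P_add by metis+
 have "z \<otimes> (A \<otimes> Q) \<ominus> y \<otimes> (B \<otimes> Q) = (z \<otimes> A \<ominus> y \<otimes> B) \<otimes> Q"
  if "A \<in> carrier R" "B \<in> carrier R" "Q \<in> carrier R" for A B Q using that assms(1,2) by algebra
 thus ?thesis unfolding e using I_shift[OF assms(6), of "l' - l"] by simp
qed

lemma same_sym:
 assumes "same n z k y" "z \<in> carrier R" "y \<in> carrier R"
 shows "same k y n z"
proof -
 obtain l where l: "n \<le> l" "k \<le> l" "z \<otimes> lprod (pw (l - n) xs) \<ominus> y \<otimes> lprod (pw (l - k) xs) \<in> I l"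
  using assms(1) unfolding same_def by blast
 have "\<ominus> (a \<ominus> b) = b \<ominus> a" if "a \<in> carrier R" "b \<in> carrier R" for a b using that by algebra
 hence "y \<otimes> lprod (pw (l - k) xs) \<ominus> z \<otimes> lprod (pw (l - n) xs) \<in> I l" using ideal_neg[OF I_ideal l(3)] assms by simp
 thus ?thesis using l unfolding same_def by blast
qed

lemma same_trans:
 assumes "same n z k y" "same k y k' y'" "z \<in> carrier R" "y \<in> carrier R" "y' \<in> carrier R"
 shows "same n z k' y'"
proof -
 obtain l where l: "n \<le> l" "k \<le> l" "z \<otimes> lprod (pw (l - n) xs) \<ominus> y \<otimes> lprod (pw (l - k) xs) \<in> I l"
  using assms(1) unfolding same_def by blast
 obtain l' where l': "k \<le> l'" "k' \<le> l'" "y \<otimes> lprod (pw (l' - k) xs) \<ominus> y' \<otimes> lprod (pw (l' - k') xs) \<in> I l'"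
  using assms(2) unfolding same_def by blast
 let ?l = "max l l'"
 have "(a \<ominus> b) \<oplus> (b \<ominus> c) = a \<ominus> c" if "a \<in> carrier R" "b \<in> carrier R" "c \<in> carrier R" for a b c using that by algebra
 hence "z \<otimes> lprod (pw (?l - n) xs) \<ominus> y' \<otimes> lprod (pw (?l - k') xs) \<in> I ?l"
  using ideal_add[OF I_ideal same_minus[OF assms(3,4) l(1,2) _ l(3), of ?l] same_minus[OF assms(4,5) l'(1,2) _ l'(3), of ?l]] assms by simp
 thus ?thesis using l(1) l'(2) unfolding same_def by (intro exI[of _ ?l]) auto
qed

lemma same_coset:
 assumes "I n +> z = I n +> y" "z \<in> carrier R" "y \<in> carrier R"
 shows "same n z n y"
 unfolding same_def using assms coset_eq by (intro exI[of _ n]) (simp add: P_0)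

lemma same_mult:
 assumes "same n z k y" "z \<in> carrier R" "y \<in> carrier R" "a \<in> carrier R"
 shows "same n (a \<otimes> z) k (a \<otimes> y)"
proof -
 obtain l where l: "n \<le> l" "k \<le> l" "z \<otimes> lprod (pw (l - n) xs) \<ominus> y \<otimes> lprod (pw (l - k) xs) \<in> I l"
  using assms(1) unfolding same_def by blast
 have "(a \<otimes> z) \<otimes> A \<ominus> (a \<otimes> y) \<otimes> B = a \<otimes> (z \<otimes> A \<ominus> y \<otimes> B)" if "A \<in> carrier R" "B \<in> carrier R" for A B
  using that assms by algebra
 thus ?thesis using ideal_mult[OF I_ideal l(3) assms(4)] l(1,2) unfolding same_def by auto
qed

text \<open>Frobenius turns a witness at level l into one at level p l.\<close>

lemma same_frobenius:
 assumes "same n z k y" "z \<in> carrier R" "y \<in> carrier R"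
 shows "same (p * n) (z [^] p) (p * k) (y [^] p)"
proof -
 obtain l where l: "n \<le> l" "k \<le> l" "z \<otimes> lprod (pw (l - n) xs) \<ominus> y \<otimes> lprod (pw (l - k) xs) \<in> I l"
  using assms(1) unfolding same_def by blast
 let ?A = "lprod (pw (l - n) xs)" and ?B = "lprod (pw (l - k) xs)"
 have P: "lprod (pw i xs) [^] p = lprod (pw (p * i) xs)" for i
  using lprod_pow[OF pw_carr[OF xs]] pw_pw[OF xs] by (simp add: mult.commute)
 have "(z \<otimes> ?A \<ominus> y \<otimes> ?B) [^] (p ^ 1) \<in> Idl ({\<zero>} \<union> set (pw (l * p ^ 1) xs))"
  using l(3) unfolding I_eq by (rule frobenius_pw[OF zeroideal xs])
 moreover have "(z \<otimes> ?A \<ominus> y \<otimes> ?B) [^] (p ^ 1) = (z \<otimes> ?A) [^] (p ^ 1) \<ominus> (y \<otimes> ?B) [^] (p ^ 1)"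
  by (rule frobenius_minus) (use assms in auto)
 ultimately have "z [^] p \<otimes> lprod (pw (p * (l - n)) xs) \<ominus> y [^] p \<otimes> lprod (pw (p * (l - k)) xs) \<in> I (p * l)"
  using assms P unfolding I_eq by (simp add: nat_pow_distrib mult.commute)
 thus ?thesis using l(1,2) unfolding same_def by (intro exI[of _ "p * l"]) (simp add: diff_mult_distrib2)
qed

text \<open>The zero class is represented by 0 at level 0. For n > 0 the levels n (t + 1) that occur
  in \<open>lim\<close> are cofinal among all levels.\<close>

lemma lim_iff_same:
 assumes n: "n > 0" and z: "z \<in> carrier R"
 shows "z \<in> lim {\<zero>} (pw n xs) \<longleftrightarrow> same n z 0 \<zero>"
proof
 assume "z \<in> lim {\<zero>} (pw n xs)"
 then obtain t where "z \<otimes> lprod (pw (n * t) xs) \<in> I (n * Suc t)" unfolding lim_def I_eq by (auto simp: pw_pw[OF xs])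
 thus "same n z 0 \<zero>" using z unfolding same_def by (intro exI[of _ "n * Suc t"]) (simp add: minus_eq)
next
 assume "same n z 0 \<zero>"
 then obtain l where l: "n \<le> l" "z \<otimes> lprod (pw (l - n) xs) \<ominus> \<zero> \<otimes> lprod (pw (l - 0) xs) \<in> I l" unfolding same_def by blast
 have "l \<le> n * Suc l" using n by (simp add: trans_le_add2)
 from same_minus[OF z zero_closed l(1) le0 this l(2)] have "z \<otimes> lprod (pw (n * l) xs) \<in> I (n * Suc l)" using z by (simp add: minus_eq)
 thus "z \<in> lim {\<zero>} (pw n xs)" using z unfolding lim_def I_eq by (auto simp: pw_pw[OF xs])
qed

lemma lc_map_coset: "a \<in> carrier R ==> lc_map R xs n (I n +> a) = I (Suc n) +> (a \<otimes> lprod (pw 1 xs))"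
proof -
 assume a: "a \<in> carrier R"
 have "lc_map R xs n (I n +> a) = (\<Union>c\<in>I n +> a. I (Suc n) +> (lprod (pw 1 xs) \<otimes> c))"
  unfolding lc_map_def using pw_1[OF xs] by (simp add: lprod_def)
 also have "\<dots> = I (Suc n) +> (lprod (pw 1 xs) \<otimes> a)"
 proof (rule coset_UN[OF a])
  fix c assume c: "c \<in> carrier R" "I n +> c = I n +> a"
  hence "(c \<ominus> a) \<otimes> lprod (pw 1 xs) \<in> I (Suc n)" using coset_eq[OF c(1) a] I_shift[of _ n 1] by simp
  moreover have "P \<otimes> c \<ominus> P \<otimes> a = (c \<ominus> a) \<otimes> P" if "P \<in> carrier R" for P using that c(1) a by algebra
  ultimately show "I (Suc n) +> (lprod (pw 1 xs) \<otimes> c) = I (Suc n) +> (lprod (pw 1 xs) \<otimes> a)"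
   using coset_eq c(1) a by simp
 qed
 finally show ?thesis using a P_closed[of 1] by (simp add: m_comm)
qed

lemma fold_lc_map:
 assumes "z \<in> carrier R" "n \<le> l"
 shows "fold (lc_map R xs) [n..<l] (I n +> z) = I l +> (z \<otimes> lprod (pw (l - n) xs))"
 using assms(2)
proof (induction l rule: dec_induct)
 case base thus ?case using assms(1) by (simp add: P_0)
next
 case (step l)
 thus ?case using assms(1) lc_map_coset[of "z \<otimes> lprod (pw (l - n) xs)" l] P_add[of "l - n" 1]
  by (simp add: m_assoc Suc_diff_le)
qed

lemma lc_carrier: "carrier (lc_term R xs n) = {I n +> z | z. z \<in> carrier R}"
 by (auto simp: quotient_module_def FactRing_def A_RCOSETS_def')

lemma lc_mem:
 assumes z: "z \<in> carrier R"
 shows "(k, C) \<in> lc_class R xs n z \<longleftrightarrow> (\<exists>y\<in>carrier R. C = I k +> y \<and> same n z k y)"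
proof -
 have "fold (lc_map R xs) [n..<l] (I n +> z) = fold (lc_map R xs) [k..<l] (I k +> y) \<longleftrightarrow>
   z \<otimes> lprod (pw (l - n) xs) \<ominus> y \<otimes> lprod (pw (l - k) xs) \<in> I l" if "n \<le> l" "k \<le> l" "y \<in> carrier R" for l y
  unfolding fold_lc_map[OF z that(1)] fold_lc_map[OF that(3,2)] using coset_eq z that(3) by simp
 hence "same n z k y \<longleftrightarrow> (\<exists>l. n \<le> l \<and> k \<le> l \<and> fold (lc_map R xs) [n..<l] (I n +> z) = fold (lc_map R xs) [k..<l] (I k +> y))"
  if "y \<in> carrier R" for y using that unfolding same_def by blast
 thus ?thesis unfolding lc_class_def limit_class_def mem_Collect_eq case_prod_conv lc_carrier by blast
qed

lemma lc_same:
 assumes "same n z k y" "z \<in> carrier R" "y \<in> carrier R"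
 shows "lc_class R xs n z = lc_class R xs k y"
proof -
 have "(i, C) \<in> lc_class R xs n z \<longleftrightarrow> (i, C) \<in> lc_class R xs k y" for i C
  unfolding lc_mem[OF assms(2)] lc_mem[OF assms(3)]
  using same_trans[OF assms(1) _ assms(2,3)] same_trans[OF same_sym[OF assms] _ assms(3,2)] by blast
 thus ?thesis by auto
qed

lemma lc_self: "z \<in> carrier R ==> (n, I n +> z) \<in> lc_class R xs n z"
 using lc_mem same_coset by blast

lemma lc_zero: "\<zero>\<^bsub>local_cohomology R xs\<^esub> = lc_class R xs 0 \<zero>"
 using a_coset_add_zero[OF ideal_sub[OF I_ideal]]
 by (simp add: local_cohomology_def direct_limit_def lc_class_def quotient_module_def FactRing_def)

lemma lc_zero_iff:
 assumes "z \<in> carrier R"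
 shows "lc_class R xs n z = \<zero>\<^bsub>local_cohomology R xs\<^esub> \<longleftrightarrow> same n z 0 \<zero>"
proof
 assume "lc_class R xs n z = \<zero>\<^bsub>local_cohomology R xs\<^esub>"
 hence "(0, I 0 +> \<zero>) \<in> lc_class R xs n z" using lc_self lc_zero by simp
 then obtain y where y: "y \<in> carrier R" "I 0 +> \<zero> = I 0 +> y" "same n z 0 y" using lc_mem[OF assms] by blast
 show "same n z 0 \<zero>" using same_trans[OF y(3) same_coset[OF y(2)[symmetric]]] assms y(1) by simp
qed (use lc_same assms lc_zero in simp)

lemma lc_smult:
 assumes a: "a \<in> carrier R" and z: "z \<in> carrier R"
 shows "a \<odot>\<^bsub>local_cohomology R xs\<^esub> lc_class R xs n z = lc_class R xs n (a \<otimes> z)"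
proof -
 have sm: "a \<odot>\<^bsub>lc_term R xs k\<^esub> (I k +> y) = I k +> (a \<otimes> y)" if y: "y \<in> carrier R" for k y
 proof -
  have "(\<Union>c\<in>I k +> y. I k +> (a \<otimes> c)) = I k +> (a \<otimes> y)"
  proof (rule coset_UN[OF y])
   fix c assume c: "c \<in> carrier R" "I k +> c = I k +> y"
   have "a \<otimes> c \<ominus> a \<otimes> y = a \<otimes> (c \<ominus> y)" using a c y by algebra
   thus "I k +> (a \<otimes> c) = I k +> (a \<otimes> y)" using coset_eq[OF c(1) y] coset_eq c(2) ideal_mult[OF I_ideal _ a] a c(1) y by simp
  qed
  thus ?thesis by (simp add: quotient_module_def)
 qed
 have "limit_class (lc_term R xs) (lc_map R xs) k (a \<odot>\<^bsub>lc_term R xs k\<^esub> C) = lc_class R xs n (a \<otimes> z)"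
  if "(k, C) \<in> lc_class R xs n z" for k C
 proof -
  obtain y where y: "y \<in> carrier R" "C = I k +> y" "same n z k y" using \<open>(k, C) \<in> _\<close> lc_mem[OF z] by blast
  show ?thesis using lc_same[OF same_mult[OF y(3) z y(1) a]] a z y(1) unfolding y(2) sm[OF y(1)] lc_class_def by simp
 qed
 hence "{limit_class (lc_term R xs) (lc_map R xs) k (a \<odot>\<^bsub>lc_term R xs k\<^esub> C) | k C. (k, C) \<in> lc_class R xs n z} = {lc_class R xs n (a \<otimes> z)}"
  using lc_self[OF z] by blast
 thus ?thesis by (simp add: local_cohomology_def direct_limit_def)
qed

lemma lc_frobenius:
 assumes z: "z \<in> carrier R"
 shows "lc_frobenius R p xs (lc_class R xs n z) = lc_class R xs (p * n) (z [^] p)"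
proof -
 have "lc_class R xs (p * k) (z' [^] p) = lc_class R xs (p * n) (z [^] p)"
  if "(k, C) \<in> lc_class R xs n z" "z' \<in> C" for k C z'
 proof -
  obtain y where y: "y \<in> carrier R" "C = I k +> y" "same n z k y" using \<open>(k, C) \<in> _\<close> lc_mem[OF z] by blast
  note z' = coset_memD[OF \<open>z' \<in> C\<close>[unfolded y(2)] y(1)]
  have "same n z k z'" by (rule same_trans[OF y(3) same_coset[OF z'(2)[symmetric] y(1) z'(1)] z y(1) z'(1)])
  from lc_same[OF same_frobenius[OF this z z'(1)]] z z'(1) show ?thesis by simp
 qed
 moreover have "z \<in> I n +> z"
  by (rule abelian_subgroup.a_rcos_self[OF abelian_subgroupI3[OF ideal.axioms(1)[OF I_ideal] is_abelian_group] z])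
 ultimately have "{lc_class R xs (p * k) (z' [^] p) | k C z'. (k, C) \<in> lc_class R xs n z \<and> z' \<in> C} = {lc_class R xs (p * n) (z [^] p)}"
  using lc_self[OF z] by blast
 thus ?thesis by (simp add: lc_frobenius_def)
qed

lemma F_ideal_fprop:
 assumes F: "F_ideal R p xs J" and n: "n > 0"
 shows "fprop J (pw n xs)"
 unfolding fprop_def
proof (intro ballI impI)
 have J: "ideal J R" and st: "lc_frobenius R p xs ` lc_annihilated R xs J <= lc_annihilated R xs J"
  using F unfolding F_ideal_def F_stable_def by auto
 note Jc = ideal_carr[OF J]
 have ann: "lc_class R xs k y \<in> lc_annihilated R xs J \<longleftrightarrow> (\<forall>j\<in>J. j \<otimes> y \<in> lim {\<zero>} (pw k xs))" if "y \<in> carrier R" "k > 0" for k y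
 proof -
  have "lc_class R xs k y \<in> carrier (local_cohomology R xs)"
   using that lc_carrier by (auto simp: local_cohomology_def direct_limit_def lc_class_def)
  thus ?thesis unfolding lc_annihilated_def using lc_smult[OF Jc that(1)] lc_zero_iff lim_iff_same[OF that(2)] Jc that(1) by simp
 qed
 fix z j assume z: "z \<in> carrier R" "\<forall>j\<in>J. j \<otimes> z \<in> lim {\<zero>} (pw n xs)" and j: "j \<in> J"
 have "lc_class R xs (p * n) (z [^] p) \<in> lc_annihilated R xs J" using st ann[OF z(1) n] z(2) lc_frobenius[OF z(1)] by blast
 hence "j \<otimes> z [^] p \<in> lim {\<zero>} (pw (p * n) xs)" using ann[of "z [^] p" "p * n"] z(1) n p_gt_1 j by simp
 thus "j \<otimes> z [^] p \<in> lim {\<zero>} (pw p (pw n xs))" by (simp add: pw_pw[OF xs] mult.commute)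
qed

text \<open>Multiplying by the complementary powers y^(N-n) rewrites a class with unequal exponents
  as one with the common exponent N, one entry at a time; \<open>us\<close> holds the entries
  already treated.\<close>

lemma lim_pows_shift:
 assumes "length ns = length ys" "set (us @ ys) <= carrier R" "z \<in> carrier R" "\<forall>n\<in>set ns. 0 < n \<and> n \<le> N"
 shows "z \<otimes> lprod (pows ys (map (%n. N - n) ns)) \<in> lim {\<zero>} (us @ pw N ys) \<longleftrightarrow> z \<in> lim {\<zero>} (us @ pows ys ns)"
 using assms
proof (induction ns ys arbitrary: us z rule: list_induct2)
 case (Cons n ns y ys)
 have c: "y \<in> carrier R" "set us <= carrier R" "set ys <= carrier R" "set (pows ys ns) <= carrier R" using Cons(3) pows_carr by auto
 have n: "n > 0" "n + (N - n) = N" using Cons(5) by auto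
 have P: "lprod (pows ys (map (%n. N - n) ns)) \<in> carrier R" using pows_carr[OF c(3)] by simp
 let ?z = "z \<otimes> y [^] (N - n)"
 have "z \<otimes> lprod (pows (y # ys) (map (%n. N - n) (n # ns))) \<in> lim {\<zero>} (us @ pw N (y # ys)) \<longleftrightarrow>
   ?z \<otimes> lprod (pows ys (map (%n. N - n) ns)) \<in> lim {\<zero>} ((us @ [y [^] N]) @ pw N ys)"
  using c P Cons(4) by (simp add: m_assoc)
 also have "\<dots> \<longleftrightarrow> ?z \<in> lim {\<zero>} ((us @ [y [^] N]) @ pows ys ns)" by (rule Cons.IH) (use c Cons(4,5) in auto)
 also have "lim {\<zero>} ((us @ [y [^] N]) @ pows ys ns) = lim {\<zero>} (y [^] (n + (N - n)) # us @ pows ys ns)"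
  unfolding n(2) by (rule lim_mset) (use c in auto)
 also have "?z \<in> \<dots> \<longleftrightarrow> z \<in> lim {\<zero>} (y [^] n # us @ pows ys ns)"
  by (rule lim_shift[OF zeroideal _ c(1) n(1) Cons(4)]) (use c in auto)
 also have "lim {\<zero>} (y [^] n # us @ pows ys ns) = lim {\<zero>} (us @ pows (y # ys) (n # ns))" by (rule lim_mset) (use c in auto)
 finally show ?case .
qed simp

text \<open>The definition of the limit only knows equal exponents. Any common upper bound N of the
  exponents allows the passage to equal exponents and, after Frobenius has multiplied all of them by
  p, the return.\<close>

lemma F_ideal_fgood:
 assumes F: "F_ideal R p xs J"
 shows "fgood J xs"
 unfolding fgood_def
proof (intro allI impI)
 fix ns :: "nat list" assume ns: "length ns = length xs" "\<forall>n\<in>set ns. n > 0"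
 have J: "ideal J R" using F unfolding F_ideal_def by blast
 let ?N = "Suc (sum_list ns)"
 have N: "\<forall>n\<in>set ns. 0 < n \<and> n \<le> ?N" using ns(2) member_le_sum_list by (auto intro: le_SucI)
 let ?P = "lprod (pows xs (map (%n. ?N - n) ns))" and ?ns = "map (%n. n * p) ns"
 have P: "?P \<in> carrier R" using pows_carr[OF xs] by simp
 have pp: "pw p (pows xs ms) = pows xs (map (%n. n * p) ms)" for ms
  using xs by (auto simp: pw_def pows_def zip_map2 nat_pow_pow dest!: set_zip_leftD)
 have N': "\<forall>n\<in>set ?ns. 0 < n \<and> n \<le> ?N * p" using N p_gt_1 mult_le_mono1[of _ ?N p] by fastforce
 have Pp: "?P [^] p = lprod (pows xs (map (%n. ?N * p - n) ?ns))"
  unfolding lprod_pow[OF pows_carr[OF xs]] pp by (simp add: o_def diff_mult_distrib)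
 show "fprop J (pows xs ns)" unfolding fprop_def
 proof (intro ballI impI)
  fix z j assume z: "z \<in> carrier R" "\<forall>j\<in>J. j \<otimes> z \<in> lim {\<zero>} (pows xs ns)" and j: "j \<in> J"
  have jc: "i \<in> carrier R" if "i \<in> J" for i using ideal_carr[OF J that] .
  have "i \<otimes> (z \<otimes> ?P) \<in> lim {\<zero>} (pw ?N xs)" if i: "i \<in> J" for i
   using lim_pows_shift[OF ns(1), of "[]" "i \<otimes> z" ?N] z i N xs jc[OF i] P by (simp add: m_assoc)
  hence "j \<otimes> (z \<otimes> ?P) [^] p \<in> lim {\<zero>} (pw p (pw ?N xs))"
   using F_ideal_fprop[OF F, of ?N] j z(1) P unfolding fprop_def by simp
  hence "(j \<otimes> z [^] p) \<otimes> ?P [^] p \<in> lim {\<zero>} (pw (?N * p) xs)"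
   using z(1) P jc[OF j] by (simp only: pw_pw[OF xs] nat_pow_distrib m_assoc nat_pow_closed)
  thus "j \<otimes> z [^] p \<in> lim {\<zero>} (pw p (pows xs ns))"
   using lim_pows_shift[of ?ns xs "[]" "j \<otimes> z [^] p" "?N * p"] ns(1) N' xs jc[OF j] z(1) unfolding Pp pp by simp
 qed
qed

end

section \<open>Proof of the theorem\<close>

text \<open>Positivity of d excludes the empty set, whose supremum is 0.\<close>

lemma Sup_enat_attained:
 assumes "Sup {enat n | n. Q n} = enat d" "d > 0"
 shows "\<exists>n\<ge>d. Q n"
proof -
 have "enat (d - 1) < Sup {enat n | n. Q n}" using assms by simp
 then obtain n where "Q n" "d - 1 < n" unfolding less_Sup_iff by auto
 thus ?thesis using assms(2) by (intro exI[of _ n]) auto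
qed

lemma (in cring) lift_prime_chain:
 assumes P: "ideal P R" and g: "prime_chain (R Quot P) n g"
 shows "\<exists>f. prime_chain R n f \<and> P <= f 0"
proof -
 have zero: "\<zero>\<^bsub>R Quot P\<^esub> = P" by (simp add: FactRing_def)
 interpret h: ring_hom_ring R "R Quot P" "(+>) P" by (rule ideal.rcos_ring_hom_ring[OF P])
 let ?f = "%i. {a \<in> carrier R. P +> a \<in> g i}"
 have pr: "primeideal (g i) (R Quot P)" if "i \<le> n" for i using g that unfolding prime_chain_def by blast
 have "?f i \<subset> ?f (Suc i)" if i: "i < n" for i
 proof -
  have "g i \<subset> g (Suc i)" using g i unfolding prime_chain_def by blast
  then obtain x where x: "x \<in> g (Suc i)" "x \<notin> g i" "g i <= g (Suc i)" by blast
  have "x \<in> carrier (R Quot P)" using x(1) ideal.Icarr[OF primeideal.axioms(1)[OF pr[of "Suc i"]]] i by simp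
  then obtain a where "a \<in> carrier R" "x = P +> a" unfolding FactRing_def A_RCOSETS_def' by auto
  thus ?thesis using x by blast
 qed
 moreover have "P <= ?f 0"
 proof
  fix a assume a: "a \<in> P"
  hence "a \<ominus> \<zero> \<in> P" using ideal_carr[OF P] by (simp add: minus_eq)
  hence "P +> a = P +> \<zero>" using quotient_eq_iff_same_a_r_cos[OF P ideal_carr[OF P a] zero_closed] by (rule iffD1[rotated])
  hence "P +> a = \<zero>\<^bsub>R Quot P\<^esub>" unfolding a_coset_add_zero[OF ideal_sub[OF P]] zero .
  moreover have "\<zero>\<^bsub>R Quot P\<^esub> \<in> g 0"
   using additive_subgroup.zero_closed[OF ideal.axioms(1)[OF primeideal.axioms(1)[OF pr[OF le0]]]] .
  ultimately show "a \<in> ?f 0" using ideal_carr[OF P a] by simp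
 qed
 ultimately show ?thesis using h.primeideal_vimage[OF is_cring pr] unfolding prime_chain_def by (intro exI[of _ ?f]) auto
qed

section \<open>From the resolution to the ladder, and the two cases of the theorem\<close>

context ncharp
begin

lemma dimlt_regs:
 assumes "ideal c R" "c <= m" "set ys <= m" "regs c ys" "dimlt c n"
 shows "length ys < n \<and> dimlt (Idl (c \<union> set ys)) (n - length ys)"
 using assms
proof (induction ys arbitrary: c n)
 case Nil
 have "n \<noteq> 0" using dimlt_0[OF Nil(1)] Nil(2,5) one_notin_m by (cases n) auto
 thus ?case using Nil Idl_ideal by simp
next
 case (Cons y ys)
 have "n \<noteq> 0" using dimlt_0[OF Cons(2)] Cons(3,6) one_notin_m by (cases n) auto
 then obtain k where k: "n = Suc k" using not0_implies_Suc by blast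
 have ym: "y \<in> m" "set ys <= m" using Cons(4) by auto
 have S: "insert y c <= carrier R" "set ys <= carrier R" using ym m_carr ideal_sub[OF Cons(2)] by auto
 have "dimlt (Idl (insert y c)) k" by (rule dimlt_nonzerodivisor[OF Cons(2)]) (use Cons(5,6) k S in auto)
 from Cons.IH[OF genideal_ideal[OF S(1)] _ ym(2) _ this] have "length ys < k \<and> dimlt (Idl (Idl (insert y c) \<union> set ys)) (k - length ys)"
  using Idl_subI[OF _ m_ideal, of "insert y c"] ym(1) Cons(3,5) by simp
 thus ?case using Idl_Un_Idl[OF S] k by simp
qed

lemma regular_sequence_regs:
 assumes "regular_sequence R ys"
 shows "regs {\<zero>} ys"
proof -
 have c: "set ys <= carrier R" using assms unfolding regular_sequence_def by blast
 have "regs {\<zero>} (take i ys)" if "i \<le> length ys" for i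
  using that
 proof (induction i)
  case (Suc i)
  have ci: "set (take i ys) <= carrier R" using c by (auto dest: in_set_takeD)
  have "\<forall>a\<in>carrier R. ys ! i \<otimes> a \<in> Idl (set (take i ys)) --> a \<in> Idl (set (take i ys))"
   using assms Suc(2) unfolding regular_sequence_def by simp
  thus ?case using Suc regs_append[OF zeroideal ci, of "[ys ! i]"] zero_Un[OF ci] by (simp add: take_Suc_conv_app_nth)
 qed simp
 from this[of "length ys"] show ?thesis by simp
qed

text \<open>The regular sequence lowers the dimension by its length, so a generic list completes it
  to d parameters. The first congruence shows that \<psi> 0 0 times the row generating I is
  divisible by the first parameter up to the others, so \<psi> 0 0 multiplies I into the parameter
  ideal.\<close>

lemma ladder_of_resolution:
 assumes res: "finite_resolution R m I r M s" and dim: "dimlt {\<zero>} (Suc d)"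
 shows "\<exists>zs b D \<psi>. ladder s b D \<psi> zs \<and> length zs = d \<and> set zs <= m \<and> mprim (Idl (set zs)) \<and>
  (s > 0 --> (\<forall>j\<in>I. j \<otimes> \<psi> 0 0 \<in> Idl (set zs)))"
proof -
 interpret finite_resolution R m I r M s by fact
 obtain ys \<psi> where ys: "length ys = s" "set ys <= m" "regs {\<zero>} ys" and \<psi>: "\<And>i. tot (\<psi> i)" "\<psi> s 0 = \<one>"
  and step: "\<And>i k. i < s ==> k < r (Suc i) ==>
   ys ! i \<otimes> \<psi> (Suc i) k \<ominus> dot (r i) (\<psi> i) (%l. M i l k) \<in> Idl ({\<zero>} \<union> set (drop (Suc i) ys))" using dual_ladder by blast
 have z0: "{\<zero>} <= m" using ideal_zero[OF m_ideal] by simp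
 have yR: "set ys <= carrier R" using ys(2) m_carr by blast
 from dimlt_regs[OF zeroideal z0 ys(2,3) dim] have sd: "s \<le> d" "dimlt (Idl (set ys)) (Suc (d - s))"
  unfolding zero_Un[OF yR] ys(1) by (auto simp: Suc_diff_le)
 obtain ws where ws: "length ws = d - s" "set ws <= m" "mprim (Idl (Idl (set ys) \<union> set ws))"
  using generic_parameters[of "{Idl (set ys)}" "d - s"] sd(2) genideal_ideal[OF yR] by auto
 \<comment> \<open>The index shift of the ladder: rank 0 and a zero matrix are put in front of the
   resolution.\<close>
 let ?zs = "ys @ ws" and ?b = "%i. case i of 0 => 0 | Suc i => r i" and ?D = "%i. case i of 0 => %_ _. \<zero> | Suc i => M i"
 have wR: "set ws <= carrier R" and zR: "set ?zs <= carrier R" using ws(2) yR m_carr by auto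
 have step': "?zs ! i \<otimes> \<psi> (Suc i) k \<ominus> dot (r i) (\<psi> i) (%l. M i l k) \<in> Idl (set (take i ?zs @ drop (Suc i) ?zs))"
  if i: "i < s" "k < r (Suc i)" for i k
 proof -
  have c: "set (drop (Suc i) ys) <= carrier R" "set (take i ?zs @ drop (Suc i) ?zs) <= carrier R"
   using yR zR by (auto dest: in_set_dropD in_set_takeD)
  have "Idl (set (drop (Suc i) ys)) <= Idl (set (take i ?zs @ drop (Suc i) ?zs))" by (rule Idl_mono[OF _ c(2)]) auto
  thus ?thesis using step[OF i] zero_Un[OF c(1)] i(1) ys(1) by (auto simp: nth_append)
 qed
 have "ladder s ?b ?D \<psi> ?zs" unfolding ladder_def
 proof (intro conjI allI impI)
  show "?b 1 = 1" using minres unfolding minres_def by simp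
  show "tot (?D i l)" for i l using tot_M tot_zero by (cases i) auto
  show "?D s l 0 \<in> m" for l using M_m ideal_zero[OF m_ideal] by (cases s) auto
  show "dot (?b (Suc i)) (?D i j) (%l. ?D (Suc i) l k) = \<zero>" if "j < ?b i" for i j k
   using that complex by (cases i) auto
 qed (use ys(1) rank_top(1) \<psi> step' in auto)
 moreover have "length ?zs = d" "set ?zs <= m" using ys ws sd(1) by auto
 moreover have "mprim (Idl (set ?zs))" using ws(3) Idl_Un_Idl[OF yR wR] by simp
 moreover have "j \<otimes> \<psi> 0 0 \<in> Idl (set ?zs)" if s: "s > 0" and j: "j \<in> I" for j
 proof -
  note Z = genideal_ideal[OF zR]
  obtain u where u: "tot u" "j = dot (r 1) (M 0 0) u" using minres j unfolding minres_def by blast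
  have "M 0 0 k \<otimes> \<psi> 0 0 \<in> Idl (set ?zs)" if k: "k < r 1" for k
  proof -
   have "Idl (set (take 0 ?zs @ drop (Suc 0) ?zs)) <= Idl (set ?zs)" by (rule Idl_mono[OF _ zR]) (auto dest: in_set_dropD)
   moreover have "?zs ! 0 \<in> Idl (set ?zs)" by (rule Idl_mem[OF _ zR]) (use s ys(1) in \<open>auto simp: nth_append\<close>)
   ultimately have "dot (r 0) (\<psi> 0) (%l. M 0 l k) \<in> Idl (set ?zs)"
    using ideal_minus_cancel'[OF Z ideal_mult'[OF Z _ totD[OF \<psi>(1)]] dot_closed[OF \<psi>(1) tot_M(2)]] step'[OF s, of k] k by auto
   thus ?thesis using minres totD[OF \<psi>(1)] totD[OF tot_M(1)] unfolding minres_def by (simp add: m_comm)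
  qed
  hence "dot (r 1) (%k. \<psi> 0 0 \<otimes> M 0 0 k) u \<in> Idl (set ?zs)"
   by (intro dot_ideal'[OF Z u(1)]) (use totD[OF \<psi>(1)] totD[OF tot_M(1)] in \<open>simp add: m_comm\<close>)
  thus ?thesis using dot_smult[OF totD[OF \<psi>(1)] tot_M(1) u(1)] totD[OF \<psi>(1)] dot_closed[OF tot_M(1) u(1)] u(2) by (simp add: m_comm)
 qed
 ultimately show ?thesis by (intro exI[of _ ?zs] exI[of _ ?b] exI[of _ ?D] exI[of _ \<psi>] conjI impI ballI)
qed

lemma F_ideal_not_subset:
 assumes sop: "system_of_parameters R m xs" and I: "ideal I R" "I \<noteq> carrier R"
  and pd: "finite_projective_dimension TYPE('m) R (ideal_module R I)" and F: "F_ideal R p xs J" "J \<noteq> {\<zero>}"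
  and R: "cohen_macaulay R m \<or> (equidimensional R \<and> reduced_ring R)"
 shows "\<not> J <= I"
proof
 assume JI: "J <= I"
 have J: "ideal J R" using F(1) unfolding F_ideal_def by blast
 note Jz = ideal_zero[OF J]
 let ?d = "length xs"
 have xm: "set xs <= m" "mprim (Idl (set xs))" and dim: "krull_dim R = enat ?d"
  using sop unfolding system_of_parameters_def mprim_def by auto
 interpret parameters R m p xs by unfold_locales (use xm m_carr in blast)
 have chain: "n \<le> ?d" if "prime_chain R n f" for n f
  using Sup_upper[of "enat n" "{enat n | n. \<exists>c. prime_chain R n c}"] that dim unfolding krull_dim_def by auto
 hence dl: "dimlt {\<zero>} (Suc ?d)" unfolding dimlt_def by (meson less_Suc_eq_le)
 obtain r M where rM: "minres I r M" using minres_exists[OF I] by blast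
 obtain n P \<epsilon> d where "projective_resolution R (ideal_module R I) n (P :: nat => ('a, 'm) module) \<epsilon> d"
  using pd unfolding finite_projective_dimension_def by blast
 from minres_vanishes[OF I(1) rM this] have "r (LEAST t. r t = 0) = 0" by (rule LeastI)
 moreover have r0: "r 0 = 1" using rM unfolding minres_def by blast
 ultimately obtain s where s: "(LEAST t. r t = 0) = Suc s" "r (Suc s) = 0" by (metis not0_implies_Suc zero_neq_one)
 have "r s > 0" using not_less_Least[of s "%t. r t = 0"] s(1) by simp
 hence res: "finite_resolution R m I r M s" using rM s(2) by unfold_locales
 \<comment> \<open>Otherwise r 1 = 0 and the empty row generates I, so I and with it J would be
   zero.\<close>
 have "s \<noteq> 0"
 proof
  assume "s = 0"
  hence "I <= {\<zero>}" using rM s(2) unfolding minres_def by auto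
  thus False using JI F(2) Jz by blast
 qed
 obtain zs b D \<psi> where L: "ladder s b D \<psi> zs" and zs: "length zs = ?d" "set zs <= m" "mprim (Idl (set zs))"
  and z: "\<forall>j\<in>J. j \<otimes> \<psi> 0 0 \<in> Idl (set zs)" using ladder_of_resolution[OF res dl] \<open>s \<noteq> 0\<close> JI by blast
 have d0: "?d > 0" using L \<open>s \<noteq> 0\<close> zs(1) unfolding ladder_def by auto
 \<comment> \<open>Frobenius stability is given for \<open>xs\<close>, while the ladder stands over
   \<open>zs\<close>; exchanges of single parameters connect the two.\<close>
 have "fgood J ([] @ zs)"
  by (rule exchange_connected[where Q = "fgood J" and xs = xs and k = ?d, OF fgood_exchange[OF ideal_sub[OF J]]]) (use F_ideal_fgood[OF F(1)] xm zs in simp_all)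
 hence good: "fgood J zs" by simp
 show False using R
 proof
  assume "cohen_macaulay R m"
  moreover have "{enat (length vs) | vs. set vs <= m \<and> regular_sequence R vs} =
    {enat n | n. \<exists>vs. n = length vs \<and> set vs <= m \<and> regular_sequence R vs}" by blast
  ultimately have "Sup {enat n | n. \<exists>vs. n = length vs \<and> set vs <= m \<and> regular_sequence R vs} = enat ?d"
   using dim unfolding cohen_macaulay_def depth_def by simp
  from Sup_enat_attained[OF this d0] obtain vs where vs: "length vs \<ge> ?d" "set vs <= m" "regs {\<zero>} vs"
   using regular_sequence_regs by blast
  have vR: "set vs <= carrier R" using vs(2) m_carr by blast
  from dimlt_regs[OF zeroideal _ vs(2,3) dl] have v: "length vs < Suc ?d" "dimlt (Idl (set vs)) (Suc ?d - length vs)"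
   using ideal_zero[OF m_ideal] zero_Un[OF vR] by auto
  hence l: "length vs = ?d" using vs(1) by simp
  hence vl: "length vs = ?d" "mprim (Idl (set vs))" using v(2) dimlt_1_mprim[OF genideal_ideal[OF vR]] by simp_all
  \<comment> \<open>A regular sequence of length d is itself a system of parameters, and regularity
    also passes along the exchanges.\<close>
  have "regs {\<zero>} ([] @ zs)"
   by (rule exchange_connected[where Q = "regs {\<zero>}" and xs = vs and k = ?d, OF regs_exchange]) (use vs vl zs in simp_all)
  hence "regs {\<zero>} zs" by simp
  from ladder_regular[OF L zs(2,3) this J good z] show False using F(2) by blast
 next
  assume ER: "equidimensional R \<and> reduced_ring R"
  obtain j where j: "j \<in> J" "j \<noteq> \<zero>" using Jz F(2) by blast
  have jR: "j \<in> carrier R" using ideal_carr[OF J j(1)] .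
  let ?S = "range (%n::nat. j [^] n)"
  have "a \<otimes> b \<in> ?S" if "a \<in> ?S" "b \<in> ?S" for a b using that jR by (auto simp: nat_pow_mult)
  note mult = this
  \<comment> \<open>Reducedness gives a prime missing all powers of j, hence a minimal prime P
    without j; equidimensionality then provides a chain of length d over P.\<close>
  have "\<zero> \<noteq> j [^] n" for n :: nat using ER jR j(2) unfolding reduced_ring_def by metis
  hence disj: "{\<zero>} \<inter> ?S = {}" by auto
  have one: "\<one> \<in> ?S" and SR: "?S <= carrier R" using nat_pow_0[of j] jR by (metis rangeI, auto)
  obtain Q where Q: "primeideal Q R" "{\<zero>} <= Q" "Q \<inter> ?S = {}" by (rule prime_disjoint[OF zeroideal SR one mult disj])
  obtain P where P: "primeideal P R" "{\<zero>} <= P" "P <= Q"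
   and min: "\<And>P'. primeideal P' R ==> {\<zero>} <= P' ==> P' <= P ==> P' = P"
   using minimal_prime_below[OF Q(1) zeroideal Q(2)] by metis
  have "j [^] (1::nat) \<notin> Q" using Q(3) by blast
  hence jP: "j \<notin> P" using P(3) jR by auto
  have "minimal_prime R P" using P(1) min ideal_zero[OF prime_ideal] unfolding minimal_prime_def by simp
  hence "krull_dim (R Quot P) = enat ?d" using ER dim unfolding equidimensional_def by simp
  from Sup_enat_attained[OF this[unfolded krull_dim_def] d0] obtain n g where n: "n \<ge> ?d" "prime_chain (R Quot P) n g" by blast
  obtain f where f: "prime_chain R n f" "P <= f 0" using lift_prime_chain[OF prime_ideal[OF P(1)] n(2)] by blast
  have "n = ?d" using chain[OF f(1)] n(1) by simp
  \<comment> \<open>Otherwise P could be put in front of the chain, making it longer than d.\<close>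
  moreover have "f 0 = P" using chain[OF prime_chain_Cons[OF f(1) P(1)]] f(2) n(1) by auto
  ultimately show False using ladder_domain[OF L zs(2,3) _ _ J good z, of f] f(1) zs(1) d0 j(1) jP by auto
 qed
qed

end

theorem theorem1p3:
  fixes R :: "('a, 'r) ring_scheme" and m I J :: "'a set" and p :: nat and xs :: "'a list"
  assumes "noetherian_local_ring R m"
    and "Factorial_Ring.prime p" and "[p] \<cdot>\<^bsub>R\<^esub> \<one>\<^bsub>R\<^esub> = \<zero>\<^bsub>R\<^esub>"
    and "system_of_parameters R m xs"
    and "ideal I R" and "I \<noteq> carrier R"
    and "finite_projective_dimension TYPE('m) R (ideal_module R I)"
    and "F_ideal R p xs J" and "J \<noteq> {\<zero>\<^bsub>R\<^esub>}"
    and "cohen_macaulay R m \<or> (excellent R \<and> equidimensional R \<and> reduced_ring R)"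
  shows "\<not> J \<subseteq> I"
proof -
 have "noetherian_ring R" "local_ring R m" "cring R" using assms(1) unfolding noetherian_local_ring_def local_ring_def by auto
 then interpret ncharp R m p
  unfolding ncharp_def ncharp_axioms_def nlocal_def nlocal_axioms_def noeth_def using assms(2,3) by blast
 show ?thesis using F_ideal_not_subset[OF assms(4-9)] assms(10) by blast
qed

end
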